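(* Let $(\mathcal{T}(n))_{n\ge1}$ be the delayed attachment tree process with parameters $\beta\in[0,1)$, $\mu$, $f$, where $f$ satisfies Assumption 1 and $(\mu,f)$ satisfy Assumption 2. Then $(\mathcal{T}(n))_{n\ge1}$ converges in probability in the extended fringe sense to the random sin-tree $\mathcal{T}_\infty$ whose law is determined by the fringe distribution $\varpi_{\mathrm{BP}_f}$. That is, for every $k\ge0$ and every $(s_0,\dots,s_k)\in\mathbb{T}^{k+1}$, $$\mathfrak{P}^k_n(\{(s_0,\dots,s_k)\})\ \xrightarrow{\ P\ }\ \mathbb{P}\big(F_k(0,\mathcal{T}_\infty)=(s_0,\dots,s_k)\big)\qquad (n\to\infty).$$
   Context: Model. Fix $\beta\in[0,1)$, a probability distribution $\mu$ on $[0,\infty)$ (the delay distribution) and a function $f:\{1,2,\dots\}\to(0,\infty)$ (the attachment function); $\xi$ denotes a generic random variable with law $\mu$. For $x\in\mathbb{R}$ let $\lfloor x\rfloor_+:=\max\{\lfloor x\rfloor,1\}$. A sequence of random rooted trees $(\mathcal{T}(n))_{n\ge1}$ is grown as follows; $\mathcal{T}(n)$ has vertex set $\{v_1,\dots,v_n\}$ and root $\rho=v_1$. - $\mathcal{T}(1)$ consists of $v_1$ alone, and $\mathcal{T}(2)$ consists of $v_1,v_2$ with $v_1$ the parent of $v_2$. - For $j\ge i$, $\deg(v_i,j)$ is the number of children of $v_i$ in $\mathcal{T}(j)$ plus one (so $\deg(v_i,i)=1$), and $\deg(v_i,j):=0$ for $j<i$. - For $n\ge2$, given $\mathcal{T}(1),\dots,\mathcal{T}(n)$,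 draw $\xi_{n+1}\sim\mu$ independently of everything before and put $m:=\lfloor n-n^{\beta}\xi_{n+1}\rfloor_+$. The new vertex $v_{n+1}$ chooses its parent $v\in\mathcal{T}(m)$ with probability $f(\deg(v,m))/\sum_{u\in\mathcal{T}(m)}f(\deg(u,m))$, and $\mathcal{T}(n+1)$ is $\mathcal{T}(n)$ together with this new vertex and edge. - $\mathcal{F}_n$ denotes the $\sigma$-field generated by $\mathcal{T}(1),\dots,\mathcal{T}(n)$ and $\xi_2,\dots,\xi_n$. Assumption 1 on $f$: (i) $f_*:=\inf_{k\ge1}f(k)>0$; (ii) there is $C<\infty$ with $f(k)\le Ck$ for all $k\ge1$; (iii) for $\lambda>0$ let $\hat\rho(\lambda):=\sum_{k=1}^\infty\prod_{i=1}^k\frac{f(i)}{\lambda+f(i)}\in(0,\infty]$ and $\underline\lambda:=\inf\{\lambda>0:\hat\rho(\lambda)<\infty\}$; then $\underline\lambda<\infty$ and $\lim_{\lambda\downarrow\underline\lambda}\hat\rho(\lambda)>1$. The Malthusian parameter $\lambda^*\in(0,\infty)$ is the unique solution of $\hat\rho(\lambda^* )=1$. Assumption 2: (a) $\lim_{n\to\infty}\mathbb{E}\Big[\frac{n^\beta\xi\,\mathbf 1\{n-n^\beta\xi\ge1\}}{\lfloor n-n^\beta\xi\rfloor_+}\Big]=0$; (b) $f$ satisfies one of the following: (A) $f(k)=k+\alpha$ for all $k\ge1$, for a constant $\alpha>-1$; (B) $\lim_{k\to\infty}f(k)/k=0$ and $f$ is Lipschitz; (C) $\lim_{k\to\infty}f(k)/k=0$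 and $f$ is non-decreasing. Branching process. Let $E_1,E_2,\dots$ be independent with $E_i\sim\mathrm{Exp}(f(i))$ (rate $f(i)$), and let $\sigma_i=E_1+\dots+E_i$. $\mathrm{BP}_f$ is the continuous-time branching process started at time $0$ from one individual, in which every individual born at time $b$ has children at times $b+\sigma_1,b+\sigma_2,\dots$, using an independent copy of $(\sigma_i)_{i\ge1}$ for each individual. The stable age distribution $\varpi_{\mathrm{BP}_f}$ is the law of the genealogical tree of the individuals of $\mathrm{BP}_f(T)$, viewed as a finite rooted tree up to root-preserving isomorphism, where $T\sim\mathrm{Exp}(\lambda^* )$ is independent of $\mathrm{BP}_f$. Fringes. $\mathbb{T}$ is the countable set of finite rooted trees up to root-preserving isomorphism, including the empty tree $\emptyset$. For a finite rooted tree $t$ and a vertex $v$ at distance $h$ from the root, let $v=u_0,u_1,\dots,u_h$ be the path from $v$ to the root. Then: - $f_0(v,t)$ is the subtree of $v$ and its descendants, rooted at $v$ (the fringe at $v$); - for $1\le i\le h$, $f_i(v,t)$ is the subtree rooted at $u_i$ consisting of $u_i$ and those descendants of $u_i$ that are not descendants of $u_{i-1}$; - $f_i(v,t)=\emptyset$ for $i>h$; - $F_k(v,t):=(f_0(v,t),\dots,f_k(v,t))$. The empirical extended fringe measure is $\mathfrak{P}^k_n:=\frac1n\sum_{v\in\mathcal{T}(n)}\delta_{F_k(v,\mathcal{T}(n))}$, a random probability measure on $\mathbb{T}^{k+1}$. Sin-trees. For $s,t\in\mathbb{T}$, $Q(s,t)$ is the number of children $w$ of the root of $s$ whose subtree (of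 $w$ and its descendants, rooted at $w$) is isomorphic to $t$. A sin-tree is an infinite rooted tree with a single path to infinity, whose vertices on that path are labelled $0,1,2,\dots$ with $0$ the root. For such a tree $\omega$: - $t_i$ is the subtree rooted at $i$ consisting of $i$ and its descendants not through $i-1$; - $F_k(0,\omega):=(t_0,\dots,t_k)$; - $\bar t_i$ is the subtree of $i$ together with all of $0,\dots,i-1$ and their hanging subtrees (the monotone representation). Given the probability measure $\varpi=\varpi_{\mathrm{BP}_f}$ on $\mathbb{T}$, $\mathcal{T}_\infty$ is the random sin-tree with $\mathbb{P}(\bar t_0=s_0,\dots,\bar t_i=s_i)=\varpi(s_i)\prod_{j=1}^iQ(s_j,s_{j-1})$ for all $i\ge0$ and all $s_0,\dots,s_i\in\mathbb{T}$. *)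

theory Defs
  imports "HOL-Probability.Probability" "HOL-Library.Multiset"
begin

text \<open>An unlabelled finite rooted tree is a root together with the multiset of
  (isomorphism classes of) the subtrees hanging from its children. The set of
  trees including the empty tree is \<open>utree option\<close> (\<open>None\<close> = empty tree).\<close>

datatype utree = Node "utree multiset"

type_synonym ttree = "utree option"

definition children_of :: "utree \<Rightarrow> utree multiset" where
  "children_of t = (case t of Node M \<Rightarrow> M)"

definition Qcount :: "ttree \<Rightarrow> ttree \<Rightarrow> nat" where
  "Qcount s t = (case (s, t) of (Some s', Some t') \<Rightarrow> count (children_of s') t' | _ \<Rightarrow> 0)"

text \<open>A tree on vertices \<open>{0..<n}\<close> (vertex i is v_(i+1) of the paper, vertex 0 the root)
  is encoded by a list \<open>p\<close> of length n with \<open>p!i < i\<close> the parent of i for i \<ge> 1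
  (the entry \<open>p!0\<close> is a dummy).\<close>

definition children :: "nat list \<Rightarrow> nat \<Rightarrow> nat \<Rightarrow> nat set" where
  "children p m v = {w. v < w \<and> w < m \<and> p ! w = v}"

definition deg :: "nat list \<Rightarrow> nat \<Rightarrow> nat \<Rightarrow> nat" where
  "deg p m v = card (children p m v) + 1"

text \<open>Shape of the subtree of v and its descendants (fuel argument d; with d \<ge> length p
  it is exact since depths are bounded by the number of vertices).\<close>
fun tshape :: "nat list \<Rightarrow> nat \<Rightarrow> nat \<Rightarrow> utree" where
  "tshape p 0 v = Node {#}"
| "tshape p (Suc d) v = Node (image_mset (tshape p d) (mset_set (children p (length p) v)))"

definition fringe0 :: "nat list \<Rightarrow> nat \<Rightarrow> utree" where
  "fringe0 p v = tshape p (length p) v"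

definition anc :: "nat list \<Rightarrow> nat \<Rightarrow> nat \<Rightarrow> nat" where
  "anc p i v = ((\<lambda>u. p ! u) ^^ i) v"

definition height :: "nat list \<Rightarrow> nat \<Rightarrow> nat" where
  "height p v = (LEAST h. anc p h v = 0)"

definition fringe_i :: "nat list \<Rightarrow> nat \<Rightarrow> nat \<Rightarrow> ttree" where
  "fringe_i p v i =
     (if i = 0 then Some (fringe0 p v)
      else if i \<le> height p v then
        Some (Node (image_mset (tshape p (length p))
          (mset_set (children p (length p) (anc p i v) - {anc p (i - 1) v}))))
      else None)"

definition ext_fringe :: "nat list \<Rightarrow> nat \<Rightarrow> nat \<Rightarrow> ttree list" where
  "ext_fringe p k v = map (fringe_i p v) [0..<Suc k]"

definition emp_fringe :: "nat list \<Rightarrow> nat \<Rightarrow> ttree list \<Rightarrow> real" where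
  "emp_fringe p k s = real (card {v. v < length p \<and> ext_fringe p k v = s}) / real (length p)"

definition floor_plus :: "real \<Rightarrow> int" where
  "floor_plus x = max \<lfloor>x\<rfloor> 1"

definition delay_index :: "real \<Rightarrow> nat \<Rightarrow> real \<Rightarrow> nat" where
  "delay_index \<beta> n \<xi> = nat (floor_plus (real n - real n powr \<beta> * \<xi>))"

definition attach_prob :: "(nat \<Rightarrow> real) \<Rightarrow> nat list \<Rightarrow> nat \<Rightarrow> nat \<Rightarrow> real" where
  "attach_prob f p m v =
     (if v < m then f (deg p m v) / (\<Sum>u<m. f (deg p m u)) else 0)"

text \<open>Law of the parent of the new vertex v_(n+1), given T(1),...,T(n) (encoded by p of
  length n): average over \<xi> ~ \<mu>.\<close>
definition step_pmf ::
  "real \<Rightarrow> real measure \<Rightarrow> (nat \<Rightarrow> real) \<Rightarrow> nat \<Rightarrow> nat list \<Rightarrow> nat pmf" where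
  "step_pmf \<beta> \<mu> f n p =
     embed_pmf (\<lambda>v. \<integral>\<xi>. attach_prob f p (delay_index \<beta> n \<xi>) v \<partial>\<mu>)"

fun tree_pmf :: "real \<Rightarrow> real measure \<Rightarrow> (nat \<Rightarrow> real) \<Rightarrow> nat \<Rightarrow> nat list pmf" where
  "tree_pmf \<beta> \<mu> f 0 = return_pmf [0]"
| "tree_pmf \<beta> \<mu> f (Suc 0) = return_pmf [0]"
| "tree_pmf \<beta> \<mu> f (Suc (Suc 0)) = return_pmf [0, 0]"
| "tree_pmf \<beta> \<mu> f (Suc (Suc (Suc n))) =
     bind_pmf (tree_pmf \<beta> \<mu> f (Suc (Suc n)))
       (\<lambda>p. map_pmf (\<lambda>v. p @ [v]) (step_pmf \<beta> \<mu> f (Suc (Suc n)) p))"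

definition rho_hat :: "(nat \<Rightarrow> real) \<Rightarrow> real \<Rightarrow> ennreal" where
  "rho_hat f lam = (\<Sum>k. ennreal (\<Prod>i\<in>{1..Suc k}. f i / (lam + f i)))"

definition lambda_low :: "(nat \<Rightarrow> real) \<Rightarrow> real" where
  "lambda_low f = Inf {lam. 0 < lam \<and> rho_hat f lam < \<top>}"

definition lambda_star :: "(nat \<Rightarrow> real) \<Rightarrow> real" where
  "lambda_star f = (THE lam. 0 < lam \<and> rho_hat f lam = 1)"

definition assumption1 :: "(nat \<Rightarrow> real) \<Rightarrow> bool" where
  "assumption1 f \<longleftrightarrow>
     (\<forall>k\<ge>1. 0 < f k) \<and>
     (INF k\<in>{1..}. f k) > 0 \<and>
     (\<exists>C. \<forall>k\<ge>1. f k \<le> C * real k) \<and>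
     {lam. 0 < lam \<and> rho_hat f lam < \<top>} \<noteq> {} \<and>
     (\<exists>L. (rho_hat f \<longlongrightarrow> L) (at_right (lambda_low f)) \<and> L > 1)"

definition assumption2a :: "real \<Rightarrow> real measure \<Rightarrow> bool" where
  "assumption2a \<beta> \<mu> \<longleftrightarrow>
     (\<lambda>n::nat. \<integral>\<xi>. (if real n - real n powr \<beta> * \<xi> \<ge> 1
                      then real n powr \<beta> * \<xi> / real_of_int (floor_plus (real n - real n powr \<beta> * \<xi>))
                      else 0) \<partial>\<mu>) \<longlonglongrightarrow> 0"

definition assumption2b :: "(nat \<Rightarrow> real) \<Rightarrow> bool" where
  "assumption2b f \<longleftrightarrow>
     (\<exists>\<alpha>>-1. \<forall>k\<ge>1. f k = real k + \<alpha>) \<or>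
     ((\<lambda>k. f k / real k) \<longlonglongrightarrow> 0 \<and> (\<exists>L. \<forall>j\<ge>1. \<forall>k\<ge>1. \<bar>f j - f k\<bar> \<le> L * \<bar>real j - real k\<bar>)) \<or>
     ((\<lambda>k. f k / real k) \<longlonglongrightarrow> 0 \<and> (\<forall>j\<ge>1. \<forall>k\<ge>j. f j \<le> f k))"

definition exp_meas :: "real \<Rightarrow> real measure" where
  "exp_meas r = density lborel (exponential_density r)"

text \<open>Individuals are Ulam-Harris words (lists of 0-based child numbers). The random input
  \<omega>(x,j) ~ Exp(f(j+1)), all independent, is the (j+1)-th waiting time E_(j+1) of x.\<close>
definition bp_space :: "(nat \<Rightarrow> real) \<Rightarrow> (nat list \<times> nat \<Rightarrow> real) measure" where
  "bp_space f = PiM UNIV (\<lambda>(x, j). exp_meas (f (Suc j)))"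

definition birth :: "(nat list \<times> nat \<Rightarrow> real) \<Rightarrow> nat list \<Rightarrow> real" where
  "birth \<omega> x = (\<Sum>k<length x. \<Sum>j\<le>x ! k. \<omega> (take k x, j))"

definition bp_pop :: "(nat list \<times> nat \<Rightarrow> real) \<Rightarrow> real \<Rightarrow> nat list set" where
  "bp_pop \<omega> t = {x. birth \<omega> x \<le> t}"

fun lshape :: "nat list set \<Rightarrow> nat \<Rightarrow> nat list \<Rightarrow> utree" where
  "lshape S 0 x = Node {#}"
| "lshape S (Suc d) x = Node (image_mset (\<lambda>i. lshape S d (x @ [i])) (mset_set {i. x @ [i] \<in> S}))"

definition varpi :: "(nat \<Rightarrow> real) \<Rightarrow> ttree \<Rightarrow> real" where
  "varpi f s = (case s of None \<Rightarrow> 0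
     | Some t \<Rightarrow> measure (bp_space f \<Otimes>\<^sub>M exp_meas (lambda_star f))
         {(\<omega>, T). finite (bp_pop \<omega> T) \<and> lshape (bp_pop \<omega> T) (card (bp_pop \<omega> T)) [] = t})"

text \<open>Finite-dimensional law of the monotone representation:
  P(tbar_0 = sb!0, ..., tbar_k = sb!k) = \<varpi>(sb!k) \<Prod>_(j=1..k) Q(sb!j, sb!(j-1)).\<close>
definition sin_fd :: "(nat \<Rightarrow> real) \<Rightarrow> ttree list \<Rightarrow> real" where
  "sin_fd f sb = varpi f (sb ! (length sb - 1)) *
       (\<Prod>j\<in>{1..<length sb}. real (Qcount (sb ! j) (sb ! (j - 1))))"

text \<open>t_i recovered from tbar_i and tbar_(i-1): remove the child tbar_(i-1) from the root.\<close>
definition detach :: "ttree \<Rightarrow> ttree \<Rightarrow> ttree" where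
  "detach s t = (case (s, t) of (Some s', Some t') \<Rightarrow> Some (Node (children_of s' - {#t'#}))
                  | _ \<Rightarrow> None)"

definition fringe_of_bar :: "ttree list \<Rightarrow> ttree list" where
  "fringe_of_bar sb = map (\<lambda>i. if i = 0 then sb ! 0 else detach (sb ! i) (sb ! (i - 1))) [0..<length sb]"

definition sin_fringe_prob :: "(nat \<Rightarrow> real) \<Rightarrow> ttree list \<Rightarrow> real" where
  "sin_fringe_prob f s =
     (\<Sum>\<^sub>\<infinity> sb\<in>{sb. length sb = length s \<and> fringe_of_bar sb = s}. sin_fd f sb)"

end

theory Submission
  imports Defs
begin

text \<open>An extended fringe \<open>(s\<^sub>0, \<dots>, s\<^sub>k)\<close> without empty components occurs at a vertex only if the
  ordinary fringe of its \<open>k\<close>-th ancestor is the tree \<open>bar_tree s k\<close> obtained by successively grafting the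
  \<open>s\<^sub>i\<close>; the number of such vertices below one ancestor is the product of the multiplicities \<open>Q\<close>, which
  also occurs in the law of the sin-tree. It therefore suffices that the number \<open>N(t)\<close> of fringes of
  shape \<open>t\<close> satisfies \<open>N(t) / n \<rightarrow> \<varpi>(t)\<close> in mean.

  Since \<open>n\<^sup>\<beta> \<xi> = o(n)\<close>, the delay changes the attachment probabilities by \<open>o(1)\<close> in total variation, so
  the drifts may be computed without it. If \<open>wt / n \<rightarrow> \<lambda>\<close>, where \<open>wt\<close> is the total weight, the drift of
  \<open>N(t)\<close> is linear and triangular with respect to the size of \<open>t\<close>, and \<open>N(t) / n\<close> converges to the solution
  of \<open>(\<lambda> + tot_rate t) \<pi>(t) = \<lambda> 1{t = leaf} + (\<Sum>s. \<pi>(s) rate s t)\<close>. The branching process observed at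
  an independent exponential time of rate \<open>\<lambda>\<close> satisfies the same recursion, by the memoryless property.

  The weight is deterministic for affine \<open>f\<close>. For sublinear \<open>f\<close> one compares the degree counts with the
  limiting degree distribution through a divergence weighted by reproductive values. Its
  dissipation vanishes only at the limiting distribution, and for that distribution the mean weight is
  the Malthusian parameter.\<close>

section \<open>The branching process at an exponential time\<close>

text \<open>Births happen to labelled individuals, whereas fringes are trees up to isomorphism. The
  branching process is therefore solved on planar populations (finite sets of Ulam-Harris words),
  and its law is summed over the planar versions of a shape. The operation \<open>grow\<close>,
  attaching a leaf in all possible ways, describes both processes, which is why they lead to the
  same triangular system. All limits are taken in mean. The delay enters only through
  \<open>delta n\<close>, a bound that is uniform over the trees with \<open>n\<close> vertices, so
  expectations of one-step increments suffice and no path argument is required. In the sublinear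
  case the obstacle is that the degree equations are divided by the random weight, an unbounded
  functional of infinitely many degree classes. Ratios to the total reproductive value close the
  equations; truncation at a level \<open>K\<close> leaves errors that are small because the degrees
  sum to \<open>2 * n - 1\<close>. The dissipation bound must not depend on \<open>K\<close>, since
  \<open>K\<close> can be chosen only after the size of that bound is known.\<close>

lemma sets_exp_meas [measurable_cong, simp]: "sets (exp_meas r) = sets borel"
  by (simp add: exp_meas_def)

lemma space_exp_meas: "space (exp_meas r) = UNIV"
  by (simp add: exp_meas_def)

lemma prob_space_exp_meas: "0 < r \<Longrightarrow> prob_space (exp_meas r)"
  unfolding exp_meas_def by (rule prob_space_exponential_density)

lemma nn_integral_exp_meas:
  assumes [measurable]: "g \<in> borel_measurable borel"
  shows "(\<integral>\<^sup>+x. g x \<partial>exp_meas r) = (\<integral>\<^sup>+x. ennreal (exponential_density r x) * g x \<partial>lborel)"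
  unfolding exp_meas_def by (subst nn_integral_density) auto

lemma emeasure_exp_meas_Ioi:
  assumes r: "0 < r" and s: "0 \<le> s"
  shows "emeasure (exp_meas r) {s<..} = ennreal (exp (- r * s))"
proof -
  interpret prob_space "exp_meas r" using prob_space_exp_meas[OF r] .
  have d: "distributed (exp_meas r) lborel (\<lambda>x. x) (exponential_density r)"
    unfolding distributed_def
    by (auto simp: exp_meas_def distr_id2)
  have "prob {x \<in> space (exp_meas r). s < x} = exp (- s * r)"
    using exponential_distributedD_gt[OF d s r] by simp
  moreover have "{x \<in> space (exp_meas r). s < x} = {s<..}" by (auto simp: space_exp_meas)
  ultimately show ?thesis by (simp add: emeasure_eq_measure mult.commute)
qed

lemma AE_exp_meas_pos: "AE x in exp_meas r. 0 < x"
proof -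
  have "AE x in lborel. x \<noteq> (0::real)" by (rule AE_lborel_singleton)
  then show ?thesis
    unfolding exp_meas_def by (subst AE_density) (auto simp: exponential_density_def elim: eventually_mono)
qed

lemma AE_exp_meas_neq: "AE x in exp_meas r. x \<noteq> a"
proof -
  have "AE x in lborel. x \<noteq> (a::real)" by (rule AE_lborel_singleton)
  then show ?thesis
    unfolding exp_meas_def by (subst AE_density) (auto elim: eventually_mono)
qed

lemma emeasure_exp_meas_Ico:
  assumes r: "0 < r" and s: "0 \<le> s" "s < t"
  shows "emeasure (exp_meas r) {s..<t} = ennreal (exp (- r * s) - exp (- r * t))"
proof -
  interpret prob_space "exp_meas r" using prob_space_exp_meas[OF r] .
  have "AE x in exp_meas r. x \<in> {s..<t} \<longleftrightarrow> x \<in> {s<..} - {t<..}"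
    using AE_exp_meas_neq[where a = s] AE_exp_meas_neq[where a = t] by eventually_elim (use s in auto)
  then have "emeasure (exp_meas r) {s..<t} = emeasure (exp_meas r) ({s<..} - {t<..})"
    by (intro emeasure_eq_AE) auto
  also have "\<dots> = emeasure (exp_meas r) {s<..} - emeasure (exp_meas r) {t<..}"
    using s by (intro emeasure_Diff) auto
  also have "\<dots> = ennreal (exp (- r * s) - exp (- r * t))"
    using s by (subst (1 2) emeasure_exp_meas_Ioi[OF r]) (auto simp: ennreal_minus)
  finally show ?thesis .
qed

text \<open>The clocks whose sum is the birth time of \<open>x\<close>: for every proper prefix
  \<open>y\<close>, the waiting times up to that child of \<open>y\<close> through which
  \<open>x\<close> descends. The letter of \<open>x\<close> following \<open>y\<close> is
  \<open>x ! length y\<close>.\<close>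

definition coords :: "nat list \<Rightarrow> (nat list \<times> nat) set" where
  "coords x = (SIGMA y:(\<lambda>k. take k x) ` {..<length x}. {..x ! length y})"

lemma finite_coords [simp]: "finite (coords x)"
  by (auto simp: coords_def)

lemma birth_Nil [simp]: "birth w [] = 0"
  by (simp add: birth_def)

lemma birth_snoc: "birth w (x @ [i]) = birth w x + (\<Sum>j\<le>i. w (x, j))"
proof -
  have "(\<Sum>k<length x. \<Sum>j\<le>(x @ [i]) ! k. w (take k (x @ [i]), j)) = birth w x"
    unfolding birth_def by (intro sum.cong) (auto simp: nth_append)
  then show ?thesis by (simp add: birth_def)
qed

lemma birth_coords: "birth w x = (\<Sum>c\<in>coords x. w c)"
proof -
  have inj: "inj_on (\<lambda>k. take k x) {..<length x}"
    by (auto simp: inj_on_def) (metis length_take min.absorb4)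
  have "(\<Sum>c\<in>coords x. w c) = (\<Sum>y\<in>(\<lambda>k. take k x) ` {..<length x}. \<Sum>j\<le>x ! length y. w (y, j))"
    unfolding coords_def by (subst sum.Sigma) (auto simp: split_def)
  also have "\<dots> = (\<Sum>k<length x. \<Sum>j\<le>x ! k. w (take k x, j))"
    by (subst sum.reindex[OF inj]) (auto intro!: sum.cong)
  finally show ?thesis by (simp add: birth_def)
qed

lemma birth_upd_notin: "c \<notin> coords x \<Longrightarrow> birth (w(c := s)) x = birth w x"
  unfolding birth_coords by (intro sum.cong) auto

lemma birth_upd_in:
  assumes "c \<in> coords x" shows "birth (w(c := s)) x = (birth w x - w c) + s"
proof -
  have "(\<Sum>c'\<in>coords x. (w(c := s)) c') = s + (\<Sum>c'\<in>coords x - {c}. (w(c := s)) c')"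
    using assms by (subst sum.remove[of _ c]) auto
  also have "(\<Sum>c'\<in>coords x - {c}. (w(c := s)) c') = (\<Sum>c'\<in>coords x - {c}. w c')"
    by (intro sum.cong) auto
  also have "\<dots> = (\<Sum>c'\<in>coords x. w c') - w c"
    using assms by (subst (2) sum.remove[of _ c]) auto
  finally show ?thesis by (simp add: birth_coords)
qed

lemma mem_coords_iff:
  "(y, j) \<in> coords x \<longleftrightarrow> length y < length x \<and> take (length y) x = y \<and> j \<le> x ! length y"
  by (force simp: coords_def image_iff)

lemma coords_snoc: "coords (x @ [i]) = coords x \<union> {x} \<times> {..i}"
proof -
  have "(y, j) \<in> coords (x @ [i]) \<longleftrightarrow> (y, j) \<in> coords x \<or> (y = x \<and> j \<le> i)" for y j
  proof (cases "length y < length x")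
    case True
    then have "y \<noteq> x" by auto
    then show ?thesis using True by (simp add: mem_coords_iff nth_append)
  next
    case F: False
    show ?thesis
    proof (cases "y = x")
      case False
      then have "(y, j) \<notin> coords (x @ [i])" using F by (auto simp: mem_coords_iff)
      then show ?thesis using False F by (simp add: mem_coords_iff)
    qed (simp add: mem_coords_iff)
  qed
  then show ?thesis by auto
qed

text \<open>The last clock of a nonempty word determines the word: comparing these clocks gives
  equal lengths, then equal parents, then equal last letters. This is what makes births almost
  surely distinct.\<close>

lemma coords_inj:
  assumes "x \<noteq> y" shows "coords x \<noteq> coords y"
proof
  assume eq: "coords x = coords y"
  have len: "length u \<le> length v" if "coords u = coords v" for u v
  proof (cases "u = []")
    case False
    then obtain u' i where u: "u = u' @ [i]" by (metis append_butlast_last_id)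
    then have "(u', i) \<in> coords v" using that by (auto simp: coords_snoc)
    then show ?thesis using u by (auto simp: mem_coords_iff)
  qed auto
  have l: "length x = length y" using len[OF eq] len[OF eq[symmetric]] by simp
  have "x \<noteq> []" using assms l by auto
  then obtain x' i where x: "x = x' @ [i]" by (metis append_butlast_last_id)
  have "y \<noteq> []" using assms l by auto
  then obtain y' j where y: "y = y' @ [j]" by (metis append_butlast_last_id)
  have "(x', i) \<in> coords y" using eq x by (auto simp: coords_snoc)
  then have a: "x' = y'" "i \<le> j" using l x y by (auto simp: mem_coords_iff)
  have "(y', j) \<in> coords x" using eq y by (auto simp: coords_snoc)
  then have "j \<le> i" using l x y by (auto simp: mem_coords_iff)
  then show False using a assms x y by auto
qed

lemma bp_space_eq: "bp_space f = PiM UNIV (\<lambda>c. exp_meas (f (Suc (snd c))))"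
  by (simp add: bp_space_def split_def)

lemma sets_bp_space: "sets (bp_space f) = sets (PiM UNIV (\<lambda>_. borel))"
  unfolding bp_space_eq by (rule sets_PiM_cong) auto

lemma measurable_coord: "(\<lambda>w. w c) \<in> borel_measurable (bp_space f)"
  unfolding bp_space_eq by measurable

lemma measurable_birth [measurable]: "(\<lambda>w. birth w x) \<in> borel_measurable (bp_space f)"
  unfolding birth_coords by (intro borel_measurable_sum measurable_coord)

lemma space_bp_space: "space (bp_space f) = UNIV"
  by (simp add: bp_space_eq space_PiM PiE_def space_exp_meas)

lemma measurable_fun_upd_bp [measurable]:
  "(\<lambda>(x, w). w(c := x)) \<in> measurable (exp_meas r \<Otimes>\<^sub>M bp_space f) (bp_space f)"
proof -
  let ?N = "exp_meas r \<Otimes>\<^sub>M bp_space f"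
  have 1: "fst \<in> borel_measurable ?N"
    using measurable_fst[of "exp_meas r" "bp_space f"] by (simp cong: measurable_cong_sets)
  have 2: "(\<lambda>z. snd z i) \<in> borel_measurable ?N" for i
    by (rule measurable_compose[OF measurable_snd measurable_coord])
  have "(\<lambda>z. (snd z)(c := fst z)) \<in> measurable ?N (PiM UNIV (\<lambda>_. borel))"
  proof (rule measurable_PiM_single')
    fix i
    show "(\<lambda>z. ((snd z)(c := fst z)) i) \<in> borel_measurable ?N"
      using 1 2 by (cases "i = c") simp_all
  qed auto
  then show ?thesis by (simp add: split_def cong: measurable_cong_sets[OF refl sets_bp_space])
qed

section \<open>Finite populations as planar trees, and the clocks running in them\<close>

definition bp_closed :: "nat list set \<Rightarrow> bool" where
  "bp_closed A \<longleftrightarrow> finite A \<and> [] \<in> A \<and> (\<forall>x i. x @ [i] \<in> A \<longrightarrow> x \<in> A \<and> (\<forall>j\<le>i. x @ [j] \<in> A))"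

text \<open>In a closed set the children of \<open>x\<close> are numbered without gaps, so
  \<open>kids A x\<close> is also the number of the next child, and \<open>(x, kids A x)\<close> is
  the clock of \<open>x\<close> that is running while the population is \<open>A\<close>.\<close>

definition kids :: "nat list set \<Rightarrow> nat list \<Rightarrow> nat" where
  "kids A x = card {i. x @ [i] \<in> A}"

definition nxt :: "nat list set \<Rightarrow> nat list \<Rightarrow> nat list" where
  "nxt A x = x @ [kids A x]"

lemma finite_kids_set: "finite A \<Longrightarrow> finite {i. x @ [i] \<in> A}"
  by (rule finite_imageD[of "\<lambda>i. x @ [i]"]) (auto intro: finite_subset[of _ A] simp: inj_on_def)

lemma kids_set: assumes "bp_closed A" shows "{i. x @ [i] \<in> A} = {..<kids A x}"
proof -
  have fin: "finite {i. x @ [i] \<in> A}" using assms by (auto simp: bp_closed_def intro: finite_kids_set)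
  have dc: "\<And>i j. x @ [i] \<in> A \<Longrightarrow> j \<le> i \<Longrightarrow> x @ [j] \<in> A" using assms by (auto simp: bp_closed_def)
  show ?thesis
  proof (cases "{i. x @ [i] \<in> A} = {}")
    case True show ?thesis unfolding kids_def True by simp
  next
    case False
    define m where "m = Max {i. x @ [i] \<in> A}"
    have "{i. x @ [i] \<in> A} = {..m}"
    proof (intro set_eqI iffI)
      fix i assume "i \<in> {i. x @ [i] \<in> A}"
      then show "i \<in> {..m}" unfolding m_def using Max_ge[OF fin] by blast
    next
      fix i assume i: "i \<in> {..m}"
      have "x @ [m] \<in> A" using Max_in[OF fin False] unfolding m_def by blast
      then show "i \<in> {i. x @ [i] \<in> A}" using dc[of m i] i by blast
    qed
    then show ?thesis unfolding kids_def by (simp only: card_atMost) (simp only: lessThan_Suc_atMost)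
  qed
qed

lemma snoc_mem_iff: "bp_closed A \<Longrightarrow> x @ [i] \<in> A \<longleftrightarrow> i < kids A x"
  using kids_set[of A x] by auto

lemma nxt_notin: "bp_closed A \<Longrightarrow> nxt A x \<notin> A"
  by (simp add: nxt_def snoc_mem_iff)

lemma bp_closed_take:
  assumes "bp_closed A" "a \<in> A" "k \<le> length a" shows "take k a \<in> A"
  using assms(2,3)
proof (induction a rule: rev_induct)
  case (snoc i a)
  then have "a \<in> A" using assms(1) by (auto simp: bp_closed_def)
  then show ?case using snoc by (cases "k = length (a @ [i])") auto
qed auto

text \<open>Nobody alive owes its birth to a clock that is still running. Statements about the
  births of the members of \<open>A\<close> are therefore independent of that clock.\<close>

lemma clock_notin_coords:
  assumes A: "bp_closed A" and a: "a \<in> A" shows "(x, kids A x) \<notin> coords a"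
proof
  assume "(x, kids A x) \<in> coords a"
  then have l: "length x < length a" "take (length x) a = x" "kids A x \<le> a ! length x"
    unfolding mem_coords_iff by blast+
  have "take (Suc (length x)) a \<in> A" using bp_closed_take[OF A a] l(1) by simp
  moreover have "take (Suc (length x)) a = x @ [a ! length x]"
    using take_Suc_conv_app_nth[OF l(1)] l(2) by metis
  ultimately show False using l(3) snoc_mem_iff[OF A, of x "a ! length x"] by simp
qed

lemma clock_in_coords_nxt: "(x, kids A x) \<in> coords (nxt A x)"
  by (simp add: nxt_def coords_snoc)

lemma clock_notin_coords_nxt:
  assumes "bp_closed A" "y \<in> A" "y \<noteq> x" shows "(x, kids A x) \<notin> coords (nxt A y)"
  using assms clock_notin_coords[OF assms(1,2), of x] by (auto simp: nxt_def coords_snoc)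

definition pos :: "(nat list \<times> nat \<Rightarrow> real) \<Rightarrow> bool" where
  "pos w \<longleftrightarrow> (\<forall>c. 0 < w c)"

lemma birth_snoc_gt: assumes "pos w" shows "birth w x < birth w (x @ [i])"
proof -
  have "0 < (\<Sum>j\<le>i. w (x, j))" using assms by (intro sum_pos) (auto simp: pos_def)
  then show ?thesis by (simp add: birth_snoc)
qed

lemma birth_sib_mono: assumes "pos w" "j \<le> i" shows "birth w (x @ [j]) \<le> birth w (x @ [i])"
  using assms by (simp add: birth_snoc) (intro sum_mono2, auto simp: pos_def less_imp_le)

lemma birth_sib_less: assumes "pos w" "j < i" shows "birth w (x @ [j]) < birth w (x @ [i])"
  using assms by (simp add: birth_snoc)
    (intro sum_strict_mono2[where b = i], auto simp: pos_def less_imp_le)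

lemma birth_take_le: assumes "pos w" shows "birth w (take k y) \<le> birth w y"
proof (induction y rule: rev_induct)
  case (snoc i y)
  then show ?case using birth_snoc_gt[OF assms, of y i]
    by (cases "k \<le> length y") auto
qed auto

lemma birth_nonneg: "pos w \<Longrightarrow> 0 \<le> birth w x"
  using birth_take_le[of w 0 x] by simp

lemma bp_closed_pop:
  assumes "pos w" "0 \<le> T" "finite (bp_pop w T)" shows "bp_closed (bp_pop w T)"
proof -
  have "birth w x \<le> T \<and> (\<forall>j\<le>i. birth w (x @ [j]) \<le> T)" if "birth w (x @ [i]) \<le> T" for x i
    using that birth_snoc_gt[OF assms(1), of x i] birth_sib_mono[OF assms(1)]
    by (meson order_less_imp_le order_trans)
  then show ?thesis using assms unfolding bp_closed_def bp_pop_def by auto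
qed

text \<open>Absence has to be checked only for the next child of each member: a word outside
  \<open>A\<close> leaves \<open>A\<close> right after its longest prefix in \<open>A\<close>,
  through a child that is not older than the next one due, and descendants are born later.\<close>

lemma pop_eq_iff:
  assumes A: "bp_closed A" and "pos w"
  shows "bp_pop w T = A \<longleftrightarrow> (\<forall>a\<in>A. birth w a \<le> T) \<and> (\<forall>y\<in>A. T < birth w (nxt A y))"
proof safe
  fix a assume "a \<in> bp_pop w T" "A = bp_pop w T" then show "birth w a \<le> T" by (auto simp: bp_pop_def)
next
  fix y assume y: "y \<in> bp_pop w T" "A = bp_pop w T"
  with nxt_notin[OF A, of y] show "T < birth w (nxt (bp_pop w T) y)" by (auto simp: bp_pop_def)
next
  fix x assume "x \<in> A" "\<forall>a\<in>A. birth w a \<le> T" then show "x \<in> bp_pop w T" by (auto simp: bp_pop_def)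
next
  fix y assume h: "\<forall>y\<in>A. T < birth w (nxt A y)" "y \<in> bp_pop w T"
  show "y \<in> A"
  proof (rule ccontr)
    assume "y \<notin> A"
    \<comment> \<open>Length of the longest prefix of \<open>y\<close> inside \<open>A\<close>; it
      exists because the empty word belongs to \<open>A\<close>.\<close>
    define k where "k = (GREATEST k. k \<le> length y \<and> take k y \<in> A)"
    have P0: "0 \<le> length y \<and> take 0 y \<in> A" using A by (auto simp: bp_closed_def)
    have k: "k \<le> length y" "take k y \<in> A"
      using GreatestI_nat[of "\<lambda>k. k \<le> length y \<and> take k y \<in> A", OF P0, of "length y"] by (auto simp: k_def)
    have kl: "k < length y" using k \<open>y \<notin> A\<close> by (cases "k = length y") auto
    have ns: "take (Suc k) y \<notin> A"
    proof
      assume "take (Suc k) y \<in> A"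
      then have "Suc k \<le> k" unfolding k_def using kl
        by (intro Greatest_le_nat[where b = "length y"]) (auto simp: k_def)
      then show False by simp
    qed
    then have "kids A (take k y) \<le> y ! k"
      using kl A by (simp add: take_Suc_conv_app_nth snoc_mem_iff)
    then have "birth w (nxt A (take k y)) \<le> birth w (take (Suc k) y)"
      using birth_sib_mono[OF assms(2)] kl by (simp add: nxt_def take_Suc_conv_app_nth)
    also have "\<dots> \<le> birth w y" by (rule birth_take_le[OF assms(2)])
    also have "\<dots> \<le> T" using h(2) by (simp add: bp_pop_def)
    finally show False using h(1) k(2) by force
  qed
qed

text \<open>Everyone in \<open>A\<close> is born by time \<open>T\<close>, and no member other than
  \<open>x\<close> has had its next child. The next child of \<open>x\<close> is left out so that
  the event does not involve the running clock of \<open>x\<close>.\<close>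

definition ev :: "nat list set \<Rightarrow> nat list \<Rightarrow> real \<Rightarrow> (nat list \<times> nat \<Rightarrow> real) \<Rightarrow> bool" where
  "ev A x T w \<longleftrightarrow> (\<forall>a. a \<in> A \<longrightarrow> birth w a \<le> T) \<and> (\<forall>y. y \<in> A - {x} \<longrightarrow> T < birth w (nxt A y))"

lemma in_space_bp [simp]: "w \<in> space (bp_space f)"
  by (simp add: space_bp_space)

lemma pred_le_real [measurable (raw)]:
  fixes g h :: "'a \<Rightarrow> real"
  shows "g \<in> borel_measurable M \<Longrightarrow> h \<in> borel_measurable M \<Longrightarrow> Measurable.pred M (\<lambda>w. g w \<le> h w)"
  unfolding pred_def by (rule borel_measurable_le)

lemma measurable_weighted_if:
  assumes "a \<in> borel_measurable N" "b \<in> borel_measurable N" "Measurable.pred N Q"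
  shows "(\<lambda>z. ennreal (a z) * (if Q z then ennreal (b z) else 0)) \<in> borel_measurable N"
  using assms by (intro borel_measurable_times_ennreal measurable_If measurable_compose[OF _ measurable_ennreal])
    (simp_all add: pred_def)

lemma nn_integral_cmult_iterated:
  assumes N: "sigma_finite_measure N" and g [measurable]: "(\<lambda>(w, T). g w T) \<in> borel_measurable (M \<Otimes>\<^sub>M N)"
  shows "(c :: ennreal) * (\<integral>\<^sup>+w. \<integral>\<^sup>+T. g w T \<partial>N \<partial>M) = (\<integral>\<^sup>+w. \<integral>\<^sup>+T. c * g w T \<partial>N \<partial>M)"
proof -
  interpret sigma_finite_measure N by (rule N)
  have "(\<integral>\<^sup>+w. \<integral>\<^sup>+T. c * g w T \<partial>N \<partial>M) = (\<integral>\<^sup>+w. c * (\<integral>\<^sup>+T. g w T \<partial>N) \<partial>M)"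
  proof (rule nn_integral_cong)
    fix w assume "w \<in> space M"
    then show "(\<integral>\<^sup>+T. c * g w T \<partial>N) = c * (\<integral>\<^sup>+T. g w T \<partial>N)"
      by (intro nn_integral_cmult) measurable
  qed
  also have "\<dots> = c * (\<integral>\<^sup>+w. \<integral>\<^sup>+T. g w T \<partial>N \<partial>M)"
    by (rule nn_integral_cmult) measurable
  finally show ?thesis ..
qed

section \<open>Resampling a single clock, and the balance of probability flows between
  populations\<close>

locale crump_mode =
  fixes f :: "nat \<Rightarrow> real" and lam :: real
  assumes fpos: "\<And>k. 1 \<le> k \<Longrightarrow> 0 < f k" and lampos: "0 < lam"
begin

lemma prob_space_clock: "prob_space (exp_meas (f (Suc j)))"
  by (rule prob_space_exp_meas) (simp add: fpos)

sublocale bp: prob_space "bp_space f"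
  unfolding bp_space_eq by (rule prob_space_PiM) (rule prob_space_clock)

sublocale ob: prob_space "exp_meas lam"
  using lampos by (rule prob_space_exp_meas)

text \<open>Overwriting one coordinate by an independent copy preserves a product measure. This
  isolates one clock for Fubini without splitting the infinite product.\<close>

lemma resample:
  assumes [measurable]: "g \<in> borel_measurable (bp_space f)"
  shows "(\<integral>\<^sup>+w. g w \<partial>bp_space f) = (\<integral>\<^sup>+w. \<integral>\<^sup>+s. g (w(c := s)) \<partial>exp_meas (f (Suc (snd c))) \<partial>bp_space f)"
proof -
  let ?E = "exp_meas (f (Suc (snd c)))"
  interpret E: prob_space ?E by (rule prob_space_clock)
  interpret pair_sigma_finite ?E "bp_space f" ..
  have "distr (?E \<Otimes>\<^sub>M bp_space f) (bp_space f) (\<lambda>(x, X). X(c := x)) = bp_space f"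
    unfolding bp_space_eq using distr_pair_PiM_eq_PiM[of UNIV "\<lambda>c. exp_meas (f (Suc (snd c)))" c] prob_space_clock
    by simp
  then have "(\<integral>\<^sup>+w. g w \<partial>bp_space f) = (\<integral>\<^sup>+w. g w \<partial>distr (?E \<Otimes>\<^sub>M bp_space f) (bp_space f) (\<lambda>(x, X). X(c := x)))"
    by simp
  also have "\<dots> = (\<integral>\<^sup>+z. g ((snd z)(c := fst z)) \<partial>(?E \<Otimes>\<^sub>M bp_space f))"
    by (subst nn_integral_distr) (auto simp: split_def)
  also have "\<dots> = (\<integral>\<^sup>+w. \<integral>\<^sup>+s. g (w(c := s)) \<partial>?E \<partial>bp_space f)"
    by (subst nn_integral_snd[symmetric])
       (auto intro!: measurable_compose[OF measurable_fun_upd_bp[unfolded split_def] assms])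
  finally show ?thesis .
qed

lemma AE_resample:
  assumes [measurable]: "Measurable.pred (bp_space f) P"
  assumes "\<And>w. AE s in exp_meas (f (Suc (snd c))). P (w(c := s))"
  shows "AE w in bp_space f. P w"
proof -
  have [measurable]: "{w. \<not> P w} \<in> sets (bp_space f)"
    using sets.sets_Collect_neg[of "bp_space f" P] assms(1) by (simp add: pred_def space_bp_space)
  have "emeasure (bp_space f) {w. \<not> P w} = (\<integral>\<^sup>+w. (if P w then 0 else 1) \<partial>bp_space f)"
    by (subst nn_integral_indicator[symmetric], simp, intro nn_integral_cong, simp add: indicator_def)
  also have "\<dots> = (\<integral>\<^sup>+w. \<integral>\<^sup>+s. (if P (w(c := s)) then 0 else 1) \<partial>exp_meas (f (Suc (snd c))) \<partial>bp_space f)"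
    by (rule resample) measurable
  also have "\<dots> = (\<integral>\<^sup>+w. \<integral>\<^sup>+s. 0 \<partial>exp_meas (f (Suc (snd c))) \<partial>bp_space f)"
    by (intro nn_integral_cong nn_integral_cong_AE) (use assms(2) in \<open>auto elim: eventually_mono\<close>)
  finally show ?thesis by (subst AE_iff_measurable[OF _ refl]) (auto simp: space_bp_space)
qed

lemma AE_pos: "AE w in bp_space f. pos w"
  unfolding pos_def
proof (subst AE_all_countable, intro allI)
  fix c :: "nat list \<times> nat"
  show "AE w in bp_space f. 0 < w c"
  proof (rule AE_resample[of _ c])
    show "Measurable.pred (bp_space f) (\<lambda>w. 0 < w c)" using measurable_coord[of c f] by measurable
  qed (auto simp: AE_exp_meas_pos)
qed

text \<open>Some clock occurs in one of the two sums only. With all other clocks fixed, equality of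
  the birth times prescribes the value of this clock, a null event for an exponential law.\<close>

lemma AE_birth_neq: assumes "x \<noteq> y" shows "AE w in bp_space f. birth w x \<noteq> birth w y"
proof -
  have *: "AE w in bp_space f. birth w x \<noteq> birth w y" if "c \<in> coords x" "c \<notin> coords y" for x y c
  proof (rule AE_resample[of _ c])
    fix w
    have "AE s in exp_meas (f (Suc (snd c))). s \<noteq> birth w y - (birth w x - w c)"
      by (rule AE_exp_meas_neq)
    then show "AE s in exp_meas (f (Suc (snd c))). birth (w(c := s)) x \<noteq> birth (w(c := s)) y"
      by eventually_elim (simp add: birth_upd_in[OF that(1)] birth_upd_notin[OF that(2)])
  next
    have eq: "(\<lambda>w. birth w x \<noteq> birth w y) = (\<lambda>w. \<not> (birth w x \<le> birth w y \<and> birth w y \<le> birth w x))"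
      by (auto intro!: ext)
    show "Measurable.pred (bp_space f) (\<lambda>w. birth w x \<noteq> birth w y)"
      unfolding eq by measurable
  qed
  from coords_inj[OF assms] obtain c where
    "c \<in> coords x \<and> c \<notin> coords y \<or> c \<in> coords y \<and> c \<notin> coords x" by blast
  then show ?thesis using *[of c x y] *[of c y x] by (auto simp: eq_commute)
qed

lemma AE_inj: "AE w in bp_space f. inj (birth w)"
proof -
  have "AE w in bp_space f. \<forall>x y. x \<noteq> y \<longrightarrow> birth w x \<noteq> birth w y"
    by (intro AE_all_countable[THEN iffD2] allI) (use AE_birth_neq in auto)
  then show ?thesis by eventually_elim (auto simp: inj_on_def)
qed

lemma measurable_ev [measurable (raw)]:
  assumes [measurable]: "T \<in> borel_measurable M" "W \<in> measurable M (bp_space f)"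
  shows "Measurable.pred M (\<lambda>z. ev A x (T z) (W z))"
  unfolding ev_def using measurable_compose[OF assms(2) measurable_birth] by measurable

lemma measurable_pop_eq [measurable]:
  "{(w, T). bp_pop w T = A} \<in> sets (bp_space f \<Otimes>\<^sub>M exp_meas lam)"
proof -
  let ?M = "bp_space f \<Otimes>\<^sub>M exp_meas lam"
  have [measurable]: "(\<lambda>z. birth (fst z) x) \<in> borel_measurable ?M" for x
    by (rule measurable_compose[OF measurable_fst measurable_birth])
  have [measurable]: "snd \<in> borel_measurable ?M"
    using measurable_snd[of "bp_space f" "exp_meas lam"] by (simp add: measurable_cong_sets[OF refl sets_exp_meas])
  have "{z \<in> space ?M. \<forall>x. birth (fst z) x \<le> snd z \<longleftrightarrow> x \<in> A} \<in> sets ?M"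
    by measurable
  also have "{z \<in> space ?M. \<forall>x. birth (fst z) x \<le> snd z \<longleftrightarrow> x \<in> A} = {z. bp_pop (fst z) (snd z) = A}"
    unfolding bp_pop_def set_eq_iff by (simp add: space_pair_measure space_exp_meas)
  finally show ?thesis by (simp add: split_def)
qed

definition phi :: "nat list set \<Rightarrow> ennreal" where
  "phi A = emeasure (bp_space f \<Otimes>\<^sub>M exp_meas lam) {(w, T). bp_pop w T = A}"

text \<open>Probability that the population passes through \<open>A\<close>, leaves it by the birth
  of the next child of \<open>x\<close>, and does so before the observation time:
  \<open>exp (- lam * t)\<close> is the probability that the observation comes after
  \<open>t\<close>.\<close>

definition exit_weight :: "nat list set \<Rightarrow> nat list \<Rightarrow> ennreal" where
  "exit_weight A x = (\<integral>\<^sup>+w. (if ev A x (birth w (nxt A x)) w then ennreal (exp (- lam * birth w (nxt A x))) else 0) \<partial>bp_space f)"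

lemma phi_eq: "phi A = (\<integral>\<^sup>+w. emeasure (exp_meas lam) {T. bp_pop w T = A} \<partial>bp_space f)"
  unfolding phi_def by (subst ob.emeasure_pair_measure_alt[OF measurable_pop_eq]) (simp add: vimage_def)

lemma ev_upd:
  assumes A: "bp_closed A"
  shows "ev A x T (w((x, kids A x) := s)) = ev A x T w"
  unfolding ev_def
  by (auto simp: birth_upd_notin[OF clock_notin_coords[OF A]] birth_upd_notin[OF clock_notin_coords_nxt[OF A]])

text \<open>Subtracting the running clock of \<open>x\<close> from its next birth leaves the birth
  of its youngest child, or of \<open>x\<close> itself if it has none. Either is in
  \<open>A\<close>, hence born by \<open>T\<close>.\<close>

lemma ev_imp:
  assumes A: "bp_closed A" and x: "x \<in> A" and "ev A x T w"
  shows "0 \<le> T" "birth w (nxt A x) - w (x, kids A x) \<le> T"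
proof -
  have b: "birth w a \<le> T" if "a \<in> A" for a using assms(3) that by (auto simp: ev_def)
  show "0 \<le> T" using b[of "[]"] A by (auto simp: bp_closed_def)
  show "birth w (nxt A x) - w (x, kids A x) \<le> T"
  proof (cases "kids A x")
    case 0
    then show ?thesis using b[OF x] by (simp add: nxt_def birth_snoc)
  next
    case (Suc k)
    have "x @ [k] \<in> A" using A Suc by (simp add: snoc_mem_iff)
    from b[OF this] show ?thesis by (simp add: nxt_def birth_snoc Suc)
  qed
qed

text \<open>The waiting time of the next child of \<open>x\<close> is exponential and independent of the remaining
  coordinates, which decide \<open>ev A x\<close>; shifting it turns the density of the exit time into an occupation
  time.\<close>
lemma exit_phi:
  assumes A: "bp_closed A" and x: "x \<in> A"
  shows "ennreal lam * exit_weight A x = ennreal (f (Suc (kids A x))) * phi A"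
proof -
  define F where "F = f (Suc (kids A x))"
  define c where "c = (x, kids A x)"
  \<comment> \<open>The moment at which the running clock of \<open>x\<close> was started.\<close>
  define u where "u w = birth w (nxt A x) - w c" for w
  have F: "0 < F" unfolding F_def by (simp add: fpos)
  have cF: "f (Suc (snd c)) = F" by (simp add: c_def F_def)
  have [measurable]: "u \<in> borel_measurable (bp_space f)" unfolding u_def using measurable_coord[of c f] by measurable
  have um: "(\<lambda>z. u (fst z)) \<in> borel_measurable (bp_space f \<Otimes>\<^sub>M lborel)"
    by (rule measurable_compose[OF measurable_fst]) fact
  have evm: "Measurable.pred (bp_space f \<Otimes>\<^sub>M lborel) (\<lambda>z. ev A x (snd z) (fst z))"
    by (rule measurable_ev[OF _ measurable_fst]) simp
  have nx: "birth (w(c := s)) (nxt A x) = u w + s" for w s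
    unfolding u_def c_def by (rule birth_upd_in) (rule clock_in_coords_nxt)
  have evu: "ev A x T (w(c := s)) = ev A x T w" for T w s unfolding c_def by (rule ev_upd[OF A])
  \<comment> \<open>The common value of both sides. On the exit side \<open>T\<close> is the time of
    the next birth, distributed according to the clock; on the other side \<open>T\<close> is the
    observation time, and the clock contributes the probability \<open>exp (- F * (T - u w))\<close>
    that it has not rung.\<close>
  let ?J = "\<integral>\<^sup>+w. \<integral>\<^sup>+T. (if ev A x T w then ennreal (lam * F * exp (- lam * T) * exp (- F * (T - u w))) else 0) \<partial>lborel \<partial>bp_space f"
  have "exit_weight A x = (\<integral>\<^sup>+w. \<integral>\<^sup>+s. (if ev A x (u w + s) w then ennreal (exp (- lam * (u w + s))) else 0) \<partial>exp_meas F \<partial>bp_space f)"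
    unfolding exit_weight_def by (subst resample[of _ c]) (simp_all add: nx evu cF cong: if_cong)
  also have "\<dots> = (\<integral>\<^sup>+w. \<integral>\<^sup>+s. ennreal (exponential_density F s) * (if ev A x (u w + s) w then ennreal (exp (- lam * (u w + s))) else 0) \<partial>lborel \<partial>bp_space f)"
    by (intro nn_integral_cong nn_integral_exp_meas) measurable
  also have "\<dots> = (\<integral>\<^sup>+w. \<integral>\<^sup>+T. ennreal (exponential_density F (T - u w)) * (if ev A x T w then ennreal (exp (- lam * T)) else 0) \<partial>lborel \<partial>bp_space f)"
  proof (rule nn_integral_cong)
    fix w
    show "(\<integral>\<^sup>+s. ennreal (exponential_density F s) * (if ev A x (u w + s) w then ennreal (exp (- lam * (u w + s))) else 0) \<partial>lborel)
       = (\<integral>\<^sup>+T. ennreal (exponential_density F (T - u w)) * (if ev A x T w then ennreal (exp (- lam * T)) else 0) \<partial>lborel)"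
      by (subst nn_integral_real_affine[where c = 1 and t = "- u w"]) (simp_all cong: if_cong)
  qed
  also have "ennreal lam * \<dots> = (\<integral>\<^sup>+w. \<integral>\<^sup>+T. ennreal lam * (ennreal (exponential_density F (T - u w)) * (if ev A x T w then ennreal (exp (- lam * T)) else 0)) \<partial>lborel \<partial>bp_space f)"
    by (rule nn_integral_cmult_iterated[OF lborel.sigma_finite_measure_axioms], unfold split_beta',
        rule measurable_weighted_if[OF _ _ evm]) (use um in measurable)
  also have "\<dots> = ?J"
  proof (rule nn_integral_cong_AE, rule AE_mp[OF AE_pos], intro AE_I2 impI nn_integral_cong)
    fix w T assume "pos w"
    show "ennreal lam * (ennreal (exponential_density F (T - u w)) * (if ev A x T w then ennreal (exp (- lam * T)) else 0))
      = (if ev A x T w then ennreal (lam * F * exp (- lam * T) * exp (- F * (T - u w))) else 0)"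
    proof (cases "ev A x T w")
      case True
      have "u w \<le> T" using ev_imp(2)[OF A x True] by (simp add: u_def c_def)
      then have d: "exponential_density F (T - u w) = F * exp (- F * (T - u w))"
        by (simp add: exponential_density_def algebra_simps)
      show ?thesis
        unfolding d using True lampos F by (simp add: ennreal_mult less_imp_le mult_ac del: mult_minus_left)
    qed simp
  qed
  finally have 1: "ennreal lam * exit_weight A x = ?J" .
  have "phi A = (\<integral>\<^sup>+w. \<integral>\<^sup>+T. (if ev A x T w \<and> T < birth w (nxt A x) then 1 else 0) \<partial>exp_meas lam \<partial>bp_space f)"
    unfolding phi_eq
  proof (rule nn_integral_cong_AE, rule AE_mp[OF AE_pos], intro AE_I2 impI)
    fix w assume w: "pos w"
    have "emeasure (exp_meas lam) {T. bp_pop w T = A} = (\<integral>\<^sup>+T. indicator {T. ev A x T w \<and> T < birth w (nxt A x)} T \<partial>exp_meas lam)"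
      using x by (subst nn_integral_indicator) (auto simp: pop_eq_iff[OF A w] ev_def intro!: arg_cong2[where f = emeasure])
    also have "\<dots> = (\<integral>\<^sup>+T. (if ev A x T w \<and> T < birth w (nxt A x) then 1 else 0) \<partial>exp_meas lam)"
      by (rule nn_integral_cong) (auto split: split_indicator)
    finally show "emeasure (exp_meas lam) {T. bp_pop w T = A} = (\<integral>\<^sup>+T. (if ev A x T w \<and> T < birth w (nxt A x) then 1 else 0) \<partial>exp_meas lam)" .
  qed
  also have "\<dots> = (\<integral>\<^sup>+w. \<integral>\<^sup>+s. \<integral>\<^sup>+T. (if ev A x T w \<and> T < u w + s then 1 else 0) \<partial>exp_meas lam \<partial>exp_meas F \<partial>bp_space f)"
    by (subst resample[of _ c]) (simp_all add: nx evu cF cong: if_cong)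
  also have "\<dots> = (\<integral>\<^sup>+w. \<integral>\<^sup>+T. (if ev A x T w then ennreal (exp (- F * (T - u w))) else 0) \<partial>exp_meas lam \<partial>bp_space f)"
  proof (rule nn_integral_cong)
    fix w
    interpret E: prob_space "exp_meas F" using F by (rule prob_space_exp_meas)
    interpret P: pair_sigma_finite "exp_meas lam" "exp_meas F" ..
    have "(\<integral>\<^sup>+s. \<integral>\<^sup>+T. (if ev A x T w \<and> T < u w + s then 1 else 0) \<partial>exp_meas lam \<partial>exp_meas F)
      = (\<integral>\<^sup>+T. \<integral>\<^sup>+s. (if ev A x T w \<and> T < u w + s then 1 else 0) \<partial>exp_meas F \<partial>exp_meas lam)"
      by (rule P.Fubini') measurable
    also have "\<dots> = (\<integral>\<^sup>+T. (if ev A x T w then ennreal (exp (- F * (T - u w))) else 0) \<partial>exp_meas lam)"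
    proof (rule nn_integral_cong)
      fix T
      show "(\<integral>\<^sup>+s. (if ev A x T w \<and> T < u w + s then 1 else 0) \<partial>exp_meas F) = (if ev A x T w then ennreal (exp (- F * (T - u w))) else 0)"
      proof (cases "ev A x T w")
        case True
        have "(\<integral>\<^sup>+s. (if T < u w + s then 1 else 0) \<partial>exp_meas F) = (\<integral>\<^sup>+s. indicator {T - u w<..} s \<partial>exp_meas F)"
          by (intro nn_integral_cong) (auto simp: indicator_def)
        also have "\<dots> = ennreal (exp (- F * (T - u w)))"
          using emeasure_exp_meas_Ioi[OF F, of "T - u w"] ev_imp(2)[OF A x True] by (simp add: u_def c_def)
        finally show ?thesis using True by simp
      qed auto
    qed
    finally show "(\<integral>\<^sup>+s. \<integral>\<^sup>+T. (if ev A x T w \<and> T < u w + s then 1 else 0) \<partial>exp_meas lam \<partial>exp_meas F)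
      = (\<integral>\<^sup>+T. (if ev A x T w then ennreal (exp (- F * (T - u w))) else 0) \<partial>exp_meas lam)" .
  qed
  also have "\<dots> = (\<integral>\<^sup>+w. \<integral>\<^sup>+T. ennreal (exponential_density lam T) * (if ev A x T w then ennreal (exp (- F * (T - u w))) else 0) \<partial>lborel \<partial>bp_space f)"
    by (intro nn_integral_cong nn_integral_exp_meas) measurable
  also have "ennreal F * \<dots> = (\<integral>\<^sup>+w. \<integral>\<^sup>+T. ennreal F * (ennreal (exponential_density lam T) * (if ev A x T w then ennreal (exp (- F * (T - u w))) else 0)) \<partial>lborel \<partial>bp_space f)"
    by (rule nn_integral_cmult_iterated[OF lborel.sigma_finite_measure_axioms], unfold split_beta',
        rule measurable_weighted_if[OF _ _ evm]) (use um in measurable)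
  also have "\<dots> = ?J"
  proof (intro nn_integral_cong)
    fix w T
    show "ennreal F * (ennreal (exponential_density lam T) * (if ev A x T w then ennreal (exp (- F * (T - u w))) else 0))
      = (if ev A x T w then ennreal (lam * F * exp (- lam * T) * exp (- F * (T - u w))) else 0)"
    proof (cases "ev A x T w")
      case True
      have d: "exponential_density lam T = lam * exp (- lam * T)"
        using ev_imp(1)[OF A x True] by (simp add: exponential_density_def mult.commute)
      show ?thesis
        unfolding d using True lampos F by (simp add: ennreal_mult less_imp_le mult_ac del: mult_minus_left)
    qed simp
  qed
  finally show ?thesis using 1 by (simp add: F_def)
qed

text \<open>The members that can have been born last: childless individuals, different from the
  root, without younger siblings.\<close>

definition removable :: "nat list set \<Rightarrow> nat list set" where
  "removable A = {a \<in> A. a \<noteq> [] \<and> bp_closed (A - {a})}"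

lemma nxt_removable:
  assumes A: "bp_closed A" and a: "a \<in> removable A"
  shows "nxt (A - {a}) (butlast a) = a"
proof -
  define x l where "x = butlast a" and "l = last a"
  have ax: "a = x @ [l]" using a by (simp add: x_def l_def removable_def)
  have A': "bp_closed (A - {a})" and aA: "a \<in> A" using a by (auto simp: removable_def)
  have "\<not> l < kids (A - {a}) x" using snoc_mem_iff[OF A', of x l] ax by auto
  moreover have "\<not> kids (A - {a}) x < l"
  proof
    assume lt: "kids (A - {a}) x < l"
    have "x @ [kids (A - {a}) x] \<in> A" using A aA lt ax unfolding bp_closed_def by (metis less_imp_le)
    then have "x @ [kids (A - {a}) x] \<in> A - {a}" using lt ax by auto
    then show False using snoc_mem_iff[OF A'] by blast
  qed
  ultimately show ?thesis by (simp add: nxt_def ax)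
qed

lemma nxt_Diff: "y \<noteq> butlast a \<Longrightarrow> nxt (A - {a}) y = nxt A y"
  unfolding nxt_def kids_def by (auto intro!: arg_cong[where f = card])

lemma nxt_eq_iff [simp]: "nxt A x = nxt A y \<longleftrightarrow> x = y"
  by (auto simp: nxt_def)

text \<open>The set of times \<open>T\<close> at which the population is \<open>A\<close> is an interval from the birth of the
  youngest member to the next birth; both sides evaluate \<open>exp (- lam * T)\<close> at its end points.\<close>
lemma balance_path:
  assumes A: "bp_closed A" and w: "pos w" "inj (birth w)"
  shows "emeasure (exp_meas lam) {T. bp_pop w T = A}
      + (\<Sum>x\<in>A. if ev A x (birth w (nxt A x)) w then ennreal (exp (- lam * birth w (nxt A x))) else 0)
    = (if A = {[]} then 1 else 0)
      + (\<Sum>a\<in>removable A. if ev (A - {a}) (butlast a) (birth w a) w then ennreal (exp (- lam * birth w a)) else 0)"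
proof -
  have fin: "finite A" and nil: "[] \<in> A" using A by (auto simp: bp_closed_def)
  have finR: "finite (removable A)" using fin by (auto simp: removable_def)
  define al ga where "al = Max (birth w ` A)" and "ga = Min ((\<lambda>y. birth w (nxt A y)) ` A)"
  have "al \<in> birth w ` A" unfolding al_def using fin nil by (intro Max_in) auto
  then obtain a0 where a0: "a0 \<in> A" "al = birth w a0" by auto
  have "ga \<in> (\<lambda>y. birth w (nxt A y)) ` A" unfolding ga_def using fin nil by (intro Min_in) auto
  then obtain x0 where x0: "x0 \<in> A" "ga = birth w (nxt A x0)" by auto
  have le_al: "birth w a \<le> al" if "a \<in> A" for a unfolding al_def using fin that by auto
  have ga_le: "ga \<le> birth w (nxt A y)" if "y \<in> A" for y unfolding ga_def using fin that by auto
  have ne: "birth w x = birth w y \<longleftrightarrow> x = y" for x y using w(2) by (auto simp: inj_on_def)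
  have al0: "0 \<le> al" using le_al[OF nil] by simp
  have al_ga: "al \<noteq> ga" using a0 x0 ne nxt_notin[OF A, of x0] by metis
  have pop: "{T. bp_pop w T = A} = {al..<ga}"
    using le_al ga_le a0 x0 unfolding pop_eq_iff[OF A w(1)] by fastforce
  have evx: "ev A x (birth w (nxt A x)) w \<longleftrightarrow> al < ga \<and> x = x0" if x: "x \<in> A" for x
  proof
    assume e: "ev A x (birth w (nxt A x)) w"
    have xx: "x = x0"
    proof (rule ccontr)
      assume "x \<noteq> x0"
      then have "birth w (nxt A x) < birth w (nxt A x0)" using e x0 by (auto simp: ev_def)
      then show False using ga_le[OF x] x0 by simp
    qed
    then show "al < ga \<and> x = x0" using e a0 x0 al_ga by (auto simp: ev_def)
  next
    assume h: "al < ga \<and> x = x0"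
    have "ga < birth w (nxt A y)" if "y \<in> A - {x0}" for y
      using ga_le[of y] that x0(2) ne[of "nxt A x0" "nxt A y"] by (auto simp: less_le)
    then show "ev A x (birth w (nxt A x)) w" using h le_al x0(2) unfolding ev_def by fastforce
  qed
  have S1: "(\<Sum>x\<in>A. if ev A x (birth w (nxt A x)) w then ennreal (exp (- lam * birth w (nxt A x))) else 0)
    = (if al < ga then ennreal (exp (- lam * ga)) else 0)"
  proof -
    have "(\<Sum>x\<in>A. if ev A x (birth w (nxt A x)) w then ennreal (exp (- lam * birth w (nxt A x))) else 0)
      = (\<Sum>x\<in>A. if x = x0 then (if al < ga then ennreal (exp (- lam * ga)) else 0) else 0)"
      using evx x0 by (intro sum.cong) auto
    then show ?thesis using fin x0 by simp
  qed
  have eva: "ev (A - {a}) (butlast a) (birth w a) w \<longleftrightarrow> al < ga \<and> a = a0" if a: "a \<in> removable A" for a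
  proof
    assume e: "ev (A - {a}) (butlast a) (birth w a) w"
    have aA: "a \<in> A" "a \<noteq> []" using a by (auto simp: removable_def)
    have "a = a0"
    proof (rule ccontr)
      assume "a \<noteq> a0"
      then have "birth w a0 \<le> birth w a" using e a0(1) by (auto simp: ev_def)
      then have "birth w a0 = birth w a" using le_al[OF aA(1)] a0(2) by simp
      then show False using ne \<open>a \<noteq> a0\<close> by simp
    qed
    moreover have "birth w a < birth w (nxt A y)" if y: "y \<in> A" for y
    proof -
      consider "y = a" | "y = butlast a" | "y \<in> A - {a} - {butlast a}" using y by blast
      then show ?thesis
      proof cases
        case 1 then show ?thesis by (simp add: nxt_def birth_snoc_gt[OF w(1)])
      next
        case 2
        have "butlast a @ [last a] \<in> A" using aA by simp
        then have "last a < kids A (butlast a)" using snoc_mem_iff[OF A] by blast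
        then have "birth w (butlast a @ [last a]) < birth w (nxt A y)"
          unfolding nxt_def 2 by (rule birth_sib_less[OF w(1)])
        then show ?thesis using aA by simp
      next
        case 3
        then have "birth w a < birth w (nxt (A - {a}) y)" using e by (auto simp: ev_def)
        then show ?thesis using 3 nxt_Diff[of y a A] by simp
      qed
    qed
    ultimately show "al < ga \<and> a = a0" using x0 a0(2) by blast
  next
    assume h: "al < ga \<and> a = a0"
    have "birth w a < birth w (nxt (A - {a}) y)" if "y \<in> A - {a} - {butlast a}" for y
      using ga_le[of y] that h a0 nxt_Diff[of y a A] by auto
    then show "ev (A - {a}) (butlast a) (birth w a) w" using h le_al a0(2) unfolding ev_def by auto
  qed
  \<comment> \<open>The root population is entered at time 0, where \<open>exp (- lam * T)\<close>
    is 1; every other population is entered at the birth of a member different from the root,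
    counted by the sum over \<open>removable A\<close>.\<close>
  show ?thesis
  proof (cases "A = {[]}")
    case True
    have R: "removable A = {}" using True by (auto simp: removable_def)
    have "al = 0" using a0 True by auto
    moreover have "0 < ga" using x0 birth_snoc_gt[OF w(1), of "[]"] True by (auto simp: nxt_def)
    ultimately show ?thesis
      unfolding pop S1 R using True lampos emeasure_exp_meas_Ico[OF lampos al0, of ga]
      by (simp add: ennreal_plus[symmetric] del: ennreal_plus)
  next
    case False
    then obtain b where b: "b \<in> A" "b \<noteq> []" using nil by blast
    have "birth w [] < birth w b"
      using birth_nonneg[OF w(1), of b] ne[of b "[]"] b by (auto simp: less_le)
    then have a0n: "a0 \<noteq> []" using le_al[OF b(1)] a0(2) by auto
    \<comment> \<open>The youngest member can be removed, because its children and its younger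
      siblings would have been born after it.\<close>
    have a0R: "a0 \<in> removable A"
    proof -
      have c: "x \<in> A - {a0} \<and> (\<forall>j\<le>i. x @ [j] \<in> A - {a0})" if x: "x @ [i] \<in> A - {a0}" for x i
      proof -
        have 1: "x \<in> A" "\<And>j. j \<le> i \<Longrightarrow> x @ [j] \<in> A" using x A by (auto simp: bp_closed_def)
        have 2: "birth w (x @ [i]) \<le> birth w a0" using x le_al a0(2) by auto
        have "x \<noteq> a0" using birth_snoc_gt[OF w(1), of x i] 2 by auto
        moreover have "x @ [j] \<noteq> a0" if "j \<le> i" for j
          using birth_sib_less[OF w(1), of j i x] 2 that x by (cases "j = i") auto
        ultimately show ?thesis using 1 by blast
      qed
      have "bp_closed (A - {a0})"
        unfolding bp_closed_def using c fin nil a0n by blast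
      then show ?thesis unfolding removable_def using a0(1) a0n by blast
    qed
    have S2: "(\<Sum>a\<in>removable A. if ev (A - {a}) (butlast a) (birth w a) w then ennreal (exp (- lam * birth w a)) else 0)
      = (if al < ga then ennreal (exp (- lam * al)) else 0)"
    proof -
      have "(\<Sum>a\<in>removable A. if ev (A - {a}) (butlast a) (birth w a) w then ennreal (exp (- lam * birth w a)) else 0)
        = (\<Sum>a\<in>removable A. if a = a0 then (if al < ga then ennreal (exp (- lam * al)) else 0) else 0)"
        using eva a0(2) by (intro sum.cong) auto
      then show ?thesis using finR a0R by simp
    qed
    show ?thesis
    proof (cases "al < ga")
      case True
      then show ?thesis
        unfolding pop S1 S2 using False lampos emeasure_exp_meas_Ico[OF lampos al0, of ga]
        by (simp add: ennreal_plus[symmetric] del: ennreal_plus)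
    next
      case F: False
      then show ?thesis unfolding pop S1 S2 using False by simp
    qed
  qed
qed

text \<open>Expectation of \<open>balance_path\<close>: a population that reaches \<open>A\<close>
  before the observation either is observed in \<open>A\<close> or leaves it before the
  observation.\<close>

lemma balance:
  assumes A: "bp_closed A"
  shows "phi A + (\<Sum>x\<in>A. exit_weight A x) = (if A = {[]} then 1 else 0) + (\<Sum>a\<in>removable A. exit_weight (A - {a}) (butlast a))"
proof -
  have [measurable]: "(\<lambda>w. emeasure (exp_meas lam) {T. bp_pop w T = A}) \<in> borel_measurable (bp_space f)"
    using ob.measurable_emeasure_Pair[OF measurable_pop_eq[of A]] by (simp add: vimage_def)
  have [measurable]: "(\<lambda>w. if ev B x (birth w z) w then ennreal (exp (- lam * birth w z)) else 0) \<in> borel_measurable (bp_space f)" for B x z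
  proof -
    have "Measurable.pred (bp_space f) (\<lambda>w. ev B x (birth w z) w)"
      by (rule measurable_ev[OF measurable_birth]) simp
    moreover have "(\<lambda>w. ennreal (exp (- lam * birth w z))) \<in> borel_measurable (bp_space f)"
      by (intro measurable_compose[OF measurable_birth]) simp
    ultimately show ?thesis by (intro measurable_If) (simp_all add: pred_def)
  qed
  have "phi A + (\<Sum>x\<in>A. exit_weight A x) = (\<integral>\<^sup>+w. (emeasure (exp_meas lam) {T. bp_pop w T = A}
      + (\<Sum>x\<in>A. if ev A x (birth w (nxt A x)) w then ennreal (exp (- lam * birth w (nxt A x))) else 0)) \<partial>bp_space f)"
    unfolding phi_eq exit_weight_def by (subst nn_integral_add, measurable) (subst nn_integral_sum, measurable)
  also have "\<dots> = (\<integral>\<^sup>+w. ((if A = {[]} then 1 else 0)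
      + (\<Sum>a\<in>removable A. if ev (A - {a}) (butlast a) (birth w a) w then ennreal (exp (- lam * birth w a)) else 0)) \<partial>bp_space f)"
    by (rule nn_integral_cong_AE) (use AE_pos AE_inj in eventually_elim, rule balance_path[OF A])
  also have "\<dots> = (if A = {[]} then 1 else 0) + (\<Sum>a\<in>removable A. exit_weight (A - {a}) (butlast a))"
  proof -
    have "(\<Sum>a\<in>removable A. exit_weight (A - {a}) (butlast a)) = (\<Sum>a\<in>removable A. \<integral>\<^sup>+w. (if ev (A - {a}) (butlast a) (birth w a) w
        then ennreal (exp (- lam * birth w a)) else 0) \<partial>bp_space f)"
      by (intro sum.cong refl) (simp only: exit_weight_def nxt_removable[OF A])
    then show ?thesis
      by (subst nn_integral_add, measurable) (subst nn_integral_sum, measurable, simp add: bp.emeasure_space_1)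
  qed
  finally show ?thesis .
qed

definition planar_prob :: "nat list set \<Rightarrow> real" where
  "planar_prob A = measure (bp_space f \<Otimes>\<^sub>M exp_meas lam) {(w, T). bp_pop w T = A}"

text \<open>\<open>balance\<close> multiplied by \<open>lam\<close>, with every exit weight replaced
  through \<open>exit_phi\<close>. Before the birth of \<open>a\<close> its parent had
  \<open>last a\<close> children, hence degree \<open>Suc (last a)\<close>.\<close>

lemma planar_prob_rec:
  assumes A: "bp_closed A"
  shows "(lam + (\<Sum>x\<in>A. f (Suc (kids A x)))) * planar_prob A
    = (if A = {[]} then lam else 0) + (\<Sum>a\<in>removable A. f (Suc (last a)) * planar_prob (A - {a}))"
proof -
  interpret P: pair_prob_space "bp_space f" "exp_meas lam" ..
  have phi: "phi B = ennreal (planar_prob B)" for B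
    by (simp add: phi_def planar_prob_def P.emeasure_eq_measure)
  have pp0: "0 \<le> planar_prob B" for B by (simp add: planar_prob_def)
  have fin: "finite A" using A by (auto simp: bp_closed_def)
  have e: "ennreal lam * exit_weight B x = ennreal (f (Suc (kids B x)) * planar_prob B)" if "bp_closed B" "x \<in> B" for B x
    using exit_phi[OF that] by (simp add: phi ennreal_mult' fpos less_imp_le)
  have R: "butlast a \<in> A - {a}" "kids (A - {a}) (butlast a) = last a" if "a \<in> removable A" for a
  proof -
    have c: "bp_closed (A - {a})" "a \<in> A" "a \<noteq> []" using that by (auto simp: removable_def)
    then have "butlast a @ [last a] \<in> A" by simp
    then have "butlast a \<in> A" using A unfolding bp_closed_def by blast
    moreover have "butlast a \<noteq> a" using c(3) by (metis append_butlast_last_id not_Cons_self2 append_self_conv)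
    ultimately show "butlast a \<in> A - {a}" by blast
    have "butlast a @ [kids (A - {a}) (butlast a)] = butlast a @ [last a]"
      using nxt_removable[OF A that] c(3) by (simp add: nxt_def)
    then show "kids (A - {a}) (butlast a) = last a" by simp
  qed
  have "ennreal lam * (phi A + (\<Sum>x\<in>A. exit_weight A x)) = ennreal (lam * planar_prob A + (\<Sum>x\<in>A. f (Suc (kids A x)) * planar_prob A))"
  proof -
    have "ennreal lam * (\<Sum>x\<in>A. exit_weight A x) = (\<Sum>x\<in>A. ennreal (f (Suc (kids A x)) * planar_prob A))"
      unfolding sum_distrib_left by (intro sum.cong refl e[OF A])
    also have "\<dots> = ennreal (\<Sum>x\<in>A. f (Suc (kids A x)) * planar_prob A)"
      by (intro sum_ennreal mult_nonneg_nonneg pp0) (simp add: fpos less_imp_le)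
    finally show ?thesis unfolding distrib_left phi using lampos pp0
      by (subst ennreal_plus) (auto intro!: sum_nonneg mult_nonneg_nonneg simp: ennreal_mult' fpos less_imp_le)
  qed
  moreover have "ennreal lam * ((if A = {[]} then 1 else 0) + (\<Sum>a\<in>removable A. exit_weight (A - {a}) (butlast a)))
    = ennreal ((if A = {[]} then lam else 0) + (\<Sum>a\<in>removable A. f (Suc (last a)) * planar_prob (A - {a})))"
  proof -
    have "ennreal lam * (\<Sum>a\<in>removable A. exit_weight (A - {a}) (butlast a)) = (\<Sum>a\<in>removable A. ennreal (f (Suc (last a)) * planar_prob (A - {a})))"
      unfolding sum_distrib_left
    proof (intro sum.cong refl)
      fix a assume a: "a \<in> removable A"
      then have "bp_closed (A - {a})" by (simp add: removable_def)
      from e[OF this R(1)[OF a]] R(2)[OF a]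
      show "ennreal lam * exit_weight (A - {a}) (butlast a) = ennreal (f (Suc (last a)) * planar_prob (A - {a}))" by simp
    qed
    also have "\<dots> = ennreal (\<Sum>a\<in>removable A. f (Suc (last a)) * planar_prob (A - {a}))"
      by (intro sum_ennreal mult_nonneg_nonneg pp0) (simp add: fpos less_imp_le)
    finally show ?thesis unfolding distrib_left using lampos pp0
      by (subst ennreal_plus) (auto intro!: sum_nonneg mult_nonneg_nonneg simp: fpos less_imp_le)
  qed
  ultimately have "ennreal (lam * planar_prob A + (\<Sum>x\<in>A. f (Suc (kids A x)) * planar_prob A))
    = ennreal ((if A = {[]} then lam else 0) + (\<Sum>a\<in>removable A. f (Suc (last a)) * planar_prob (A - {a})))"
    using balance[OF A] by simp
  then have "lam * planar_prob A + (\<Sum>x\<in>A. f (Suc (kids A x)) * planar_prob A)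
    = (if A = {[]} then lam else 0) + (\<Sum>a\<in>removable A. f (Suc (last a)) * planar_prob (A - {a}))"
    by (subst (asm) ennreal_inj) (auto intro!: add_nonneg_nonneg sum_nonneg mult_nonneg_nonneg pp0 simp: fpos less_imp_le lampos)
  then show ?thesis by (simp add: distrib_right sum_distrib_right)
qed

end

section \<open>Growing unlabelled trees\<close>

primrec tsize :: "utree \<Rightarrow> nat" where
  "tsize (Node M) = Suc (sum_mset (image_mset tsize M))"

text \<open>The trees obtained by attaching a leaf at some vertex, listed with the degree (number of
  children plus one) of that vertex.\<close>
primrec grow :: "utree \<Rightarrow> (nat \<times> utree) multiset" where
  "grow (Node M) = add_mset (Suc (size M), Node (add_mset (Node {#}) M))
     (sum_mset (image_mset (\<lambda>(c, G). image_mset (\<lambda>(d, c'). (d, Node (add_mset c' (M - {#c#})))) G)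
       (image_mset (\<lambda>c. (c, grow c)) M)))"

text \<open>Shape below \<open>x\<close> for an arbitrary child function, up to depth
  \<open>d\<close>. The generality allows one growth lemma to serve both the attachment tree
  (vertices are numbers) and the populations (vertices are words).\<close>

fun gsh :: "('a \<Rightarrow> 'a set) \<Rightarrow> nat \<Rightarrow> 'a \<Rightarrow> utree" where
  "gsh ch 0 x = Node {#}"
| "gsh ch (Suc d) x = Node (image_mset (gsh ch d) (mset_set (ch x)))"

fun dsc :: "('a \<Rightarrow> 'a set) \<Rightarrow> nat \<Rightarrow> 'a \<Rightarrow> 'a set" where
  "dsc ch 0 x = {x}"
| "dsc ch (Suc d) x = insert x (\<Union>y\<in>ch x. dsc ch d y)"

text \<open>The child function is a genuine tree of depth at most \<open>d\<close> below
  \<open>x\<close>: no vertex is its own descendant and siblings have disjoint descendants. Under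
  this condition the fuel \<open>d\<close> of \<open>gsh\<close> and \<open>dsc\<close> is
  sufficient.\<close>

fun tree_depth_le :: "('a \<Rightarrow> 'a set) \<Rightarrow> nat \<Rightarrow> 'a \<Rightarrow> bool" where
  "tree_depth_le ch 0 x \<longleftrightarrow> ch x = {}"
| "tree_depth_le ch (Suc d) x \<longleftrightarrow> finite (ch x) \<and> (\<forall>y\<in>ch x. tree_depth_le ch d y \<and> x \<notin> dsc ch d y)
     \<and> (\<forall>y\<in>ch x. \<forall>z\<in>ch x. y \<noteq> z \<longrightarrow> dsc ch d y \<inter> dsc ch d z = {})"

lemma dsc_self [simp]: "x \<in> dsc ch d x"
  by (cases d) auto

lemma tree_depth_le_Suc:
  "tree_depth_le ch d x \<Longrightarrow> tree_depth_le ch (Suc d) x \<and> gsh ch (Suc d) x = gsh ch d x \<and> dsc ch (Suc d) x = dsc ch d x"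
proof (induction d arbitrary: x)
  case (Suc d)
  have *: "tree_depth_le ch (Suc d) y \<and> gsh ch (Suc d) y = gsh ch d y \<and> dsc ch (Suc d) y = dsc ch d y"
    if "y \<in> ch x" for y
    by (rule Suc.IH) (use Suc.prems that in simp)
  have "gsh ch (Suc (Suc d)) x = gsh ch (Suc d) x"
    unfolding gsh.simps(2)[of ch "Suc d" x] gsh.simps(2)[of ch d x]
    using Suc.prems * by (intro arg_cong[where f = Node] image_mset_cong) auto
  moreover have "dsc ch (Suc (Suc d)) x = dsc ch (Suc d) x"
    unfolding dsc.simps(2)[of ch "Suc d" x] dsc.simps(2)[of ch d x] using * by auto
  moreover have "tree_depth_le ch (Suc (Suc d)) x"
    unfolding tree_depth_le.simps(2)[of ch "Suc d" x] using Suc.prems * by simp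
  ultimately show ?case by blast
qed simp

lemma finite_dsc: "tree_depth_le ch d x \<Longrightarrow> finite (dsc ch d x)"
  by (induction d arbitrary: x) auto

lemma children_subset_dsc: "tree_depth_le ch d x \<Longrightarrow> z \<in> dsc ch d x \<Longrightarrow> ch z \<subseteq> dsc ch d x"
proof (induction d arbitrary: x)
  case (Suc d)
  show ?case
  proof (cases "z = x")
    case True
    then show ?thesis by (auto intro: dsc_self)
  next
    case False
    then obtain y where "y \<in> ch x" "z \<in> dsc ch d y" using Suc.prems by auto
    then show ?thesis using Suc by fastforce
  qed
qed auto

lemma tsize_gsh: "tree_depth_le ch d x \<Longrightarrow> tsize (gsh ch d x) = card (dsc ch d x)"
proof (induction d arbitrary: x)
  case (Suc d)
  then have fin: "finite (ch x)" by simp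
  have "card (dsc ch (Suc d) x) = Suc (card (\<Union>y\<in>ch x. dsc ch d y))"
    using Suc.prems finite_dsc[of ch d] by (subst dsc.simps(2), subst card_insert_disjoint) auto
  also have "card (\<Union>y\<in>ch x. dsc ch d y) = (\<Sum>y\<in>ch x. card (dsc ch d y))"
    using Suc.prems finite_dsc[of ch d] by (intro card_UN_disjoint) auto
  also have "\<dots> = (\<Sum>y\<in>ch x. tsize (gsh ch d y))" using Suc by (intro sum.cong) auto
  finally show ?case by (simp add: sum_unfold_sum_mset image_mset.compositionality comp_def)
qed simp

lemma gsh_unaffected:
  "v \<notin> dsc ch d x \<Longrightarrow> gsh (ch(v := S)) d x = gsh ch d x \<and> dsc (ch(v := S)) d x = dsc ch d x
     \<and> tree_depth_le (ch(v := S)) d x = tree_depth_le ch d x"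
proof (induction d arbitrary: x)
  case (Suc d)
  define ch' where "ch' = ch(v := S)"
  have *: "\<And>y. y \<in> ch x \<Longrightarrow> gsh ch' d y = gsh ch d y \<and> dsc ch' d y = dsc ch d y
     \<and> tree_depth_le ch' d y = tree_depth_le ch d y" and "x \<noteq> v"
    using Suc unfolding dsc.simps ch'_def by blast+
  then have x: "ch' x = ch x" by (simp add: ch'_def)
  have "image_mset (gsh ch' d) (mset_set (ch x)) = image_mset (gsh ch d) (mset_set (ch x))"
  proof (cases "finite (ch x)")
    case True
    then show ?thesis using * by (intro image_mset_cong) auto
  qed simp
  moreover have "(\<Union>y\<in>ch x. dsc ch' d y) = (\<Union>y\<in>ch x. dsc ch d y)" using * by simp
  moreover have "tree_depth_le ch' (Suc d) x = tree_depth_le ch (Suc d) x"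
    unfolding tree_depth_le.simps x using * by (simp cong: ball_cong)
  ultimately show ?case unfolding ch'_def[symmetric] gsh.simps dsc.simps x by simp
qed auto

lemma image_mset_sum: "image_mset h (sum g S) = (\<Sum>y\<in>S. image_mset h (g y))"
  by (induction S rule: infinite_finite_induct) auto

lemma mset_set_UN:
  assumes "finite S" "\<And>y. y \<in> S \<Longrightarrow> finite (D y)" "\<And>y z. y \<in> S \<Longrightarrow> z \<in> S \<Longrightarrow> y \<noteq> z \<Longrightarrow> D y \<inter> D z = {}"
  shows "mset_set (\<Union>y\<in>S. D y) = (\<Sum>y\<in>S. mset_set (D y))"
  using assms
proof (induction S rule: finite_induct)
  case (insert y S)
  have "mset_set (D y \<union> (\<Union>z\<in>S. D z)) = mset_set (D y) + mset_set (\<Union>z\<in>S. D z)"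
    using insert by (intro mset_set_Union) auto
  then show ?case using insert by auto
qed simp

text \<open>A leaf is attached either at \<open>x\<close> or inside the subtree of exactly one
  child, and only that subtree changes; these are the two parts of \<open>grow\<close>. The new
  shape is read with one more unit of fuel because the leaf may increase the depth by one.\<close>

lemma grow_gsh:
  assumes "tree_depth_le ch d x" "\<And>v. v \<in> dsc ch d x \<Longrightarrow> w v \<notin> dsc ch d x \<and> ch (w v) = {}"
  shows "image_mset (\<lambda>v. (Suc (card (ch v)), gsh (ch(v := insert (w v) (ch v))) (Suc d) x)) (mset_set (dsc ch d x))
    = grow (gsh ch d x)"
  using assms(1,2)
proof (induction d arbitrary: x)
  case 0
  then show ?case by simp
next
  case (Suc d)
  define S where "S = ch x"
  define ch' where "ch' v = ch(v := insert (w v) (ch v))" for v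
  define M where "M = image_mset (gsh ch d) (mset_set S)"
  have fin: "finite S" and ok: "\<And>y. y \<in> S \<Longrightarrow> tree_depth_le ch d y" and xn: "\<And>y. y \<in> S \<Longrightarrow> x \<notin> dsc ch d y"
    and dj: "\<And>y z. y \<in> S \<Longrightarrow> z \<in> S \<Longrightarrow> y \<noteq> z \<Longrightarrow> dsc ch d y \<inter> dsc ch d z = {}"
    using Suc.prems by (auto simp: S_def)
  have wx: "w x \<notin> dsc ch (Suc d) x" "ch (w x) = {}" using Suc.prems(2)[OF dsc_self] by auto
  then have wn: "w x \<noteq> x" "w x \<notin> S" using dsc_self by (auto simp: S_def)
  have wy: "w v \<notin> dsc ch d y \<and> ch (w v) = {}" if "y \<in> S" "v \<in> dsc ch d y" for v y
    using Suc.prems(2)[of v] that by (auto simp: S_def)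
  have un: "gsh (ch' v) (Suc d) y = gsh ch d y" if "v \<notin> dsc ch d y" "y \<in> S" for v y
    using gsh_unaffected[OF that(1)] ok[OF that(2)] tree_depth_le_Suc[of "ch' v" d y] unfolding ch'_def by simp
  have gx: "gsh ch (Suc d) x = Node M" by (simp add: M_def S_def)
  have ds: "mset_set (dsc ch (Suc d) x) = add_mset x (\<Sum>y\<in>S. mset_set (dsc ch d y))"
  proof -
    have U: "mset_set (\<Union>y\<in>S. dsc ch d y) = (\<Sum>y\<in>S. mset_set (dsc ch d y))"
      using fin ok dj finite_dsc[of ch d] by (intro mset_set_UN) auto
    have "x \<notin> (\<Union>y\<in>S. dsc ch d y)" "finite (\<Union>y\<in>S. dsc ch d y)"
      using fin ok xn finite_dsc[of ch d] by auto
    then show ?thesis using U by (simp add: S_def[symmetric])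
  qed
  have top: "gsh (ch' x) (Suc (Suc d)) x = Node (add_mset (Node {#}) M)"
  proof -
    have "ch' x x = insert (w x) S" by (simp add: ch'_def S_def)
    moreover have "gsh (ch' x) (Suc d) (w x) = Node {#}" using wn wx by (simp add: ch'_def)
    moreover have "image_mset (gsh (ch' x) (Suc d)) (mset_set S) = M"
      unfolding M_def using un xn fin by (intro image_mset_cong) auto
    ultimately show ?thesis using fin wn(2) by (subst gsh.simps(2)) simp
  qed
  have sub: "gsh (ch' v) (Suc (Suc d)) x = Node (add_mset (gsh (ch' v) (Suc d) y) (M - {#gsh ch d y#}))"
    if y: "y \<in> S" and v: "v \<in> dsc ch d y" for y v
  proof -
    have vx: "v \<noteq> x" using v xn[OF y] by auto
    have "image_mset (gsh (ch' v) (Suc d)) (mset_set (S - {y})) = image_mset (gsh ch d) (mset_set (S - {y}))"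
      using un dj[OF _ y] v fin by (intro image_mset_cong) auto
    moreover have "mset_set S = add_mset y (mset_set (S - {y}))"
      using fin y by (metis finite_Diff insert_Diff insert_Diff_single mset_set.insert_remove)
    ultimately show ?thesis using vx by (subst gsh.simps(2)) (simp add: ch'_def M_def S_def)
  qed
  have "image_mset (\<lambda>v. (Suc (card (ch v)), gsh (ch' v) (Suc (Suc d)) x)) (mset_set (dsc ch (Suc d) x))
    = add_mset (Suc (size M), Node (add_mset (Node {#}) M))
       (\<Sum>y\<in>S. image_mset (\<lambda>v. (Suc (card (ch v)), gsh (ch' v) (Suc (Suc d)) x)) (mset_set (dsc ch d y)))"
    unfolding ds by (simp only: image_mset_add_mset image_mset_sum top) (simp add: M_def S_def)
  also have "(\<Sum>y\<in>S. image_mset (\<lambda>v. (Suc (card (ch v)), gsh (ch' v) (Suc (Suc d)) x)) (mset_set (dsc ch d y)))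
    = (\<Sum>y\<in>S. image_mset (\<lambda>(e, c'). (e, Node (add_mset c' (M - {#gsh ch d y#})))) (grow (gsh ch d y)))"
  proof (intro sum.cong refl)
    fix y assume y: "y \<in> S"
    have "image_mset (\<lambda>v. (Suc (card (ch v)), gsh (ch' v) (Suc (Suc d)) x)) (mset_set (dsc ch d y))
      = image_mset (\<lambda>(e, c'). (e, Node (add_mset c' (M - {#gsh ch d y#}))))
          (image_mset (\<lambda>v. (Suc (card (ch v)), gsh (ch' v) (Suc d) y)) (mset_set (dsc ch d y)))"
      unfolding image_mset.compositionality comp_def
      using sub[OF y] finite_dsc[OF ok[OF y]] by (intro image_mset_cong) simp
    then show "image_mset (\<lambda>v. (Suc (card (ch v)), gsh (ch' v) (Suc (Suc d)) x)) (mset_set (dsc ch d y))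
      = image_mset (\<lambda>(e, c'). (e, Node (add_mset c' (M - {#gsh ch d y#})))) (grow (gsh ch d y))"
      using Suc.IH[OF ok[OF y] wy[OF y]] unfolding ch'_def[symmetric] by (simp only:)
  qed
  also have "\<dots> = sum_mset (image_mset (\<lambda>(c, G). image_mset (\<lambda>(d, c'). (d, Node (add_mset c' (M - {#c#})))) G)
       (image_mset (\<lambda>c. (c, grow c)) M))"
    unfolding M_def by (simp add: sum_unfold_sum_mset image_mset.compositionality comp_def)
  finally show ?case unfolding gx ch'_def by simp
qed

lemma tsize_grow: "(d, s) \<in># grow t \<Longrightarrow> tsize s = Suc (tsize t)"
proof (induction t arbitrary: d s)
  case (Node M)
  then consider "s = Node (add_mset (Node {#}) M)"
    | c d' c' where "c \<in># M" "(d', c') \<in># grow c" "s = Node (add_mset c' (M - {#c#}))"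
    by auto
  then show ?case
  proof cases
    case 2
    then have "tsize c' = Suc (tsize c)" using Node.IH by auto
    moreover have "M = add_mset c (M - {#c#})" using 2 by simp
    then have "sum_mset (image_mset tsize M) = tsize c + sum_mset (image_mset tsize (M - {#c#}))"
      by (metis image_mset_add_mset sum_mset.add_mset)
    ultimately show ?thesis using 2(3) by simp
  qed simp
qed

lemma tsize_pos: "0 < tsize t"
  by (cases t) simp

text \<open>Every tree has at least one vertex, so both the number and the sizes of the root
  subtrees are bounded. This makes the sums over smaller trees in the recursions finite.\<close>

lemma finite_tsize_le: "finite {t. tsize t \<le> n}"
proof (induction n)
  case 0
  have "{t. tsize t \<le> 0} = {}" using tsize_pos by (metis Collect_empty_eq not_le)
  then show ?case by (metis finite.emptyI)
next
  case (Suc n)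
  have sz: "size M \<le> sum_mset (image_mset tsize M)" for M
  proof (induction M)
    case (add x M)
    then show ?case using tsize_pos[of x] by simp
  qed simp
  have el: "c \<in># M \<Longrightarrow> tsize c \<le> sum_mset (image_mset tsize M)" for c M
    by (metis image_mset_add_mset le_add1 multi_member_split sum_mset.add_mset)
  have "{t. tsize t \<le> Suc n} \<subseteq> Node ` (\<Union>m\<le>n. multisets_of_size {t. tsize t \<le> n} m)"
  proof
    fix t assume t: "t \<in> {t. tsize t \<le> Suc n}"
    obtain M where M: "t = Node M" by (cases t)
    then have le: "sum_mset (image_mset tsize M) \<le> n" using t by simp
    have "M \<in> multisets_of_size {t. tsize t \<le> n} (size M)"
      using el le by (fastforce simp: multisets_of_size_def)
    then show "t \<in> Node ` (\<Union>m\<le>n. multisets_of_size {t. tsize t \<le> n} m)"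
      using M order_trans[OF sz[of M] le] by blast
  qed
  then show ?case using Suc by (elim finite_subset) (intro finite_imageI finite_UN_I finite_multisets_of_size, auto)
qed

text \<open>A descendant returns to \<open>y\<close> by parent steps that stay among the descendants
  of \<open>y\<close>. The rank strictly increases along this path, so its vertices are
  distinct.\<close>

lemma dsc_path:
  assumes "\<And>x y. y \<in> ch x \<Longrightarrow> par y = x \<and> r y < (r x :: nat)" and "z \<in> dsc ch d y"
  shows "\<exists>j. (par ^^ j) z = y \<and> (\<forall>i\<le>j. (par ^^ i) z \<in> dsc ch d y) \<and> (\<forall>i<j. r ((par ^^ i) z) < r ((par ^^ Suc i) z))"
  using assms(2)
proof (induction d arbitrary: y)
  case 0
  then show ?case by (intro exI[of _ 0]) auto
next
  case (Suc d)
  show ?case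
  proof (cases "z = y")
    case True
    then show ?thesis by (intro exI[of _ 0]) auto
  next
    case False
    then obtain y' where y': "y' \<in> ch y" "z \<in> dsc ch d y'" using Suc.prems by auto
    from Suc.IH[OF y'(2)] obtain j where j: "(par ^^ j) z = y'" "\<forall>i\<le>j. (par ^^ i) z \<in> dsc ch d y'"
      "\<forall>i<j. r ((par ^^ i) z) < r ((par ^^ Suc i) z)" by blast
    have top: "(par ^^ Suc j) z = y" using j(1) assms(1)[OF y'(1)] by simp
    have "(par ^^ i) z \<in> dsc ch (Suc d) y" if "i \<le> Suc j" for i
      using that j(2) y'(1) top by (cases "i = Suc j") (auto simp: le_Suc_eq simp del: funpow.simps)
    moreover have "r ((par ^^ i) z) < r ((par ^^ Suc i) z)" if "i < Suc j" for i
      using that j(1,3) top assms(1)[OF y'(1)] by (cases "i = j") (auto simp: less_Suc_eq)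
    ultimately show ?thesis using top by blast
  qed
qed

text \<open>A parent map and a rank decreasing towards the children exclude cycles and shared
  descendants, and the rank bounds the depth.\<close>

lemma tree_depth_le_rank:
  assumes fin: "\<And>x. finite (ch x)" and pr: "\<And>x y. y \<in> ch x \<Longrightarrow> par y = x \<and> r y < (r x :: nat)"
  shows "r x \<le> d \<Longrightarrow> tree_depth_le ch d x"
proof (induction d arbitrary: x)
  case 0
  then show ?case using pr by fastforce
next
  case (Suc d)
  have inc: "r ((par ^^ i) z) \<le> r ((par ^^ j) z)"
    if "\<forall>i<j. r ((par ^^ i) z) < r ((par ^^ Suc i) z)" "i \<le> j" for i j z
    using that(2,1) by (induction j rule: dec_induct) (auto intro: order_trans less_imp_le)
  have le: "r z \<le> r y" if "z \<in> dsc ch d y" for z y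
    using dsc_path[where par = par and r = r, OF pr that] inc[of _ z 0] by fastforce
  have dj: False if y: "y \<in> ch x" "z \<in> dsc ch d y" and y': "y' \<in> ch x" "z \<in> dsc ch d y'" and "y \<noteq> y'" for y y' z
  proof -
    \<comment> \<open>If the parent path of a common descendant met one child of \<open>x\<close>
      before another, it would pass from the former to \<open>x\<close>, and the rank of the latter
      would be at least that of \<open>x\<close>.\<close>
    have *: False if y: "y \<in> ch x" and y': "y' \<in> ch x" and ij: "i < j" and i: "(par ^^ i) z = y" and j: "(par ^^ j) z = y'"
      and mono: "\<forall>i<j. r ((par ^^ i) z) < r ((par ^^ Suc i) z)" for y y' i j
    proof -
      have "(par ^^ Suc i) z = x" using i pr[OF y] by simp
      then have "r x \<le> r y'" using inc[OF mono, of "Suc i"] ij j by simp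
      then show False using pr[OF y'] by simp
    qed
    obtain i where i: "(par ^^ i) z = y" "\<forall>k<i. r ((par ^^ k) z) < r ((par ^^ Suc k) z)"
      using dsc_path[where par = par and r = r, OF pr y(2)] by blast
    obtain j where j: "(par ^^ j) z = y'" "\<forall>k<j. r ((par ^^ k) z) < r ((par ^^ Suc k) z)"
      using dsc_path[where par = par and r = r, OF pr y'(2)] by blast
    show False
      using *[OF y(1) y'(1) _ i(1) j(1) j(2)] *[OF y'(1) y(1) _ j(1) i(1) i(2)] \<open>y \<noteq> y'\<close> i(1) j(1)
      by (cases i j rule: linorder_cases) auto
  qed
  show ?case
    unfolding tree_depth_le.simps
  proof (intro conjI ballI impI)
    fix y assume y: "y \<in> ch x"
    then have "r y < r x" using pr by blast
    then show "tree_depth_le ch d y" using Suc by simp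
    show "x \<notin> dsc ch d y" using le \<open>r y < r x\<close> by fastforce
    fix z assume "z \<in> ch x" "y \<noteq> z"
    then show "dsc ch d y \<inter> dsc ch d z = {}" using dj y by blast
  qed (rule fin)
qed

section \<open>Fringes of growing trees\<close>

definition leaf :: utree where "leaf = Node {#}"

text \<open>With \<open>rate\<close>, the total and individual jump rates of the tree-valued chain
  in which each vertex of degree \<open>d\<close> independently receives a child at rate
  \<open>f d\<close>.\<close>

definition tot_rate :: "(nat \<Rightarrow> real) \<Rightarrow> utree \<Rightarrow> real" where
  "tot_rate f t = sum_mset (image_mset (\<lambda>(d, s). f d) (grow t))"

definition rate :: "(nat \<Rightarrow> real) \<Rightarrow> utree \<Rightarrow> utree \<Rightarrow> real" where
  "rate f s t = sum_mset (image_mset (\<lambda>(d, s'). if s' = t then f d else 0) (grow s))"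

lemma rate_eq_0: "tsize t \<noteq> Suc (tsize s) \<Longrightarrow> rate f s t = 0"
  unfolding rate_def by (subst image_mset_cong[where g = "\<lambda>_. 0"]) (auto dest: tsize_grow)

text \<open>Fixing the dummy entry to 0 makes the root its own parent, so that iterated parents
  remain inside the tree.\<close>

definition vtree :: "nat list \<Rightarrow> bool" where
  "vtree p \<longleftrightarrow> p \<noteq> [] \<and> p ! 0 = 0 \<and> (\<forall>i<length p. 0 < i \<longrightarrow> p ! i < i)"

definition desc :: "nat list \<Rightarrow> nat \<Rightarrow> nat set" where
  "desc p u = dsc (children p (length p)) (length p) u"

lemma finite_children [simp]: "finite (children p m v)"
  by (rule finite_subset[of _ "{..<m}"]) (auto simp: children_def)

lemma tshape_gsh: "tshape p d v = gsh (children p (length p)) d v"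
proof (induction d arbitrary: v)
  case (Suc d)
  then have "tshape p d = gsh (children p (length p)) d" by (rule ext)
  then show ?case by simp
qed simp

lemma tree_depth_le_children: "tree_depth_le (children p (length p)) (length p) u"
  by (rule tree_depth_le_rank[where par = "\<lambda>u. p ! u" and r = "\<lambda>u. length p - u"])
     (auto simp: children_def)

lemma fringe0_gsh: "fringe0 p u = gsh (children p (length p)) (length p) u"
  by (simp add: fringe0_def tshape_gsh)

lemma fringe0_unfold: "fringe0 p u = Node (image_mset (fringe0 p) (mset_set (children p (length p) u)))"
proof -
  have "fringe0 p u = gsh (children p (length p)) (Suc (length p)) u"
    using tree_depth_le_Suc[OF tree_depth_le_children] by (simp only: fringe0_gsh)
  then show ?thesis by (simp add: fringe0_gsh[abs_def])
qed

lemma dsc_children_subset: "dsc (children p n) d u \<subseteq> insert u {..<n}"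
proof (induction d arbitrary: u)
  case (Suc d)
  have "dsc (children p n) d y \<subseteq> {..<n}" if "y \<in> children p n u" for y
  proof -
    have "y < n" using that by (simp add: children_def)
    then show ?thesis using Suc[of y] by blast
  qed
  then show ?case by auto
qed auto

lemma desc_subset: "u < length p \<Longrightarrow> desc p u \<subseteq> {..<length p}"
  using dsc_children_subset[of p "length p" "length p" u] by (auto simp: desc_def)

lemma finite_desc [simp]: "finite (desc p u)"
  unfolding desc_def by (rule finite_dsc[OF tree_depth_le_children])

lemma children_append:
  assumes "v < length p"
  shows "children (p @ [v]) (Suc (length p)) = (children p (length p))(v := insert (length p) (children p (length p) v))"
  using assms by (auto simp: children_def nth_append less_Suc_eq fun_eq_iff)

lemma fringe0_append_gsh:
  assumes "v < length p"
  shows "fringe0 (p @ [v]) u = gsh ((children p (length p))(v := insert (length p) (children p (length p) v))) (Suc (length p)) u"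
  by (simp only: fringe0_gsh length_append_singleton children_append[OF assms])

lemma fringe0_append_other:
  assumes "v < length p" "v \<notin> desc p u"
  shows "fringe0 (p @ [v]) u = fringe0 p u"
proof -
  let ?c = "children p (length p)" and ?c' = "(children p (length p))(v := insert (length p) (children p (length p) v))"
  have "tree_depth_le ?c' (length p) u" "gsh ?c' (length p) u = gsh ?c (length p) u"
    using gsh_unaffected[OF assms(2)[unfolded desc_def]] tree_depth_le_children by auto
  then have "gsh ?c' (Suc (length p)) u = gsh ?c (length p) u"
    using tree_depth_le_Suc[of ?c' "length p" u] by (simp only:)
  then show ?thesis unfolding fringe0_append_gsh[OF assms(1)] by (simp only: fringe0_gsh)
qed

lemma fringe0_append_new:
  assumes "v < length p" shows "fringe0 (p @ [v]) (length p) = leaf"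
proof -
  have "children (p @ [v]) (Suc (length p)) (length p) = {}" by (auto simp: children_def)
  then show ?thesis by (subst fringe0_unfold) (simp add: leaf_def)
qed

lemma grow_fringe0:
  assumes "u < length p"
  shows "image_mset (\<lambda>v. (deg p (length p) v, fringe0 (p @ [v]) u)) (mset_set (desc p u)) = grow (fringe0 p u)"
proof -
  let ?c = "children p (length p)"
  have "image_mset (\<lambda>v. (Suc (card (?c v)), gsh (?c(v := insert (length p) (?c v))) (Suc (length p)) u)) (mset_set (desc p u))
    = grow (fringe0 p u)"
    unfolding desc_def fringe0_gsh
    by (rule grow_gsh[OF tree_depth_le_children, where w = "\<lambda>_. length p"])
       (use desc_subset[OF assms] in \<open>auto simp: desc_def children_def\<close>)
  moreover have "image_mset (\<lambda>v. (deg p (length p) v, fringe0 (p @ [v]) u)) (mset_set (desc p u)) =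
    image_mset (\<lambda>v. (Suc (card (?c v)), gsh (?c(v := insert (length p) (?c v))) (Suc (length p)) u)) (mset_set (desc p u))"
    using desc_subset[OF assms] by (intro image_mset_cong) (auto simp: deg_def fringe0_append_gsh simp del: gsh.simps)
  ultimately show ?thesis by simp
qed

lemma tsize_fringe0: "tsize (fringe0 p u) = card (desc p u)"
  unfolding fringe0_gsh desc_def by (rule tsize_gsh[OF tree_depth_le_children])

lemma desc_root: assumes "vtree p" shows "desc p 0 = {..<length p}"
proof
  show "desc p 0 \<subseteq> {..<length p}" using assms by (intro desc_subset) (auto simp: vtree_def)
  have "u < length p \<Longrightarrow> u \<in> desc p 0" for u
  proof (induction u rule: less_induct)
    case (less u)
    show ?case
    proof (cases "u = 0")
      case False
      then have "p ! u < u" using assms less.prems by (auto simp: vtree_def)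
      then have "p ! u \<in> desc p 0" using less by auto
      moreover have "u \<in> children p (length p) (p ! u)" using \<open>p ! u < u\<close> less.prems by (auto simp: children_def)
      ultimately show ?thesis
        unfolding desc_def using children_subset_dsc[OF tree_depth_le_children] by blast
    qed (simp add: desc_def)
  qed
  then show "{..<length p} \<subseteq> desc p 0" by auto
qed

section \<open>Numbers of fringes of a given shape and their drift\<close>

definition cnt :: "nat list \<Rightarrow> utree \<Rightarrow> nat" where
  "cnt p t = card {u. u < length p \<and> fringe0 p u = t}"

lemma real_cnt: "real (cnt p t) = (\<Sum>u<length p. if fringe0 p u = t then 1 else 0)"
proof -
  have "{u. u < length p \<and> fringe0 p u = t} = {u \<in> {..<length p}. fringe0 p u = t}" by auto
  then show ?thesis unfolding cnt_def by (simp add: sum.If_cases Int_def)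
qed

lemma cnt_append_diff:
  assumes "v < length p"
  shows "real (cnt (p @ [v]) t) - real (cnt p t) = (if t = leaf then 1 else 0)
    + (\<Sum>u<length p. if v \<in> desc p u then (if fringe0 (p @ [v]) u = t then 1 else 0) - (if fringe0 p u = t then 1 else 0) else 0)"
proof -
  have "real (cnt (p @ [v]) t) - real (cnt p t) = (if t = leaf then 1 else 0)
    + (\<Sum>u<length p. (if fringe0 (p @ [v]) u = t then 1 else 0) - (if fringe0 p u = t then 1 else 0))"
    unfolding real_cnt by (auto simp: fringe0_append_new[OF assms] sum_subtractf)
  also have "(\<Sum>u<length p. (if fringe0 (p @ [v]) u = t then 1 else 0) - (if fringe0 p u = t then 1 else 0))
    = (\<Sum>u<length p. if v \<in> desc p u then (if fringe0 (p @ [v]) u = t then 1 else 0) - (if fringe0 p u = t then 1 else (0::real)) else 0)"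
    by (intro sum.cong) (auto simp: fringe0_append_other[OF assms])
  finally show ?thesis .
qed

text \<open>The sums over the chosen vertex \<open>v\<close> and over the vertices \<open>u\<close>
  carrying a fringe are exchanged. For fixed \<open>u\<close> only the descendants \<open>v\<close>
  of \<open>u\<close> matter, and \<open>grow_fringe0\<close> evaluates their sum. Transitions into
  \<open>t\<close> come only from trees with one vertex less, which makes the system
  triangular.\<close>

lemma drift_fringe:
  shows "(\<Sum>v<length p. f (deg p (length p) v) * (real (cnt (p @ [v]) t) - real (cnt p t)))
    = (if t = leaf then (\<Sum>v<length p. f (deg p (length p) v)) else 0)
      + (\<Sum>s\<in>{s. tsize s < tsize t}. real (cnt p s) * rate f s t) - real (cnt p t) * tot_rate f t"
proof -
  let ?n = "length p"
  let ?d = "\<lambda>v. f (deg p ?n v)"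
  have "(\<Sum>v<?n. ?d v * (real (cnt (p @ [v]) t) - real (cnt p t)))
    = (\<Sum>v<?n. ?d v * (if t = leaf then 1 else 0) + (\<Sum>u<?n. ?d v * (if v \<in> desc p u then (if fringe0 (p @ [v]) u = t then 1 else 0) - (if fringe0 p u = t then 1 else 0) else 0)))"
    by (intro sum.cong refl) (simp add: cnt_append_diff distrib_left sum_distrib_left)
  also have "\<dots> = (if t = leaf then (\<Sum>v<?n. ?d v) else 0)
     + (\<Sum>u<?n. \<Sum>v<?n. ?d v * (if v \<in> desc p u then (if fringe0 (p @ [v]) u = t then 1 else 0) - (if fringe0 p u = t then 1 else 0) else 0))"
    by (subst sum.swap[of _ _ "{..<?n}"]) (simp add: sum.distrib)
  also have "(\<Sum>u<?n. \<Sum>v<?n. ?d v * (if v \<in> desc p u then (if fringe0 (p @ [v]) u = t then 1 else 0) - (if fringe0 p u = t then 1 else 0) else 0))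
    = (\<Sum>u<?n. rate f (fringe0 p u) t - (if fringe0 p u = t then tot_rate f t else 0))"
  proof (intro sum.cong refl)
    fix u assume "u \<in> {..<?n}"
    then have u: "u < ?n" by simp
    have "(\<Sum>v<?n. ?d v * (if v \<in> desc p u then (if fringe0 (p @ [v]) u = t then 1 else 0) - (if fringe0 p u = t then 1 else 0) else 0))
      = (\<Sum>v\<in>desc p u. ?d v * ((if fringe0 (p @ [v]) u = t then 1 else 0) - (if fringe0 p u = t then 1 else 0)))"
      using desc_subset[OF u] by (intro sum.mono_neutral_cong_right) auto
    also have "\<dots> = (\<Sum>v\<in>desc p u. (if fringe0 (p @ [v]) u = t then ?d v else 0)) - (\<Sum>v\<in>desc p u. ?d v * (if fringe0 p u = t then 1 else 0))"
      unfolding sum_subtractf[symmetric] by (intro sum.cong refl) auto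
    also have "(\<Sum>v\<in>desc p u. (if fringe0 (p @ [v]) u = t then ?d v else 0)) = rate f (fringe0 p u) t"
      unfolding rate_def grow_fringe0[OF u, symmetric]
      by (simp add: sum_unfold_sum_mset image_mset.compositionality comp_def)
    also have "(\<Sum>v\<in>desc p u. ?d v * (if fringe0 p u = t then 1 else 0)) = (if fringe0 p u = t then tot_rate f (fringe0 p u) else 0)"
      unfolding tot_rate_def grow_fringe0[OF u, symmetric]
      by (simp add: sum_unfold_sum_mset image_mset.compositionality comp_def)
    finally show "(\<Sum>v<?n. ?d v * (if v \<in> desc p u then (if fringe0 (p @ [v]) u = t then 1 else 0) - (if fringe0 p u = t then 1 else 0) else 0))
      = rate f (fringe0 p u) t - (if fringe0 p u = t then tot_rate f t else 0)"
      by (auto split: if_splits)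
  qed
  also have "\<dots> = (\<Sum>u<?n. rate f (fringe0 p u) t) - real (cnt p t) * tot_rate f t"
    unfolding real_cnt sum_subtractf sum_distrib_right by (auto intro!: sum.cong)
  also have "(\<Sum>u<?n. rate f (fringe0 p u) t) = (\<Sum>s\<in>{s. tsize s < tsize t}. real (cnt p s) * rate f s t)"
  proof -
    have fin: "finite {s. tsize s < tsize t}"
      by (rule finite_subset[OF _ finite_tsize_le[of "tsize t"]]) auto
    have "(\<Sum>u<?n. rate f (fringe0 p u) t) = (\<Sum>u<?n. \<Sum>s\<in>{s. tsize s < tsize t}. if fringe0 p u = s then rate f s t else 0)"
    proof (intro sum.cong refl)
      fix u
      show "rate f (fringe0 p u) t = (\<Sum>s\<in>{s. tsize s < tsize t}. if fringe0 p u = s then rate f s t else 0)"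
        using rate_eq_0[of t "fringe0 p u" f] fin by (cases "tsize (fringe0 p u) < tsize t") (auto simp: sum.delta)
    qed
    also have "\<dots> = (\<Sum>s\<in>{s. tsize s < tsize t}. \<Sum>u<?n. if fringe0 p u = s then rate f s t else 0)"
      by (rule sum.swap)
    also have "\<dots> = (\<Sum>s\<in>{s. tsize s < tsize t}. real (cnt p s) * rate f s t)"
      unfolding real_cnt sum_distrib_right by (intro sum.cong refl) auto
    finally show ?thesis .
  qed
  finally show ?thesis by simp
qed

text \<open>The vertices between \<open>v\<close> and \<open>u\<close> are distinct descendants of
  \<open>u\<close>, so there are fewer generations between them than \<open>u\<close> has
  descendants.\<close>

lemma mem_desc_path:
  assumes "v \<in> desc p u"
  shows "\<exists>i<card (desc p u). (((!) p) ^^ i) v = u"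
proof -
  have "(p ! y = x \<and> length p - y < length p - x)" if "y \<in> children p (length p) x" for x y
    using that by (auto simp: children_def)
  from dsc_path[of "children p (length p)" "(!) p" "\<lambda>u. length p - u", OF this assms[unfolded desc_def]]
  obtain j where j: "(((!) p) ^^ j) v = u" "\<forall>i\<le>j. (((!) p) ^^ i) v \<in> desc p u"
    "\<forall>i<j. length p - (((!) p) ^^ i) v < length p - (((!) p) ^^ Suc i) v"
    unfolding desc_def by blast
  have lt: "length p - (((!) p) ^^ a) v < length p - (((!) p) ^^ b) v" if "a < b" "b \<le> j" for a b
    using that
  proof (induction b)
    case (Suc b)
    have "length p - (((!) p) ^^ b) v < length p - (((!) p) ^^ Suc b) v" using j(3) Suc.prems by auto
    then show ?case using Suc by (cases "a = b") (auto simp del: funpow.simps)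
  qed simp
  have "inj_on (\<lambda>i. (((!) p) ^^ i) v) {..j}"
    by (rule linorder_inj_onI) (use lt in \<open>force+\<close>)
  then have "card {..j} \<le> card (desc p u)"
    using j(2) by (intro card_inj_on_le) auto
  then show ?thesis using j(1) by (intro exI[of _ j]) auto
qed

text \<open>Besides the new leaf, only those ancestors of the new vertex count that have few
  descendants; they are within \<open>tsize t\<close> generations above its parent, at most one in
  each.\<close>

lemma cnt_append_bound:
  assumes "v < length p"
  shows "\<bar>real (cnt (p @ [v]) t) - real (cnt p t)\<bar> \<le> 1 + real (tsize t)"
proof -
  let ?n = "length p"
  \<comment> \<open>A vertex whose fringe is \<open>t\<close> before or after the step has at most
    \<open>tsize t\<close> descendants before it, since the step adds one.\<close>
  define U where "U = {u. u < ?n \<and> v \<in> desc p u \<and> card (desc p u) \<le> tsize t}"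
  have fin: "finite U" by (auto simp: U_def)
  have "U \<subseteq> (\<lambda>i. (((!) p) ^^ i) v) ` {..<tsize t}"
    unfolding U_def using mem_desc_path by fastforce
  then have "card U \<le> card {..<tsize t}" by (meson card_image_le finite_lessThan le_trans surj_card_le)
  then have cU: "real (card U) \<le> real (tsize t)" by simp
  have "\<bar>\<Sum>u<?n. if v \<in> desc p u then (if fringe0 (p @ [v]) u = t then 1 else 0) - (if fringe0 p u = t then 1 else 0) else (0::real)\<bar>
    \<le> (\<Sum>u<?n. if u \<in> U then 1 else 0)"
  proof (rule order_trans[OF sum_abs], rule sum_mono)
    fix u assume "u \<in> {..<?n}"
    then have u: "u < ?n" by simp
    have "u \<in> U" if v: "v \<in> desc p u" and t: "fringe0 (p @ [v]) u = t \<or> fringe0 p u = t"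
    proof -
      have "(deg p ?n v, fringe0 (p @ [v]) u) \<in># image_mset (\<lambda>v. (deg p ?n v, fringe0 (p @ [v]) u)) (mset_set (desc p u))"
        using v by auto
      then have "tsize (fringe0 (p @ [v]) u) = Suc (tsize (fringe0 p u))"
        unfolding grow_fringe0[OF u] by (rule tsize_grow)
      then show ?thesis using t v u tsize_fringe0[of p u] by (auto simp: U_def)
    qed
    then show "\<bar>if v \<in> desc p u then (if fringe0 (p @ [v]) u = t then 1 else 0) - (if fringe0 p u = t then 1 else 0) else (0::real)\<bar>
      \<le> (if u \<in> U then 1 else 0)" by auto
  qed
  also have "\<dots> = real (card U)"
  proof -
    have "{..<?n} \<inter> {u. u \<in> U} = U" by (auto simp: U_def)
    then show ?thesis by (simp add: sum.If_cases)
  qed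
  finally show ?thesis unfolding cnt_append_diff[OF assms] using cU by auto
qed

section \<open>Reduction of extended fringes to fringes\<close>

text \<open>The full subtree of the \<open>j\<close>-th ancestor, reconstructed from the hanging
  pieces: the tree of the previous ancestor becomes one more child of the root of
  \<open>s j\<close>.\<close>

primrec bar_tree :: "(nat \<Rightarrow> utree) \<Rightarrow> nat \<Rightarrow> utree" where
  "bar_tree s 0 = s 0"
| "bar_tree s (Suc j) = Node (add_mset (bar_tree s j) (children_of (s (Suc j))))"

lemma children_of_Node [simp]: "children_of (Node M) = M"
  by (simp add: children_of_def)

lemma Node_children_of [simp]: "Node (children_of t) = t"
  by (cases t) simp

lemma anc_0 [simp]: "anc p 0 v = v" and anc_Suc [simp]: "anc p (Suc i) v = p ! anc p i v"
  by (simp_all add: anc_def)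

lemma anc_less: "vtree p \<Longrightarrow> v < length p \<Longrightarrow> anc p i v < length p"
proof (induction i)
  case (Suc i)
  then show ?case by (cases "anc p i v = 0") (auto simp: vtree_def intro: less_trans)
qed simp

lemma ex_anc_0: "vtree p \<Longrightarrow> v < length p \<Longrightarrow> \<exists>h. anc p h v = 0"
proof (induction v rule: less_induct)
  case (less v)
  show ?case
  proof (cases "v = 0")
    case False
    then have "p ! v < v" using less.prems by (auto simp: vtree_def)
    then obtain h where "anc p h (p ! v) = 0" using less by force
    then have "anc p (Suc h) v = 0" by (simp add: anc_def funpow_swap1 del: anc_Suc)
    then show ?thesis by blast
  qed (auto intro: exI[of _ 0])
qed

lemma le_height_iff:
  assumes "vtree p" "v < length p"
  shows "i \<le> height p v \<longleftrightarrow> (\<forall>h<i. anc p h v \<noteq> 0)"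
proof
  assume "i \<le> height p v"
  then show "\<forall>h<i. anc p h v \<noteq> 0"
    using not_less_Least[of _ "\<lambda>h. anc p h v = 0"] unfolding height_def by (meson less_le_trans)
next
  assume "\<forall>h<i. anc p h v \<noteq> 0"
  moreover have "anc p (height p v) v = 0"
    unfolding height_def using ex_anc_0[OF assms] by (rule LeastI_ex)
  ultimately show "i \<le> height p v" by (meson not_le)
qed

definition fringe_class :: "nat list \<Rightarrow> (nat \<Rightarrow> utree) \<Rightarrow> nat \<Rightarrow> nat \<Rightarrow> nat set" where
  "fringe_class p s j u = {v. v < length p \<and> anc p j v = u \<and> (\<forall>h<j. anc p h v \<noteq> 0) \<and> (\<forall>i\<le>j. fringe_i p v i = Some (s i))}"

lemma fringe_i_Suc:
  assumes "vtree p" "v < length p" "\<forall>h<Suc i. anc p h v \<noteq> 0"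
  shows "fringe_i p v (Suc i) = Some (Node (image_mset (fringe0 p) (mset_set (children p (length p) (anc p (Suc i) v) - {anc p i v}))))"
proof -
  have "fringe0 p = tshape p (length p)" by (rule ext) (simp add: fringe0_def)
  then show ?thesis using le_height_iff[OF assms(1,2), of "Suc i"] assms(3) by (simp add: fringe_i_def)
qed

lemma count_image_mset_set: "finite A \<Longrightarrow> count (image_mset g (mset_set A)) y = card {w \<in> A. g w = y}"
proof (induction A rule: finite_induct)
  case (insert x A)
  have "{w \<in> insert x A. g w = y} = (if g x = y then insert x {w \<in> A. g w = y} else {w \<in> A. g w = y})" by auto
  then show ?case using insert by auto
qed simp

text \<open>Induction along the ancestors: a vertex counted at \<open>u\<close> is counted, one
  level down, at a unique child of \<open>u\<close>. The admissible children are those of shape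
  \<open>bar_tree s j\<close>, and removing any one of them leaves the prescribed piece at
  \<open>u\<close>, so each contributes the same number.\<close>

lemma card_fringe_class:
  assumes p: "vtree p" and "u < length p"
  shows "card (fringe_class p s j u) = (if fringe0 p u = bar_tree s j
    then (\<Prod>i<j. count (children_of (bar_tree s (Suc i))) (bar_tree s i)) else 0)"
  using assms(2)
proof (induction j arbitrary: u)
  case 0
  have "fringe_class p s 0 u = (if fringe0 p u = s 0 then {u} else {})"
    using 0 by (auto simp: fringe_class_def fringe_i_def)
  then show ?case by simp
next
  case (Suc j)
  let ?ch = "children p (length p) u"
  define K where "K = (\<Prod>i<j. count (children_of (bar_tree s (Suc i))) (bar_tree s i))"
  define M where "M = image_mset (fringe0 p) (mset_set ?ch)"
  define D where "D w = (if Node (image_mset (fringe0 p) (mset_set (?ch - {w}))) = s (Suc j) then fringe_class p s j w else {})" for w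
  have M: "fringe0 p u = Node M" unfolding M_def by (rule fringe0_unfold)
  have eq: "fringe_class p s (Suc j) u = (\<Union>w\<in>?ch. D w)"
  proof (intro set_eqI iffI)
    fix v assume v: "v \<in> fringe_class p s (Suc j) u"
    define w where "w = anc p j v"
    have vl: "v < length p" and wn: "w \<noteq> 0" and wu: "p ! w = u" and nz: "\<forall>h<Suc j. anc p h v \<noteq> 0"
      using v by (auto simp: fringe_class_def w_def)
    have wl: "w < length p" unfolding w_def by (rule anc_less[OF p vl])
    have "p ! w < w" using p wl wn by (auto simp: vtree_def)
    then have wc: "w \<in> ?ch" using wu wl by (auto simp: children_def)
    have "fringe_i p v (Suc j) = Some (s (Suc j))" using v by (auto simp: fringe_class_def)
    then have "Node (image_mset (fringe0 p) (mset_set (?ch - {w}))) = s (Suc j)"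
      unfolding fringe_i_Suc[OF p vl nz] using wu by (simp add: w_def)
    moreover have "v \<in> fringe_class p s j w" using v by (auto simp: fringe_class_def w_def)
    ultimately show "v \<in> (\<Union>w\<in>?ch. D w)" using wc by (auto simp: D_def)
  next
    fix v assume "v \<in> (\<Union>w\<in>?ch. D w)"
    then obtain w where w: "w \<in> ?ch" "v \<in> fringe_class p s j w"
      and N: "Node (image_mset (fringe0 p) (mset_set (?ch - {w}))) = s (Suc j)"
      by (auto simp: D_def split: if_splits)
    have vl: "v < length p" and a: "anc p j v = w" using w by (auto simp: fringe_class_def)
    have w0: "w \<noteq> 0" "p ! w = u" using w by (auto simp: children_def)
    have nz: "\<forall>h<Suc j. anc p h v \<noteq> 0" using w(2) w0 a by (auto simp: fringe_class_def less_Suc_eq)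
    have "fringe_i p v (Suc j) = Some (s (Suc j))"
      unfolding fringe_i_Suc[OF p vl nz] using w0 a N by simp
    then show "v \<in> fringe_class p s (Suc j) u"
      using w(2) nz w0 a by (auto simp: fringe_class_def le_Suc_eq)
  qed
  have finC: "finite (fringe_class p s j w)" for w
    by (rule finite_subset[of _ "{..<length p}"]) (auto simp: fringe_class_def)
  have "card (fringe_class p s (Suc j) u) = (\<Sum>w\<in>?ch. card (D w))"
    unfolding eq by (intro card_UN_disjoint) (auto simp: D_def finC fringe_class_def)
  also have "\<dots> = (\<Sum>w\<in>?ch. if M = add_mset (bar_tree s j) (children_of (s (Suc j))) \<and> fringe0 p w = bar_tree s j then K else 0)"
  proof (intro sum.cong refl)
    fix w assume w: "w \<in> ?ch"
    then have wl: "w < length p" by (auto simp: children_def)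
    have "mset_set ?ch = add_mset w (mset_set (?ch - {w}))"
      using w by (metis finite_Diff finite_children insert_Diff insert_Diff_single mset_set.insert_remove)
    then have Mw: "M = add_mset (fringe0 p w) (image_mset (fringe0 p) (mset_set (?ch - {w})))" by (simp add: M_def)
    have "Node (image_mset (fringe0 p) (mset_set (?ch - {w}))) = s (Suc j) \<longleftrightarrow> image_mset (fringe0 p) (mset_set (?ch - {w})) = children_of (s (Suc j))"
      by (cases "s (Suc j)") auto
    then show "card (D w) = (if M = add_mset (bar_tree s j) (children_of (s (Suc j))) \<and> fringe0 p w = bar_tree s j then K else 0)"
      unfolding D_def using Suc.IH[OF wl] Mw by (auto simp: K_def)
  qed
  also have "\<dots> = (if fringe0 p u = bar_tree s (Suc j) then K * count M (bar_tree s j) else 0)"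
  proof (cases "fringe0 p u = bar_tree s (Suc j)")
    case True
    then have "M = add_mset (bar_tree s j) (children_of (s (Suc j)))" using M by simp
    then have "(\<Sum>w\<in>?ch. if M = add_mset (bar_tree s j) (children_of (s (Suc j))) \<and> fringe0 p w = bar_tree s j then K else 0)
      = (\<Sum>w\<in>?ch. if fringe0 p w = bar_tree s j then K else 0)" by simp
    also have "\<dots> = K * card {w \<in> ?ch. fringe0 p w = bar_tree s j}"
      by (simp add: sum.If_cases Int_def)
    also have "card {w \<in> ?ch. fringe0 p w = bar_tree s j} = count M (bar_tree s j)"
      unfolding M_def by (rule count_image_mset_set[symmetric]) simp
    finally show ?thesis using True by simp
  qed (use M in auto)
  finally show ?case using M by (auto simp: K_def)
qed

lemma ext_fringe_eq_iff:
  assumes "length s = Suc k"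
  shows "ext_fringe p k v = s \<longleftrightarrow> (\<forall>i\<le>k. fringe_i p v i = s ! i)"
proof
  assume "\<forall>i\<le>k. fringe_i p v i = s ! i"
  then show "ext_fringe p k v = s"
    using assms by (intro nth_equalityI) (auto simp: ext_fringe_def simp del: upt_Suc)
next
  assume "ext_fringe p k v = s"
  then show "\<forall>i\<le>k. fringe_i p v i = s ! i"
    by (auto simp: ext_fringe_def nth_append simp del: upt_Suc)
qed

lemma emp_fringe_Some:
  assumes p: "vtree p"
  shows "emp_fringe p k (map (\<lambda>i. Some (s i)) [0..<Suc k])
    = real (cnt p (bar_tree s k)) / real (length p) * (\<Prod>i<k. real (count (children_of (bar_tree s (Suc i))) (bar_tree s i)))"
proof -
  let ?s = "map (\<lambda>i. Some (s i)) [0..<Suc k]"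
  have nth: "?s ! i = Some (s i)" if "i \<le> k" for i using that by (simp del: upt_Suc)
  have ls: "length ?s = Suc k" by simp
  have eq: "{v. v < length p \<and> ext_fringe p k v = ?s} = (\<Union>u\<in>{..<length p}. fringe_class p s k u)"
  proof (intro set_eqI iffI)
    fix v assume "v \<in> {v. v < length p \<and> ext_fringe p k v = ?s}"
    then have v: "v < length p" and f: "\<forall>i\<le>k. fringe_i p v i = Some (s i)"
      using nth by (auto simp: ext_fringe_eq_iff[OF ls] simp del: upt_Suc)
    have "\<forall>h<k. anc p h v \<noteq> 0"
    proof (cases k)
      case (Suc j)
      have "fringe_i p v k \<noteq> None" using f by simp
      then have "k \<le> height p v" using Suc by (auto simp: fringe_i_def split: if_splits)
      then show ?thesis using le_height_iff[OF p v] by blast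
    qed simp
    then show "v \<in> (\<Union>u\<in>{..<length p}. fringe_class p s k u)"
      using v f anc_less[OF p v, of k] by (auto simp: fringe_class_def)
  next
    fix v assume "v \<in> (\<Union>u\<in>{..<length p}. fringe_class p s k u)"
    then show "v \<in> {v. v < length p \<and> ext_fringe p k v = ?s}"
      using nth by (auto simp: ext_fringe_eq_iff[OF ls] fringe_class_def simp del: upt_Suc)
  qed
  have fin: "finite (fringe_class p s k w)" for w
    by (rule finite_subset[of _ "{..<length p}"]) (auto simp: fringe_class_def)
  have "card {v. v < length p \<and> ext_fringe p k v = ?s} = (\<Sum>u<length p. card (fringe_class p s k u))"
    unfolding eq by (intro card_UN_disjoint) (auto simp: fin, auto simp: fringe_class_def)
  also have "\<dots> = (\<Sum>u<length p. if fringe0 p u = bar_tree s k then (\<Prod>i<k. count (children_of (bar_tree s (Suc i))) (bar_tree s i)) else 0)"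
    by (intro sum.cong refl card_fringe_class[OF p]) simp
  also have "\<dots> = cnt p (bar_tree s k) * (\<Prod>i<k. count (children_of (bar_tree s (Suc i))) (bar_tree s i))"
    by (simp add: sum.If_cases cnt_def Int_def)
  finally show ?thesis unfolding emp_fringe_def by simp
qed

text \<open>An empty component says that the root is a near ancestor. The pieces before it then make
  up the entire tree, whose size is thereby prescribed; larger trees have no such vertex.\<close>

lemma emp_fringe_None:
  assumes "length s = Suc k" and "m \<le> k" and "s ! m = None"
  shows "\<exists>N. \<forall>p. vtree p \<longrightarrow> N < length p \<longrightarrow> emp_fringe p k s = 0"
proof -
  \<comment> \<open>The first empty component. If it is component 0, no vertex qualifies, as that
    component of an extended fringe is never empty; otherwise the ancestor number
    \<open>m0 - 1\<close> is the root.\<close>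
  define m0 where "m0 = (LEAST m. s ! m = None)"
  have m0: "s ! m0 = None" "m0 \<le> m" unfolding m0_def by (rule LeastI[of _ m], fact, rule Least_le, fact)
  have sm: "s ! i = Some (the (s ! i))" if "i < m0" for i
    using not_less_Least[of i "\<lambda>m. s ! m = None"] that by (auto simp: m0_def)
  define t where "t i = the (s ! i)" for i
  have "emp_fringe p k s = 0" if p: "vtree p" and N: "tsize (bar_tree t (m0 - 1)) < length p" for p
  proof -
    have "ext_fringe p k v \<noteq> s" if v: "v < length p" for v
    proof
      assume "ext_fringe p k v = s"
      then have f: "\<And>i. i \<le> k \<Longrightarrow> fringe_i p v i = s ! i" using ext_fringe_eq_iff[OF assms(1)] by blast
      have n: "fringe_i p v m0 = None" using f[of m0] m0 assms(2) by simp
      then obtain j where j: "m0 = Suc j" by (cases m0) (auto simp: fringe_i_def)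
      have "\<not> m0 \<le> height p v" using n j by (auto simp: fringe_i_def)
      then obtain h where h: "h < Suc j" "anc p h v = 0" using le_height_iff[OF p v, of m0] j by auto
      have ft: "\<forall>i\<le>j. fringe_i p v i = Some (t i)"
      proof (intro allI impI)
        fix i assume "i \<le> j"
        then have "i < m0" "i \<le> k" using j m0(2) assms(2) by auto
        then show "fringe_i p v i = Some (t i)" using f[of i] sm[of i] unfolding t_def by (simp only:)
      qed
      have nz: "\<forall>h<j. anc p h v \<noteq> 0"
      proof (cases j)
        case (Suc j')
        have "fringe_i p v j \<noteq> None" using ft by simp
        then have "j \<le> height p v" using Suc by (auto simp: fringe_i_def split: if_splits)
        then show ?thesis using le_height_iff[OF p v] by blast
      qed simp
      have "anc p j v = 0" using h nz less_Suc_eq by metis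
      then have "v \<in> fringe_class p t j 0" using v ft nz by (auto simp: fringe_class_def)
      moreover have "finite (fringe_class p t j 0)"
        by (rule finite_subset[of _ "{..<length p}"]) (auto simp: fringe_class_def)
      ultimately have c: "card (fringe_class p t j 0) \<noteq> 0" by auto
      have "0 < length p" using v by linarith
      from card_fringe_class[OF p this, of t j] c have "fringe0 p 0 = bar_tree t j" by (auto split: if_splits)
      then have "tsize (bar_tree t j) = length p" using tsize_fringe0[of p 0] desc_root[OF p] by simp
      then show False using N j by simp
    qed
    then have "{v. v < length p \<and> ext_fringe p k v = s} = {}" by blast
    then show ?thesis unfolding emp_fringe_def by (simp only: card.empty of_nat_0 div_0)
  qed
  then show ?thesis by blast
qed

lemma sin_fd_None:
  assumes "i < length sb" "sb ! i = None"
  shows "sin_fd f sb = 0"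
proof (cases "i = length sb - 1")
  case True
  then show ?thesis using assms by (simp add: sin_fd_def varpi_def)
next
  case False
  then have "Suc i \<in> {1..<length sb}" using assms by auto
  moreover have "real (Qcount (sb ! Suc i) (sb ! (Suc i - 1))) = 0"
    using assms by (simp add: Qcount_def split: option.splits)
  ultimately have "(\<Prod>j\<in>{1..<length sb}. real (Qcount (sb ! j) (sb ! (j - 1)))) = 0"
    by (subst prod_zero_iff) blast+
  then show ?thesis by (simp add: sin_fd_def)
qed

lemma fringe_of_bar_nth:
  "i < length sb \<Longrightarrow> fringe_of_bar sb ! i = (if i = 0 then sb ! 0 else detach (sb ! i) (sb ! (i - 1)))"
  by (simp add: fringe_of_bar_def)

lemma sin_fringe_prob_None:
  assumes "length s = Suc k" and "m \<le> k" and "s ! m = None"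
  shows "sin_fringe_prob f s = 0"
proof -
  have "sin_fd f sb = 0" if "length sb = length s" "fringe_of_bar sb = s" for sb
  proof -
    have m: "m < length sb" using that assms by simp
    have "fringe_of_bar sb ! m = None" using that(2) assms(3) by simp
    then have "(if m = 0 then sb ! 0 else detach (sb ! m) (sb ! (m - 1))) = None"
      using fringe_of_bar_nth[OF m] by simp
    then have "sb ! m = None \<or> sb ! (m - 1) = None"
      by (auto simp: detach_def split: if_splits option.splits)
    then show ?thesis using sin_fd_None[of m sb f] sin_fd_None[of "m - 1" sb f] m by auto
  qed
  then show ?thesis unfolding sin_fringe_prob_def by (intro infsum_0) auto
qed

text \<open>Several monotone sequences may be mapped to the same pieces, because
  \<open>detach\<close> leaves the multiset unchanged when the child to be removed is absent. For
  those sequences a factor \<open>Qcount\<close> vanishes; only the sequence given by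
  \<open>bar_tree\<close> can contribute.\<close>

lemma sin_fringe_prob_Some:
  "sin_fringe_prob f (map (\<lambda>i. Some (s i)) [0..<Suc k])
    = varpi f (Some (bar_tree s k)) * (\<Prod>i<k. real (count (children_of (bar_tree s (Suc i))) (bar_tree s i)))"
proof -
  let ?s = "map (\<lambda>i. Some (s i)) [0..<Suc k]" and ?sb = "map (\<lambda>i. Some (bar_tree s i)) [0..<Suc k]"
  have nth: "?s ! i = Some (s i)" "?sb ! i = Some (bar_tree s i)" if "i \<le> k" for i using that by (simp_all del: upt_Suc)
  have mem: "fringe_of_bar ?sb = ?s"
  proof (rule nth_equalityI)
    fix i assume "i < length (fringe_of_bar ?sb)"
    then have i: "i \<le> k" by (simp add: fringe_of_bar_def)
    then have "fringe_of_bar ?sb ! i = (if i = 0 then ?sb ! 0 else detach (?sb ! i) (?sb ! (i - 1)))"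
      by (intro fringe_of_bar_nth) simp
    also have "\<dots> = Some (s i)"
      using i nth(2)[of i] nth(2)[of "i - 1"] nth(2)[of 0] by (cases i) (auto simp: detach_def simp del: upt_Suc)
    finally show "fringe_of_bar ?sb ! i = ?s ! i" using nth(1)[OF i] by (simp only:)
  qed (simp add: fringe_of_bar_def)
  have uniq: "sb = ?sb" if l: "length sb = length ?s" and fb: "fringe_of_bar sb = ?s" and nz: "sin_fd f sb \<noteq> 0" for sb
  proof -
    have Q: "Qcount (sb ! j) (sb ! (j - 1)) \<noteq> 0" if "1 \<le> j" "j \<le> k" for j
    proof
      assume "Qcount (sb ! j) (sb ! (j - 1)) = 0"
      then have "(\<Prod>j\<in>{1..<length sb}. real (Qcount (sb ! j) (sb ! (j - 1)))) = 0"
        using that l by (subst prod_zero_iff) (auto intro!: bexI[of _ j])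
      then show False using nz by (simp add: sin_fd_def)
    qed
    have "sb ! i = Some (bar_tree s i)" if "i \<le> k" for i
      using that
    proof (induction i)
      case 0
      have "fringe_of_bar sb ! 0 = sb ! 0" using l by (subst fringe_of_bar_nth) auto
      then show ?case using fb nth(1)[of 0] by (simp del: upt_Suc)
    next
      case (Suc i)
      then have IH: "sb ! i = Some (bar_tree s i)" by simp
      have "fringe_of_bar sb ! Suc i = detach (sb ! Suc i) (sb ! i)"
        using l Suc.prems by (subst fringe_of_bar_nth) auto
      then have d: "detach (sb ! Suc i) (Some (bar_tree s i)) = Some (s (Suc i))"
        using fb nth(1)[OF Suc.prems] IH by (simp del: upt_Suc)
      then obtain x where x: "sb ! Suc i = Some x" "Node (children_of x - {#bar_tree s i#}) = s (Suc i)"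
        by (auto simp: detach_def split: option.splits)
      have "bar_tree s i \<in># children_of x"
        using Q[of "Suc i"] Suc.prems x(1) IH by (auto simp: Qcount_def not_in_iff)
      then have "children_of x = add_mset (bar_tree s i) (children_of x - {#bar_tree s i#})" by simp
      also have "children_of x - {#bar_tree s i#} = children_of (s (Suc i))" using x(2) by (metis children_of_Node)
      finally have "x = bar_tree s (Suc i)" by (cases x) simp
      then show ?case using x(1) by simp
    qed
    then show ?thesis using l nth(2) by (intro nth_equalityI) (auto simp del: upt_Suc)
  qed
  have "sin_fringe_prob f ?s = infsum (sin_fd f) {?sb}"
    unfolding sin_fringe_prob_def
  proof (rule infsum_cong_neutral)
    fix sb assume "sb \<in> {?sb} - {sb. length sb = length ?s \<and> fringe_of_bar sb = ?s}"
    then show "sin_fd f sb = 0" using mem by auto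
  next
    fix sb assume "sb \<in> {sb. length sb = length ?s \<and> fringe_of_bar sb = ?s} - {?sb}"
    then show "sin_fd f sb = 0" using uniq by blast
  qed simp
  also have "\<dots> = sin_fd f ?sb" by simp
  also have "\<dots> = varpi f (Some (bar_tree s k)) * (\<Prod>j\<in>{1..<Suc k}. real (Qcount (?sb ! j) (?sb ! (j - 1))))"
    unfolding sin_fd_def using nth(2)[of k] by (simp del: upt_Suc)
  also have "(\<Prod>j\<in>{1..<Suc k}. real (Qcount (?sb ! j) (?sb ! (j - 1))))
    = (\<Prod>i<k. real (count (children_of (bar_tree s (Suc i))) (bar_tree s i)))"
    by (rule prod.reindex_bij_witness[of _ Suc "\<lambda>j. j - 1"]) (auto simp: nth Qcount_def simp del: upt_Suc)
  finally show ?thesis .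
qed

section \<open>The stable age distribution\<close>

lemma bp_closed_finite: "bp_closed A \<Longrightarrow> finite A"
  by (simp add: bp_closed_def)

lemma bp_closed_Nil: "bp_closed A \<Longrightarrow> [] \<in> A"
  by (simp add: bp_closed_def)

lemma bp_closed_parent: "bp_closed A \<Longrightarrow> x @ [i] \<in> A \<Longrightarrow> x \<in> A"
  unfolding bp_closed_def by blast

definition kid_words :: "nat list set \<Rightarrow> nat list \<Rightarrow> nat list set" where
  "kid_words A x = (\<lambda>i. x @ [i]) ` {i. x @ [i] \<in> A}"

definition planar_shape :: "nat list set \<Rightarrow> utree" where
  "planar_shape A = lshape A (card A) []"

lemma lshape_gsh: "lshape A d x = gsh (kid_words A) d x"
proof (induction d arbitrary: x)
  case (Suc d)
  have inj: "inj_on (\<lambda>i. x @ [i]) {i. x @ [i] \<in> A}" by (auto simp: inj_on_def)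
  have "mset_set (kid_words A x) = image_mset (\<lambda>i. x @ [i]) (mset_set {i. x @ [i] \<in> A})"
    unfolding kid_words_def by (rule image_mset_mset_set[OF inj, symmetric])
  then show ?case by (simp add: Suc image_mset.compositionality comp_def)
qed simp

lemma length_less_card:
  assumes A: "bp_closed A" and a: "a \<in> A" shows "length a < card A"
proof -
  have "inj_on (\<lambda>k. take k a) {..length a}" by (rule inj_onI) (metis atMost_iff length_take min.absorb2)
  moreover have "(\<lambda>k. take k a) ` {..length a} \<subseteq> A" using bp_closed_take[OF A a] by auto
  ultimately have "card {..length a} \<le> card A" by (rule card_inj_on_le) (rule bp_closed_finite[OF A])
  then show ?thesis by simp
qed

lemma tree_depth_le_planar:
  assumes A: "bp_closed A" shows "tree_depth_le (kid_words A) (card A) []"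
proof (rule tree_depth_le_rank[where par = butlast and r = "\<lambda>x. card A - length x"])
  fix x y assume "y \<in> kid_words A x"
  then obtain i where y: "y = x @ [i]" "x @ [i] \<in> A" by (auto simp: kid_words_def)
  then have "length (x @ [i]) < card A" using length_less_card[OF A] by blast
  then show "butlast y = x \<and> card A - length y < card A - length x" using y by auto
next
  show "finite (kid_words A x)" for x
    using finite_kids_set[OF bp_closed_finite[OF A], of x] by (simp add: kid_words_def)
qed simp

lemma dsc_planar:
  assumes A: "bp_closed A" shows "dsc (kid_words A) (card A) [] = A"
proof
  have "dsc (kid_words A) d x \<subseteq> insert x A" for d x
    by (induction d arbitrary: x) (force simp: kid_words_def)+
  then show "dsc (kid_words A) (card A) [] \<subseteq> A" using bp_closed_Nil[OF A] by blast
  have "a \<in> A \<Longrightarrow> a \<in> dsc (kid_words A) (card A) []" for a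
  proof (induction a rule: rev_induct)
    case (snoc i a)
    then have "a \<in> A" using bp_closed_parent[OF A] by blast
    then have "kid_words A a \<subseteq> dsc (kid_words A) (card A) []"
      using snoc.IH children_subset_dsc[OF tree_depth_le_planar[OF A]] by blast
    moreover have "a @ [i] \<in> kid_words A a" using snoc.prems by (simp add: kid_words_def)
    ultimately show ?case by blast
  qed simp
  then show "A \<subseteq> dsc (kid_words A) (card A) []" by blast
qed

lemma tsize_planar_shape: "bp_closed A \<Longrightarrow> tsize (planar_shape A) = card A"
  unfolding planar_shape_def lshape_gsh by (simp add: tsize_gsh[OF tree_depth_le_planar] dsc_planar)

lemma bp_closed_insert_nxt:
  assumes A: "bp_closed A" and x: "x \<in> A" shows "bp_closed (insert (nxt A x) A)"
proof -
  have "y \<in> insert (nxt A x) A \<and> (\<forall>j\<le>i. y @ [j] \<in> insert (nxt A x) A)" if "y @ [i] \<in> insert (nxt A x) A" for y i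
  proof (cases "y @ [i] \<in> A")
    case True
    then show ?thesis using A unfolding bp_closed_def by blast
  next
    case False
    then have yi: "y = x" "i = kids A x" using that by (auto simp: nxt_def)
    have "y @ [j] \<in> insert (nxt A x) A" if "j \<le> i" for j
      using that yi snoc_mem_iff[OF A, of x j] by (cases "j = i") (auto simp: nxt_def)
    then show ?thesis using x yi by blast
  qed
  then show ?thesis using A unfolding bp_closed_def by (metis finite_insert insertI2)
qed

lemma card_kid_words: "bp_closed A \<Longrightarrow> card (kid_words A x) = kids A x"
  unfolding kid_words_def kids_def by (rule card_image) (auto simp: inj_on_def)

lemma grow_planar:
  assumes A: "bp_closed A"
  shows "image_mset (\<lambda>x. (Suc (kids A x), planar_shape (insert (nxt A x) A))) (mset_set A) = grow (planar_shape A)"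
proof -
  have fin: "finite A" using A by (simp add: bp_closed_def)
  have empty: "kid_words A (nxt A x) = {}" for x
    using bp_closed_parent[OF A, of "nxt A x"] nxt_notin[OF A, of x] by (auto simp: kid_words_def)
  have "image_mset (\<lambda>v. (Suc (card (kid_words A v)), gsh ((kid_words A)(v := insert (nxt A v) (kid_words A v))) (Suc (card A)) []))
      (mset_set (dsc (kid_words A) (card A) [])) = grow (gsh (kid_words A) (card A) [])"
    by (rule grow_gsh[OF tree_depth_le_planar[OF A]]) (use nxt_notin[OF A] empty in \<open>simp add: dsc_planar[OF A]\<close>)
  then have *: "image_mset (\<lambda>v. (Suc (card (kid_words A v)), gsh ((kid_words A)(v := insert (nxt A v) (kid_words A v))) (Suc (card A)) []))
      (mset_set A) = grow (planar_shape A)"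
    by (simp only: dsc_planar[OF A] planar_shape_def lshape_gsh)
  have "image_mset (\<lambda>x. (Suc (kids A x), planar_shape (insert (nxt A x) A))) (mset_set A)
    = image_mset (\<lambda>v. (Suc (card (kid_words A v)), gsh ((kid_words A)(v := insert (nxt A v) (kid_words A v))) (Suc (card A)) [])) (mset_set A)"
  proof (intro image_mset_cong)
    fix x assume "x \<in># mset_set A"
    then have x: "x \<in> A" using fin by simp
    have "kid_words (insert (nxt A x) A) = (kid_words A)(x := insert (nxt A x) (kid_words A x))"
      by (auto simp: kid_words_def nxt_def fun_eq_iff)
    moreover have "card (insert (nxt A x) A) = Suc (card A)" using fin nxt_notin[OF A, of x] by simp
    ultimately show "(Suc (kids A x), planar_shape (insert (nxt A x) A))
      = (Suc (card (kid_words A x)), gsh ((kid_words A)(x := insert (nxt A x) (kid_words A x))) (Suc (card A)) [])"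
      by (simp only: planar_shape_def lshape_gsh card_kid_words[OF A])
  qed
  then show ?thesis using * by simp
qed

text \<open>The planar populations of unlabelled shape \<open>t\<close>: one tree shape arises from
  several birth orders among siblings.\<close>

definition planar_class :: "utree \<Rightarrow> nat list set set" where
  "planar_class t = {A. bp_closed A \<and> planar_shape A = t}"

text \<open>All words of a population of size \<open>n\<close> are shorter than \<open>n\<close> and
  use letters below \<open>n\<close>, because a letter is less than the number of siblings.\<close>

lemma finite_planar_class: "finite (planar_class t)"
proof -
  define n where "n = tsize t"
  let ?W = "{x :: nat list. set x \<subseteq> {..<n} \<and> length x \<le> n}"
  have "A \<subseteq> ?W" if "A \<in> planar_class t" for A
  proof
    fix a assume a: "a \<in> A"
    have A: "bp_closed A" and n: "card A = n" using that tsize_planar_shape by (auto simp: planar_class_def n_def)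
    have "i < n" if ia: "i \<in> set a" for i
    proof -
      obtain k where k: "k < length a" "a ! k = i" using ia by (auto simp: in_set_conv_nth)
      have "take (Suc k) a \<in> A" using bp_closed_take[OF A a, of "Suc k"] k by simp
      then have "take k a @ [i] \<in> A" using k by (simp add: take_Suc_conv_app_nth)
      then have "i < kids A (take k a)" using snoc_mem_iff[OF A] by blast
      also have "\<dots> = card ((\<lambda>i. take k a @ [i]) ` {i. take k a @ [i] \<in> A})"
        unfolding kids_def by (rule card_image[symmetric]) (auto simp: inj_on_def)
      also have "\<dots> \<le> card A"
      proof (rule card_mono)
        show "finite A" by (rule bp_closed_finite[OF A])
        show "(\<lambda>i. take k a @ [i]) ` {i. take k a @ [i] \<in> A} \<subseteq> A" by blast
      qed
      finally show ?thesis using n by simp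
    qed
    then show "a \<in> ?W" using length_less_card[OF A a] n by auto
  qed
  then have "planar_class t \<subseteq> Pow ?W" by blast
  moreover have "finite (Pow ?W)" using finite_lists_length_le[of "{..<n}" n] by simp
  ultimately show ?thesis by (rule finite_subset)
qed

lemma planar_class_leaf: "planar_class leaf = {{[]}}"
proof
  have "A = {[]}" if A: "bp_closed A" "planar_shape A = leaf" for A
  proof -
    have "card A = 1" using tsize_planar_shape[OF A(1)] A(2) by (simp add: leaf_def)
    then show ?thesis using bp_closed_Nil[OF A(1)] by (auto simp: card_1_singleton_iff)
  qed
  then show "planar_class leaf \<subseteq> {{[]}}" by (auto simp: planar_class_def)
  have "bp_closed {[]}" by (auto simp: bp_closed_def)
  then show "{{[]}} \<subseteq> planar_class leaf" by (simp add: planar_class_def planar_shape_def leaf_def)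
qed

context crump_mode
begin

definition shape_prob :: "utree \<Rightarrow> real" where
  "shape_prob t = (\<Sum>A\<in>planar_class t. planar_prob A)"

text \<open>Sum of \<open>planar_prob_rec\<close> over the planar versions of \<open>t\<close>. The
  exit rate depends on the shape alone, and by \<open>grow_planar\<close> the entries from the
  planar versions of a shape \<open>s\<close> collect to \<open>rate f s t\<close>.\<close>

lemma shape_prob_rec:
  "(lam + tot_rate f t) * shape_prob t
    = (if t = leaf then lam else 0) + (\<Sum>s\<in>{s. tsize s < tsize t}. shape_prob s * rate f s t)"
proof -
  let ?T = "{s. tsize s < tsize t}"
  have finT: "finite ?T" by (rule finite_subset[OF _ finite_tsize_le[of "tsize t"]]) auto
  have tot: "(\<Sum>x\<in>A. f (Suc (kids A x))) = tot_rate f t" if "A \<in> planar_class t" for A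
  proof -
    have A: "bp_closed A" "planar_shape A = t" using that by (auto simp: planar_class_def)
    show ?thesis unfolding tot_rate_def A(2)[symmetric] grow_planar[OF A(1), symmetric]
      by (simp add: sum_unfold_sum_mset image_mset.compositionality comp_def)
  qed
  have rt: "(\<Sum>x\<in>B. if planar_shape (insert (nxt B x) B) = t then f (Suc (kids B x)) else 0) = rate f (planar_shape B) t"
    if "bp_closed B" for B
    unfolding rate_def grow_planar[OF that, symmetric]
    by (simp add: sum_unfold_sum_mset image_mset.compositionality comp_def)
  have finc: "finite B" if "B \<in> planar_class s" for B s using that by (auto simp: planar_class_def bp_closed_finite)
  have finU: "finite (\<Union>s\<in>?T. planar_class s)" using finT finite_planar_class by blast
  have "(lam + tot_rate f t) * shape_prob t = (\<Sum>A\<in>planar_class t. (lam + (\<Sum>x\<in>A. f (Suc (kids A x)))) * planar_prob A)"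
    unfolding shape_prob_def sum_distrib_left by (intro sum.cong refl) (simp add: tot)
  also have "\<dots> = (\<Sum>A\<in>planar_class t. (if A = {[]} then lam else 0) + (\<Sum>a\<in>removable A. f (Suc (last a)) * planar_prob (A - {a})))"
    by (intro sum.cong refl planar_prob_rec) (simp add: planar_class_def)
  also have "\<dots> = (\<Sum>A\<in>planar_class t. if A = {[]} then lam else 0) + (\<Sum>A\<in>planar_class t. \<Sum>a\<in>removable A. f (Suc (last a)) * planar_prob (A - {a}))"
    by (rule sum.distrib)
  also have "(\<Sum>A\<in>planar_class t. if A = {[]} then lam else 0) = (if t = leaf then lam else 0)"
  proof (cases "t = leaf")
    case True
    then show ?thesis by (simp add: planar_class_leaf)
  next
    case False
    have "{[]} \<notin> planar_class t" using False planar_class_leaf by (auto simp: planar_class_def)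
    then show ?thesis using False by (intro sum.neutral[THEN trans]) auto
  qed
  also have "(\<Sum>A\<in>planar_class t. \<Sum>a\<in>removable A. f (Suc (last a)) * planar_prob (A - {a}))
    = (\<Sum>(A, a)\<in>(SIGMA A:planar_class t. removable A). f (Suc (last a)) * planar_prob (A - {a}))"
    by (rule sum.Sigma) (auto simp: finite_planar_class removable_def intro: finite_subset[OF _ finc])
  \<comment> \<open>A population with its last-born member corresponds to the population before that
    birth together with the parent.\<close>
  also have "\<dots> = (\<Sum>(B, x)\<in>{(B, x). B \<in> (\<Union>s\<in>?T. planar_class s) \<and> x \<in> B \<and> planar_shape (insert (nxt B x) B) = t}. f (Suc (kids B x)) * planar_prob B)"
  proof (rule sum.reindex_bij_witness[of _ "\<lambda>(B, x). (insert (nxt B x) B, nxt B x)" "\<lambda>(A, a). (A - {a}, butlast a)"], goal_cases)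
    case (1 z)
    then obtain A a where z: "z = (A, a)" "A \<in> planar_class t" "a \<in> removable A" by auto
    then have A: "bp_closed A" by (simp add: planar_class_def)
    from nxt_removable[OF A z(3)] z show ?case by (auto simp: removable_def)
  next
    case (2 z)
    then obtain A a where z: "z = (A, a)" "A \<in> planar_class t" "a \<in> removable A" by auto
    then have A: "bp_closed A" and t: "planar_shape A = t" by (auto simp: planar_class_def)
    have B: "bp_closed (A - {a})" "a \<in> A" "a \<noteq> []" using z by (auto simp: removable_def)
    have n: "nxt (A - {a}) (butlast a) = a" by (rule nxt_removable[OF A z(3)])
    have "butlast a @ [last a] \<in> A" using B by simp
    then have "butlast a \<in> A" by (rule bp_closed_parent[OF A])
    moreover have "butlast a \<noteq> a" using B(3) by (metis append_butlast_last_id not_Cons_self2 append_self_conv)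
    moreover have "A - {a} \<in> planar_class (planar_shape (A - {a}))" using B by (simp add: planar_class_def)
    moreover have "tsize (planar_shape (A - {a})) < tsize t"
    proof -
      have "finite A" by (rule bp_closed_finite[OF A])
      then have "card (A - {a}) < card A" using B(2) by (rule card_Diff1_less)
      then show ?thesis using tsize_planar_shape[OF B(1)] tsize_planar_shape[OF A] t by simp
    qed
    moreover have "insert a (A - {a}) = A" using B by auto
    ultimately show ?case using z n t by auto
  next
    case (3 z)
    then obtain B x where z: "z = (B, x)" "bp_closed B" "x \<in> B" by (auto simp: planar_class_def)
    then show ?case using nxt_notin[OF z(2), of x] by (auto simp: nxt_def)
  next
    case (4 z)
    then obtain B x where z: "z = (B, x)" "bp_closed B" "x \<in> B" "planar_shape (insert (nxt B x) B) = t" by (auto simp: planar_class_def)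
    have "insert (nxt B x) B - {nxt B x} = B" using nxt_notin[OF z(2), of x] by auto
    then have "nxt B x \<in> removable (insert (nxt B x) B)" using z by (auto simp: removable_def nxt_def)
    then show ?case using z bp_closed_insert_nxt[OF z(2,3)] by (auto simp: planar_class_def)
  next
    case (5 z)
    then obtain A a where z: "z = (A, a)" "A \<in> planar_class t" "a \<in> removable A" by auto
    then have A: "bp_closed A" by (simp add: planar_class_def)
    have "a \<noteq> []" using z by (simp add: removable_def)
    then have "butlast a @ [kids (A - {a}) (butlast a)] = butlast a @ [last a]"
      using nxt_removable[OF A z(3)] by (simp add: nxt_def)
    then show ?case using z by simp
  qed
  also have "\<dots> = (\<Sum>B\<in>(\<Union>s\<in>?T. planar_class s). \<Sum>x\<in>{x \<in> B. planar_shape (insert (nxt B x) B) = t}. f (Suc (kids B x)) * planar_prob B)"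
  proof -
    let ?U = "\<Union>s\<in>?T. planar_class s"
    have "{(B, x). B \<in> ?U \<and> x \<in> B \<and> planar_shape (insert (nxt B x) B) = t}
      = (SIGMA B:?U. {x \<in> B. planar_shape (insert (nxt B x) B) = t})" by blast
    moreover have "\<forall>B\<in>?U. finite {x \<in> B. planar_shape (insert (nxt B x) B) = t}"
    proof
      fix B assume "B \<in> ?U"
      then obtain s where "B \<in> planar_class s" by blast
      then have "finite B" by (rule finc)
      then show "finite {x \<in> B. planar_shape (insert (nxt B x) B) = t}" by simp
    qed
    ultimately show ?thesis by (simp only:) (rule sum.Sigma[OF finU, symmetric])
  qed
  also have "\<dots> = (\<Sum>B\<in>(\<Union>s\<in>?T. planar_class s). planar_prob B * rate f (planar_shape B) t)"
  proof (intro sum.cong refl)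
    fix B assume "B \<in> (\<Union>s\<in>?T. planar_class s)"
    then have B: "bp_closed B" "finite B" by (auto simp: planar_class_def bp_closed_finite)
    have "(\<Sum>x\<in>{x \<in> B. planar_shape (insert (nxt B x) B) = t}. f (Suc (kids B x)) * planar_prob B)
      = (\<Sum>x\<in>B. planar_prob B * (if planar_shape (insert (nxt B x) B) = t then f (Suc (kids B x)) else 0))"
      using B(2) by (intro sum.mono_neutral_cong_left) auto
    then show "(\<Sum>x\<in>{x \<in> B. planar_shape (insert (nxt B x) B) = t}. f (Suc (kids B x)) * planar_prob B) = planar_prob B * rate f (planar_shape B) t"
      by (simp add: sum_distrib_left[symmetric] rt[OF B(1)])
  qed
  also have "\<dots> = (\<Sum>s\<in>?T. \<Sum>B\<in>planar_class s. planar_prob B * rate f (planar_shape B) t)"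
    by (rule sum.UNION_disjoint) (auto simp: finT finite_planar_class, auto simp: planar_class_def)
  also have "\<dots> = (\<Sum>s\<in>?T. shape_prob s * rate f s t)"
    unfolding shape_prob_def sum_distrib_right by (intro sum.cong refl) (auto simp: planar_class_def)
  finally show ?thesis .
qed

text \<open>Almost surely all clocks and the observation time are positive, so a finite observed
  population is closed. Up to a null set the event defining \<open>varpi\<close> is thus the finite
  disjoint union over \<open>planar_class t\<close>.\<close>

lemma varpi_shape_prob:
  assumes "lam = lambda_star f"
  shows "varpi f (Some t) = shape_prob t"
proof -
  let ?P = "bp_space f \<Otimes>\<^sub>M exp_meas lam"
  interpret P: pair_prob_space "bp_space f" "exp_meas lam" ..
  let ?S = "{(w, T). finite (bp_pop w T) \<and> lshape (bp_pop w T) (card (bp_pop w T)) [] = t}"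
  let ?U = "\<Union>A\<in>planar_class t. {(w, T). bp_pop w T = A}"
  have spP: "space ?P = UNIV" by (simp add: space_pair_measure space_bp_space space_exp_meas)
  have S: "?S \<in> sets ?P"
  proof -
    have "?S = (\<Union>A\<in>{A. finite A \<and> lshape A (card A) [] = t}. {(w, T). bp_pop w T = A})" by auto
    moreover have "countable {A :: nat list set. finite A \<and> lshape A (card A) [] = t}"
      by (rule countable_subset[OF _ countable_Collect_finite]) auto
    ultimately show ?thesis using measurable_pop_eq by (auto intro!: sets.countable_UN')
  qed
  have U: "?U \<in> sets ?P" using finite_planar_class measurable_pop_eq by (intro sets.finite_UN) auto
  have "AE z in ?P. pos (fst z) \<and> 0 < snd z"
  proof (rule P.AE_pair_measure)
    have [measurable]: "(\<lambda>z. fst z c) \<in> borel_measurable ?P" for c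
      by (rule measurable_compose[OF measurable_fst measurable_coord])
    have [measurable]: "snd \<in> borel_measurable ?P"
      using measurable_snd[of "bp_space f" "exp_meas lam"] by (simp add: measurable_cong_sets[OF refl sets_exp_meas])
    show "{z \<in> space ?P. pos (fst z) \<and> 0 < snd z} \<in> sets ?P" unfolding pos_def by measurable
    show "AE w in bp_space f. AE T in exp_meas lam. pos (fst (w, T)) \<and> 0 < snd (w, T)"
      using AE_pos by eventually_elim (simp add: AE_exp_meas_pos)
  qed
  then have "AE z in ?P. z \<in> ?S \<longleftrightarrow> z \<in> ?U"
  proof eventually_elim
    case (elim z)
    obtain w T where z: "z = (w, T)" by (cases z)
    have "bp_closed (bp_pop w T)" if "finite (bp_pop w T)"
      using bp_closed_pop[of w T] that elim z by auto
    then show ?case using z bp_closed_finite by (auto simp: planar_class_def planar_shape_def)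
  qed
  then have "measure ?P ?S = measure ?P ?U" using S U by (rule measure_eq_AE)
  also have "\<dots> = (\<Sum>A\<in>planar_class t. measure ?P {(w, T). bp_pop w T = A})"
    using finite_planar_class measurable_pop_eq
    by (intro P.finite_measure_finite_Union) (auto simp: disjoint_family_on_def)
  finally show ?thesis unfolding varpi_def shape_prob_def planar_prob_def assms[symmetric] by simp
qed

end

section \<open>The effect of the delay\<close>

lemma deg_pos [simp]: "Suc 0 \<le> deg p m v" by (simp add: deg_def)

lemma sum_card_children:
  assumes p: "vtree p" and m: "1 \<le> m" "m \<le> length p"
  shows "(\<Sum>v<m. card (children p m v)) = m - 1"
proof -
  have "(\<Sum>v<m. card (children p m v)) = card (\<Union>v\<in>{..<m}. children p m v)"
    by (intro card_UN_disjoint[symmetric]) (auto simp: children_def)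
  also have "(\<Union>v\<in>{..<m}. children p m v) = {1..<m}"
  proof (intro set_eqI iffI)
    fix w assume w: "w \<in> {1..<m}"
    then have "p ! w < w" using p m by (auto simp: vtree_def)
    then show "w \<in> (\<Union>v\<in>{..<m}. children p m v)" using w by (auto simp: children_def)
  qed (auto simp: children_def)
  finally show ?thesis by simp
qed

lemma sum_deg:
  assumes "vtree p" "1 \<le> m" "m \<le> length p"
  shows "(\<Sum>v<m. real (deg p m v)) = 2 * real m - 1"
proof -
  have "(\<Sum>v<m. real (deg p m v)) = real (\<Sum>v<m. card (children p m v)) + real m"
    by (simp add: deg_def sum.distrib)
  then show ?thesis using sum_card_children[OF assms] assms(2) by simp
qed

definition wt :: "(nat \<Rightarrow> real) \<Rightarrow> nat list \<Rightarrow> nat \<Rightarrow> real" where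
  "wt f p m = (\<Sum>u<m. f (deg p m u))"

text \<open>The value 0 for a vertex not yet born follows the convention for degrees; with it the
  newborn vertices are part of the total change of degrees.\<close>

definition late_deg :: "nat list \<Rightarrow> nat \<Rightarrow> nat \<Rightarrow> nat" where
  "late_deg p m v = (if v < m then deg p m v else 0)"

lemma late_deg_le: "m \<le> length p \<Longrightarrow> late_deg p m v \<le> deg p (length p) v"
  unfolding late_deg_def deg_def by (auto intro!: card_mono simp: children_def)

text \<open>Every late vertex adds 2 to the total degree: 1 for itself and 1 at its parent.\<close>

lemma sum_late_deg_diff:
  assumes "vtree p" "1 \<le> m" "m \<le> length p"
  shows "(\<Sum>v<length p. real (deg p (length p) v) - real (late_deg p m v)) = 2 * (real (length p) - real m)"
proof -
  have "(\<Sum>v<length p. real (late_deg p m v)) = (\<Sum>v<m. real (deg p m v))"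
    using assms by (intro sum.mono_neutral_cong_right) (auto simp: late_deg_def)
  then show ?thesis using sum_deg[OF assms] sum_deg[OF assms(1), of "length p"] assms
    by (simp add: sum_subtractf)
qed

text \<open>Controls the effect of looking at the tree \<open>length p - m\<close> steps too late; all that the delay
  requires of \<open>f\<close>.\<close>
definition perturbation_bound :: "(nat \<Rightarrow> real) \<Rightarrow> bool" where
  "perturbation_bound f \<longleftrightarrow> (\<forall>e>0. \<exists>C\<ge>0. \<forall>p m. vtree p \<longrightarrow> 1 \<le> m \<longrightarrow> m \<le> length p \<longrightarrow>
    (\<Sum>v<length p. \<bar>(if v < m then f (deg p m v) else 0) - f (deg p (length p) v)\<bar>)
      \<le> e * real (length p) + C * (real (length p) - real m))"

text \<open>A difference of values of \<open>f\<close> equals the difference of degrees, and at a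
  late vertex \<open>f d\<close> is at most \<open>(1 + \<bar>\<alpha>\<bar>) * d\<close> because
  \<open>d\<close> is at least 1. Everything is charged to the total change of degrees.\<close>

lemma perturbation_bound_linear:
  assumes "\<And>k. 1 \<le> k \<Longrightarrow> f k = real k + \<alpha>"
  shows "perturbation_bound f"
  unfolding perturbation_bound_def
proof (intro allI impI exI[of _ "2 * (1 + \<bar>\<alpha>\<bar>)"] conjI)
  fix e :: real and p m assume e: "e > 0" and p: "vtree p" "1 \<le> m" "m \<le> length p"
  have "(\<Sum>v<length p. \<bar>(if v < m then f (deg p m v) else 0) - f (deg p (length p) v)\<bar>)
    \<le> (\<Sum>v<length p. (1 + \<bar>\<alpha>\<bar>) * (real (deg p (length p) v) - real (late_deg p m v)))"
  proof (rule sum_mono)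
    fix v
    have le: "real (late_deg p m v) \<le> real (deg p (length p) v)" using late_deg_le[OF p(3)] by simp
    show "\<bar>(if v < m then f (deg p m v) else 0) - f (deg p (length p) v)\<bar> \<le> (1 + \<bar>\<alpha>\<bar>) * (real (deg p (length p) v) - real (late_deg p m v))"
    proof (cases "v < m")
      case True
      have "0 \<le> \<bar>\<alpha>\<bar> * (real (deg p (length p) v) - real (late_deg p m v))" using le by simp
      moreover have "f (deg p m v) = real (deg p m v) + \<alpha>" "f (deg p (length p) v) = real (deg p (length p) v) + \<alpha>"
        by (simp_all add: assms)
      ultimately show ?thesis using True le by (simp add: late_deg_def algebra_simps)
    next
      case False
      have "1 \<le> real (deg p (length p) v)" using deg_pos[of p "length p" v] by linarith
      then have "\<bar>\<alpha>\<bar> * 1 \<le> \<bar>\<alpha>\<bar> * real (deg p (length p) v)" by (intro mult_left_mono) auto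
      moreover have "f (deg p (length p) v) = real (deg p (length p) v) + \<alpha>" by (simp add: assms)
      ultimately show ?thesis using False by (simp add: late_deg_def distrib_right)
    qed
  qed
  also have "\<dots> = 2 * (1 + \<bar>\<alpha>\<bar>) * (real (length p) - real m)"
    unfolding sum_distrib_left[symmetric] sum_late_deg_diff[OF p] by (simp add: algebra_simps)
  also have "\<dots> \<le> e * real (length p) + 2 * (1 + \<bar>\<alpha>\<bar>) * (real (length p) - real m)" using e by simp
  finally show "(\<Sum>v<length p. \<bar>(if v < m then f (deg p m v) else 0) - f (deg p (length p) v)\<bar>)
    \<le> e * real (length p) + 2 * (1 + \<bar>\<alpha>\<bar>) * (real (length p) - real m)" .
qed auto

lemma sublinear_bound:
  assumes "(\<lambda>k. f k / real k) \<longlonglongrightarrow> 0" and "0 < e"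
  shows "\<exists>C\<ge>0. \<forall>k\<ge>1. f k \<le> e * real k + (C::real)"
proof -
  have "eventually (\<lambda>k. f k / real k < e) sequentially" using assms by (rule order_tendstoD)
  then obtain K where K: "\<And>k. k \<ge> K \<Longrightarrow> f k / real k < e" by (auto simp: eventually_sequentially)
  define C where "C = (\<Sum>k\<le>K. \<bar>f k\<bar>)"
  have "f k \<le> e * real k + C" if k: "k \<ge> 1" for k
  proof (cases "K \<le> k")
    case True
    then have "f k < e * real k" using K[OF True] k by (simp add: field_simps)
    moreover have "0 \<le> C" by (auto simp: C_def intro: sum_nonneg)
    ultimately show ?thesis by simp
  next
    case False
    then have "\<bar>f k\<bar> \<le> C" unfolding C_def by (intro member_le_sum) auto
    moreover have "0 \<le> e * real k" using assms by simp
    ultimately show ?thesis by linarith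
  qed
  moreover have "0 \<le> C" by (auto simp: C_def intro: sum_nonneg)
  ultimately show ?thesis by blast
qed

text \<open>Vertices whose degree did not change contribute nothing. At the others the degree
  changed by at least 1, which pays for the constant in the bound \<open>e / 4 * k + C\<close> of
  \<open>f\<close>; the linear part is paid by the total degree, less than twice the number of
  vertices.\<close>

lemma perturbation_bound_sublinear:
  assumes pos: "\<And>k. 1 \<le> k \<Longrightarrow> 0 < f k" and lim: "(\<lambda>k. f k / real k) \<longlonglongrightarrow> 0"
  shows "perturbation_bound f"
  unfolding perturbation_bound_def
proof (intro allI impI)
  fix e :: real assume e: "e > 0"
  then obtain C where C: "C \<ge> 0" "\<And>k. k \<ge> 1 \<Longrightarrow> f k \<le> e / 4 * real k + C"
    using sublinear_bound[OF lim, of "e / 4"] by auto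
  show "\<exists>C\<ge>0. \<forall>p m. vtree p \<longrightarrow> 1 \<le> m \<longrightarrow> m \<le> length p \<longrightarrow>
    (\<Sum>v<length p. \<bar>(if v < m then f (deg p m v) else 0) - f (deg p (length p) v)\<bar>)
      \<le> e * real (length p) + C * (real (length p) - real m)"
  proof (intro exI[of _ "4 * C"] conjI allI impI)
    fix p m assume p: "vtree p" "1 \<le> m" "m \<le> length p"
    have "(\<Sum>v<length p. \<bar>(if v < m then f (deg p m v) else 0) - f (deg p (length p) v)\<bar>)
      \<le> (\<Sum>v<length p. e / 2 * real (deg p (length p) v) + 2 * C * (real (deg p (length p) v) - real (late_deg p m v)))"
    proof (rule sum_mono)
      fix v
      let ?d = "deg p (length p) v" and ?l = "late_deg p m v"
      have le: "?l \<le> ?d" using late_deg_le[OF p(3)] .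
      show "\<bar>(if v < m then f (deg p m v) else 0) - f ?d\<bar> \<le> e / 2 * real ?d + 2 * C * (real ?d - real ?l)"
      proof (cases "?l = ?d")
        case True
        then have "v < m" by (auto simp: late_deg_def deg_def split: if_splits)
        then show ?thesis using True e by (simp add: late_deg_def)
      next
        case False
        then have d1: "1 \<le> real ?d - real ?l" using le by linarith
        have u1: "0 < f ?d" "f ?d \<le> e / 4 * real ?d + C" using pos C(2) by auto
        have u2: "0 \<le> (if v < m then f (deg p m v) else 0)" using pos[of "deg p m v"] by auto
        have u3: "(if v < m then f (deg p m v) else 0) \<le> e / 4 * real ?l + C"
          using C(1) C(2)[of "deg p m v"] e by (auto simp: late_deg_def)
        have "e / 4 * real ?l \<le> e / 4 * real ?d" using le e by (intro mult_left_mono) auto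
        moreover have "2 * C * 1 \<le> 2 * C * (real ?d - real ?l)" using d1 C(1) by (intro mult_left_mono) auto
        ultimately show ?thesis using u1 u2 u3 by linarith
      qed
    qed
    also have "\<dots> = e / 2 * (2 * real (length p) - 1) + 2 * C * (2 * (real (length p) - real m))"
    proof -
      have "(\<Sum>v<length p. real (deg p (length p) v)) = 2 * real (length p) - 1"
        using p by (intro sum_deg) auto
      then show ?thesis using sum_late_deg_diff[OF p]
        by (simp only: sum.distrib sum_distrib_left[symmetric])
    qed
    also have "\<dots> \<le> e * real (length p) + 4 * C * (real (length p) - real m)"
      using e by (simp add: field_simps)
    finally show "(\<Sum>v<length p. \<bar>(if v < m then f (deg p m v) else 0) - f (deg p (length p) v)\<bar>)
      \<le> e * real (length p) + 4 * C * (real (length p) - real m)" .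
  qed (use C in simp)
qed

text \<open>The factor 2 arises since the distance is paid once for the numerators and once for the
  change of the normalising sum.\<close>

lemma normalised_distance:
  fixes x y :: "'a \<Rightarrow> real"
  assumes "finite A" "\<And>v. v \<in> A \<Longrightarrow> 0 \<le> x v" "0 < sum x A" "0 < sum y A"
  shows "(\<Sum>v\<in>A. \<bar>x v / sum x A - y v / sum y A\<bar>) \<le> 2 * (\<Sum>v\<in>A. \<bar>x v - y v\<bar>) / sum y A"
proof -
  define X Y D where "X = sum x A" "Y = sum y A" "D = (\<Sum>v\<in>A. \<bar>x v - y v\<bar>)"
  have XY: "0 < X" "0 < Y" using assms by (auto simp: X_Y_D_def)
  have "\<bar>x v / X - y v / Y\<bar> \<le> \<bar>x v - y v\<bar> / Y + x v * (D / (X * Y))" if v: "v \<in> A" for v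
  proof -
    have "\<bar>Y - X\<bar> \<le> D" unfolding X_Y_D_def using sum_abs[of "\<lambda>v. x v - y v" A]
      by (simp add: sum_subtractf abs_minus_commute)
    then have d: "\<bar>Y - X\<bar> / (X * Y) \<le> D / (X * Y)" using XY by (intro divide_right_mono) auto
    have "x v / X - y v / Y = (x v - y v) / Y + x v * ((Y - X) / (X * Y))"
      using XY by (simp add: field_simps)
    also have "\<bar>\<dots>\<bar> \<le> \<bar>x v - y v\<bar> / Y + x v * (\<bar>Y - X\<bar> / (X * Y))"
      using XY assms(2)[OF v] by (intro order_trans[OF abs_triangle_ineq]) (simp add: abs_mult)
    also have "\<dots> \<le> \<bar>x v - y v\<bar> / Y + x v * (D / (X * Y))"
      using d assms(2)[OF v] by (intro add_left_mono mult_left_mono) auto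
    finally show ?thesis .
  qed
  then have "(\<Sum>v\<in>A. \<bar>x v / X - y v / Y\<bar>) \<le> (\<Sum>v\<in>A. \<bar>x v - y v\<bar> / Y + x v * (D / (X * Y)))"
    by (rule sum_mono)
  also have "\<dots> = D / Y + X * (D / (X * Y))"
    by (simp add: sum.distrib sum_divide_distrib[symmetric] sum_distrib_right[symmetric] X_Y_D_def)
  also have "\<dots> = 2 * D / Y" using XY by (simp add: field_simps)
  finally show ?thesis by (simp add: X_Y_D_def)
qed

section \<open>The delayed attachment law and its distance from the undelayed one\<close>

locale delayed_attachment =
  fixes \<beta> :: real and \<mu> :: "real measure" and f :: "nat \<Rightarrow> real" and fs :: real
  assumes beta: "0 \<le> \<beta>" "\<beta> < 1"
    and prob_mu: "prob_space \<mu>" and sets_mu: "sets \<mu> = sets borel" and mu_nonneg: "AE \<xi> in \<mu>. 0 \<le> \<xi>"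
    and fs: "0 < fs" "\<And>k. 1 \<le> k \<Longrightarrow> fs \<le> f k"
    and pert: "perturbation_bound f"
begin

sublocale mu: prob_space \<mu> by (rule prob_mu)

lemma f_pos: "1 \<le> k \<Longrightarrow> 0 < f k" using fs by force

lemma wt_ge: "fs * real m \<le> wt f p m"
proof -
  have "(\<Sum>u<m. fs) \<le> wt f p m" unfolding wt_def by (intro sum_mono fs) simp
  then show ?thesis by (simp add: mult.commute)
qed

lemma wt_pos: "1 \<le> m \<Longrightarrow> 0 < wt f p m"
  using wt_ge[of m p] fs(1) by (smt (verit) mult_pos_pos of_nat_0_less_iff One_nat_def Suc_le_eq)

lemma attach_prob_wt: "attach_prob f p m v = (if v < m then f (deg p m v) / wt f p m else 0)"
  by (simp add: attach_prob_def wt_def)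

lemma attach_prob_nonneg: "0 \<le> attach_prob f p m v"
  using wt_pos[of m p] f_pos[of "deg p m v"] by (auto simp: attach_prob_wt intro!: divide_nonneg_nonneg)

lemma sum_attach_prob: "1 \<le> m \<Longrightarrow> m \<le> n \<Longrightarrow> (\<Sum>v<n. attach_prob f p m v) = 1"
proof -
  assume m: "1 \<le> m" "m \<le> n"
  have "(\<Sum>v<n. attach_prob f p m v) = (\<Sum>v<m. f (deg p m v) / wt f p m)"
    using m by (intro sum.mono_neutral_cong_right) (auto simp: attach_prob_wt)
  also have "\<dots> = 1" using wt_pos[OF m(1), of p] by (simp add: sum_divide_distrib[symmetric] wt_def)
  finally show ?thesis .
qed

lemma attach_prob_le_1: "attach_prob f p m v \<le> 1"
proof (cases "v < m")
  case True
  then have "attach_prob f p m v \<le> (\<Sum>v<m. attach_prob f p m v)"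
    by (intro member_le_sum) (auto simp: attach_prob_nonneg)
  then show ?thesis using sum_attach_prob[of m m p] True by simp
qed (simp add: attach_prob_def)

lemma measurable_delay_index: "delay_index \<beta> n \<in> measurable \<mu> (count_space UNIV)"
proof -
  have [measurable]: "(\<lambda>\<xi>. \<xi>) \<in> borel_measurable \<mu>" using sets_mu by (simp add: measurable_ident_sets)
  show ?thesis unfolding delay_index_def floor_plus_def by measurable
qed

lemma measurable_attach: "(\<lambda>\<xi>. attach_prob f p (delay_index \<beta> n \<xi>) v) \<in> borel_measurable \<mu>"
  by (rule measurable_compose[OF measurable_delay_index]) simp

lemma integrable_attach: "integrable \<mu> (\<lambda>\<xi>. attach_prob f p (delay_index \<beta> n \<xi>) v)"
  by (rule mu.integrable_const_bound[where B = 1])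
     (auto simp: attach_prob_nonneg attach_prob_le_1 measurable_attach)

lemma delay_index_bounds:
  assumes "0 \<le> \<xi>" "1 \<le> n"
  shows "1 \<le> delay_index \<beta> n \<xi>" "delay_index \<beta> n \<xi> \<le> n"
    "real n - real (delay_index \<beta> n \<xi>) \<le> real n powr \<beta> * \<xi> + 1"
proof -
  have le: "real n - real n powr \<beta> * \<xi> \<le> real n" using assms by simp
  show "1 \<le> delay_index \<beta> n \<xi>" by (simp add: delay_index_def floor_plus_def)
  have "\<lfloor>real n - real n powr \<beta> * \<xi>\<rfloor> \<le> int n" using le by linarith
  then show "delay_index \<beta> n \<xi> \<le> n" using assms by (simp add: delay_index_def floor_plus_def)
  have "real (delay_index \<beta> n \<xi>) = real_of_int (max \<lfloor>real n - real n powr \<beta> * \<xi>\<rfloor> 1)"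
    by (simp add: delay_index_def floor_plus_def)
  also have "\<dots> \<ge> real n - real n powr \<beta> * \<xi> - 1" by linarith
  finally show "real n - real (delay_index \<beta> n \<xi>) \<le> real n powr \<beta> * \<xi> + 1" by simp
qed

lemma sum_step: assumes "1 \<le> n"
  shows "(\<Sum>v<n. \<integral>\<xi>. attach_prob f p (delay_index \<beta> n \<xi>) v \<partial>\<mu>) = 1"
proof -
  have "(\<Sum>v<n. \<integral>\<xi>. attach_prob f p (delay_index \<beta> n \<xi>) v \<partial>\<mu>)
    = (\<integral>\<xi>. (\<Sum>v<n. attach_prob f p (delay_index \<beta> n \<xi>) v) \<partial>\<mu>)"
    by (rule Bochner_Integration.integral_sum[symmetric]) (rule integrable_attach)
  also have "\<dots> = (\<integral>\<xi>. 1 \<partial>\<mu>)"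
  proof (intro integral_cong_AE borel_measurable_sum measurable_attach)
    show "AE \<xi> in \<mu>. (\<Sum>v<n. attach_prob f p (delay_index \<beta> n \<xi>) v) = 1"
      using mu_nonneg by eventually_elim (use delay_index_bounds[OF _ assms] in \<open>auto simp: sum_attach_prob\<close>)
  qed simp
  finally show ?thesis by (simp add: mu.prob_space)
qed

lemma step_zero: assumes "1 \<le> n" "n \<le> v"
  shows "(\<integral>\<xi>. attach_prob f p (delay_index \<beta> n \<xi>) v \<partial>\<mu>) = 0"
proof -
  have "(\<integral>\<xi>. attach_prob f p (delay_index \<beta> n \<xi>) v \<partial>\<mu>) = (\<integral>\<xi>. 0 \<partial>\<mu>)"
  proof (intro integral_cong_AE measurable_attach)
    show "AE \<xi> in \<mu>. attach_prob f p (delay_index \<beta> n \<xi>) v = 0"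
      using mu_nonneg
    proof eventually_elim
      case (elim \<xi>)
      then show ?case using delay_index_bounds(2)[OF elim assms(1)] assms(2) by (simp add: attach_prob_def)
    qed
  qed simp
  then show ?thesis by simp
qed

text \<open>The averaged attachment probabilities are nonnegative and sum to 1, so
  \<open>embed_pmf\<close> yields the intended law of the parent.\<close>

lemma pmf_step:
  assumes "1 \<le> n"
  shows "pmf (step_pmf \<beta> \<mu> f n p) v = (\<integral>\<xi>. attach_prob f p (delay_index \<beta> n \<xi>) v \<partial>\<mu>)"
  unfolding step_pmf_def
proof (rule pmf_embed_pmf)
  let ?g = "\<lambda>v. \<integral>\<xi>. attach_prob f p (delay_index \<beta> n \<xi>) v \<partial>\<mu>"
  show nn: "0 \<le> ?g v" for v by (simp add: attach_prob_nonneg)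
  have "(\<integral>\<^sup>+ v. ennreal (?g v) \<partial>count_space UNIV) = (\<Sum>v<n. ennreal (?g v))"
    using step_zero[OF assms] by (intro nn_integral_count_space'[of "{..<n}"]) auto
  also have "\<dots> = ennreal (\<Sum>v<n. ?g v)" by (rule sum_ennreal) (rule nn)
  finally show "(\<integral>\<^sup>+ v. ennreal (?g v) \<partial>count_space UNIV) = 1" using sum_step[OF assms] by simp
qed

lemma sum_pmf_step: "1 \<le> n \<Longrightarrow> (\<Sum>v<n. pmf (step_pmf \<beta> \<mu> f n p) v) = 1"
  by (simp add: pmf_step sum_step)

lemma set_pmf_step: "1 \<le> n \<Longrightarrow> set_pmf (step_pmf \<beta> \<mu> f n p) \<subseteq> {..<n}"
  using step_zero by (auto simp: set_pmf_eq pmf_step not_less[symmetric])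

lemma attach_distance:
  assumes p: "vtree p" "1 \<le> m" "m \<le> length p"
    and C: "(\<Sum>v<length p. \<bar>(if v < m then f (deg p m v) else 0) - f (deg p (length p) v)\<bar>) \<le> D"
  shows "(\<Sum>v<length p. \<bar>attach_prob f p m v - attach_prob f p (length p) v\<bar>) \<le> 2 * D / (fs * real (length p))"
proof -
  let ?n = "length p"
  let ?x = "\<lambda>v. if v < m then f (deg p m v) else 0" and ?y = "\<lambda>v. f (deg p ?n v)"
  have sx: "sum ?x {..<?n} = wt f p m"
    unfolding wt_def using p by (intro sum.mono_neutral_cong_right) auto
  have sy: "sum ?y {..<?n} = wt f p ?n" by (simp add: wt_def)
  have n: "1 \<le> ?n" using p by simp
  have "(\<Sum>v<?n. \<bar>attach_prob f p m v - attach_prob f p ?n v\<bar>) = (\<Sum>v<?n. \<bar>?x v / sum ?x {..<?n} - ?y v / sum ?y {..<?n}\<bar>)"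
    unfolding sx sy by (intro sum.cong) (auto simp: attach_prob_wt)
  also have "\<dots> \<le> 2 * (\<Sum>v<?n. \<bar>?x v - ?y v\<bar>) / sum ?y {..<?n}"
  proof (rule normalised_distance)
    show "0 \<le> ?x v" for v using f_pos[of "deg p m v"] by simp
  qed (simp_all only: sx sy wt_pos[OF p(2)] wt_pos[OF n] finite_lessThan)
  also have "\<dots> \<le> 2 * D / sum ?y {..<?n}"
    using C wt_pos[OF n, of p] by (intro divide_right_mono) (auto simp: sy)
  also have "\<dots> \<le> 2 * D / (fs * real ?n)"
  proof -
    have "0 \<le> D" using C by (rule order_trans[rotated]) (simp add: sum_nonneg)
    then show ?thesis unfolding sy using wt_ge[of ?n p] fs(1) n wt_pos[OF n, of p] by (intro divide_left_mono mult_pos_pos) auto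
  qed
  finally show ?thesis .
qed

text \<open>The bound is uniform over all trees of the given size. With high probability the delay
  variable is below a constant, and then the process looks back \<open>o(n)\<close> steps because
  \<open>\<beta> < 1\<close>; otherwise the distance is at most 2.\<close>

lemma step_close:
  assumes e: "0 < e"
  shows "\<exists>N. \<forall>p. vtree p \<longrightarrow> N \<le> length p \<longrightarrow>
    (\<Sum>v<length p. \<bar>pmf (step_pmf \<beta> \<mu> f (length p) p) v - attach_prob f p (length p) v\<bar>) \<le> e"
proof -
  \<comment> \<open>\<open>attach_distance\<close> turns a perturbation of size
    \<open>2 * e1 * n\<close> into \<open>4 * e1 / fs\<close>, which is
    \<open>e / 2\<close>.\<close>
  define e1 where "e1 = e * fs / 8"
  have e1: "0 < e1" using e fs by (simp add: e1_def)
  obtain C where C: "C \<ge> 0" "\<And>p m. vtree p \<Longrightarrow> 1 \<le> m \<Longrightarrow> m \<le> length p \<Longrightarrow>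
    (\<Sum>v<length p. \<bar>(if v < m then f (deg p m v) else 0) - f (deg p (length p) v)\<bar>)
      \<le> e1 * real (length p) + C * (real (length p) - real m)"
    using pert e1 unfolding perturbation_bound_def by blast
  have [measurable]: "(\<lambda>\<xi>. \<xi>) \<in> borel_measurable \<mu>" using sets_mu by (simp add: measurable_ident_sets)
  have "(\<lambda>i::nat. measure \<mu> {\<xi> \<in> space \<mu>. real i < \<xi>}) \<longlonglongrightarrow> measure \<mu> (\<Inter>i. {\<xi> \<in> space \<mu>. real i < \<xi>})"
    by (rule mu.finite_Lim_measure_decseq) (auto simp: decseq_def intro: le_less_trans[OF of_nat_mono])
  moreover have "(\<Inter>i. {\<xi> \<in> space \<mu>. real i < \<xi>}) = {}"
    by (auto simp: not_less) (metis reals_Archimedean2 less_asym)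
  ultimately have "(\<lambda>i::nat. measure \<mu> {\<xi> \<in> space \<mu>. real i < \<xi>}) \<longlonglongrightarrow> 0" by simp
  then have "eventually (\<lambda>i::nat. measure \<mu> {\<xi> \<in> space \<mu>. real i < \<xi>} < e / 4) sequentially"
    using e by (intro order_tendstoD) auto
  then obtain i :: nat where i: "measure \<mu> {\<xi> \<in> space \<mu>. real i < \<xi>} < e / 4"
    by (auto simp: eventually_sequentially)
  \<comment> \<open>The exceptional event has probability below \<open>e / 4\<close>; with the
    trivial bound 2 it costs the other \<open>e / 2\<close>.\<close>
  define B where "B = {\<xi> \<in> space \<mu>. real i < \<xi>}"
  have B: "B \<in> sets \<mu>" unfolding B_def by measurable
  have "(\<lambda>n::nat. real n powr (\<beta> - 1) * real i + 1 / real n) \<longlonglongrightarrow> 0 * real i + 0"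
    using beta by (intro tendsto_add tendsto_mult tendsto_const lim_1_over_n
      tendsto_neg_powr filterlim_real_sequentially) auto
  then have "(\<lambda>n::nat. C * (real n powr (\<beta> - 1) * real i + 1 / real n)) \<longlonglongrightarrow> C * 0"
    by (intro tendsto_mult tendsto_const) simp
  then have "eventually (\<lambda>n::nat. C * (real n powr (\<beta> - 1) * real i + 1 / real n) < e1) sequentially"
    using e1 by (intro order_tendstoD) auto
  then obtain N where N: "\<And>n. n \<ge> N \<Longrightarrow> C * (real n powr (\<beta> - 1) * real i + 1 / real n) < e1"
    by (auto simp: eventually_sequentially)
  show ?thesis
  proof (intro exI[of _ N] allI impI)
    fix p assume p: "vtree p" "N \<le> length p"
    define n where "n = length p"
    have n: "1 \<le> n" "n \<ge> N" using p by (auto simp: vtree_def n_def Suc_le_eq)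
    let ?a = "\<lambda>m v. attach_prob f p m v"
    let ?s = "\<lambda>\<xi>. \<Sum>v<n. \<bar>?a (delay_index \<beta> n \<xi>) v - ?a n v\<bar>"
    have int: "integrable \<mu> (\<lambda>\<xi>. ?a (delay_index \<beta> n \<xi>) v - ?a n v)" for v
      by (intro Bochner_Integration.integrable_diff integrable_attach) simp
    have ptw: "?s \<xi> \<le> e / 2 + 2 * indicator B \<xi>" if xi: "0 \<le> \<xi>" "\<xi> \<in> space \<mu>" for \<xi>
    proof (cases "\<xi> \<in> B")
      case True
      have "?s \<xi> \<le> (\<Sum>v<n. ?a (delay_index \<beta> n \<xi>) v + ?a n v)"
        by (rule sum_mono) (smt (verit) attach_prob_nonneg)
      also have "\<dots> = 2" using delay_index_bounds[OF xi(1) n(1)] n by (simp add: sum.distrib sum_attach_prob)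
      finally show ?thesis using True e by simp
    next
      case False
      then have xi2: "\<xi> \<le> real i" using xi by (auto simp: B_def)
      let ?m = "delay_index \<beta> n \<xi>"
      note db = delay_index_bounds[OF xi(1) n(1)]
      have r: "(\<Sum>v<n. \<bar>(if v < ?m then f (deg p ?m v) else 0) - f (deg p n v)\<bar>) \<le> 2 * e1 * real n"
      proof -
        have "real n - real ?m \<le> real n powr \<beta> * real i + 1"
          using db(3) xi2 by (smt (verit) mult_left_mono powr_ge_zero)
        also have "\<dots> = real n * (real n powr (\<beta> - 1) * real i + 1 / real n)"
          using n by (simp add: field_simps powr_diff)
        finally have "C * (real n - real ?m) \<le> C * (real n * (real n powr (\<beta> - 1) * real i + 1 / real n))"
          using C(1) by (rule mult_left_mono)
        also have "\<dots> \<le> real n * e1"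
          using N[OF n(2)] n by (subst mult.left_commute) (intro mult_left_mono, auto)
        finally show ?thesis using C(2)[OF p(1) db(1)] db(2) unfolding n_def[symmetric] by (simp add: algebra_simps)
      qed
      have "?s \<xi> \<le> 2 * (2 * e1 * real n) / (fs * real n)"
        using attach_distance[OF p(1) db(1), unfolded n_def[symmetric], OF db(2) r] .
      also have "\<dots> = e / 2" using fs n by (simp add: e1_def field_simps)
      finally show ?thesis using False by simp
    qed
    have "(\<Sum>v<n. \<bar>pmf (step_pmf \<beta> \<mu> f n p) v - ?a n v\<bar>) = (\<Sum>v<n. \<bar>\<integral>\<xi>. ?a (delay_index \<beta> n \<xi>) v - ?a n v \<partial>\<mu>\<bar>)"
      using n by (intro sum.cong refl) (simp add: pmf_step Bochner_Integration.integral_diff[OF integrable_attach] mu.prob_space)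
    also have "\<dots> \<le> (\<Sum>v<n. \<integral>\<xi>. \<bar>?a (delay_index \<beta> n \<xi>) v - ?a n v\<bar> \<partial>\<mu>)"
      by (intro sum_mono integral_abs_bound)
    also have "\<dots> = (\<integral>\<xi>. ?s \<xi> \<partial>\<mu>)"
      by (rule Bochner_Integration.integral_sum[symmetric]) (intro integrable_abs int)
    also have "\<dots> \<le> (\<integral>\<xi>. e / 2 + 2 * indicator B \<xi> \<partial>\<mu>)"
    proof (rule integral_mono_AE)
      show "integrable \<mu> ?s" by (intro Bochner_Integration.integrable_sum integrable_abs int)
      show "integrable \<mu> (\<lambda>\<xi>. e / 2 + 2 * indicator B \<xi>)" using B
        by (intro Bochner_Integration.integrable_add integrable_mult_right) (auto simp: mu.emeasure_finite less_top[symmetric])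
      show "AE \<xi> in \<mu>. ?s \<xi> \<le> e / 2 + 2 * indicator B \<xi>"
        using mu_nonneg AE_space by eventually_elim (rule ptw)
    qed
    also have "\<dots> = e / 2 + 2 * measure \<mu> B" using B
      by (subst Bochner_Integration.integral_add)
         (auto simp: mu.prob_space mu.emeasure_finite less_top[symmetric])
    also have "\<dots> \<le> e" using i unfolding B_def by simp
    finally show "(\<Sum>v<length p. \<bar>pmf (step_pmf \<beta> \<mu> f (length p) p) v - attach_prob f p (length p) v\<bar>) \<le> e"
      by (simp add: n_def)
  qed
qed

end

section \<open>Drift and convergence in mean\<close>

text \<open>Summing increments \<open>o(n)\<close> gives \<open>o(n^2)\<close>: from some index on,
  the increments are at most \<open>r / 2 * n\<close>, and the initial value is negligible after
  division by the square.\<close>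

lemma slow_growth_tendsto:
  fixes y \<eta> :: "nat \<Rightarrow> real"
  assumes rec: "\<And>n. n \<ge> m \<Longrightarrow> y (Suc n) \<le> y n + real n * \<eta> n" and \<eta>: "\<eta> \<longlonglongrightarrow> 0" and nn: "\<And>n. 0 \<le> y n"
  shows "(\<lambda>n. y n / (real n)\<^sup>2) \<longlonglongrightarrow> 0"
proof (rule LIMSEQ_I)
  fix r :: real assume r: "0 < r"
  have "eventually (\<lambda>n. \<eta> n < r / 2) sequentially" using \<eta> r by (intro order_tendstoD) auto
  then obtain N1 where N1: "\<And>n. n \<ge> N1 \<Longrightarrow> \<eta> n < r / 2" by (auto simp: eventually_sequentially)
  define N where "N = max m N1"
  have bd: "y n \<le> y N + r / 2 * real n * real (n - N)" if "N \<le> n" for n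
    using that
  proof (induction n rule: dec_induct)
    case (step n)
    have "y (Suc n) \<le> y n + real n * (r / 2)"
      using rec[of n] N1[of n] step(1) by (smt (verit) N_def max.bounded_iff mult_left_mono of_nat_0_le_iff)
    also have "\<dots> \<le> y N + r / 2 * real n * real (n - N) + real n * (r / 2)" using step.IH by simp
    also have "\<dots> = y N + r / 2 * (real n * real (Suc n - N))"
    proof -
      define d where "d = real (n - N)"
      have "real (Suc n - N) = d + 1" using step(1) by (simp add: Suc_diff_le d_def)
      then show ?thesis unfolding d_def[symmetric] by (simp only:) (simp add: field_simps)
    qed
    also have "\<dots> \<le> y N + r / 2 * (real (Suc n) * real (Suc n - N))"
      using r by (intro add_left_mono mult_left_mono mult_right_mono) auto
    finally show ?case by (simp add: mult.assoc)
  qed simp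
  have "(\<lambda>n. y N * (1 / real n) * (1 / real n)) \<longlonglongrightarrow> y N * 0 * 0"
    by (intro tendsto_mult tendsto_const lim_1_over_n)
  then have "eventually (\<lambda>n. y N * (1 / real n) * (1 / real n) < r / 2) sequentially"
    using r by (intro order_tendstoD) auto
  then obtain N2 where N2: "\<And>n. n \<ge> N2 \<Longrightarrow> y N * (1 / real n) * (1 / real n) < r / 2"
    by (auto simp: eventually_sequentially)
  show "\<exists>no. \<forall>n\<ge>no. norm (y n / (real n)\<^sup>2 - 0) < r"
  proof (intro exI[of _ "max (max N N2) 1"] allI impI)
    fix n assume n: "max (max N N2) 1 \<le> n"
    have "r / 2 * real n * real (n - N) \<le> r / 2 * real n * real n"
      using r by (intro mult_left_mono) auto
    then have "y n \<le> y N + r / 2 * (real n)\<^sup>2" using bd[of n] n by (simp add: power2_eq_square)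
    then have "y n / (real n)\<^sup>2 \<le> (y N + r / 2 * (real n)\<^sup>2) / (real n)\<^sup>2" by (rule divide_right_mono) simp
    also have "\<dots> = y N * (1 / real n) * (1 / real n) + r / 2" using n by (simp add: add_divide_distrib power2_eq_square)
    also have "\<dots> < r"
    proof -
      have "N2 \<le> n" using n by simp
      from N2[OF this] show ?thesis by linarith
    qed
    finally show "norm (y n / (real n)\<^sup>2 - 0) < r" using nn[of n] by simp
  qed
qed

section \<open>Expectations along the process and one-step inequalities\<close>

context delayed_attachment
begin

definition mean :: "nat \<Rightarrow> (nat list \<Rightarrow> real) \<Rightarrow> real" where
  "mean n X = measure_pmf.expectation (tree_pmf \<beta> \<mu> f n) X"

definition drift :: "nat list \<Rightarrow> (nat \<Rightarrow> real) \<Rightarrow> real" where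
  "drift p g = (\<Sum>v<length p. attach_prob f p (length p) v * g v)"

lemma vtree_append: "vtree p \<Longrightarrow> v < length p \<Longrightarrow> vtree (p @ [v])"
  by (auto simp: vtree_def nth_append less_Suc_eq)

lemma support_tree_pmf:
  "1 \<le> n \<Longrightarrow> p \<in> set_pmf (tree_pmf \<beta> \<mu> f n) \<Longrightarrow> vtree p \<and> length p = n"
proof (induction n arbitrary: p rule: less_induct)
  case (less n)
  consider "n = 1" | "n = 2" | k where "n = Suc (Suc (Suc k))"
    using less.prems(1) by (metis One_nat_def Suc_1 not0_implies_Suc not_one_le_zero)
  then show ?case
  proof cases
    case 3
    then obtain q v where q: "q \<in> set_pmf (tree_pmf \<beta> \<mu> f (Suc (Suc k)))" "p = q @ [v]"
      "v \<in> set_pmf (step_pmf \<beta> \<mu> f (Suc (Suc k)) q)" using less.prems by auto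
    have "vtree q" "length q = Suc (Suc k)" using less.IH[of "Suc (Suc k)" q] 3 q by auto
    moreover have "v < Suc (Suc k)" using set_pmf_step[of "Suc (Suc k)" q] q(3) by auto
    ultimately show ?thesis using vtree_append[of q v] q(2) 3 by auto
  qed (use less.prems in \<open>auto simp: vtree_def numeral_2_eq_2 less_Suc_eq\<close>)
qed

text \<open>Consequently every function is integrable under \<open>tree_pmf\<close>, and worst cases
  over the trees of a given size are maxima.\<close>

lemma finite_vtrees: "finite {p. vtree p \<and> length p = n}"
proof (rule finite_subset)
  show "{p. vtree p \<and> length p = n} \<subseteq> {p. set p \<subseteq> {..n} \<and> length p = n}"
    by (auto simp: vtree_def in_set_conv_nth) (metis gr0I le_less_trans less_imp_le nat_le_linear not_less)
  show "finite {p. set p \<subseteq> {..n} \<and> length p = n}" by (rule finite_lists_length_eq) simp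
qed

lemma finite_support: "1 \<le> n \<Longrightarrow> finite (set_pmf (tree_pmf \<beta> \<mu> f n))"
  by (rule finite_subset[OF _ finite_vtrees[of n]]) (use support_tree_pmf in blast)

lemma integrable_mean: "1 \<le> n \<Longrightarrow> integrable (measure_pmf (tree_pmf \<beta> \<mu> f n)) (X :: nat list \<Rightarrow> real)"
  by (rule integrable_measure_pmf_finite[OF finite_support])

lemma mean_mono:
  "1 \<le> n \<Longrightarrow> (\<And>p. vtree p \<Longrightarrow> length p = n \<Longrightarrow> X p \<le> Y p) \<Longrightarrow> mean n X \<le> mean n Y"
  unfolding mean_def
  by (rule integral_mono_AE) (use support_tree_pmf[of n] in \<open>auto simp: integrable_mean AE_measure_pmf_iff\<close>)

lemma mean_cong:
  "1 \<le> n \<Longrightarrow> (\<And>p. vtree p \<Longrightarrow> length p = n \<Longrightarrow> X p = Y p) \<Longrightarrow> mean n X = mean n Y"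
  by (rule antisym) (auto intro: mean_mono)

lemma mean_add: "1 \<le> n \<Longrightarrow> mean n (\<lambda>p. X p + Y p) = mean n X + mean n Y"
  unfolding mean_def by (rule Bochner_Integration.integral_add) (auto simp: integrable_mean)

lemma mean_diff: "1 \<le> n \<Longrightarrow> mean n (\<lambda>p. X p - Y p) = mean n X - mean n Y"
  unfolding mean_def by (rule Bochner_Integration.integral_diff) (auto simp: integrable_mean)

lemma mean_cmult: "mean n (\<lambda>p. c * X p) = c * mean n X"
  unfolding mean_def by simp

lemma mean_const [simp]: "mean n (\<lambda>p. c) = c"
  unfolding mean_def by simp

lemma mean_sum: "1 \<le> n \<Longrightarrow> mean n (\<lambda>p. \<Sum>i\<in>I. X i p) = (\<Sum>i\<in>I. mean n (X i))"
  unfolding mean_def by (rule Bochner_Integration.integral_sum) (simp add: integrable_mean)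

lemma mean_nonneg: "1 \<le> n \<Longrightarrow> (\<And>p. vtree p \<Longrightarrow> length p = n \<Longrightarrow> 0 \<le> X p) \<Longrightarrow> 0 \<le> mean n X"
  using mean_mono[of n "\<lambda>_. 0" X] by simp

lemma prob_le_mean:
  assumes "1 \<le> n" "\<And>p. vtree p \<Longrightarrow> length p = n \<Longrightarrow> 0 \<le> X p" "\<And>p. vtree p \<Longrightarrow> length p = n \<Longrightarrow> p \<in> S \<Longrightarrow> 1 \<le> X p"
  shows "measure_pmf.prob (tree_pmf \<beta> \<mu> f n) S \<le> mean n X"
proof -
  have "measure_pmf.prob (tree_pmf \<beta> \<mu> f n) S = mean n (indicator S)" by (simp add: mean_def)
  also have "\<dots> \<le> mean n X" by (rule mean_mono) (use assms in \<open>auto simp: indicator_def\<close>)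
  finally show ?thesis .
qed

lemma mean_Suc:
  assumes "2 \<le> n"
  shows "mean (Suc n) X = mean n (\<lambda>p. \<Sum>v<n. pmf (step_pmf \<beta> \<mu> f n p) v * X (p @ [v]))"
proof -
  define k where "k = n - 2"
  have k: "n = Suc (Suc k)" using assms by (simp add: k_def)
  let ?T = "tree_pmf \<beta> \<mu> f n"
  have T: "tree_pmf \<beta> \<mu> f (Suc n) = bind_pmf ?T (\<lambda>p. map_pmf (\<lambda>v. p @ [v]) (step_pmf \<beta> \<mu> f n p))"
    unfolding k by (rule tree_pmf.simps)
  have fin: "finite (set_pmf ?T)" using assms by (intro finite_support) simp
  have fs: "finite (set_pmf (step_pmf \<beta> \<mu> f n q))" for q
    using set_pmf_step[of n q] assms finite_subset by fastforce
  have "mean (Suc n) X = (\<Sum>q\<in>set_pmf ?T. pmf ?T q *\<^sub>R measure_pmf.expectation (map_pmf (\<lambda>v. q @ [v]) (step_pmf \<beta> \<mu> f n q)) X)"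
    unfolding mean_def T using fin fs
    by (subst pmf_expectation_bind[of "set_pmf ?T"]) auto
  also have "\<dots> = (\<Sum>q\<in>set_pmf ?T. pmf ?T q *\<^sub>R (\<Sum>v<n. pmf (step_pmf \<beta> \<mu> f n q) v * X (q @ [v])))"
  proof (intro sum.cong refl arg_cong2[where f = "(*\<^sub>R)"])
    fix q
    have "measure_pmf.expectation (step_pmf \<beta> \<mu> f n q) (\<lambda>v. X (q @ [v])) = (\<Sum>v<n. pmf (step_pmf \<beta> \<mu> f n q) v *\<^sub>R X (q @ [v]))"
      using set_pmf_step[of n q] assms by (intro integral_measure_pmf) auto
    then show "measure_pmf.expectation (map_pmf (\<lambda>v. q @ [v]) (step_pmf \<beta> \<mu> f n q)) X = (\<Sum>v<n. pmf (step_pmf \<beta> \<mu> f n q) v * X (q @ [v]))"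
      by simp
  qed
  also have "\<dots> = mean n (\<lambda>p. \<Sum>v<n. pmf (step_pmf \<beta> \<mu> f n p) v * X (p @ [v]))"
    unfolding mean_def by (rule integral_measure_pmf[OF fin, symmetric]) auto
  finally show ?thesis .
qed

text \<open>Largest distance between the delayed and the undelayed step law over the trees with
  \<open>n\<close> vertices. Being deterministic, it can be taken out of expectations.\<close>

definition delta :: "nat \<Rightarrow> real" where
  "delta n = Max (insert 0 ((\<lambda>p. \<Sum>v<length p. \<bar>pmf (step_pmf \<beta> \<mu> f (length p) p) v - attach_prob f p (length p) v\<bar>) ` {p. vtree p \<and> length p = n}))"

lemma delta_nonneg: "0 \<le> delta n"
  unfolding delta_def by (intro Max_ge) (auto intro: finite_imageI finite_vtrees)

lemma delta_ge:
  "vtree p \<Longrightarrow> (\<Sum>v<length p. \<bar>pmf (step_pmf \<beta> \<mu> f (length p) p) v - attach_prob f p (length p) v\<bar>) \<le> delta (length p)"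
  unfolding delta_def by (intro Max_ge) (auto intro: finite_imageI finite_vtrees)

lemma delta_tendsto: "delta \<longlonglongrightarrow> 0"
proof (rule LIMSEQ_I)
  fix r :: real assume r: "0 < r"
  obtain N where N: "\<And>p. vtree p \<Longrightarrow> N \<le> length p \<Longrightarrow>
    (\<Sum>v<length p. \<bar>pmf (step_pmf \<beta> \<mu> f (length p) p) v - attach_prob f p (length p) v\<bar>) \<le> r / 2"
    using step_close[of "r / 2"] r by auto
  have "delta n \<le> r / 2" if "n \<ge> N" for n
    unfolding delta_def using N that r by (subst Max_le_iff) (auto intro: finite_imageI finite_vtrees)
  then show "\<exists>no. \<forall>n\<ge>no. norm (delta n - 0) < r"
    using r delta_nonneg by (intro exI[of _ N]) (fastforce simp: abs_of_nonneg)
qed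

lemma drift_add: "drift p (\<lambda>v. g v + h v) = drift p g + drift p h"
  by (simp add: drift_def distrib_left sum.distrib)

lemma drift_cmult: "drift p (\<lambda>v. c * g v) = c * drift p g"
  by (simp add: drift_def sum_distrib_left mult.left_commute)

lemma drift_const: "vtree p \<Longrightarrow> drift p (\<lambda>v. c) = c"
  using sum_attach_prob[of "length p" "length p" p]
  by (simp add: drift_def sum_distrib_right[symmetric] vtree_def Suc_le_eq)

lemma drift_mono: "(\<And>v. v < length p \<Longrightarrow> g v \<le> h v) \<Longrightarrow> drift p g \<le> drift p h"
  unfolding drift_def by (intro sum_mono mult_left_mono attach_prob_nonneg) auto

lemma drift_wt: "drift p g = (\<Sum>v<length p. f (deg p (length p) v) * g v) / wt f p (length p)"
  unfolding drift_def sum_divide_distrib by (intro sum.cong) (auto simp: attach_prob_wt)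

text \<open>Replacing the true step law by the undelayed one costs at most the increment bound times
  the distance of the two laws.\<close>

lemma mean_Suc_le:
  assumes n: "2 \<le> n" and B: "0 \<le> B"
    and inc: "\<And>p v. vtree p \<Longrightarrow> length p = n \<Longrightarrow> v < n \<Longrightarrow> \<bar>X (p @ [v]) - X p\<bar> \<le> B"
  shows "mean (Suc n) X \<le> mean n (\<lambda>p. X p + drift p (\<lambda>v. X (p @ [v]) - X p)) + B * delta n"
proof -
  have "mean (Suc n) X = mean n (\<lambda>p. \<Sum>v<n. pmf (step_pmf \<beta> \<mu> f n p) v * X (p @ [v]))"
    by (rule mean_Suc[OF n])
  also have "\<dots> \<le> mean n (\<lambda>p. X p + drift p (\<lambda>v. X (p @ [v]) - X p) + B * delta n)"
  proof (rule mean_mono)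
    fix p assume p: "vtree p" "length p = n"
    let ?k = "\<lambda>v. pmf (step_pmf \<beta> \<mu> f n p) v" and ?a = "\<lambda>v. attach_prob f p n v"
    have "(\<Sum>v<n. ?k v * X (p @ [v])) = (\<Sum>v<n. ?k v * X p + (?a v * (X (p @ [v]) - X p) + (?k v - ?a v) * (X (p @ [v]) - X p)))"
      by (intro sum.cong) (auto simp: algebra_simps)
    also have "\<dots> = X p + drift p (\<lambda>v. X (p @ [v]) - X p) + (\<Sum>v<n. (?k v - ?a v) * (X (p @ [v]) - X p))"
      using sum_pmf_step[of n p] n p by (simp add: sum.distrib sum_distrib_right[symmetric] drift_def)
    also have "(\<Sum>v<n. (?k v - ?a v) * (X (p @ [v]) - X p)) \<le> (\<Sum>v<n. \<bar>?k v - ?a v\<bar> * B)"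
    proof (rule sum_mono)
      fix v assume "v \<in> {..<n}"
      then have "\<bar>?k v - ?a v\<bar> * \<bar>X (p @ [v]) - X p\<bar> \<le> \<bar>?k v - ?a v\<bar> * B"
        using inc[OF p] by (intro mult_left_mono) auto
      then show "(?k v - ?a v) * (X (p @ [v]) - X p) \<le> \<bar>?k v - ?a v\<bar> * B"
        by (metis abs_le_D1 abs_mult)
    qed
    also have "\<dots> \<le> delta n * B"
      using delta_ge[OF p(1)] p(2) B by (simp add: sum_distrib_right[symmetric] mult_right_mono)
    finally show "(\<Sum>v<n. ?k v * X (p @ [v])) \<le> X p + drift p (\<lambda>v. X (p @ [v]) - X p) + B * delta n"
      by (simp add: mult.commute)
  qed (use n in simp)
  also have "\<dots> = mean n (\<lambda>p. X p + drift p (\<lambda>v. X (p @ [v]) - X p)) + B * delta n"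
    using n by (simp add: mean_add)
  finally show ?thesis .
qed

lemma mean_abs_tendsto:
  assumes "(\<lambda>n. mean n (\<lambda>p. (Z p)\<^sup>2)) \<longlonglongrightarrow> 0"
  shows "(\<lambda>n. mean n (\<lambda>p. \<bar>Z p\<bar>)) \<longlonglongrightarrow> 0"
proof (rule LIMSEQ_I)
  fix r :: real assume r: "0 < r"
  have "eventually (\<lambda>n. mean n (\<lambda>p. (Z p)\<^sup>2) < (r / 2) * (r / 2)) sequentially"
    using assms r by (intro order_tendstoD) auto
  then obtain N where N: "\<And>n. n \<ge> N \<Longrightarrow> mean n (\<lambda>p. (Z p)\<^sup>2) < (r / 2) * (r / 2)" by (auto simp: eventually_sequentially)
  show "\<exists>no. \<forall>n\<ge>no. norm (mean n (\<lambda>p. \<bar>Z p\<bar>) - 0) < r"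
  proof (intro exI[of _ "max N 1"] allI impI)
    fix n assume n: "max N 1 \<le> n"
    have "mean n (\<lambda>p. \<bar>Z p\<bar>) \<le> mean n (\<lambda>p. r / 2 + (2 / r) * (Z p)\<^sup>2)"
    proof (rule mean_mono)
      fix p
      have "2 * \<bar>Z p\<bar> * (r / 2) \<le> \<bar>Z p\<bar>\<^sup>2 + (r / 2)\<^sup>2" by (rule sum_squares_bound)
      moreover have "0 \<le> \<bar>Z p\<bar> * (r / 2)" using r by simp
      ultimately have "\<bar>Z p\<bar> * (r / 2) \<le> (r / 2)\<^sup>2 + (Z p)\<^sup>2" unfolding power2_abs by linarith
      then show "\<bar>Z p\<bar> \<le> r / 2 + 2 / r * (Z p)\<^sup>2" using r by (simp add: field_simps power2_eq_square)
    qed (use n in simp)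
    also have "\<dots> = r / 2 + (2 / r) * mean n (\<lambda>p. (Z p)\<^sup>2)"
    proof -
      have "1 \<le> n" using n by simp
      then show ?thesis by (simp only: mean_add mean_const mean_cmult)
    qed
    also have "\<dots> < r / 2 + (2 / r) * ((r / 2) * (r / 2))"
      using N[of n] n r by (intro add_strict_left_mono mult_strict_left_mono) auto
    also have "\<dots> = r" using r by (simp add: field_simps)
    finally show "norm (mean n (\<lambda>p. \<bar>Z p\<bar>) - 0) < r" using mean_nonneg[of n "\<lambda>p. \<bar>Z p\<bar>"] n by simp
  qed
qed

text \<open>\<open>D = X - x n\<close> has conditional drift \<open>- c D / n\<close> up to an error that is small in mean, hence
  \<open>E D\<^sup>2\<close> grows by only \<open>o(n)\<close> per step.\<close>
lemma L2_convergence: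
  fixes X :: "nat list \<Rightarrow> real"
  assumes c: "0 \<le> c" and B: "0 \<le> B"
    and inc: "\<And>p v. vtree p \<Longrightarrow> v < length p \<Longrightarrow> \<bar>X (p @ [v]) - X p\<bar> \<le> B"
    and bnd: "\<And>p. vtree p \<Longrightarrow> \<bar>X p\<bar> \<le> B * real (length p)"
    and err: "(\<lambda>n. mean n (\<lambda>p. \<bar>drift p (\<lambda>v. X (p @ [v]) - X p) - (x - c * (X p / real (length p) - x))\<bar>)) \<longlonglongrightarrow> 0"
  shows "(\<lambda>n. mean n (\<lambda>p. (X p / real (length p) - x)\<^sup>2)) \<longlonglongrightarrow> 0"
proof -
  define D where "D p = X p - x * real (length p)" for p
  define r where "r p = drift p (\<lambda>v. X (p @ [v]) - X p) - (x - c * (X p / real (length p) - x))" for p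
  define K where "K = B + \<bar>x\<bar>"
  have K: "0 \<le> K" using B by (simp add: K_def)
  have Dinc: "\<bar>D (p @ [v]) - D p\<bar> \<le> K" if "vtree p" "v < length p" for p v
    using inc[OF that] by (auto simp: D_def K_def algebra_simps)
  have Dbnd: "\<bar>D p\<bar> \<le> K * real (length p)" if "vtree p" for p
  proof -
    have "\<bar>D p\<bar> \<le> \<bar>X p\<bar> + \<bar>x\<bar> * real (length p)"
      unfolding D_def by (rule order_trans[OF abs_triangle_ineq4]) (simp add: abs_mult)
    then show ?thesis using bnd[OF that] by (simp add: K_def distrib_right)
  qed
  \<comment> \<open>The three sources of growth of the second moment: the drift error times
    \<open>D\<close>, the squared increment, and the delay.\<close>
  define \<eta> where "\<eta> n = 2 * K * mean n (\<lambda>p. \<bar>r p\<bar>) + K * K * (1 / real n) + 3 * K * K * delta n" for n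
  have \<eta>: "\<eta> \<longlonglongrightarrow> 0"
  proof -
    have "\<eta> \<longlonglongrightarrow> 2 * K * 0 + K * K * 0 + 3 * K * K * 0"
      unfolding \<eta>_def r_def by (intro tendsto_add tendsto_mult tendsto_const err lim_1_over_n delta_tendsto)
    then show ?thesis by simp
  qed
  have "(\<lambda>n. (mean n (\<lambda>p. (D p)\<^sup>2)) / (real n)\<^sup>2) \<longlonglongrightarrow> 0"
  proof (rule slow_growth_tendsto[where m = 2, OF _ \<eta>])
    fix n :: nat assume n: "2 \<le> n"
    have sq: "(D (p @ [v]))\<^sup>2 - (D p)\<^sup>2 = 2 * D p * (D (p @ [v]) - D p) + (D (p @ [v]) - D p)\<^sup>2" for p v
      by (simp add: power2_eq_square algebra_simps)
    have "mean (Suc n) (\<lambda>p. (D p)\<^sup>2) \<le> mean n (\<lambda>p. (D p)\<^sup>2 + drift p (\<lambda>v. (D (p @ [v]))\<^sup>2 - (D p)\<^sup>2)) + (3 * K * K * real n) * delta n"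
    proof (rule mean_Suc_le[OF n])
      fix p v assume p: "vtree p" "length p = n" "v < n"
      have i: "\<bar>D (p @ [v]) - D p\<bar> \<le> K" using Dinc p by simp
      have "\<bar>(D (p @ [v]))\<^sup>2 - (D p)\<^sup>2\<bar> \<le> 2 * \<bar>D p\<bar> * \<bar>D (p @ [v]) - D p\<bar> + \<bar>D (p @ [v]) - D p\<bar> * \<bar>D (p @ [v]) - D p\<bar>"
        unfolding sq by (rule order_trans[OF abs_triangle_ineq]) (simp add: abs_mult power2_eq_square)
      also have "\<dots> \<le> 2 * (K * real n) * K + K * K"
        using i Dbnd[OF p(1)] p(2) K by (intro add_mono mult_mono) auto
      also have "\<dots> \<le> 2 * (K * real n) * K + K * K * real n"
        using n K mult_left_mono[of 1 "real n" "K * K"] by simp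
      finally show "\<bar>(D (p @ [v]))\<^sup>2 - (D p)\<^sup>2\<bar> \<le> 3 * K * K * real n" by (simp add: algebra_simps)
    qed (use K in simp)
    also have "mean n (\<lambda>p. (D p)\<^sup>2 + drift p (\<lambda>v. (D (p @ [v]))\<^sup>2 - (D p)\<^sup>2)) \<le> mean n (\<lambda>p. (D p)\<^sup>2 + (2 * K * real n * \<bar>r p\<bar> + K * K))"
    proof (rule mean_mono)
      fix p assume p: "vtree p" "length p = n"
      have "drift p (\<lambda>v. (D (p @ [v]))\<^sup>2 - (D p)\<^sup>2) \<le> drift p (\<lambda>v. 2 * D p * ((X (p @ [v]) - X p) + - x) + K * K)"
      proof (rule drift_mono)
        fix v assume v: "v < length p"
        have "(D (p @ [v]) - D p)\<^sup>2 \<le> K * K"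
          using Dinc[OF p(1) v] K by (simp add: abs_le_square_iff[symmetric] power2_eq_square[symmetric])
        moreover have "D (p @ [v]) - D p = (X (p @ [v]) - X p) + - x" by (simp add: D_def algebra_simps)
        ultimately show "(D (p @ [v]))\<^sup>2 - (D p)\<^sup>2 \<le> 2 * D p * ((X (p @ [v]) - X p) + - x) + K * K" unfolding sq by simp
      qed
      also have "\<dots> = 2 * D p * (drift p (\<lambda>v. X (p @ [v]) - X p) - x) + K * K"
        unfolding drift_add[of p "\<lambda>v. 2 * D p * ((X (p @ [v]) - X p) + - x)"] drift_cmult
        unfolding drift_add[of p "\<lambda>v. X (p @ [v]) - X p"] drift_const[OF p(1)] by simp
      also have "drift p (\<lambda>v. X (p @ [v]) - X p) - x = r p - c * (D p / real n)"
        using p n by (simp add: r_def D_def diff_divide_distrib)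
      \<comment> \<open>The restoring part of the drift has a favourable sign and is dropped; no
        rate of convergence is sought.\<close>
      also have "2 * D p * (r p - c * (D p / real n)) \<le> 2 * D p * r p"
      proof -
        have "0 \<le> c * (D p * D p / real n)" using c by simp
        moreover have "2 * D p * (r p - c * (D p / real n)) = 2 * D p * r p - 2 * (c * (D p * D p / real n))"
          by (simp add: algebra_simps)
        ultimately show ?thesis by linarith
      qed
      also have "2 * D p * r p \<le> 2 * K * real n * \<bar>r p\<bar>"
      proof -
        have "2 * D p * r p \<le> 2 * (\<bar>D p\<bar> * \<bar>r p\<bar>)" by (metis abs_ge_self abs_mult mult.assoc mult_le_cancel_left_pos zero_less_numeral)
        also have "\<dots> \<le> 2 * ((K * real n) * \<bar>r p\<bar>)"
          using Dbnd[OF p(1)] p(2) by (intro mult_left_mono mult_right_mono) auto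
        finally show ?thesis by simp
      qed
      finally show "(D p)\<^sup>2 + drift p (\<lambda>v. (D (p @ [v]))\<^sup>2 - (D p)\<^sup>2) \<le> (D p)\<^sup>2 + (2 * K * real n * \<bar>r p\<bar> + K * K)" by simp
    qed (use n in simp)
    also have "\<dots> = mean n (\<lambda>p. (D p)\<^sup>2) + (2 * K * real n * mean n (\<lambda>p. \<bar>r p\<bar>) + K * K)"
    proof -
      have "1 \<le> n" using n by simp
      then show ?thesis by (simp only: mean_add mean_const mean_cmult)
    qed
    finally show "mean (Suc n) (\<lambda>p. (D p)\<^sup>2) \<le> mean n (\<lambda>p. (D p)\<^sup>2) + real n * \<eta> n"
      using n by (simp add: \<eta>_def algebra_simps)
  next
    show "0 \<le> mean n (\<lambda>p. (D p)\<^sup>2)" for n unfolding mean_def by simp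
  qed
  moreover have "eventually (\<lambda>n. mean n (\<lambda>p. (D p)\<^sup>2) / (real n)\<^sup>2 = mean n (\<lambda>p. (X p / real (length p) - x)\<^sup>2)) sequentially"
    using eventually_ge_at_top[of 1]
  proof eventually_elim
    case (elim n)
    have "mean n (\<lambda>p. (X p / real (length p) - x)\<^sup>2) = mean n (\<lambda>p. (1 / (real n)\<^sup>2) * (D p)\<^sup>2)"
    proof (rule mean_cong[OF elim])
      fix p :: "nat list" assume "length p = n"
      then have "X p / real (length p) - x = D p / real n" using elim by (simp add: D_def field_simps)
      then show "(X p / real (length p) - x)\<^sup>2 = (1 / (real n)\<^sup>2) * (D p)\<^sup>2" by (simp add: power_divide)
    qed
    then show ?case by (simp only: mean_cmult) simp
  qed
  ultimately show ?thesis by (rule Lim_transform_eventually)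
qed

lemma cnt_le: "real (cnt p t) \<le> real (length p)"
proof -
  have "cnt p t \<le> card {..<length p}" unfolding cnt_def by (intro card_mono) auto
  then show ?thesis by simp
qed

text \<open>Induction on the size of \<open>t\<close>: the drift of its count involves the counts of
  smaller trees, which already converge, and its own count with a nonpositive coefficient. The
  recursion states that \<open>\<pi> t\<close> is the value at which drift and density agree, so
  \<open>L2_convergence\<close> applies.\<close>

theorem fringe_convergence:
  assumes lam: "0 < lam"
    and wt: "(\<lambda>n. mean n (\<lambda>p. \<bar>wt f p (length p) / real (length p) - lam\<bar>)) \<longlonglongrightarrow> 0"
    and rec: "\<And>t. (lam + tot_rate f t) * \<pi> t = (if t = leaf then lam else 0) + (\<Sum>s\<in>{s. tsize s < tsize t}. \<pi> s * rate f s t)"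
  shows "(\<lambda>n. mean n (\<lambda>p. \<bar>real (cnt p t) / real (length p) - \<pi> t\<bar>)) \<longlonglongrightarrow> 0"
proof (induction "tsize t" arbitrary: t rule: less_induct)
  case less
  let ?T = "{s. tsize s < tsize t}"
  define R where "R = tot_rate f t"
  have R: "0 \<le> R" unfolding R_def tot_rate_def
  proof -
    have "0 \<le> sum_mset M" if "\<And>x. x \<in># M \<Longrightarrow> 0 \<le> x" for M :: "real multiset"
      using that by (induction M) auto
    moreover have "0 \<le> y" if "y \<in># image_mset (\<lambda>(d, s). f d) (grow t)" for y
    proof -
    from that obtain d s where ds: "(d, s) \<in># grow t" "y = f d" by auto
    have "1 \<le> d" using ds(1)
    proof (induction t arbitrary: d s)
      case (Node M)
      then consider "d = Suc (size M)" | c c' where "c \<in># M" "(d, c') \<in># grow c" by auto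
      then show ?case using Node.IH by cases auto
    qed
    then show "0 \<le> y" using f_pos ds by (simp add: less_imp_le)
    qed
    ultimately show "0 \<le> sum_mset (image_mset (\<lambda>(d, s). f d) (grow t))" by blast
  qed
  let ?w = "\<lambda>p. \<bar>wt f p (length p) / real (length p) - lam\<bar>"
  \<comment> \<open>Bound for the drift error: replacing the weight by \<open>lam * n\<close> costs
    \<open>?w p / (lam * fs)\<close> per count, as a count divided by the weight is at most
    \<open>1 / fs\<close>; the remaining terms are covered by the induction hypothesis.\<close>
  define G where "G p = (\<Sum>s\<in>?T. \<bar>rate f s t\<bar> * (?w p / (lam * fs) + \<bar>real (cnt p s) / real (length p) - \<pi> s\<bar> / lam)) + R * (?w p / (lam * fs))" for p
  have "(\<lambda>n. mean n (\<lambda>p. (real (cnt p t) / real (length p) - \<pi> t)\<^sup>2)) \<longlonglongrightarrow> 0"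
  proof (rule L2_convergence[where B = "1 + real (tsize t)" and c = "R / lam"])
    show "\<bar>real (cnt (p @ [v]) t) - real (cnt p t)\<bar> \<le> 1 + real (tsize t)" if "v < length p" for p v
      using cnt_append_bound[OF that] .
    show "\<bar>real (cnt p t)\<bar> \<le> (1 + real (tsize t)) * real (length p)" for p
      using cnt_le[of p t] by (simp add: algebra_simps add_increasing2)
    let ?err = "\<lambda>p. \<bar>drift p (\<lambda>v. real (cnt (p @ [v]) t) - real (cnt p t)) - (\<pi> t - R / lam * (real (cnt p t) / real (length p) - \<pi> t))\<bar>"
    have err: "?err p \<le> G p" if p: "vtree p" for p
    proof -
      define n where "n = real (length p)"
      define W where "W = wt f p (length p)"
      have n: "0 < n" using p by (simp add: n_def vtree_def)
      have Wf: "fs * n \<le> W" unfolding W_def n_def by (rule wt_ge)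
      have W: "0 < W" using Wf n fs by (smt (verit) mult_pos_pos)
      have key: "\<bar>real (cnt p s) / W - real (cnt p s) / n / lam\<bar> \<le> ?w p / (lam * fs)" for s
      proof -
        have "real (cnt p s) / W - real (cnt p s) / n / lam = real (cnt p s) / W * ((lam - W / n) / lam)"
          using n W lam by (simp add: field_simps)
        also have "\<bar>\<dots>\<bar> = real (cnt p s) / W * (\<bar>W / n - lam\<bar> / lam)"
          using W lam by (simp add: abs_mult abs_minus_commute)
        also have "\<dots> \<le> (1 / fs) * (\<bar>W / n - lam\<bar> / lam)"
        proof (rule mult_right_mono)
          have "real (cnt p s) * fs \<le> W" using cnt_le[of p s] Wf fs(1) unfolding n_def by (smt (verit) mult.commute mult_left_mono)
          then show "real (cnt p s) / W \<le> 1 / fs" using W fs(1) by (simp add: field_simps)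
        qed (use lam in simp)
        finally show ?thesis by (simp add: W_def n_def mult.commute)
      qed
      have dr: "drift p (\<lambda>v. real (cnt (p @ [v]) t) - real (cnt p t))
        = (if t = leaf then 1 else 0) + (\<Sum>s\<in>?T. rate f s t * (real (cnt p s) / W)) - R * (real (cnt p t) / W)"
        unfolding drift_wt drift_fringe W_def[symmetric] R_def wt_def[symmetric] using W
        by (simp add: add_divide_distrib diff_divide_distrib sum_divide_distrib mult_ac wt_def[symmetric] W_def[symmetric])
      \<comment> \<open>The recursion for \<open>\<pi>\<close> divided by \<open>lam\<close>,
        written in the form of the drift with the weight replaced by \<open>lam * n\<close>.\<close>
      have x: "\<pi> t - R / lam * (real (cnt p t) / n - \<pi> t)
        = (if t = leaf then 1 else 0) + (\<Sum>s\<in>?T. rate f s t * (\<pi> s / lam)) - R * (real (cnt p t) / n / lam)"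
      proof -
        have "\<pi> t + R / lam * \<pi> t = (lam + R) * \<pi> t / lam" using lam by (simp add: field_simps)
        also have "\<dots> = (if t = leaf then 1 else 0) + (\<Sum>s\<in>?T. rate f s t * (\<pi> s / lam))"
          unfolding R_def rec[of t] using lam by (simp add: add_divide_distrib sum_divide_distrib mult_ac)
        finally show ?thesis by (simp add: algebra_simps)
      qed
      have "?err p = \<bar>(\<Sum>s\<in>?T. rate f s t * (real (cnt p s) / W - \<pi> s / lam)) - R * (real (cnt p t) / W - real (cnt p t) / n / lam)\<bar>"
        unfolding dr n_def[symmetric] x by (simp add: sum_subtractf right_diff_distrib)
      also have "\<dots> \<le> (\<Sum>s\<in>?T. \<bar>rate f s t\<bar> * \<bar>real (cnt p s) / W - \<pi> s / lam\<bar>) + R * \<bar>real (cnt p t) / W - real (cnt p t) / n / lam\<bar>"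
        using R by (intro order_trans[OF abs_triangle_ineq4] add_mono order_trans[OF sum_abs]) (auto simp: abs_mult)
      also have "\<dots> \<le> G p"
        unfolding G_def
      proof (intro add_mono sum_mono mult_left_mono key R)
        fix s
        have "\<bar>real (cnt p s) / W - \<pi> s / lam\<bar> \<le> \<bar>real (cnt p s) / W - real (cnt p s) / n / lam\<bar> + \<bar>real (cnt p s) / n / lam - \<pi> s / lam\<bar>"
          by linarith
        also have "real (cnt p s) / n / lam - \<pi> s / lam = (real (cnt p s) / n - \<pi> s) / lam"
          by (simp only: diff_divide_distrib)
        also have "\<bar>\<dots>\<bar> = \<bar>real (cnt p s) / n - \<pi> s\<bar> / lam" using lam by (simp only: abs_divide abs_of_pos)
        finally show "\<bar>real (cnt p s) / W - \<pi> s / lam\<bar> \<le> ?w p / (lam * fs) + \<bar>real (cnt p s) / real (length p) - \<pi> s\<bar> / lam"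
          using key[of s] by (simp add: n_def)
      qed simp
      finally show ?thesis .
    qed
    have G: "(\<lambda>n. mean n G) \<longlonglongrightarrow> 0"
    proof -
      have "(\<lambda>n. (\<Sum>s\<in>?T. \<bar>rate f s t\<bar> * (mean n ?w * (1 / (lam * fs)) + mean n (\<lambda>p. \<bar>real (cnt p s) / real (length p) - \<pi> s\<bar>) * (1 / lam))) + R * (mean n ?w * (1 / (lam * fs))))
        \<longlonglongrightarrow> (\<Sum>s\<in>?T. \<bar>rate f s t\<bar> * (0 * (1 / (lam * fs)) + 0 * (1 / lam))) + R * (0 * (1 / (lam * fs)))"
        by (intro tendsto_add tendsto_sum tendsto_mult tendsto_const wt less) auto
      moreover have "eventually (\<lambda>n. (\<Sum>s\<in>?T. \<bar>rate f s t\<bar> * (mean n ?w * (1 / (lam * fs)) + mean n (\<lambda>p. \<bar>real (cnt p s) / real (length p) - \<pi> s\<bar>) * (1 / lam))) + R * (mean n ?w * (1 / (lam * fs))) = mean n G) sequentially"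
        using eventually_ge_at_top[of 1]
      proof eventually_elim
        case (elim n)
        have div: "mean n (\<lambda>p. X p / c) = mean n X * (1 / c)" for X :: "nat list \<Rightarrow> real" and c
          unfolding mean_def by simp
        show ?case unfolding G_def by (simp only: mean_add[OF elim] mean_sum[OF elim] mean_cmult div)
      qed
      ultimately show ?thesis by (auto intro: Lim_transform_eventually)
    qed
    show "(\<lambda>n. mean n ?err) \<longlonglongrightarrow> 0"
    proof (rule tendsto_sandwich[OF _ _ tendsto_const G])
      show "eventually (\<lambda>n. 0 \<le> mean n ?err) sequentially" unfolding mean_def by simp
      show "eventually (\<lambda>n. mean n ?err \<le> mean n G) sequentially"
        using eventually_ge_at_top[of 1] by eventually_elim (intro mean_mono err)
    qed
  qed (use R lam in auto)
  then show ?case by (rule mean_abs_tendsto)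
qed

end

section \<open>The Malthusian parameter\<close>

text \<open>Probability that an individual has at least \<open>k\<close> children before an
  independent exponential time of rate \<open>lam\<close>. Hence \<open>rho_hat\<close> is its
  expected number of children at that time.\<close>

definition survival :: "(nat \<Rightarrow> real) \<Rightarrow> real \<Rightarrow> nat \<Rightarrow> real" where
  "survival f lam k = (\<Prod>i\<in>{1..k}. f i / (lam + f i))"

lemma survival_0 [simp]: "survival f lam 0 = 1"
  by (simp add: survival_def)

lemma survival_Suc: "survival f lam (Suc k) = survival f lam k * (f (Suc k) / (lam + f (Suc k)))"
  by (simp add: survival_def atLeastAtMostSuc_conv mult.commute)

lemma rho_hat_survival: "rho_hat f lam = (\<Sum>k. ennreal (survival f lam (Suc k)))"
  by (simp add: rho_hat_def survival_def)

context
  fixes f :: "nat \<Rightarrow> real"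
  assumes f_pos: "\<And>k. 1 \<le> k \<Longrightarrow> 0 < f k"
begin

lemma survival_pos: "0 \<le> lam \<Longrightarrow> 0 < survival f lam k"
proof (induction k)
  case (Suc k)
  have "0 < f (Suc k)" by (rule f_pos) simp
  then show ?case using Suc by (simp add: survival_Suc)
qed simp

lemma survival_antimono: "0 \<le> a \<Longrightarrow> a \<le> b \<Longrightarrow> survival f b k \<le> survival f a k"
proof (induction k)
  case (Suc k)
  have f: "0 < f (Suc k)" by (rule f_pos) simp
  have "f (Suc k) / (b + f (Suc k)) \<le> f (Suc k) / (a + f (Suc k))"
    using f Suc.prems by (intro divide_left_mono) auto
  then show ?case using Suc f survival_pos[of a k]
    unfolding survival_Suc by (intro mult_mono) (auto intro: divide_nonneg_nonneg)
qed simp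

text \<open>Only the first factor is kept exactly; it suffices to make the whole series small as
  \<open>b\<close> grows.\<close>

lemma survival_first_factor:
  assumes "0 < a" "a \<le> b"
  shows "survival f b (Suc k) \<le> survival f a (Suc k) * ((a + f 1) / (b + f 1))"
proof (induction k)
  case 0
  have "0 < f 1" by (rule f_pos) simp
  then show ?case using assms by (simp add: survival_Suc)
next
  case (Suc k)
  have f: "0 < f (Suc (Suc k))" and f1: "0 < f 1" by (rule f_pos, simp)+
  have "f (Suc (Suc k)) / (b + f (Suc (Suc k))) \<le> f (Suc (Suc k)) / (a + f (Suc (Suc k)))"
    using f assms by (intro divide_left_mono) auto
  then have "survival f b (Suc k) * (f (Suc (Suc k)) / (b + f (Suc (Suc k))))
    \<le> (survival f a (Suc k) * ((a + f 1) / (b + f 1))) * (f (Suc (Suc k)) / (a + f (Suc (Suc k))))"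
    using Suc f f1 assms survival_pos[of a "Suc k"] by (intro mult_mono) (auto intro: divide_nonneg_nonneg mult_nonneg_nonneg)
  then show ?case unfolding survival_Suc[of f _ "Suc k"] by (simp add: mult_ac)
qed

lemma rho_hat_eq_suminf:
  assumes "0 < lam" "summable (\<lambda>k. survival f lam (Suc k))"
  shows "rho_hat f lam = ennreal (\<Sum>k. survival f lam (Suc k))"
  unfolding rho_hat_survival using assms survival_pos[of lam]
  by (intro suminf_ennreal_eq summable_sums) (auto intro: less_imp_le)

lemma summable_survival:
  assumes "0 < lam" "rho_hat f lam < \<top>"
  shows "summable (\<lambda>k. survival f lam (Suc k))"
  using assms survival_pos[of lam] unfolding rho_hat_survival
  by (intro summable_suminf_not_top) (auto intro: less_imp_le)

lemma rho_hat_eq_1_iff: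
  assumes "0 < lam"
  shows "rho_hat f lam = 1 \<longleftrightarrow> (\<lambda>k. survival f lam (Suc k)) sums 1"
proof
  assume r: "rho_hat f lam = 1"
  then have s: "summable (\<lambda>k. survival f lam (Suc k))" using assms by (intro summable_survival) auto
  then have "ennreal (\<Sum>k. survival f lam (Suc k)) = 1" using rho_hat_eq_suminf[OF assms s] r by simp
  then show "(\<lambda>k. survival f lam (Suc k)) sums 1" using s by (simp add: sums_iff)
next
  assume "(\<lambda>k. survival f lam (Suc k)) sums 1"
  then show "rho_hat f lam = 1" using rho_hat_eq_suminf[OF assms] by (simp add: sums_iff)
qed

lemma rho_hat_1_unique:
  assumes "0 < a" "rho_hat f a = 1" "0 < b" "rho_hat f b = 1" shows "a = b"
proof -
  have *: False if ab: "0 < a" "a < b" and s: "(\<lambda>k. survival f a (Suc k)) sums 1" "(\<lambda>k. survival f b (Suc k)) sums 1" for a b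
  proof -
    have d: "(\<lambda>k. survival f a (Suc k) - survival f b (Suc k)) sums (1 - 1)" using s by (rule sums_diff)
    have nn: "0 \<le> survival f a (Suc k) - survival f b (Suc k)" for k
      using survival_antimono[of a b "Suc k"] ab by simp
    have "survival f a 1 - survival f b 1 \<le> 0"
      using sum_le_suminf[of _ "{0}", OF sums_summable[OF d]] nn d by (simp add: sums_iff)
    moreover have "0 < f 1" by (rule f_pos) simp
    then have "survival f b 1 < survival f a 1" using ab
      unfolding One_nat_def survival_Suc by (simp add: divide_strict_left_mono)
    ultimately show False by simp
  qed
  show ?thesis using assms *[of a b] *[of b a] by (cases a b rule: linorder_cases) (auto simp: rho_hat_eq_1_iff)
qed

lemma lambda_star_eqI: "0 < lam \<Longrightarrow> rho_hat f lam = 1 \<Longrightarrow> lambda_star f = lam"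
  unfolding lambda_star_def by (rule the_equality) (auto intro: rho_hat_1_unique)

lemma continuous_on_survival: "0 < a \<Longrightarrow> continuous_on {a..} (\<lambda>x. survival f x k)"
  unfolding survival_def using f_pos
  by (intro continuous_on_prod continuous_on_divide continuous_intros) (auto simp: add_pos_pos order_less_imp_not_eq2)

text \<open>Intermediate value theorem for the series, which is continuous because it is dominated
  uniformly by its terms at a fixed smaller parameter. The Malthusian parameter is defined by
  \<open>THE\<close>, so existence has to be proved.\<close>

lemma lambda_star_exists:
  assumes ne: "{lam. 0 < lam \<and> rho_hat f lam < \<top>} \<noteq> {}"
    and lim: "(rho_hat f \<longlongrightarrow> L) (at_right (lambda_low f))" "L > 1"
  shows "0 < lambda_star f \<and> rho_hat f (lambda_star f) = 1"
proof -
  let ?A = "{lam. 0 < lam \<and> rho_hat f lam < \<top>}"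
  have "eventually (\<lambda>x. rho_hat f x > 1) (at_right (lambda_low f))"
    using lim by (rule order_tendstoD)
  then obtain b where b: "lambda_low f < b" "\<And>y. lambda_low f < y \<Longrightarrow> y < b \<Longrightarrow> 1 < rho_hat f y"
    unfolding eventually_at_right_field by blast
  define c where "c = (lambda_low f + b) / 2"
  have c: "lambda_low f < c" "1 < rho_hat f c" using b by (auto simp: c_def)
  \<comment> \<open>A parameter below \<open>c\<close> with a finite series, available since
    \<open>c\<close> exceeds the infimum; its terms serve as the dominating sequence.\<close>
  have "\<exists>a\<in>?A. a < c" using c(1) ne unfolding lambda_low_def
    by (intro cInf_lessD) auto
  then obtain a where a: "0 < a" "rho_hat f a < \<top>" "a < c" by auto
  have sa: "summable (\<lambda>k. survival f a (Suc k))" using a by (intro summable_survival)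
  define R where "R x = (\<Sum>k. survival f x (Suc k))" for x
  have bound: "norm (survival f x (Suc k)) \<le> survival f a (Suc k)" if "a \<le> x" for x k
    using survival_antimono[of a x "Suc k"] survival_pos[of x "Suc k"] a that by simp
  have sx: "summable (\<lambda>k. survival f x (Suc k))" if "a \<le> x" for x
    by (rule summable_comparison_test'[OF sa]) (rule bound[OF that])
  have "uniform_limit {a..} (\<lambda>n x. \<Sum>k<n. survival f x (Suc k)) R sequentially"
    unfolding R_def by (rule Weierstrass_m_test[OF _ sa]) (rule bound, simp)
  then have cont: "continuous_on {a..} R"
    by (rule uniform_limit_theorem[rotated]) (auto intro!: always_eventually continuous_on_sum continuous_on_survival a)
  have Rc: "1 < R c"
    using c(2) a rho_hat_eq_suminf[of c] sx[of c] unfolding R_def by simp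
  \<comment> \<open>Chosen such that the bound from \<open>survival_first_factor\<close>,
    \<open>R a * (a + f 1) / (d + f 1)\<close>, is at most 1.\<close>
  define d where "d = max c (R a * (a + f 1))"
  have f1: "0 < f 1" by (rule f_pos) simp
  have Rd: "R d \<le> 1"
  proof -
    have ad: "a \<le> d" using a by (simp add: d_def)
    have "R d \<le> (\<Sum>k. survival f a (Suc k) * ((a + f 1) / (d + f 1)))"
      unfolding R_def using ad a by (intro suminf_le survival_first_factor sx summable_mult2 sa) auto
    also have "\<dots> = R a * (a + f 1) / (d + f 1)"
      unfolding R_def using suminf_mult2[OF sa, of "(a + f 1) / (d + f 1)"] by (simp only: times_divide_eq_right)
    also have "\<dots> \<le> 1" using ad a f1 by (simp add: d_def)
    finally show ?thesis .
  qed
  have "\<exists>x. c \<le> x \<and> x \<le> d \<and> R x = 1"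
    using Rc Rd a by (intro IVT2' continuous_on_subset[OF cont]) (auto simp: d_def)
  then obtain x where x: "c \<le> x" "R x = 1" by blast
  then have "rho_hat f x = 1" "0 < x"
    using a rho_hat_eq_suminf[of x] sx[of x] unfolding R_def by auto
  then show ?thesis using lambda_star_eqI by metis
qed

end

text \<open>For affine \<open>f\<close> the series telescopes, up to the limit of the telescoping
  sequence; a positive limit would make the terms comparable to the harmonic series.\<close>

lemma rho_hat_linear:
  assumes \<alpha>: "-1 < \<alpha>" and f: "\<And>k. 1 \<le> k \<Longrightarrow> f k = real k + \<alpha>"
  shows "rho_hat f (2 + \<alpha>) = 1"
proof -
  have pos: "0 < f k" if "1 \<le> k" for k using f[OF that] \<alpha> that by simp
  define r where "r k = survival f (2 + \<alpha>) k" for k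
  \<comment> \<open>\<open>q k\<close> is \<open>r k * f (k + 1)\<close>, and
    \<open>q k - q (Suc k)\<close> is \<open>(1 + \<alpha>) * r (Suc k)\<close>.\<close>
  define q where "q k = r k * (real k + 1 + \<alpha>)" for k
  have rp: "0 < r k" for k unfolding r_def using \<alpha> by (intro survival_pos[OF pos]) auto
  have rS: "r (Suc k) * (real k + 3 + 2 * \<alpha>) = q k" for k
    unfolding q_def r_def survival_Suc using f[of "Suc k"] \<alpha> by (simp add: field_simps)
  have part: "(1 + \<alpha>) * (\<Sum>k<n. r (Suc k)) = (1 + \<alpha>) - q n" for n
  proof (induction n)
    case 0 then show ?case by (simp add: q_def r_def)
  next
    case (Suc n)
    have "q n - q (Suc n) = (1 + \<alpha>) * r (Suc n)"
      unfolding rS[of n, symmetric] unfolding q_def by (simp add: algebra_simps)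
    then show ?case using Suc by (simp add: distrib_left)
  qed
  have q0: "0 \<le> q k" for k unfolding q_def using rp[of k] \<alpha> by (intro mult_nonneg_nonneg) auto
  have qdec: "q (Suc k) \<le> q k" for k
    unfolding rS[of k, symmetric] unfolding q_def using rp[of "Suc k"] \<alpha> by (intro mult_left_mono) auto
  then have dec: "decseq q" by (rule decseq_SucI)
  obtain l where l: "q \<longlonglongrightarrow> l" using decseq_convergent[of q 0] dec q0 by metis
  have l0: "0 \<le> l" using l q0 by (intro LIMSEQ_le_const) auto
  have lq: "l \<le> q k" for k using decseq_ge[OF dec l] .
  have sum_r: "(\<lambda>k. r (Suc k)) sums (((1 + \<alpha>) - l) / (1 + \<alpha>))"
    unfolding sums_def
  proof -
    have "(\<lambda>n. ((1 + \<alpha>) - q n) / (1 + \<alpha>)) \<longlonglongrightarrow> ((1 + \<alpha>) - l) / (1 + \<alpha>)"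
      using l \<alpha> by (intro tendsto_intros) auto
    moreover have "(\<Sum>k<n. r (Suc k)) = ((1 + \<alpha>) - q n) / (1 + \<alpha>)" for n
      using part[of n] \<alpha> by (simp add: field_simps)
    ultimately show "(\<lambda>n. \<Sum>k<n. r (Suc k)) \<longlonglongrightarrow> ((1 + \<alpha>) - l) / (1 + \<alpha>)" by simp
  qed
  have "l = 0"
  proof (rule ccontr)
    assume "l \<noteq> 0"
    then have lp: "0 < l" using l0 by simp
    define c where "c = l / (2 + \<bar>\<alpha>\<bar>)"
    have cp: "0 < c" using lp by (simp add: c_def)
    have ge: "c * inverse (real (Suc (Suc k))) \<le> r (Suc k)" for k
    proof -
      have "real (Suc k) + 1 + \<alpha> \<le> (2 + \<bar>\<alpha>\<bar>) * real (Suc (Suc k))"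
      proof -
        have "\<bar>\<alpha>\<bar> * 1 \<le> \<bar>\<alpha>\<bar> * real (Suc (Suc k))" by (intro mult_left_mono) auto
        moreover have "(2 + \<bar>\<alpha>\<bar>) * real (Suc (Suc k)) = 2 * real (Suc (Suc k)) + \<bar>\<alpha>\<bar> * real (Suc (Suc k))"
          by (rule distrib_right)
        ultimately show ?thesis by simp
      qed
      then have "l \<le> r (Suc k) * ((2 + \<bar>\<alpha>\<bar>) * real (Suc (Suc k)))"
        using lq[of "Suc k"] rp[of "Suc k"] unfolding q_def by (smt (verit) mult_left_mono)
      moreover have "0 < (2 + \<bar>\<alpha>\<bar>) * real (Suc (Suc k))" by (intro mult_pos_pos) auto
      ultimately have "l / ((2 + \<bar>\<alpha>\<bar>) * real (Suc (Suc k))) \<le> r (Suc k)" by (simp only: pos_divide_le_eq)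
      then show ?thesis unfolding c_def by (simp only: divide_inverse inverse_mult_distrib mult.assoc)
    qed
    have "summable (\<lambda>k. c * inverse (real (Suc (Suc k))))"
      by (rule summable_comparison_test'[OF sums_summable[OF sum_r], of 0]) (use ge cp in auto)
    then have "summable (\<lambda>k. inverse (real (Suc (Suc k))))" using cp by (subst (asm) summable_cmult_iff) auto
    then have "summable (\<lambda>k. inverse (real k))"
      using summable_Suc_iff[of "\<lambda>k. inverse (real k)"] summable_Suc_iff[of "\<lambda>k. inverse (real (Suc k))"] by simp
    then show False using not_summable_harmonic[where 'a = real] by (simp add: inverse_eq_divide)
  qed
  then have "(\<lambda>k. survival f (2 + \<alpha>) (Suc k)) sums 1" using sum_r \<alpha> by (simp add: r_def)
  then show ?thesis using \<alpha> by (subst rho_hat_eq_1_iff[OF pos]) auto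
qed

lemma lambda_star_linear:
  assumes "-1 < \<alpha>" "\<And>k. 1 \<le> k \<Longrightarrow> f k = real k + \<alpha>"
  shows "lambda_star f = 2 + \<alpha>"
  using assms by (intro lambda_star_eqI rho_hat_linear) auto

section \<open>Reproductive values\<close>

text \<open>\<open>stat k\<close> is the limiting degree distribution and \<open>repro k\<close> the (normalised) reproductive
  value of a vertex of degree \<open>k\<close>: its expected number of future children, discounted at rate \<open>lam\<close>.\<close>
locale sublinear_attachment =
  fixes f :: "nat \<Rightarrow> real" and lam fs :: real
  assumes fs_pos: "0 < fs" and fs_le: "\<And>k. 1 \<le> k \<Longrightarrow> fs \<le> f k" and lam_pos: "0 < lam"
    and malthus: "(\<lambda>k. survival f lam (Suc k)) sums 1"
    and sublinear: "(\<lambda>k. f k / real k) \<longlonglongrightarrow> 0"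
begin

abbreviation r :: "nat \<Rightarrow> real" where "r \<equiv> survival f lam"

definition stat :: "nat \<Rightarrow> real" where "stat k = lam * r (k - 1) / (lam + f k)"

definition tail_sum :: "nat \<Rightarrow> real" where "tail_sum k = (\<Sum>j. r (j + k))"

text \<open>For a vertex with \<open>k - 1\<close> children, \<open>r j / r (k - 1)\<close> is the
  conditional probability of reaching \<open>j\<close> children before the exponential time; the sum
  over \<open>j \<ge> k\<close> is the expected number of further ones. A newborn vertex has value 1
  by the Malthusian equation.\<close>

definition repro0 :: "nat \<Rightarrow> real" where "repro0 k = tail_sum k / r (k - 1)"

text \<open>The normalisation that turns \<open>stat k * repro k\<close> into a probability
  distribution, the limiting share of degree \<open>k\<close> in the total reproductive
  value.\<close>

definition repro_total :: real where "repro_total = (\<Sum>k. stat (Suc k) * repro0 (Suc k))"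

definition repro :: "nat \<Rightarrow> real" where "repro k = repro0 k / repro_total"

lemma f_gt0: "1 \<le> k \<Longrightarrow> 0 < f k" using fs_pos fs_le by force

lemma r_pos: "0 < r k"
  using lam_pos by (intro survival_pos f_gt0) auto

lemma r_rec: "1 \<le> k \<Longrightarrow> r k * (lam + f k) = r (k - 1) * f k"
  using f_gt0[of k] lam_pos by (cases k) (auto simp: survival_Suc field_simps)

lemma stat_pos: "1 \<le> k \<Longrightarrow> 0 < stat k"
  unfolding stat_def using f_gt0[of k] lam_pos r_pos[of "k - 1"] by (intro divide_pos_pos mult_pos_pos add_pos_pos) auto

lemma stat_out: "1 \<le> k \<Longrightarrow> (lam + f k) * stat k = lam * r (k - 1)"
  unfolding stat_def using f_gt0[of k] lam_pos by simp

text \<open>The flow from degree \<open>k\<close> to \<open>k + 1\<close> in the limiting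
  distribution is \<open>lam\<close> times the proportion of vertices beyond degree
  \<open>k\<close>.\<close>

lemma stat_up: assumes "1 \<le> k" shows "f k * stat k = lam * r k"
proof -
  have "lam + f k \<noteq> 0" using f_gt0[OF assms] lam_pos by simp
  moreover have "(lam + f k) * (f k * stat k) = (lam + f k) * (lam * r k)"
    using stat_out[OF assms] r_rec[OF assms] by (simp add: mult_ac)
  ultimately show ?thesis by simp
qed

lemma stat_diff: "1 \<le> k \<Longrightarrow> stat k = r (k - 1) - r k"
proof -
  assume k: "1 \<le> k"
  have "lam * stat k = lam * (r (k - 1) - r k)"
    using stat_out[OF k] stat_up[OF k] by (simp add: algebra_simps)
  then show ?thesis using lam_pos by simp
qed

lemma summable_r: "summable r"
  using sums_summable[OF malthus] summable_Suc_iff[of r] by blast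

lemma r_tendsto: "r \<longlonglongrightarrow> 0" by (rule summable_LIMSEQ_zero[OF summable_r])

lemma tail_sum_rec: "tail_sum k = r k + tail_sum (Suc k)"
proof -
  have "summable (\<lambda>j. r (j + k))" using summable_iff_shift[of r k] summable_r by blast
  from suminf_split_head[OF this] show ?thesis by (simp add: tail_sum_def)
qed

lemma tail_sum_1: "tail_sum 1 = 1"
  using malthus by (simp add: tail_sum_def sums_iff)

lemma tail_sum_ge: "r k \<le> tail_sum k"
proof -
  have "summable (\<lambda>j. r (j + Suc k))" using summable_iff_shift[of r "Suc k"] summable_r by blast
  then have "0 \<le> tail_sum (Suc k)" unfolding tail_sum_def
    by (rule suminf_nonneg) (rule less_imp_le[OF r_pos])
  then show ?thesis using tail_sum_rec[of k] by simp
qed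

lemma repro0_rec: assumes "1 \<le> k" shows "r k * (repro0 1 + repro0 (Suc k)) = r (k - 1) * repro0 k"
proof -
  have "repro0 1 = 1" using tail_sum_1 by (simp add: repro0_def)
  then show ?thesis using r_pos[of k] r_pos[of "k - 1"] tail_sum_rec[of k]
    by (simp add: repro0_def field_simps)
qed

lemma repro0_ge: assumes "1 \<le> k" shows "fs / (lam + fs) \<le> repro0 k"
proof -
  have "fs / (lam + fs) \<le> f k / (lam + f k)"
    using fs_pos lam_pos fs_le[OF assms] by (simp add: divide_simps mult.commute mult_left_mono add_pos_pos) (simp add: algebra_simps)
  also have "\<dots> = r k / r (k - 1)"
    using r_rec[OF assms] r_pos[of "k - 1"] f_gt0[OF assms] lam_pos by (simp add: field_simps)
  also have "\<dots> \<le> repro0 k"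
    unfolding repro0_def using tail_sum_ge r_pos[of "k - 1"] by (intro divide_right_mono) auto
  finally show ?thesis .
qed

text \<open>Comparison with the affine function \<open>e k + C\<close> dominating \<open>f\<close>, for which the discounted
  number of children is at most \<open>(e k + C) / (lam - e)\<close>.\<close>
lemma repro0_affine_bound:
  assumes e: "0 < e" "e < lam" and C: "0 \<le> C" "\<And>k. 1 \<le> k \<Longrightarrow> f k \<le> e * real k + C" and k: "1 \<le> k"
  shows "repro0 k \<le> (e * real k + C) / (lam - e)"
proof -
  \<comment> \<open>Partial sums by induction on the number of terms, for all \<open>k\<close> at
    once: the affine bound reproduces itself when one further child is split off.\<close>
  have part: "(\<Sum>j<n. r (j + k)) / r (k - 1) \<le> (e * real k + C) / (lam - e)" if "1 \<le> k" for n k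
    using that
  proof (induction n arbitrary: k)
    case 0
    then show ?case using e C by simp
  next
    case (Suc n)
    define g where "g = e * real k + C"
    have g: "0 < f k" "f k \<le> g" using f_gt0 C(2) Suc.prems by (auto simp: g_def)
    have fr: "f k / (lam + f k) = r k / r (k - 1)"
      using r_rec[OF Suc.prems] r_pos[of "k - 1"] g lam_pos by (simp add: field_simps)
    have "(\<Sum>j<Suc n. r (j + k)) = r k + (\<Sum>j<n. r (j + Suc k))"
      by (subst sum.lessThan_Suc_shift) simp
    then have "(\<Sum>j<Suc n. r (j + k)) / r (k - 1) = (r k / r (k - 1)) * (1 + (\<Sum>j<n. r (j + Suc k)) / r k)"
      using r_pos[of k] by (simp only:) (simp add: add_divide_distrib distrib_left)
    also have "\<dots> \<le> (r k / r (k - 1)) * (1 + (e * real (Suc k) + C) / (lam - e))"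
      using Suc.IH[of "Suc k"] r_pos[of k] r_pos[of "k - 1"] by (intro mult_left_mono add_left_mono) auto
    also have "1 + (e * real (Suc k) + C) / (lam - e) = (lam + g) / (lam - e)"
      using e by (simp add: g_def field_simps)
    also have "r k / r (k - 1) * ((lam + g) / (lam - e)) \<le> g / (lam + g) * ((lam + g) / (lam - e))"
    proof (rule mult_right_mono)
      show "r k / r (k - 1) \<le> g / (lam + g)"
        unfolding fr[symmetric] using g lam_pos by (simp add: divide_simps) (simp add: algebra_simps)
    qed (use g e lam_pos in simp)
    also have "\<dots> = g / (lam - e)" using g lam_pos by simp
    finally show ?case by (simp add: g_def)
  qed
  have "(\<lambda>n. (\<Sum>j<n. r (j + k)) / r (k - 1)) \<longlonglongrightarrow> tail_sum k / r (k - 1)"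
    unfolding tail_sum_def using summable_r r_pos[of "k - 1"]
    by (intro tendsto_divide tendsto_const summable_LIMSEQ) (auto simp: summable_iff_shift)
  then show ?thesis unfolding repro0_def using part[OF k] by (intro LIMSEQ_le_const2) auto
qed

lemma repro0_sublinear:
  assumes e: "0 < e" shows "\<exists>C\<ge>0. \<forall>k\<ge>1. repro0 k \<le> e * real k + C"
proof -
  \<comment> \<open>The first bound keeps \<open>lam - e'\<close> above \<open>lam / 2\<close>, the
    second then makes \<open>e' / (lam - e')\<close> at most \<open>e\<close>.\<close>
  define e' where "e' = min (lam / 2) (e * lam / 2)"
  have e': "0 < e'" "e' \<le> lam / 2" "e' \<le> e * lam / 2" using e lam_pos by (auto simp: e'_def)
  then obtain C where C: "0 \<le> C" "\<And>k. 1 \<le> k \<Longrightarrow> f k \<le> e' * real k + C"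
    using sublinear_bound[OF sublinear] by meson
  have le: "e' < lam" using e' lam_pos by linarith
  have "repro0 k \<le> e * real k + C / (lam - e')" if k: "1 \<le> k" for k
  proof -
    have "repro0 k \<le> (e' * real k + C) / (lam - e')" by (rule repro0_affine_bound[OF e'(1) le C k])
    also have "\<dots> = e' / (lam - e') * real k + C / (lam - e')" by (simp add: add_divide_distrib)
    also have "e' / (lam - e') \<le> e"
    proof -
      have "e' \<le> e * (lam / 2)" using e' by simp
      also have "\<dots> \<le> e * (lam - e')" using e e' by (intro mult_left_mono) auto
      finally show ?thesis using le by (simp add: pos_divide_le_eq)
    qed
    finally show ?thesis by (simp add: mult_right_mono)
  qed
  moreover have "0 \<le> C / (lam - e')" using C le by simp
  ultimately show ?thesis by blast
qed

lemma sum_stat: "(\<Sum>k<n. stat (Suc k)) = 1 - r n"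
  by (induction n) (auto simp: stat_diff)

lemma stat_sums: "(\<lambda>k. stat (Suc k)) sums 1"
proof -
  have "(\<lambda>n. 1 - r n) \<longlonglongrightarrow> 1 - 0" by (intro tendsto_intros r_tendsto)
  then show ?thesis by (simp add: sums_def sum_stat)
qed

text \<open>Summation by parts leaves the series of \<open>r\<close>, whose value is
  \<open>r 0 + 1 = 2\<close>: the mean degree of a tree.\<close>

lemma sum_k_stat_le: "(\<Sum>k<n. real (Suc k) * stat (Suc k)) \<le> 2"
proof -
  have "(\<Sum>k<n. real (Suc k) * stat (Suc k)) = (\<Sum>k<n. r k) - real n * r n"
    by (induction n) (auto simp: stat_diff algebra_simps)
  also have "\<dots> \<le> (\<Sum>k<n. r k)" using r_pos[of n] by simp
  also have "\<dots> \<le> suminf r" using summable_r r_pos by (intro sum_le_suminf) (auto intro: less_imp_le)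
  also have "\<dots> = 2"
    using malthus suminf_split_head[OF summable_r] by (simp add: sums_iff)
  finally show ?thesis .
qed

lemma repro0_pos: "1 \<le> k \<Longrightarrow> 0 < repro0 k"
  using repro0_ge[of k] fs_pos lam_pos by (smt (verit) divide_pos_pos)

lemma summable_stat_repro0: "summable (\<lambda>k. stat (Suc k) * repro0 (Suc k))"
proof -
  obtain C where C: "0 \<le> C" "\<And>k. 1 \<le> k \<Longrightarrow> repro0 k \<le> 1 * real k + C"
    using repro0_sublinear[of 1] by auto
  show ?thesis
  proof (rule summableI_nonneg_bounded)
    show "0 \<le> stat (Suc k) * repro0 (Suc k)" for k
      using stat_pos[of "Suc k"] repro0_pos[of "Suc k"] by simp
    fix n
    have "(\<Sum>k<n. stat (Suc k) * repro0 (Suc k)) \<le> (\<Sum>k<n. real (Suc k) * stat (Suc k) + C * stat (Suc k))"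
    proof (rule sum_mono)
      fix k
      have "stat (Suc k) * repro0 (Suc k) \<le> stat (Suc k) * (1 * real (Suc k) + C)"
        using stat_pos[of "Suc k"] C(2)[of "Suc k"] by (intro mult_left_mono) auto
      then show "stat (Suc k) * repro0 (Suc k) \<le> real (Suc k) * stat (Suc k) + C * stat (Suc k)"
        by (simp add: algebra_simps)
    qed
    also have "\<dots> \<le> 2 + C * 1"
      unfolding sum.distrib sum_distrib_left[symmetric] sum_stat
      using sum_k_stat_le[of n] r_pos[of n] C(1) by (intro add_mono mult_left_mono) auto
    finally show "(\<Sum>k<n. stat (Suc k) * repro0 (Suc k)) \<le> 2 + C * 1" .
  qed
qed

lemma repro_total_pos: "0 < repro_total"
  unfolding repro_total_def
  using stat_pos repro0_pos by (intro suminf_pos summable_stat_repro0) auto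

lemma repro_pos: "1 \<le> k \<Longrightarrow> 0 < repro k"
  unfolding repro_def using repro0_pos repro_total_pos by simp

lemma repro_rec: "1 \<le> k \<Longrightarrow> r k * (repro 1 + repro (Suc k)) = r (k - 1) * repro k"
  using repro0_rec[of k] by (simp add: repro_def add_divide_distrib[symmetric])

text \<open>\<open>repro\<close> is an eigenfunction of the branching generator: a birth at a vertex
  of degree \<open>k\<close> moves it to \<open>k + 1\<close> and adds a vertex of degree 1, and the
  reproductive value grows at rate \<open>lam\<close>.\<close>

lemma repro_generator:
  assumes "1 \<le> k" shows "f k * (repro 1 + repro (Suc k) - repro k) = lam * repro k"
proof -
  have "r (k - 1) * (f k * (repro 1 + repro (Suc k))) = (r (k - 1) * f k) * (repro 1 + repro (Suc k))"
    by (rule mult.assoc[symmetric])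
  also have "\<dots> = (lam + f k) * (r k * (repro 1 + repro (Suc k)))"
    unfolding r_rec[OF assms, symmetric] by (simp only: mult_ac)
  also have "\<dots> = r (k - 1) * ((lam + f k) * repro k)"
    unfolding repro_rec[OF assms] by (simp only: mult_ac)
  finally have "r (k - 1) * (f k * (repro 1 + repro (Suc k))) = r (k - 1) * ((lam + f k) * repro k)" .
  then have "f k * (repro 1 + repro (Suc k)) = (lam + f k) * repro k" using r_pos[of "k - 1"] by simp
  then show ?thesis by (simp add: algebra_simps)
qed

lemma repro_lower: "\<exists>c>0. \<forall>k\<ge>1. c \<le> repro k"
proof (intro exI[of _ "fs / (lam + fs) / repro_total"] conjI allI impI)
  show "0 < fs / (lam + fs) / repro_total" using fs_pos lam_pos repro_total_pos by simp
  show "fs / (lam + fs) / repro_total \<le> repro k" if "1 \<le> k" for k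
    unfolding repro_def using repro0_ge[OF that] repro_total_pos by (intro divide_right_mono) auto
qed

lemma repro_sublinear: assumes "0 < e" shows "\<exists>C\<ge>0. \<forall>k\<ge>1. repro k \<le> e * real k + C"
proof -
  have "0 < e * repro_total" using assms repro_total_pos by simp
  from repro0_sublinear[OF this] obtain C where C: "0 \<le> C" "\<And>k. 1 \<le> k \<Longrightarrow> repro0 k \<le> e * repro_total * real k + C"
    by auto
  have "repro k \<le> e * real k + C / repro_total" if "1 \<le> k" for k
    using C(2)[OF that] repro_total_pos unfolding repro_def by (simp add: field_simps)
  then show ?thesis using C(1) repro_total_pos by (intro exI[of _ "C / repro_total"]) auto
qed

lemma stat_repro_sums: "(\<lambda>k. stat (Suc k) * repro (Suc k)) sums 1"
proof -
  have "(\<lambda>k. stat (Suc k) * repro0 (Suc k) / repro_total) sums (repro_total / repro_total)"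
    unfolding repro_total_def by (rule sums_divide[OF summable_sums[OF summable_stat_repro0]])
  then show ?thesis using repro_total_pos by (simp add: repro_def)
qed

text \<open>The mean of \<open>f\<close> under the limiting degree distribution is
  \<open>lam\<close>. This is how the Malthusian parameter becomes the limit of the weight per
  vertex.\<close>

lemma stat_balance_sums: "(\<lambda>k. (f (Suc k) - lam) * stat (Suc k)) sums 0"
proof -
  have "(\<lambda>k. lam * r (Suc k) - lam * stat (Suc k)) sums (lam * 1 - lam * 1)"
    by (intro sums_diff sums_mult malthus stat_sums)
  then show ?thesis using stat_up by (simp add: left_diff_distrib)
qed

text \<open>All the quantities that have to be small for truncation at degree \<open>K\<close> to be harmless.\<close>
definition good_level :: "real \<Rightarrow> nat \<Rightarrow> bool" where
  "good_level \<eta> K \<longleftrightarrow> 1 \<le> K \<and> (\<forall>k\<ge>K. f k \<le> \<eta> * real k \<and> repro k \<le> \<eta> * real k) \<and>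
    1 - \<eta> \<le> (\<Sum>k\<in>{1..K}. r k) \<and> 1 - \<eta> \<le> (\<Sum>k\<in>{1..K}. stat k * repro k) \<and>
    \<bar>\<Sum>k\<in>{1..K}. (f k - lam) * stat k\<bar> \<le> \<eta> \<and> lam \<le> \<eta> * real K"

lemma sum_Suc_shift: "(\<Sum>k<n. g (Suc k)) = (\<Sum>k\<in>{1..n}. g k)" for g :: "nat \<Rightarrow> real"
  by (rule sum.reindex_bij_witness[of _ "\<lambda>k. k - 1" Suc]) auto

lemma eventually_good_level: assumes "0 < \<eta>" shows "eventually (good_level \<eta>) sequentially"
proof -
  have lin: "eventually (\<lambda>K. \<forall>k\<ge>K. g k \<le> \<eta> * real k) sequentially"
    if bd: "\<exists>C\<ge>0. \<forall>k\<ge>1. g k \<le> \<eta> / 2 * real k + (C::real)" for g :: "nat \<Rightarrow> real"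
  proof -
    obtain C where C: "0 \<le> C" "\<And>k. 1 \<le> k \<Longrightarrow> g k \<le> \<eta> / 2 * real k + C" using bd by blast
    obtain m :: nat where m: "2 * C / \<eta> \<le> real m" using real_arch_simple by blast
    have "g k \<le> \<eta> * real k" if k: "max 1 m \<le> k" for k
    proof -
      have "2 * C / \<eta> \<le> real k" using m k by linarith
      then have "C \<le> \<eta> / 2 * real k" using assms by (simp add: field_simps)
      then show ?thesis using C(2)[of k] k by simp
    qed
    then show ?thesis unfolding eventually_sequentially by (meson order_trans)
  qed
  have h2: "0 < \<eta> / 2" using assms by simp
  have 1: "eventually (\<lambda>K. \<forall>k\<ge>K. f k \<le> \<eta> * real k) sequentially"
    by (rule lin[OF sublinear_bound[OF sublinear h2]])
  have 2: "eventually (\<lambda>K. \<forall>k\<ge>K. repro k \<le> \<eta> * real k) sequentially"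
    by (rule lin[OF repro_sublinear[OF h2]])
  have 3: "eventually (\<lambda>K. 1 - \<eta> < (\<Sum>k\<in>{1..K}. r k)) sequentially"
    using malthus assms unfolding sums_def sum_Suc_shift[of r] by (intro order_tendstoD) auto
  have 4: "eventually (\<lambda>K. 1 - \<eta> < (\<Sum>k\<in>{1..K}. stat k * repro k)) sequentially"
    using stat_repro_sums assms unfolding sums_def sum_Suc_shift[of "\<lambda>k. stat k * repro k"] by (intro order_tendstoD) auto
  have "(\<lambda>K. \<bar>\<Sum>k\<in>{1..K}. (f k - lam) * stat k\<bar>) \<longlonglongrightarrow> \<bar>0\<bar>"
    using stat_balance_sums unfolding sums_def sum_Suc_shift[of "\<lambda>k. (f k - lam) * stat k"] by (rule tendsto_rabs)
  then have 5: "eventually (\<lambda>K. \<bar>\<Sum>k\<in>{1..K}. (f k - lam) * stat k\<bar> < \<eta>) sequentially"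
    using assms by (intro order_tendstoD) auto
  obtain m :: nat where m: "lam / \<eta> \<le> real m" using real_arch_simple by blast
  have 6: "eventually (\<lambda>K. 1 \<le> K \<and> m \<le> K) sequentially"
    using eventually_ge_at_top[of "max 1 m"] by eventually_elim auto
  show ?thesis
    using 1 2 3 4 5 6
  proof eventually_elim
    case (elim K)
    have "lam / \<eta> \<le> real K" using m elim by linarith
    then have "lam \<le> \<eta> * real K" using assms by (simp add: field_simps)
    then show ?case using elim by (auto simp: good_level_def)
  qed
qed

end

section \<open>A Lyapunov function for the degree distribution\<close>

text \<open>A convex function vanishing exactly at \<open>1\<close>, its derivative and its Bregman remainder. Unlike
  the relative entropy density it has a bounded derivative on \<open>{0..}\<close>.\<close>
definition gain :: "real \<Rightarrow> real" where "gain y = (y - 1)\<^sup>2 / (1 + y)"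

definition gain' :: "real \<Rightarrow> real" where "gain' y = 1 - 4 / (1 + y)\<^sup>2"

definition breg :: "real \<Rightarrow> real \<Rightarrow> real" where "breg x y = 4 * (y - x)\<^sup>2 / ((1 + x)\<^sup>2 * (1 + y))"

text \<open>On the nonnegative reals \<open>gain z\<close> is \<open>z - 3 + 4 / (1 + z)\<close>.
  The affine part has no remainder, so \<open>breg\<close> is the remainder of the hyperbola
  alone.\<close>

lemma gain_breg:
  assumes "0 \<le> x" "0 \<le> y" shows "gain y = gain x + gain' x * (y - x) + breg x y"
proof -
  have g: "gain z = z - 3 + 4 / (1 + z)" if "0 \<le> z" for z
    using that by (simp add: gain_def field_simps power2_eq_square)
  define a b where "a = 1 + x" and "b = 1 + y"
  have ab: "0 < a" "0 < b" using assms by (auto simp: a_def b_def)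
  have "4 / b - 4 / a = - (4 / a\<^sup>2 * (b - a)) + 4 * (b - a)\<^sup>2 / (a\<^sup>2 * b)"
    using ab by (simp add: field_simps power2_eq_square)
  moreover have e: "y - x = b - a" by (simp add: a_def b_def)
  ultimately show ?thesis
    unfolding g[OF assms(1)] g[OF assms(2)] gain'_def breg_def a_def[symmetric] b_def[symmetric] e
    using e by (simp only: left_diff_distrib mult_1)
qed

lemma breg_nonneg: "0 \<le> x \<Longrightarrow> 0 \<le> y \<Longrightarrow> 0 \<le> breg x y"
  by (simp add: breg_def)

lemma breg_le: assumes "0 \<le> x" "0 \<le> y" shows "breg x y \<le> 4 * (y - x)\<^sup>2"
proof -
  have "1 * 1 \<le> (1 + x)\<^sup>2 * (1 + y)" using assms by (intro mult_mono one_le_power) auto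
  then have "4 * (y - x)\<^sup>2 / ((1 + x)\<^sup>2 * (1 + y)) \<le> 4 * (y - x)\<^sup>2 / 1"
    by (intro divide_left_mono) auto
  then show ?thesis by (simp add: breg_def)
qed

lemma gain'_abs: assumes "0 \<le> x" shows "\<bar>gain' x\<bar> \<le> 3"
proof -
  have "1 \<le> (1 + x)\<^sup>2" using assms by (intro one_le_power) auto
  then have "4 / (1 + x)\<^sup>2 \<le> 4" "0 \<le> 4 / (1 + x)\<^sup>2" by (auto simp: divide_le_eq)
  then show ?thesis unfolding gain'_def by linarith
qed

lemma gain_nonneg: "0 \<le> x \<Longrightarrow> 0 \<le> gain x"
  by (simp add: gain_def)

lemma gain_le: assumes "0 \<le> x" shows "gain x \<le> 1 + x"
proof -
  have "(x - 1)\<^sup>2 \<le> (1 + x) * (1 + x)" using assms by (simp add: power2_eq_square algebra_simps)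
  then show ?thesis using assms by (simp add: gain_def divide_le_eq)
qed

lemma gain_le_sq: assumes "0 \<le> x" shows "gain x \<le> (x - 1)\<^sup>2"
proof -
  have "(x - 1)\<^sup>2 / (1 + x) \<le> (x - 1)\<^sup>2 / 1" using assms by (intro divide_left_mono) auto
  then show ?thesis by (simp add: gain_def)
qed

lemma gain_lipschitz: assumes "0 \<le> x" "0 \<le> y" shows "\<bar>gain y - gain x\<bar> \<le> 3 * \<bar>y - x\<bar>"
proof -
  have le: "gain x - gain y \<le> 3 * \<bar>y - x\<bar>" if "0 \<le> x" "0 \<le> y" for x y
  proof -
    have "gain x - gain y \<le> - (gain' x * (y - x))" using gain_breg[OF that] breg_nonneg[OF that] by simp
    also have "\<dots> \<le> \<bar>gain' x\<bar> * \<bar>y - x\<bar>" by (metis abs_ge_minus_self abs_mult)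
    also have "\<dots> \<le> 3 * \<bar>y - x\<bar>" using gain'_abs[OF that(1)] by (intro mult_right_mono) auto
    finally show ?thesis .
  qed
  show ?thesis using le[OF assms] le[OF assms(2,1)] by (simp add: abs_le_iff abs_minus_commute)
qed

section \<open>Sums over the vertices of functions of the degree\<close>

definition deg_sum :: "(nat \<Rightarrow> real) \<Rightarrow> nat list \<Rightarrow> real" where
  "deg_sum g p = (\<Sum>v<length p. g (deg p (length p) v))"

lemma deg_append:
  assumes "v < length p" "u < length p"
  shows "deg (p @ [v]) (Suc (length p)) u = deg p (length p) u + (if u = v then 1 else 0)"
proof -
  have "length p \<notin> children p (length p) v" by (auto simp: children_def)
  then show ?thesis unfolding deg_def children_append[OF assms(1)] by auto
qed

lemma deg_append_new:
  assumes "v < length p" shows "deg (p @ [v]) (Suc (length p)) (length p) = 1"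
proof -
  have "children (p @ [v]) (Suc (length p)) (length p) = {}" by (auto simp: children_def)
  then show ?thesis by (simp add: deg_def)
qed

lemma deg_sum_append:
  assumes "v < length p"
  shows "deg_sum g (p @ [v]) - deg_sum g p = g 1 + g (Suc (deg p (length p) v)) - g (deg p (length p) v)"
proof -
  have "deg_sum g (p @ [v]) = (\<Sum>u<length p. g (deg (p @ [v]) (Suc (length p)) u)) + g 1"
    by (simp add: deg_sum_def deg_append_new[OF assms])
  also have "(\<Sum>u<length p. g (deg (p @ [v]) (Suc (length p)) u))
    = (\<Sum>u<length p. g (deg p (length p) u) + (if u = v then g (Suc (deg p (length p) v)) - g (deg p (length p) v) else 0))"
    by (intro sum.cong refl) (simp add: deg_append[OF assms])
  also have "\<dots> = deg_sum g p + (g (Suc (deg p (length p) v)) - g (deg p (length p) v))"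
    using assms by (simp add: sum.distrib deg_sum_def)
  finally show ?thesis by simp
qed

definition degc :: "nat list \<Rightarrow> nat \<Rightarrow> real" where
  "degc p k = deg_sum (\<lambda>d. if d = k then 1 else 0) p"

lemma degc_nonneg: "0 \<le> degc p k"
  by (simp add: degc_def deg_sum_def sum_nonneg)

lemma deg_sum_split:
  "deg_sum g p = (\<Sum>k\<in>{1..K}. g k * degc p k) + deg_sum (\<lambda>d. if K < d then g d else 0) p"
proof -
  have "(\<Sum>k\<in>{1..K}. g k * degc p k) = (\<Sum>v<length p. \<Sum>k\<in>{1..K}. if deg p (length p) v = k then g k else 0)"
    unfolding degc_def deg_sum_def sum_distrib_left by (subst sum.swap) (auto intro!: sum.cong)
  also have "\<dots> = (\<Sum>v<length p. if K < deg p (length p) v then 0 else g (deg p (length p) v))"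
    by (intro sum.cong refl) (auto simp: sum.delta)
  finally show ?thesis unfolding deg_sum_def by (simp add: sum.distrib[symmetric]) (auto intro!: sum.cong)
qed

lemma deg_sum_id: "vtree p \<Longrightarrow> deg_sum real p = 2 * real (length p) - 1"
  unfolding deg_sum_def by (rule sum_deg) (auto simp: vtree_def Suc_le_eq)

lemma deg_sum_mono: "(\<And>d. 1 \<le> d \<Longrightarrow> g d \<le> h d) \<Longrightarrow> deg_sum g p \<le> deg_sum h p"
  unfolding deg_sum_def by (intro sum_mono) simp

lemma deg_sum_le_linear:
  assumes "vtree p" "0 \<le> c" "\<And>d. 1 \<le> d \<Longrightarrow> g d \<le> c * real d"
  shows "deg_sum g p \<le> 2 * c * real (length p)"
proof -
  have "deg_sum g p \<le> deg_sum (\<lambda>d. c * real d) p" using assms(3) by (rule deg_sum_mono)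
  also have "\<dots> = c * deg_sum real p" by (simp add: deg_sum_def sum_distrib_left)
  also have "\<dots> \<le> c * (2 * real (length p))" unfolding deg_sum_id[OF assms(1)] using assms(2) by (intro mult_left_mono) auto
  finally show ?thesis by simp
qed

lemma deg_sum_ge: "(\<And>d. 1 \<le> d \<Longrightarrow> c \<le> g d) \<Longrightarrow> c * real (length p) \<le> deg_sum g p"
proof -
  assume "\<And>d. 1 \<le> d \<Longrightarrow> c \<le> g d"
  then have "(\<Sum>v<length p. c) \<le> deg_sum g p" unfolding deg_sum_def by (intro sum_mono) simp
  then show ?thesis by (simp add: mult.commute)
qed

lemma wt_deg_sum: "wt f p (length p) = deg_sum f p"
  by (simp add: wt_def deg_sum_def)

section \<open>Ratios to the limiting degree distribution and their divergence\<close>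

context sublinear_attachment
begin

definition repro_min :: real where "repro_min = (SOME c. 0 < c \<and> (\<forall>k\<ge>1. c \<le> repro k))"

lemma repro_min: "0 < repro_min" "1 \<le> k \<Longrightarrow> repro_min \<le> repro k"
proof -
  have "0 < repro_min \<and> (\<forall>k\<ge>1. repro_min \<le> repro k)"
    unfolding repro_min_def by (rule someI_ex) (use repro_lower in blast)
  then show "0 < repro_min" "1 \<le> k \<Longrightarrow> repro_min \<le> repro k" by auto
qed

lemma linear_bound_ex:
  assumes "\<exists>C\<ge>0. \<forall>k\<ge>1. g k \<le> 1 * real k + (C::real)"
  shows "\<exists>C>0. \<forall>k\<ge>1. g k \<le> C * real k"
proof -
  obtain C where C: "0 \<le> C" "\<And>k. 1 \<le> k \<Longrightarrow> g k \<le> 1 * real k + C" using assms by blast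
  have "g k \<le> (1 + C) * real k" if k: "1 \<le> k" for k
  proof -
    have "C * 1 \<le> C * real k" using C k by (intro mult_left_mono) auto
    then show ?thesis using C(2)[OF k] by (simp add: distrib_right)
  qed
  then show ?thesis using C(1) by (intro exI[of _ "1 + C"]) auto
qed

definition slope :: real where
  "slope = (SOME c. 0 < c \<and> (\<forall>k\<ge>1. repro k \<le> c * real k) \<and> (\<forall>k\<ge>1. f k \<le> c * real k))"

lemma slope: "0 < slope" "1 \<le> k \<Longrightarrow> repro k \<le> slope * real k" "1 \<le> k \<Longrightarrow> f k \<le> slope * real k"
proof -
  obtain a where a: "0 < a" "\<forall>k\<ge>1. repro k \<le> a * real k" using linear_bound_ex[OF repro_sublinear[of 1]] by auto
  obtain b where b: "0 < b" "\<forall>k\<ge>1. f k \<le> b * real k" using linear_bound_ex[OF sublinear_bound[OF sublinear, of 1]] by auto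
  have le: "a * real k \<le> max a b * real k" "b * real k \<le> max a b * real k" for k
    by (intro mult_right_mono; simp)+
  have "0 < max a b \<and> (\<forall>k\<ge>1. repro k \<le> max a b * real k) \<and> (\<forall>k\<ge>1. f k \<le> max a b * real k)"
    using a b le by (meson less_max_iff_disj order_trans)
  then have "0 < slope \<and> (\<forall>k\<ge>1. repro k \<le> slope * real k) \<and> (\<forall>k\<ge>1. f k \<le> slope * real k)"
    unfolding slope_def by (rule someI)
  then show "0 < slope" "1 \<le> k \<Longrightarrow> repro k \<le> slope * real k" "1 \<le> k \<Longrightarrow> f k \<le> slope * real k" by auto
qed

text \<open>Freezing the value at degree \<open>K\<close> keeps the increments of the total value
  bounded, at the price of an error that only vertices of degree at least \<open>K\<close>
  cause.\<close>

definition capped :: "nat \<Rightarrow> nat \<Rightarrow> real" where "capped K d = repro (min d K)"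

definition value_of :: "nat \<Rightarrow> nat list \<Rightarrow> real" where "value_of K p = deg_sum (capped K) p"

text \<open>Degree frequencies are normalised by the total reproductive value instead of the number of
  vertices: the value grows at rate \<open>lam\<close> times itself whatever the total weight is, which closes the
  equations for the ratios.\<close>
definition ratio :: "nat \<Rightarrow> nat list \<Rightarrow> nat \<Rightarrow> real" where
  "ratio K p k = degc p k / (stat k * value_of K p)"

definition lyap :: "nat \<Rightarrow> nat list \<Rightarrow> real" where
  "lyap K p = (\<Sum>k\<in>{1..K}. stat k * repro k * gain (ratio K p k))"

lemma value_ge: "1 \<le> K \<Longrightarrow> repro_min * real (length p) \<le> value_of K p"
  unfolding value_of_def capped_def by (intro deg_sum_ge repro_min) simp

lemma value_pos: assumes "1 \<le> K" "vtree p" shows "0 < value_of K p"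
proof -
  have "0 < repro_min * real (length p)" using repro_min(1) assms by (simp add: vtree_def)
  then show ?thesis using value_ge[OF assms(1), of p] by linarith
qed

lemma value_le: assumes "1 \<le> K" "vtree p" shows "value_of K p \<le> 2 * slope * real (length p)"
  unfolding value_of_def
proof (rule deg_sum_le_linear[OF assms(2)])
  fix d :: nat assume d: "1 \<le> d"
  have "capped K d \<le> slope * real (min d K)" unfolding capped_def using d assms by (intro slope) simp
  also have "\<dots> \<le> slope * real d" using slope(1) by (intro mult_left_mono) auto
  finally show "capped K d \<le> slope * real d" .
qed (use slope in simp)

lemma ratio_nonneg: assumes "1 \<le> K" "vtree p" "1 \<le> k" shows "0 \<le> ratio K p k"
  unfolding ratio_def using value_pos[OF assms(1,2)] stat_pos[OF assms(3)] degc_nonneg by (intro divide_nonneg_pos mult_pos_pos) auto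

lemma degc_ratio: assumes "1 \<le> K" "vtree p" "1 \<le> k" shows "degc p k = stat k * ratio K p k * value_of K p"
  unfolding ratio_def using value_pos[OF assms(1,2)] stat_pos[OF assms(3)] by simp

lemma value_split:
  "value_of K p = (\<Sum>k\<in>{1..m}. capped K k * degc p k) + deg_sum (\<lambda>d. if m < d then capped K d else 0) p"
  unfolding value_of_def by (rule deg_sum_split)

text \<open>The shares of the degrees up to \<open>m\<close> in the total capped value, missing only
  the share of higher degrees. This mass identity fixes the common value of the ratios at
  equilibrium.\<close>

lemma ratio_sum_split:
  assumes "1 \<le> K" "vtree p" "m \<le> K"
  shows "(\<Sum>k\<in>{1..m}. stat k * repro k * ratio K p k) = 1 - deg_sum (\<lambda>d. if m < d then capped K d else 0) p / value_of K p"
proof -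
  have V: "0 < value_of K p" by (rule value_pos[OF assms(1,2)])
  have "(\<Sum>k\<in>{1..m}. capped K k * degc p k) = value_of K p * (\<Sum>k\<in>{1..m}. stat k * repro k * ratio K p k)"
    unfolding sum_distrib_left using assms by (intro sum.cong) (auto simp: capped_def degc_ratio[OF assms(1,2)])
  then show ?thesis using value_split[of K p m] V by (simp add: field_simps)
qed

lemma capped_pos: "1 \<le> K \<Longrightarrow> 1 \<le> d \<Longrightarrow> 0 < capped K d"
  unfolding capped_def by (intro repro_pos) simp

lemma tail_capped_nonneg: "1 \<le> K \<Longrightarrow> 0 \<le> deg_sum (\<lambda>d. if m < d then capped K d else 0) p"
  unfolding deg_sum_def using capped_pos[of K] by (intro sum_nonneg) (auto intro: less_imp_le)

lemma ratio_sum_le: assumes "1 \<le> K" "vtree p" "m \<le> K" shows "(\<Sum>k\<in>{1..m}. stat k * repro k * ratio K p k) \<le> 1"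
proof -
  have "0 \<le> deg_sum (\<lambda>d. if m < d then capped K d else 0) p / value_of K p"
    using tail_capped_nonneg[OF assms(1)] value_pos[OF assms(1,2)] by simp
  then show ?thesis unfolding ratio_sum_split[OF assms] by simp
qed

lemma weight_pos: "1 \<le> k \<Longrightarrow> 0 < stat k * repro k"
  using stat_pos repro_pos by simp

lemma ratio_le: assumes "1 \<le> K" "vtree p" "1 \<le> k" "k \<le> K" shows "ratio K p k \<le> 1 / (stat k * repro k)"
proof -
  have "stat k * repro k * ratio K p k \<le> (\<Sum>k\<in>{1..K}. stat k * repro k * ratio K p k)"
    using assms ratio_nonneg weight_pos by (intro member_le_sum) (auto intro!: mult_nonneg_nonneg simp: less_imp_le stat_pos repro_pos)
  also have "\<dots> \<le> 1" by (rule ratio_sum_le) (use assms in auto)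
  finally show ?thesis using weight_pos[OF assms(3)] by (simp add: field_simps)
qed

lemma sum_weights_le: "(\<Sum>k\<in>{1..K}. stat k * repro k) \<le> 1"
proof -
  have "(\<Sum>k<K. stat (Suc k) * repro (Suc k)) \<le> 1"
    using sum_le_suminf[OF sums_summable[OF stat_repro_sums], of "{..<K}"] stat_repro_sums weight_pos
    by (auto simp: sums_iff intro: less_imp_le)
  then show ?thesis unfolding sum_Suc_shift[of "\<lambda>k. stat k * repro k"] .
qed

lemma sum_r_le: "(\<Sum>k\<in>{1..K}. r k) \<le> 1"
proof -
  have "(\<Sum>k<K. r (Suc k)) \<le> 1"
    using sum_le_suminf[OF sums_summable[OF malthus], of "{..<K}"] malthus r_pos
    by (auto simp: sums_iff intro: less_imp_le)
  then show ?thesis unfolding sum_Suc_shift[of r] .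
qed

lemma lyap_le_2: assumes "1 \<le> K" "vtree p" shows "lyap K p \<le> 2"
proof -
  have "lyap K p \<le> (\<Sum>k\<in>{1..K}. stat k * repro k * (1 + ratio K p k))"
    unfolding lyap_def using gain_le ratio_nonneg[OF assms] weight_pos
    by (intro sum_mono mult_left_mono) (auto simp: less_imp_le stat_pos repro_pos)
  also have "\<dots> = (\<Sum>k\<in>{1..K}. stat k * repro k) + (\<Sum>k\<in>{1..K}. stat k * repro k * ratio K p k)"
    by (simp add: distrib_left sum.distrib)
  also have "\<dots> \<le> 1 + 1" by (intro add_mono sum_weights_le ratio_sum_le assms) simp
  finally show ?thesis by simp
qed

text \<open>Summation by parts: by the recursion for \<open>repro\<close> everything but the boundary terms cancels.\<close>
lemma flow_telescope:
  assumes "1 \<le> K"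
  shows "(\<Sum>k\<in>{2..K}. r (k - 1) * repro k * (g (k - 1) - g k)) + repro 1 * (\<Sum>j\<in>{1..K}. r j * g j)
    = repro 1 * g 1 - r K * repro (Suc K) * g K"
  using assms
proof (induction K rule: dec_induct)
  case base
  have "r 1 * (repro 1 + repro 2) = repro 1" using repro_rec[of 1] by (simp add: numeral_2_eq_2)
  then show ?case by (simp add: numeral_2_eq_2 algebra_simps) (metis distrib_left mult.commute)
next
  case (step K)
  have "r (Suc K) * (repro 1 + repro (Suc (Suc K))) = r K * repro (Suc K)" using repro_rec[of "Suc K"] by simp
  then have e: "r K * repro (Suc K) * g (Suc K) = r (Suc K) * repro 1 * g (Suc K) + r (Suc K) * repro (Suc (Suc K)) * g (Suc K)"
    by (simp add: distrib_left distrib_right flip: distrib_right)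
  have "{2..Suc K} = insert (Suc K) {2..K}" using step by auto
  then have "(\<Sum>k\<in>{2..Suc K}. r (k - 1) * repro k * (g (k - 1) - g k))
    = (\<Sum>k\<in>{2..K}. r (k - 1) * repro k * (g (k - 1) - g k)) + r K * repro (Suc K) * (g K - g (Suc K))" by simp
  then show ?case using step.IH e by (simp add: algebra_simps)
qed

text \<open>Convexity bounds each transition between degrees by a difference of \<open>gain\<close>.
  For births, which couple degree 1 to every other degree, the Bregman remainder is kept: it is the
  dissipation. What remains telescopes by \<open>flow_telescope\<close>. The error comes from the
  missing mass of the truncated series of \<open>r\<close>; its constant 4 is 3 for
  \<open>gain'\<close> plus 1 for \<open>gain\<close>.\<close>

lemma drift_algebra:
  assumes K: "1 \<le> K" and good: "1 - \<eta> \<le> (\<Sum>k\<in>{1..K}. r k)" "0 \<le> \<eta>" and y: "\<And>k. 1 \<le> k \<Longrightarrow> 0 \<le> y k"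
  shows "(\<Sum>k\<in>{2..K}. r (k - 1) * repro k * gain' (y k) * (y (k - 1) - y k))
      + repro 1 * gain' (y 1) * ((\<Sum>j\<in>{1..K}. r j * y j) - y 1)
    \<le> - repro 1 * (\<Sum>j\<in>{1..K}. r j * breg (y 1) (y j)) + 4 * repro 1 * (1 + y 1) * \<eta>"
proof -
  define R where "R = (\<Sum>k\<in>{1..K}. r k)"
  have R: "1 - \<eta> \<le> R" "R \<le> 1" using good sum_r_le by (auto simp: R_def)
  have y1: "0 \<le> y 1" using y by simp
  have H: "0 < repro 1" by (rule repro_pos) simp
  have 1: "(\<Sum>k\<in>{2..K}. r (k - 1) * repro k * gain' (y k) * (y (k - 1) - y k))
    \<le> (\<Sum>k\<in>{2..K}. r (k - 1) * repro k * (gain (y (k - 1)) - gain (y k)))"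
  proof (rule sum_mono)
    fix k assume "k \<in> {2..K}"
    then have k: "1 \<le> k" "1 \<le> k - 1" by auto
    have "gain' (y k) * (y (k - 1) - y k) \<le> gain (y (k - 1)) - gain (y k)"
      using gain_breg[OF y[OF k(1)] y[OF k(2)]] breg_nonneg[OF y[OF k(1)] y[OF k(2)]] by linarith
    then have "r (k - 1) * repro k * (gain' (y k) * (y (k - 1) - y k)) \<le> r (k - 1) * repro k * (gain (y (k - 1)) - gain (y k))"
      using r_pos[of "k - 1"] repro_pos[OF k(1)] by (intro mult_left_mono) auto
    then show "r (k - 1) * repro k * gain' (y k) * (y (k - 1) - y k) \<le> r (k - 1) * repro k * (gain (y (k - 1)) - gain (y k))"
      by (simp add: mult.assoc)
  qed
  have "gain' (y 1) * ((\<Sum>j\<in>{1..K}. r j * y j) - y 1) = (\<Sum>j\<in>{1..K}. r j * (gain' (y 1) * (y j - y 1))) - gain' (y 1) * y 1 * (1 - R)"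
  proof -
    have s: "(\<Sum>j\<in>{1..K}. r j * (c * (y j - d))) = c * (\<Sum>j\<in>{1..K}. r j * y j) - c * d * R" for c d
      unfolding R_def sum_distrib_left sum_subtractf[symmetric]
      by (intro sum.cong refl) (simp add: algebra_simps)
    show ?thesis unfolding s by (simp add: algebra_simps)
  qed
  also have "(\<Sum>j\<in>{1..K}. r j * (gain' (y 1) * (y j - y 1))) = (\<Sum>j\<in>{1..K}. r j * (gain (y j) - gain (y 1) - breg (y 1) (y j)))"
  proof (intro sum.cong refl)
    fix j assume "j \<in> {1..K}"
    then have "0 \<le> y j" using y by simp
    then have "gain' (y 1) * (y j - y 1) = gain (y j) - gain (y 1) - breg (y 1) (y j)"
      using gain_breg[OF y1, of "y j"] by linarith
    then show "r j * (gain' (y 1) * (y j - y 1)) = r j * (gain (y j) - gain (y 1) - breg (y 1) (y j))"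
      by (simp only:)
  qed
  also have "\<dots> = (\<Sum>j\<in>{1..K}. r j * gain (y j)) - R * gain (y 1) - (\<Sum>j\<in>{1..K}. r j * breg (y 1) (y j))"
    unfolding R_def sum_distrib_right sum_subtractf[symmetric]
    by (intro sum.cong refl) (simp add: algebra_simps)
  finally have 2: "gain' (y 1) * ((\<Sum>j\<in>{1..K}. r j * y j) - y 1)
    = (\<Sum>j\<in>{1..K}. r j * gain (y j)) - R * gain (y 1) - (\<Sum>j\<in>{1..K}. r j * breg (y 1) (y j)) - gain' (y 1) * y 1 * (1 - R)" .
  have 3: "- (gain' (y 1) * y 1 * (1 - R)) \<le> 3 * y 1 * \<eta>"
  proof -
    have "- gain' (y 1) \<le> 3" using gain'_abs[OF y1] by linarith
    moreover have "0 \<le> y 1 * (1 - R)" using y1 R by simp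
    ultimately have "(- gain' (y 1)) * (y 1 * (1 - R)) \<le> 3 * (y 1 * (1 - R))" by (rule mult_right_mono)
    moreover have "y 1 * (1 - R) \<le> y 1 * \<eta>" using y1 R by (intro mult_left_mono) auto
    moreover have "- (gain' (y 1) * y 1 * (1 - R)) = (- gain' (y 1)) * (y 1 * (1 - R))" by (simp only: mult.assoc minus_mult_left)
    ultimately show ?thesis by linarith
  qed
  have 4: "gain (y 1) * (1 - R) \<le> (1 + y 1) * \<eta>"
    using gain_le[OF y1] gain_nonneg[OF y1] R good y1 by (intro mult_mono) auto
  have 5: "0 \<le> r K * repro (Suc K) * gain (y K)"
    using r_pos[of K] repro_pos[of "Suc K"] gain_nonneg[OF y[OF K]] by simp
  have "repro 1 * gain' (y 1) * ((\<Sum>j\<in>{1..K}. r j * y j) - y 1)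
    = repro 1 * (\<Sum>j\<in>{1..K}. r j * gain (y j)) - repro 1 * (R * gain (y 1)) - repro 1 * (\<Sum>j\<in>{1..K}. r j * breg (y 1) (y j))
      + repro 1 * (- (gain' (y 1) * y 1 * (1 - R)))"
    unfolding mult.assoc 2[unfolded mult.assoc] by (simp add: algebra_simps)
  moreover have "repro 1 * (- (gain' (y 1) * y 1 * (1 - R))) \<le> repro 1 * (3 * y 1 * \<eta>)"
    using 3 H by (intro mult_left_mono) auto
  moreover have "repro 1 * (gain (y 1) * (1 - R)) \<le> repro 1 * ((1 + y 1) * \<eta>)"
    using 4 H by (intro mult_left_mono) auto
  moreover have "repro 1 * (gain (y 1) * (1 - R)) = repro 1 * gain (y 1) - repro 1 * (R * gain (y 1))" by (simp add: algebra_simps)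
  moreover have "repro 1 * ((1 + y 1) * \<eta>) + repro 1 * (3 * y 1 * \<eta>) \<le> 4 * repro 1 * (1 + y 1) * \<eta>"
    using H good y1 by (simp add: algebra_simps)
  moreover note flow_telescope[OF K, of "\<lambda>k. gain (y k)"]
  ultimately show ?thesis using 1 5 by linarith
qed

end

section \<open>Drift and increments of the divergence\<close>

context sublinear_attachment
begin

text \<open>First-order term of the increment of \<open>lyap K\<close> when a child of \<open>v\<close> is added.\<close>
definition lin :: "nat \<Rightarrow> nat list \<Rightarrow> nat \<Rightarrow> real" where
  "lin K p v = (\<Sum>k\<in>{1..K}. repro k * gain' (ratio K p k) *
     (degc (p @ [v]) k - degc p k - stat k * ratio K p k * (value_of K (p @ [v]) - value_of K p))) / value_of K p"

lemma deg_sum_drift: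
  "(\<Sum>v<length p. f (deg p (length p) v) * (deg_sum g (p @ [v]) - deg_sum g p))
    = g 1 * deg_sum f p + deg_sum (\<lambda>d. f d * (g (Suc d) - g d)) p"
proof -
  have "(\<Sum>v<length p. f (deg p (length p) v) * (deg_sum g (p @ [v]) - deg_sum g p))
    = (\<Sum>v<length p. g 1 * f (deg p (length p) v) + f (deg p (length p) v) * (g (Suc (deg p (length p) v)) - g (deg p (length p) v)))"
    by (intro sum.cong refl) (simp add: deg_sum_append algebra_simps)
  then show ?thesis by (simp add: sum.distrib deg_sum_def sum_distrib_left)
qed

lemma degc_0: "degc p 0 = 0"
  by (simp add: degc_def deg_sum_def deg_def)

lemma degc_drift:
  assumes "1 \<le> k"
  shows "(\<Sum>v<length p. f (deg p (length p) v) * (degc (p @ [v]) k - degc p k))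
    = (if k = 1 then deg_sum f p else 0) + f (k - 1) * degc p (k - 1) - f k * degc p k"
proof -
  have "deg_sum (\<lambda>d. f d * ((if Suc d = k then 1 else 0) - (if d = k then 1 else 0))) p
    = deg_sum (\<lambda>d. f (k - 1) * (if d = k - 1 then 1 else 0) - f k * (if d = k then 1 else 0)) p"
    unfolding deg_sum_def using assms by (intro sum.cong refl) auto
  also have "\<dots> = f (k - 1) * degc p (k - 1) - f k * degc p k"
    unfolding degc_def deg_sum_def by (simp only: sum_subtractf sum_distrib_left)
  finally show ?thesis unfolding degc_def[of _ k] deg_sum_drift by (auto simp: degc_def)
qed

text \<open>Below degree \<open>K\<close> the eigenfunction relation is exact. From \<open>K\<close>
  on the capped value is constant, and the defect is bounded by
  \<open>f d * repro 1 + lam * repro K\<close>, a small multiple of \<open>d\<close> at a good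
  level.\<close>

lemma value_drift:
  assumes K: "good_level \<eta> K" "0 \<le> \<eta>" and p: "vtree p"
  shows "\<bar>(\<Sum>v<length p. f (deg p (length p) v) * (value_of K (p @ [v]) - value_of K p)) - lam * value_of K p\<bar>
    \<le> 2 * (\<eta> * (repro 1 + lam)) * real (length p)"
proof -
  have K1: "1 \<le> K" using K by (simp add: good_level_def)
  have H1: "0 < repro 1" by (rule repro_pos) simp
  define g where "g d = f d * repro 1 + f d * (capped K (Suc d) - capped K d) - lam * capped K d" for d
  have "(\<Sum>v<length p. f (deg p (length p) v) * (value_of K (p @ [v]) - value_of K p)) - lam * value_of K p = deg_sum g p"
  proof -
    have "capped K 1 = repro 1" using K1 by (simp add: capped_def min_def)
    then show ?thesis unfolding value_of_def deg_sum_drift g_def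
      by (simp add: deg_sum_def sum.distrib sum_subtractf sum_distrib_left mult.commute)
  qed
  moreover have "\<bar>deg_sum g p\<bar> \<le> deg_sum (\<lambda>d. \<bar>g d\<bar>) p"
    unfolding deg_sum_def by (rule sum_abs)
  moreover have "deg_sum (\<lambda>d. \<bar>g d\<bar>) p \<le> 2 * (\<eta> * (repro 1 + lam)) * real (length p)"
  proof (rule deg_sum_le_linear[OF p])
    fix d :: nat assume d: "1 \<le> d"
    show "\<bar>g d\<bar> \<le> \<eta> * (repro 1 + lam) * real d"
    proof (cases "d < K")
      case True
      then have "capped K d = repro d" "capped K (Suc d) = repro (Suc d)" by (auto simp: capped_def min_def Suc_le_eq)
      then have "g d = f d * (repro 1 + repro (Suc d) - repro d) - lam * repro d" by (simp add: g_def algebra_simps)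
      then have "g d = 0" using repro_generator[OF d] by simp
      then show ?thesis using K H1 lam_pos by simp
    next
      case False
      then have c: "capped K d = repro K" "capped K (Suc d) = repro K" by (auto simp: capped_def min_def)
      have fd: "0 < f d" "f d \<le> \<eta> * real d" using f_gt0[OF d] K False by (auto simp: good_level_def)
      have "repro K \<le> \<eta> * real K" using K by (auto simp: good_level_def)
      also have "\<dots> \<le> \<eta> * real d" using False K by (intro mult_left_mono) auto
      finally have rK: "0 < repro K" "repro K \<le> \<eta> * real d" using repro_pos[OF K1] by auto
      have "\<bar>g d\<bar> \<le> f d * repro 1 + lam * repro K"
      proof -
        have "0 < f d * repro 1" "0 < lam * repro K" using fd H1 rK lam_pos by auto
        then show ?thesis unfolding g_def c by (simp add: abs_le_iff)
      qed
      also have "\<dots> \<le> \<eta> * real d * repro 1 + lam * (\<eta> * real d)"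
        using fd rK H1 lam_pos by (intro add_mono mult_right_mono mult_left_mono) auto
      finally show ?thesis by (simp add: algebra_simps)
    qed
  qed (use K H1 lam_pos in simp)
  ultimately show ?thesis by linarith
qed

lemma tail_f_le:
  assumes K: "good_level \<eta> m" "0 \<le> \<eta>" and p: "vtree p" and c: "0 \<le> c" "c \<le> lam"
  shows "deg_sum (\<lambda>d. if m < d then f d + c else 0) p \<le> 2 * (2 * \<eta>) * real (length p)"
proof (rule deg_sum_le_linear[OF p])
  fix d :: nat assume d: "1 \<le> d"
  show "(if m < d then f d + c else 0) \<le> 2 * \<eta> * real d"
  proof (cases "m < d")
    case True
    have "lam \<le> \<eta> * real m" "f d \<le> \<eta> * real d" using K True by (auto simp: good_level_def)
    moreover have "\<eta> * real m \<le> \<eta> * real d" using True K by (intro mult_left_mono) auto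
    ultimately show ?thesis using True c by simp
  qed (use K in simp)
qed (use K in simp)

lemma tail_capped_le:
  assumes m: "good_level \<eta> m" "0 \<le> \<eta>" "m \<le> K" and p: "vtree p"
  shows "deg_sum (\<lambda>d. if m < d then capped K d else 0) p \<le> 2 * \<eta> * real (length p)"
proof (rule deg_sum_le_linear[OF p m(2)])
  fix d :: nat assume d: "1 \<le> d"
  show "(if m < d then capped K d else 0) \<le> \<eta> * real d"
  proof (cases "m < d")
    case True
    then have "repro (min d K) \<le> \<eta> * real (min d K)" using m by (auto simp: good_level_def)
    also have "\<dots> \<le> \<eta> * real d" using m by (intro mult_left_mono) auto
    finally show ?thesis using True by (simp add: capped_def)
  qed (use m in simp)
qed

text \<open>Collects the coefficients of \<open>\<eta>\<close>: the error of
  \<open>drift_algebra\<close> with the a priori bound for the first ratio, the weight beyond degree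
  \<open>K\<close> (12 = 3 * 4), and the defect of the value growth (6 = 3 * 2), where 3 bounds
  \<open>gain'\<close>.\<close>

definition drift_const where
  "drift_const = lam * (4 * repro 1 * (1 + 1 / (stat 1 * repro 1))) + (12 * repro 1 + 6 * (repro 1 + lam)) / repro_min"

lemma drift_const_nonneg: "0 \<le> drift_const"
  unfolding drift_const_def using lam_pos repro_pos[of 1] stat_pos[of 1] repro_min(1)
  by (intro add_nonneg_nonneg mult_nonneg_nonneg divide_nonneg_nonneg) auto

text \<open>Written through the ratios, the drifts of the counts and of the value are all multiples
  of the total value. It cancels against the denominator of \<open>lin\<close>, and the expression
  of \<open>drift_algebra\<close> remains.\<close>

lemma drift_lyap:
  assumes K: "good_level \<eta> K" "0 \<le> \<eta>" and p: "vtree p"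
  shows "(\<Sum>v<length p. f (deg p (length p) v) * lin K p v)
    \<le> - (lam * repro 1) * (\<Sum>j\<in>{1..K}. r j * breg (ratio K p 1) (ratio K p j)) + drift_const * \<eta>"
proof -
  define V where "V = value_of K p"
  define y where "y = ratio K p"
  define n where "n = real (length p)"
  define F where "F = deg_sum (\<lambda>d. if K < d then f d else 0) p"
  define e where "e = (\<Sum>v<length p. f (deg p (length p) v) * (value_of K (p @ [v]) - value_of K p)) - lam * V"
  \<comment> \<open>Drift of the count of degree \<open>k\<close>, corrected by the growth of the
    total value: up to the factor \<open>stat k * V\<close>, the first-order drift of the
    ratio.\<close>
  define A where "A k = (\<Sum>v<length p. f (deg p (length p) v) * (degc (p @ [v]) k - degc p k))
     - stat k * y k * (lam * V + e)" for k
  have K1: "1 \<le> K" and KR: "1 - \<eta> \<le> (\<Sum>k\<in>{1..K}. r k)" using K by (auto simp: good_level_def)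
  have n: "0 < n" using p by (simp add: n_def vtree_def)
  have V: "0 < V" "repro_min * n \<le> V" unfolding V_def n_def using value_pos[OF K1 p] value_ge[OF K1] by auto
  have H1: "0 < repro 1" by (rule repro_pos) simp
  have y0: "0 \<le> y k" if "1 \<le> k" for k unfolding y_def by (rule ratio_nonneg[OF K1 p that])
  have N: "degc p k = stat k * y k * V" if "1 \<le> k" for k unfolding y_def V_def by (rule degc_ratio[OF K1 p that])
  have e: "\<bar>e\<bar> \<le> 2 * (\<eta> * (repro 1 + lam)) * n" unfolding e_def V_def n_def by (rule value_drift[OF K p])
  have F: "0 \<le> F" "F \<le> 2 * (2 * \<eta>) * n"
  proof -
    show "F \<le> 2 * (2 * \<eta>) * n" unfolding F_def n_def using tail_f_le[OF K p, of 0] lam_pos by (simp cong: if_cong)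
    show "0 \<le> F" unfolding F_def deg_sum_def using f_gt0 by (intro sum_nonneg) (auto intro: less_imp_le)
  qed
  have S: "deg_sum f p = lam * V * (\<Sum>j\<in>{1..K}. r j * y j) + F"
  proof -
    have "(\<Sum>k\<in>{1..K}. f k * degc p k) = lam * V * (\<Sum>j\<in>{1..K}. r j * y j)"
      unfolding sum_distrib_left
    proof (intro sum.cong refl)
      fix k assume "k \<in> {1..K}"
      then have k: "1 \<le> k" by simp
      have "f k * degc p k = (f k * stat k) * y k * V" unfolding N[OF k] by (simp only: mult_ac)
      also have "\<dots> = lam * V * (r k * y k)" unfolding stat_up[OF k] by (simp only: mult_ac)
      finally show "f k * degc p k = lam * V * (r k * y k)" .
    qed
    then show ?thesis unfolding F_def by (subst deg_sum_split[of f p K]) simp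
  qed
  \<comment> \<open>Every step creates a vertex of degree 1, so the inflow is the total weight. The
    outflow and the correction for the growing value combine to \<open>lam\<close> by
    \<open>stat_out\<close>.\<close>
  have A1: "A 1 = V * (lam * ((\<Sum>j\<in>{1..K}. r j * y j) - y 1)) + F - stat 1 * y 1 * e"
  proof -
    have "A 1 = deg_sum f p - (f 1 * stat 1 + stat 1 * lam) * (y 1 * V) - stat 1 * y 1 * e"
      unfolding A_def degc_drift[OF order_refl] using degc_0[of p] N[of 1] by (simp add: algebra_simps)
    also have "f 1 * stat 1 + stat 1 * lam = lam" using stat_out[of 1] by (simp add: algebra_simps)
    finally show ?thesis unfolding S by (simp add: algebra_simps)
  qed
  have Ak: "A k = V * (lam * (r (k - 1) * (y (k - 1) - y k))) - stat k * y k * e" if "k \<in> {2..K}" for k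
  proof -
    have k: "1 \<le> k" "1 \<le> k - 1" "k \<noteq> 1" using that by auto
    have "A k = (f (k - 1) * stat (k - 1)) * (y (k - 1) * V) - ((lam + f k) * stat k) * (y k * V) - stat k * y k * e"
      unfolding A_def degc_drift[OF k(1)] unfolding N[OF k(1)] N[OF k(2)] using k by (simp add: algebra_simps)
    then show ?thesis unfolding stat_up[OF k(2)] stat_out[OF k(1)] by (simp add: algebra_simps)
  qed
  have split: "(\<Sum>k\<in>{1..K}. G k) = G 1 + (\<Sum>k\<in>{2..K}. G k)" for G :: "nat \<Rightarrow> real"
  proof -
    have "{1..K} = insert 1 {2..K}" using K1 by auto
    then show ?thesis by simp
  qed
  have "(\<Sum>v<length p. f (deg p (length p) v) * lin K p v) = (\<Sum>k\<in>{1..K}. repro k * gain' (y k) * A k) / V"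
  proof -
    have "(\<Sum>v<length p. f (deg p (length p) v) * lin K p v)
      = (\<Sum>v<length p. \<Sum>k\<in>{1..K}. repro k * gain' (y k) * (f (deg p (length p) v) * (degc (p @ [v]) k - degc p k)
          - stat k * y k * (f (deg p (length p) v) * (value_of K (p @ [v]) - value_of K p)))) / V"
      unfolding lin_def y_def[symmetric] V_def[symmetric] times_divide_eq_right sum_divide_distrib[symmetric] sum_distrib_left
      by (intro arg_cong[where f = "\<lambda>x. x / V"] sum.cong refl) (simp add: algebra_simps V_def)
    also have "\<dots> = (\<Sum>k\<in>{1..K}. \<Sum>v<length p. repro k * gain' (y k) * (f (deg p (length p) v) * (degc (p @ [v]) k - degc p k)
          - stat k * y k * (f (deg p (length p) v) * (value_of K (p @ [v]) - value_of K p)))) / V"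
      by (subst sum.swap) simp
    also have "\<dots> = (\<Sum>k\<in>{1..K}. repro k * gain' (y k) * A k) / V"
      unfolding A_def e_def by (simp add: sum_distrib_left[symmetric] sum_subtractf)
    finally show ?thesis .
  qed
  also have "(\<Sum>k\<in>{1..K}. repro k * gain' (y k) * A k)
    = V * (lam * ((\<Sum>k\<in>{2..K}. r (k - 1) * repro k * gain' (y k) * (y (k - 1) - y k))
        + repro 1 * gain' (y 1) * ((\<Sum>j\<in>{1..K}. r j * y j) - y 1)))
      + repro 1 * gain' (y 1) * F - e * (\<Sum>k\<in>{1..K}. stat k * repro k * y k * gain' (y k))"
  proof -
    have "(\<Sum>k\<in>{2..K}. repro k * gain' (y k) * A k)
      = V * (lam * (\<Sum>k\<in>{2..K}. r (k - 1) * repro k * gain' (y k) * (y (k - 1) - y k))) - e * (\<Sum>k\<in>{2..K}. stat k * repro k * y k * gain' (y k))"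
      unfolding sum_distrib_left sum_subtractf[symmetric] by (intro sum.cong refl) (simp add: Ak algebra_simps)
    then show ?thesis unfolding split[of "\<lambda>k. repro k * gain' (y k) * A k"] A1
        split[of "\<lambda>k. stat k * repro k * y k * gain' (y k)"] by (simp add: algebra_simps)
  qed
  also have "(V * (lam * ((\<Sum>k\<in>{2..K}. r (k - 1) * repro k * gain' (y k) * (y (k - 1) - y k))
        + repro 1 * gain' (y 1) * ((\<Sum>j\<in>{1..K}. r j * y j) - y 1)))
      + repro 1 * gain' (y 1) * F - e * (\<Sum>k\<in>{1..K}. stat k * repro k * y k * gain' (y k))) / V
    = lam * ((\<Sum>k\<in>{2..K}. r (k - 1) * repro k * gain' (y k) * (y (k - 1) - y k))
        + repro 1 * gain' (y 1) * ((\<Sum>j\<in>{1..K}. r j * y j) - y 1))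
      + repro 1 * gain' (y 1) * F / V - e / V * (\<Sum>k\<in>{1..K}. stat k * repro k * y k * gain' (y k))"
    using V by (simp add: add_divide_distrib diff_divide_distrib)
  also have "\<dots> \<le> lam * (- repro 1 * (\<Sum>j\<in>{1..K}. r j * breg (y 1) (y j)) + 4 * repro 1 * (1 + 1 / (stat 1 * repro 1)) * \<eta>)
      + 12 * repro 1 / repro_min * \<eta> + 6 * (repro 1 + lam) / repro_min * \<eta>"
  proof -
    have "4 * repro 1 * (1 + y 1) * \<eta> \<le> 4 * repro 1 * (1 + 1 / (stat 1 * repro 1)) * \<eta>"
      using ratio_le[OF K1 p order_refl K1] H1 K unfolding y_def
      by (intro mult_right_mono mult_left_mono add_left_mono) auto
    then have 1: "lam * ((\<Sum>k\<in>{2..K}. r (k - 1) * repro k * gain' (y k) * (y (k - 1) - y k))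
        + repro 1 * gain' (y 1) * ((\<Sum>j\<in>{1..K}. r j * y j) - y 1))
      \<le> lam * (- repro 1 * (\<Sum>j\<in>{1..K}. r j * breg (y 1) (y j)) + 4 * repro 1 * (1 + 1 / (stat 1 * repro 1)) * \<eta>)"
    proof (intro mult_left_mono)
      have "(\<Sum>k\<in>{2..K}. r (k - 1) * repro k * gain' (y k) * (y (k - 1) - y k))
        + repro 1 * gain' (y 1) * ((\<Sum>j\<in>{1..K}. r j * y j) - y 1)
        \<le> - repro 1 * (\<Sum>j\<in>{1..K}. r j * breg (y 1) (y j)) + 4 * repro 1 * (1 + y 1) * \<eta>"
        by (rule drift_algebra[OF K1 KR K(2)]) (rule y0)
      then show "(\<Sum>k\<in>{2..K}. r (k - 1) * repro k * gain' (y k) * (y (k - 1) - y k))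
        + repro 1 * gain' (y 1) * ((\<Sum>j\<in>{1..K}. r j * y j) - y 1)
        \<le> - repro 1 * (\<Sum>j\<in>{1..K}. r j * breg (y 1) (y j)) + 4 * repro 1 * (1 + 1 / (stat 1 * repro 1)) * \<eta>"
        using \<open>4 * repro 1 * (1 + y 1) * \<eta> \<le> 4 * repro 1 * (1 + 1 / (stat 1 * repro 1)) * \<eta>\<close> by linarith
    qed (use lam_pos in simp)
    have Vn: "z / V \<le> x / repro_min" if "z \<le> x * n" "0 \<le> x" for z x
    proof -
      have "z / V \<le> x * n / V" using that V by (intro divide_right_mono) auto
      also have "\<dots> \<le> x * n / (repro_min * n)" using that V n repro_min(1) by (intro divide_left_mono) auto
      also have "\<dots> = x / repro_min" using n by simp
      finally show ?thesis .
    qed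
    have g1: "gain' (y 1) \<le> 3" using gain'_abs[OF y0[of 1]] by simp
    have "repro 1 * gain' (y 1) * F \<le> repro 1 * 3 * F" using H1 g1 F by (intro mult_right_mono mult_left_mono) auto
    also have "\<dots> \<le> repro 1 * 3 * (2 * (2 * \<eta>) * n)" using H1 F by (intro mult_left_mono) auto
    also have "\<dots> = (12 * repro 1 * \<eta>) * n" by simp
    finally have 2: "repro 1 * gain' (y 1) * F / V \<le> 12 * repro 1 * \<eta> / repro_min"
      using H1 K by (intro Vn) auto
    have s: "\<bar>\<Sum>k\<in>{1..K}. stat k * repro k * y k * gain' (y k)\<bar> \<le> 3"
    proof -
      have "\<bar>\<Sum>k\<in>{1..K}. stat k * repro k * y k * gain' (y k)\<bar> \<le> (\<Sum>k\<in>{1..K}. stat k * repro k * y k * 3)"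
      proof (rule order_trans[OF sum_abs], rule sum_mono)
        fix k assume "k \<in> {1..K}"
        then have k: "1 \<le> k" by simp
        have "0 \<le> stat k * repro k * y k" using weight_pos[OF k] y0[OF k] by simp
        then show "\<bar>stat k * repro k * y k * gain' (y k)\<bar> \<le> stat k * repro k * y k * 3"
          using gain'_abs[OF y0[OF k]] by (simp only: abs_mult[of "stat k * repro k * y k"] abs_of_nonneg) (intro mult_left_mono)
      qed
      also have "\<dots> = 3 * (\<Sum>k\<in>{1..K}. stat k * repro k * y k)" by (simp add: sum_distrib_left mult_ac)
      also have "\<dots> \<le> 3" using ratio_sum_le[OF K1 p order_refl] by (simp add: y_def)
      finally show ?thesis .
    qed
    have "- (e * (\<Sum>k\<in>{1..K}. stat k * repro k * y k * gain' (y k))) \<le> \<bar>e\<bar> * \<bar>\<Sum>k\<in>{1..K}. stat k * repro k * y k * gain' (y k)\<bar>"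
      unfolding abs_mult[symmetric] by (rule abs_ge_minus_self)
    also have "\<dots> \<le> (2 * (\<eta> * (repro 1 + lam)) * n) * 3"
      by (rule mult_mono[OF e s order_trans[OF abs_ge_zero e] abs_ge_zero])
    also have "\<dots> = (6 * (repro 1 + lam) * \<eta>) * n" by simp
    finally have "- (e * (\<Sum>k\<in>{1..K}. stat k * repro k * y k * gain' (y k))) / V \<le> 6 * (repro 1 + lam) * \<eta> / repro_min"
      using H1 K lam_pos by (intro Vn) auto
    then have 3: "- (e / V * (\<Sum>k\<in>{1..K}. stat k * repro k * y k * gain' (y k))) \<le> 6 * (repro 1 + lam) / repro_min * \<eta>"
      by simp
    show ?thesis using 1 2 3 by simp
  qed
  also have "\<dots> = - (lam * repro 1) * (\<Sum>j\<in>{1..K}. r j * breg (y 1) (y j)) + drift_const * \<eta>"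
    by (simp add: drift_const_def algebra_simps add_divide_distrib)
  finally show ?thesis by (simp add: y_def)
qed

text \<open>For fixed \<open>K\<close> a step changes counts and value by bounded amounts, while the
  value is at least a multiple of \<open>n\<close>. Ratios thus move by \<open>O(1 / n)\<close>, and
  the second-order terms are \<open>O(1 / n^2)\<close>.\<close>

lemma lyap_taylor:
  assumes K: "1 \<le> K"
  shows "\<exists>C\<ge>0. \<forall>p v. vtree p \<longrightarrow> v < length p \<longrightarrow>
    lyap K (p @ [v]) - lyap K p \<le> lin K p v + C / (real (length p))\<^sup>2 \<and>
    \<bar>lyap K (p @ [v]) - lyap K p\<bar> \<le> C / real (length p)"
proof -
  define c where "c = repro_min"
  have c: "0 < c" "\<And>k. 1 \<le> k \<Longrightarrow> c \<le> repro k" unfolding c_def using repro_min by auto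
  define B where "B = 3 * slope * real K"
  \<comment> \<open>Bound for the numerator of a ratio increment: a count changes by at most 2, the
    value by at most \<open>B\<close>, and \<open>stat k * y k\<close> is at most
    \<open>1 / c\<close>.\<close>
  define G where "G = 2 + B / c"
  have B: "0 \<le> B" using slope(1) by (simp add: B_def)
  have G: "0 \<le> G" using B c by (simp add: G_def)
  define c1 where "c1 k = 3 * G * B / c\<^sup>2 + 4 * G\<^sup>2 / (stat k * c\<^sup>2)" for k
  define C1 where "C1 = (\<Sum>k\<in>{1..K}. repro k * c1 k)"
  define C2 where "C2 = (\<Sum>k\<in>{1..K}. repro k * (3 * G / c))"
  have c1: "0 \<le> c1 k" if "1 \<le> k" for k unfolding c1_def using G B c stat_pos[OF that] by simp
  have C1: "0 \<le> C1" unfolding C1_def using repro_pos c1 by (intro sum_nonneg mult_nonneg_nonneg) (auto intro: less_imp_le)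
  have C2: "0 \<le> C2" unfolding C2_def using repro_pos G c by (intro sum_nonneg mult_nonneg_nonneg) (auto intro: less_imp_le)
  have main: "lyap K (p @ [v]) - lyap K p \<le> lin K p v + C1 / (real (length p))\<^sup>2 \<and>
    \<bar>lyap K (p @ [v]) - lyap K p\<bar> \<le> C2 / real (length p)" if p: "vtree p" "v < length p" for p v
  proof -
    define n where "n = real (length p)"
    have n: "0 < n" using p by (auto simp: n_def)
    have p': "vtree (p @ [v])" using p by (auto simp: vtree_def nth_append less_Suc_eq)
    define V V' where "V = value_of K p" and "V' = value_of K (p @ [v])"
    define d where "d k = degc (p @ [v]) k - degc p k" for k
    define y y' where "y = ratio K p" and "y' = ratio K (p @ [v])"
    define g where "g k = d k - stat k * y k * (V' - V)" for k
    have V: "0 < V" "c * n \<le> V" unfolding V_def n_def c_def using value_pos[OF K p(1)] value_ge[OF K] by auto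
    have V': "0 < V'" "c * n \<le> V'"
    proof -
      show "0 < V'" unfolding V'_def by (rule value_pos[OF K p'])
      have "c * n \<le> c * (n + 1)" using c by simp
      also have "\<dots> \<le> V'" unfolding V'_def c_def n_def using value_ge[OF K, of "p @ [v]"] by (simp add: add.commute)
      finally show "c * n \<le> V'" .
    qed
    have cap: "0 \<le> capped K i \<and> capped K i \<le> slope * real K" if "1 \<le> i" for i
    proof -
      have "capped K i \<le> slope * real (min i K)" unfolding capped_def using that K by (intro slope) simp
      also have "\<dots> \<le> slope * real K" using slope(1) by (intro mult_left_mono) auto
      finally show ?thesis using capped_pos[OF K that] by simp
    qed
    have dV: "\<bar>V' - V\<bar> \<le> B"
      unfolding V_def V'_def value_of_def deg_sum_append[OF p(2)] B_def
      using cap[of 1] cap[of "Suc (deg p (length p) v)"] cap[of "deg p (length p) v"] by (simp add: abs_le_iff)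
    have dN: "\<bar>d k\<bar> \<le> 2" for k unfolding d_def degc_def deg_sum_append[OF p(2)] by auto
    have per: "gain (y' k) - gain (y k) \<le> gain' (y k) * g k / (stat k * V) + c1 k / (stat k * n\<^sup>2) \<and>
      \<bar>gain (y' k) - gain (y k)\<bar> \<le> 3 * G / c / (stat k * n)" if k: "k \<in> {1..K}" for k
    proof -
      have k1: "1 \<le> k" "k \<le> K" using k by auto
      have st: "0 < stat k" by (rule stat_pos[OF k1(1)])
      have yn: "0 \<le> y k" "0 \<le> y' k" unfolding y_def y'_def
        using ratio_nonneg[OF K p(1) k1(1)] ratio_nonneg[OF K p' k1(1)] by auto
      have sy: "stat k * y k \<le> 1 / c"
      proof -
        have "y k \<le> 1 / (stat k * repro k)" unfolding y_def by (rule ratio_le[OF K p(1) k1])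
        then have "stat k * y k \<le> stat k * (1 / (stat k * repro k))" using st by (intro mult_left_mono) auto
        also have "\<dots> = 1 / repro k" using st by simp
        also have "\<dots> \<le> 1 / c" using c k1 by (intro divide_left_mono mult_pos_pos) (auto intro: repro_pos)
        finally show ?thesis .
      qed
      have gG: "\<bar>g k\<bar> \<le> G"
      proof -
        have "\<bar>g k\<bar> \<le> \<bar>d k\<bar> + \<bar>stat k * y k * (V' - V)\<bar>" unfolding g_def by (rule abs_triangle_ineq4)
        also have "\<bar>stat k * y k * (V' - V)\<bar> = stat k * y k * \<bar>V' - V\<bar>" using st yn by (simp add: abs_mult)
        also have "\<dots> \<le> 1 / c * B" using sy dV st yn c by (intro mult_mono) auto
        finally show ?thesis using dN[of k] by (simp add: G_def)
      qed
      have N: "degc p k = stat k * y k * V" "degc (p @ [v]) k = stat k * y' k * V'"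
        unfolding y_def y'_def V_def V'_def using degc_ratio[OF K p(1) k1(1)] degc_ratio[OF K p' k1(1)] by auto
      have D: "y' k - y k = g k / (stat k * V')"
      proof -
        have "g k = stat k * V' * (y' k - y k)" unfolding g_def d_def N by (simp add: algebra_simps)
        then show ?thesis using st V' by simp
      qed
      have absD: "\<bar>y' k - y k\<bar> \<le> G / c / (stat k * n)"
      proof -
        have "\<bar>y' k - y k\<bar> = \<bar>g k\<bar> / (stat k * V')" unfolding D using st V' by (simp add: abs_mult)
        also have "\<dots> \<le> G / (stat k * V')" using gG st V' by (intro divide_right_mono) auto
        also have "\<dots> \<le> G / (stat k * (c * n))" using G st V' c n by (intro divide_left_mono mult_left_mono mult_pos_pos) auto
        finally show ?thesis by (simp add: mult_ac)
      qed
      have "gain (y' k) - gain (y k) = gain' (y k) * (y' k - y k) + breg (y k) (y' k)"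
        using gain_breg[OF yn] by linarith
      also have "breg (y k) (y' k) \<le> 4 * (y' k - y k)\<^sup>2" by (rule breg_le[OF yn])
      also have "(y' k - y k)\<^sup>2 \<le> (G / c / (stat k * n))\<^sup>2" using power_mono[OF absD abs_ge_zero, of 2] by (simp only: power2_abs)
      \<comment> \<open>The true increment has the new value \<open>V'\<close> in its denominator,
        \<open>lin\<close> the old value \<open>V\<close>; the difference is of second
        order.\<close>
      also have "gain' (y k) * (y' k - y k) = gain' (y k) * g k / (stat k * V) + - (gain' (y k) * g k * (V' - V)) / (stat k * V * V')"
        unfolding D using st V V' by (simp add: field_simps)
      also have "- (gain' (y k) * g k * (V' - V)) / (stat k * V * V') \<le> 3 * G * B / (stat k * (c * n) * (c * n))"
      proof -
        have "- (gain' (y k) * g k * (V' - V)) \<le> \<bar>gain' (y k)\<bar> * \<bar>g k\<bar> * \<bar>V' - V\<bar>"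
          unfolding abs_mult[symmetric] by (rule abs_ge_minus_self)
        also have "\<dots> \<le> 3 * G * B" using gain'_abs[OF yn(1)] gG dV G B by (intro mult_mono) auto
        finally have "- (gain' (y k) * g k * (V' - V)) / (stat k * V * V') \<le> 3 * G * B / (stat k * V * V')"
          using st V V' by (intro divide_right_mono) auto
        also have "\<dots> \<le> 3 * G * B / (stat k * (c * n) * (c * n))"
        proof (rule divide_left_mono)
          have "stat k * (c * n) \<le> stat k * V" using st V by (intro mult_left_mono) auto
          then show "stat k * (c * n) * (c * n) \<le> stat k * V * V'" using st V V' c n by (intro mult_mono) auto
          show "0 < stat k * V * V' * (stat k * (c * n) * (c * n))" using st V V' c n by simp
        qed (use G B in simp)
        finally show ?thesis .
      qed
      finally have "gain (y' k) - gain (y k) \<le> gain' (y k) * g k / (stat k * V) + 3 * G * B / (stat k * (c * n) * (c * n)) + 4 * (G / c / (stat k * n))\<^sup>2"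
        by simp
      moreover have "3 * G * B / (stat k * (c * n) * (c * n)) + 4 * (G / c / (stat k * n))\<^sup>2 = c1 k / (stat k * n\<^sup>2)"
        unfolding c1_def using st c n by (simp add: field_simps power2_eq_square)
      moreover have "\<bar>gain (y' k) - gain (y k)\<bar> \<le> 3 * (G / c / (stat k * n))"
        by (rule order_trans[OF gain_lipschitz[OF yn] mult_left_mono[OF absD]]) simp
      ultimately show ?thesis by simp
    qed
    have w: "0 < stat k * repro k" if "k \<in> {1..K}" for k using weight_pos[of k] that by simp
    have diff: "lyap K (p @ [v]) - lyap K p = (\<Sum>k\<in>{1..K}. stat k * repro k * (gain (y' k) - gain (y k)))"
      unfolding lyap_def y_def y'_def sum_subtractf[symmetric] by (intro sum.cong refl) (simp add: algebra_simps)
    have "lyap K (p @ [v]) - lyap K p \<le> (\<Sum>k\<in>{1..K}. stat k * repro k * (gain' (y k) * g k / (stat k * V) + c1 k / (stat k * n\<^sup>2)))"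
      unfolding diff using per w by (intro sum_mono mult_left_mono) (auto intro: less_imp_le)
    also have "\<dots> = (\<Sum>k\<in>{1..K}. repro k * gain' (y k) * g k / V + repro k * c1 k / n\<^sup>2)"
    proof (intro sum.cong refl)
      fix k assume "k \<in> {1..K}"
      then have "stat k \<noteq> 0" using stat_pos[of k] by simp
      then show "stat k * repro k * (gain' (y k) * g k / (stat k * V) + c1 k / (stat k * n\<^sup>2)) = repro k * gain' (y k) * g k / V + repro k * c1 k / n\<^sup>2"
        by (simp add: distrib_left)
    qed
    also have "\<dots> = lin K p v + C1 / n\<^sup>2"
      unfolding lin_def C1_def g_def d_def y_def V_def V'_def by (simp add: sum.distrib sum_divide_distrib)
    finally have 1: "lyap K (p @ [v]) - lyap K p \<le> lin K p v + C1 / n\<^sup>2" .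
    have "\<bar>lyap K (p @ [v]) - lyap K p\<bar> \<le> (\<Sum>k\<in>{1..K}. stat k * repro k * (3 * G / c / (stat k * n)))"
      unfolding diff
    proof (rule order_trans[OF sum_abs], rule sum_mono)
      fix k assume k: "k \<in> {1..K}"
      have "\<bar>stat k * repro k * (gain (y' k) - gain (y k))\<bar> = stat k * repro k * \<bar>gain (y' k) - gain (y k)\<bar>"
        using w[OF k] by (simp only: abs_mult[of "stat k * repro k"] abs_of_pos)
      also have "\<dots> \<le> stat k * repro k * (3 * G / c / (stat k * n))"
        using per[OF k] w[OF k] by (intro mult_left_mono) auto
      finally show "\<bar>stat k * repro k * (gain (y' k) - gain (y k))\<bar> \<le> stat k * repro k * (3 * G / c / (stat k * n))" .
    qed
    also have "\<dots> = (\<Sum>k\<in>{1..K}. repro k * (3 * G / c) / n)"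
    proof (intro sum.cong refl)
      fix k assume "k \<in> {1..K}"
      then have "stat k \<noteq> 0" using stat_pos[of k] by simp
      then show "stat k * repro k * (3 * G / c / (stat k * n)) = repro k * (3 * G / c) / n" by simp
    qed
    also have "\<dots> = C2 / n" unfolding C2_def by (simp only: sum_divide_distrib)
    finally show ?thesis using 1 by (simp add: n_def)
  qed
  show ?thesis
  proof (intro exI[of _ "C1 + C2"] conjI allI impI)
    show "0 \<le> C1 + C2" using C1 C2 by simp
    fix p v assume p: "vtree p" "v < length p"
    have "C1 / (real (length p))\<^sup>2 \<le> (C1 + C2) / (real (length p))\<^sup>2" "C2 / real (length p) \<le> (C1 + C2) / real (length p)"
      using C1 C2 by (intro divide_right_mono; simp)+
    then show "lyap K (p @ [v]) - lyap K p \<le> lin K p v + (C1 + C2) / (real (length p))\<^sup>2"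
      "\<bar>lyap K (p @ [v]) - lyap K p\<bar> \<le> (C1 + C2) / real (length p)" using main[OF p] by linarith+
  qed
qed

end

section \<open>Dissipation away from the limiting distribution\<close>

context sublinear_attachment
begin

text \<open>Small dissipation brings all ratios up to \<open>m\<close> close to the ratio of degree
  1, the mass identity brings that one close to 1, and then the divergence is small. Degrees above
  \<open>m\<close> contribute little because \<open>gain y \<le> 1 + y\<close> and both the limiting
  and the actual shares there are small. Both \<open>m\<close> and \<open>\<psi>\<close> are
  independent of \<open>K\<close>.\<close>

lemma dissipation_lower_bound:
  assumes \<epsilon>: "0 < \<epsilon>"
  shows "\<exists>m \<psi>. 1 \<le> m \<and> 0 < \<psi> \<and> (\<forall>K p. m \<le> K \<longrightarrow> vtree p \<longrightarrow> \<epsilon> \<le> lyap K p \<longrightarrow>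
    \<psi> \<le> (\<Sum>j\<in>{1..m}. r j * breg (ratio K p 1) (ratio K p j)))"
proof -
  define c where "c = repro_min"
  have c: "0 < c" unfolding c_def by (rule repro_min)
  define Y where "Y j = 1 / (stat j * repro j)" for j
  have Y: "0 < Y j" if "1 \<le> j" for j unfolding Y_def using weight_pos[OF that] by simp
  \<comment> \<open>Such that the truncation errors \<open>\<eta>\<close>,
    \<open>\<eta> * (2 / c)\<close> and \<open>\<eta> * Y 1\<close> together amount to
    \<open>s / 4\<close>.\<close>
  define M where "M = 2 / c + Y 1 + 1"
  have M: "1 \<le> M" using c Y[of 1] by (simp add: M_def)
  define s where "s = min 1 (\<epsilon> / 4)"
  have s: "0 < s" "s \<le> 1" "s \<le> \<epsilon> / 4" using \<epsilon> by (auto simp: s_def)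
  define \<theta> where "\<theta> = s / 4"
  define \<eta> where "\<eta> = s / (4 * M)"
  have \<theta>: "0 < \<theta>" using s by (simp add: \<theta>_def)
  have \<eta>: "0 < \<eta>" using s M by (simp add: \<eta>_def)
  have \<eta>M: "\<eta> * M = s / 4" using M by (simp add: \<eta>_def)
  have \<eta>c: "\<eta> + \<eta> * (2 / c) + \<eta> * Y 1 = s / 4" using \<eta>M by (simp add: M_def algebra_simps)
  have \<eta>1: "0 \<le> \<eta> * (2 / c)" "0 \<le> \<eta> * Y 1" using \<eta> c Y[of 1] by auto
  obtain m where m: "good_level \<eta> m" using eventually_good_level[OF \<eta>] by (auto simp: eventually_sequentially)
  then have m1: "1 \<le> m" by (simp add: good_level_def)
  \<comment> \<open>The least dissipation at degree \<open>j\<close> when its ratio differs from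
    that of degree 1 by at least \<open>\<theta>\<close>, given the a priori bounds
    \<open>Y\<close>, which hold for every \<open>K\<close>.\<close>
  define \<psi>0 where "\<psi>0 j = r j * (4 * \<theta>\<^sup>2 / ((1 + Y 1)\<^sup>2 * (1 + Y j)))" for j
  define \<psi> where "\<psi> = Min (\<psi>0 ` {1..m})"
  have \<psi>0: "0 < \<psi>0 j" if "1 \<le> j" for j
    unfolding \<psi>0_def using r_pos[of j] \<theta> Y[OF that] Y[of 1] by (intro mult_pos_pos divide_pos_pos) (auto simp: zero_less_power add_pos_pos)
  have "\<psi> \<in> \<psi>0 ` {1..m}" unfolding \<psi>_def using m1 by (intro Min_in) auto
  then have \<psi>: "0 < \<psi>" using \<psi>0 by auto
  have \<psi>_le: "\<psi> \<le> \<psi>0 j" if "j \<in> {1..m}" for j unfolding \<psi>_def using that by (intro Min_le) auto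
  have "\<psi> \<le> (\<Sum>j\<in>{1..m}. r j * breg (ratio K p 1) (ratio K p j))"
    if K: "m \<le> K" and p: "vtree p" and L: "\<epsilon> \<le> lyap K p" for K p
  proof (rule ccontr)
    assume "\<not> \<psi> \<le> (\<Sum>j\<in>{1..m}. r j * breg (ratio K p 1) (ratio K p j))"
    then have lt: "(\<Sum>j\<in>{1..m}. r j * breg (ratio K p 1) (ratio K p j)) < \<psi>" by simp
    define y where "y = ratio K p"
    have K1: "1 \<le> K" using K m1 by simp
    have y0: "0 \<le> y k" if "1 \<le> k" for k unfolding y_def by (rule ratio_nonneg[OF K1 p that])
    have yY: "y k \<le> Y k" if "k \<in> {1..m}" for k unfolding y_def Y_def using that K by (intro ratio_le[OF K1 p]) auto
    have close: "\<bar>y j - y 1\<bar> \<le> \<theta>" if j: "j \<in> {1..m}" for j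
    proof (rule ccontr)
      assume "\<not> \<bar>y j - y 1\<bar> \<le> \<theta>"
      then have "\<theta>\<^sup>2 \<le> \<bar>y j - y 1\<bar>\<^sup>2" using \<theta> by (intro power_mono) auto
      then have "\<theta>\<^sup>2 \<le> (y j - y 1)\<^sup>2" by simp
      then have num: "4 * \<theta>\<^sup>2 \<le> 4 * (y j - y 1)\<^sup>2" by simp
      have yj: "0 \<le> y j" "y j \<le> Y j" "0 \<le> y 1" "y 1 \<le> Y 1" using y0[of 1] y0[of j] yY[OF j] yY[of 1] m1 j by auto
      then have den: "(1 + y 1)\<^sup>2 * (1 + y j) \<le> (1 + Y 1)\<^sup>2 * (1 + Y j)"
        by (intro mult_mono power_mono) auto
      have den0: "0 < (1 + y 1)\<^sup>2 * (1 + y j)" using yj by (intro mult_pos_pos zero_less_power) auto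
      have "4 * \<theta>\<^sup>2 / ((1 + Y 1)\<^sup>2 * (1 + Y j)) \<le> breg (y 1) (y j)"
        unfolding breg_def using num den den0 by (intro frac_le) auto
      then have "\<psi>0 j \<le> r j * breg (y 1) (y j)"
        unfolding \<psi>0_def using r_pos[of j] by (intro mult_left_mono) auto
      also have "\<dots> \<le> (\<Sum>j\<in>{1..m}. r j * breg (y 1) (y j))"
        using r_pos y0 j by (intro member_le_sum) (auto intro!: mult_nonneg_nonneg breg_nonneg simp: less_imp_le)
      finally show False using \<psi>_le[OF j] lt by (simp add: y_def)
    qed
    define t where "t = deg_sum (\<lambda>d. if m < d then capped K d else 0) p / value_of K p"
    have V: "0 < value_of K p" "c * real (length p) \<le> value_of K p"
      using value_pos[OF K1 p] value_ge[OF K1] by (auto simp: c_def)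
    have n: "0 < real (length p)" using p by (simp add: vtree_def)
    have t: "0 \<le> t" "t \<le> \<eta> * (2 / c)"
    proof -
      show "0 \<le> t" unfolding t_def using tail_capped_nonneg[OF K1] V by simp
      have "t \<le> (2 * \<eta> * real (length p)) / value_of K p"
        unfolding t_def using tail_capped_le[OF m _ K p] \<eta> V by (intro divide_right_mono) auto
      also have "\<dots> \<le> (2 * \<eta> * real (length p)) / (c * real (length p))"
        using V \<eta> n c by (intro divide_left_mono mult_pos_pos) auto
      also have "\<dots> = \<eta> * (2 / c)" using n by simp
      finally show "t \<le> \<eta> * (2 / c)" .
    qed
    have sum_y: "(\<Sum>k\<in>{1..m}. stat k * repro k * y k) = 1 - t"
      unfolding y_def t_def by (rule ratio_sum_split[OF K1 p K])
    define P where "P = (\<Sum>k\<in>{1..m}. stat k * repro k)"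
    have P: "1 - \<eta> \<le> P" "P \<le> 1" using m sum_weights_le by (auto simp: P_def good_level_def)
    have w: "0 \<le> stat k * repro k" if "k \<in> {1..m}" for k using weight_pos[of k] that by simp
    \<comment> \<open>The weighted ratios sum to \<open>1 - t\<close> while all are near
      \<open>y 1\<close> and the weights sum to \<open>P\<close>; with \<open>t\<close> small and
      \<open>P\<close> near 1 this forces \<open>y 1\<close> near 1.\<close>
    have "\<bar>(1 - t) - P * y 1\<bar> \<le> \<theta>"
    proof -
      have "(1 - t) - P * y 1 = (\<Sum>k\<in>{1..m}. stat k * repro k * (y k - y 1))"
        unfolding sum_y[symmetric] P_def sum_distrib_right sum_subtractf[symmetric] by (intro sum.cong refl) (simp add: algebra_simps)
      also have "\<bar>\<dots>\<bar> \<le> (\<Sum>k\<in>{1..m}. stat k * repro k * \<theta>)"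
      proof (rule order_trans[OF sum_abs], rule sum_mono)
        fix k assume k: "k \<in> {1..m}"
        show "\<bar>stat k * repro k * (y k - y 1)\<bar> \<le> stat k * repro k * \<theta>"
          unfolding abs_mult[of "stat k * repro k"] abs_of_nonneg[OF w[OF k]] by (rule mult_left_mono[OF close[OF k] w[OF k]])
      qed
      also have "\<dots> = P * \<theta>" by (simp add: P_def sum_distrib_right)
      also have "\<dots> \<le> \<theta>" using P(2) \<theta> by simp
      finally show ?thesis .
    qed
    moreover have "0 \<le> y 1 * (1 - P)" "y 1 * (1 - P) \<le> Y 1 * \<eta>"
      using y0[of 1] yY[of 1] P m1 \<eta> Y[of 1] by (simp, intro mult_mono) auto
    ultimately have y1: "\<bar>y 1 - 1\<bar> \<le> \<theta> + \<eta> * (2 / c) + \<eta> * Y 1"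
      using t by (simp add: abs_le_iff algebra_simps)
    have z: "\<bar>y k - 1\<bar> \<le> s" if "k \<in> {1..m}" for k
    proof -
      have "\<bar>y k - 1\<bar> \<le> \<bar>y k - y 1\<bar> + \<bar>y 1 - 1\<bar>" by linarith
      also have "\<dots> \<le> \<theta> + (\<theta> + \<eta> * (2 / c) + \<eta> * Y 1)" using close[OF that] y1 by linarith
      also have "\<dots> \<le> s" using \<eta>c \<eta> s by (simp add: \<theta>_def)
      finally show ?thesis .
    qed
    have un: "{1..K} = {1..m} \<union> {Suc m..K}" "{1..m} \<inter> {Suc m..K} = {}" using K by auto
    have split: "(\<Sum>k\<in>{1..K}. g k) = (\<Sum>k\<in>{1..m}. g k) + (\<Sum>k\<in>{Suc m..K}. g k)" for g :: "nat \<Rightarrow> real"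
      unfolding un(1) by (rule sum.union_disjoint) (use un(2) in auto)
    have "lyap K p = (\<Sum>k\<in>{1..m}. stat k * repro k * gain (y k)) + (\<Sum>k\<in>{Suc m..K}. stat k * repro k * gain (y k))"
      unfolding lyap_def y_def[symmetric] by (rule split)
    also have "(\<Sum>k\<in>{1..m}. stat k * repro k * gain (y k)) \<le> (\<Sum>k\<in>{1..m}. stat k * repro k * s)"
    proof (intro sum_mono mult_left_mono w)
      fix k assume k: "k \<in> {1..m}"
      then have "gain (y k) \<le> (y k - 1)\<^sup>2" by (intro gain_le_sq y0) simp
      also have "\<dots> \<le> s\<^sup>2" using z[OF k] power_mono[OF z[OF k] abs_ge_zero, of 2] by (simp only: power2_abs)
      also have "\<dots> \<le> s" using s by (simp add: power2_eq_square mult_left_le_one_le)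
      finally show "gain (y k) \<le> s" .
    qed
    also have "(\<Sum>k\<in>{1..m}. stat k * repro k * s) \<le> s"
    proof -
      have "(\<Sum>k\<in>{1..m}. stat k * repro k * s) = P * s" by (simp only: P_def sum_distrib_right)
      then show ?thesis using mult_right_mono[OF P(2), of s] s by simp
    qed
    also have "(\<Sum>k\<in>{Suc m..K}. stat k * repro k * gain (y k)) \<le> (\<Sum>k\<in>{Suc m..K}. stat k * repro k + stat k * repro k * y k)"
    proof (rule sum_mono)
      fix k assume "k \<in> {Suc m..K}"
      then have k: "1 \<le> k" by simp
      have "stat k * repro k * gain (y k) \<le> stat k * repro k * (1 + y k)"
        using gain_le[OF y0[OF k]] weight_pos[OF k] by (intro mult_left_mono) auto
      then show "stat k * repro k * gain (y k) \<le> stat k * repro k + stat k * repro k * y k" by (simp add: algebra_simps)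
    qed
    also have "\<dots> \<le> \<eta> + \<eta> * (2 / c)"
    proof -
      have "(\<Sum>k\<in>{Suc m..K}. stat k * repro k) \<le> \<eta>"
        using split[of "\<lambda>k. stat k * repro k"] sum_weights_le[of K] P by (simp add: P_def)
      moreover have "(\<Sum>k\<in>{Suc m..K}. stat k * repro k * y k) \<le> t"
        using split[of "\<lambda>k. stat k * repro k * y k"] ratio_sum_le[OF K1 p order_refl] sum_y by (simp add: y_def)
      ultimately show ?thesis using t by (simp add: sum.distrib)
    qed
    finally have "lyap K p \<le> s + (\<eta> + \<eta> * (2 / c))" by simp
    then show False using L \<eta>c \<eta>1 s by linarith
  qed
  then show ?thesis using m1 \<psi> by blast
qed

end

text \<open>As long as \<open>Z\<close> exceeds \<open>e\<close> it loses a multiple of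
  \<open>1 / n\<close> per step, which the divergence of the harmonic series limits to finitely many
  steps. Once \<open>c \<le> n\<close>, the bound \<open>e\<close> is preserved.\<close>

lemma eventually_le_of_contraction:
  fixes Z :: "nat \<Rightarrow> real"
  assumes c: "0 < c" and rec: "eventually (\<lambda>n. Z (Suc n) \<le> Z n - c / real n * Z n) sequentially" and e: "0 < e"
  shows "eventually (\<lambda>n. Z n \<le> e) sequentially"
proof -
  obtain N0 where N0: "\<And>n. n \<ge> N0 \<Longrightarrow> Z (Suc n) \<le> Z n - c / real n * Z n" using rec by (auto simp: eventually_sequentially)
  obtain N1 :: nat where N1: "c \<le> real N1" using real_arch_simple by blast
  define N where "N = max (max N0 N1) 1"
  have step: "Z (Suc n) \<le> e" if n: "N \<le> n" and Z: "Z n \<le> e" for n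
  proof -
    have nn: "0 < real n" "c \<le> real n" "N0 \<le> n" using n N1 by (auto simp: N_def)
    have f: "0 \<le> 1 - c / real n" "1 - c / real n \<le> 1" using nn c by auto
    have "Z (Suc n) \<le> (1 - c / real n) * Z n" using N0[OF nn(3)] by (simp add: left_diff_distrib)
    also have "\<dots> \<le> (1 - c / real n) * e" using f Z by (intro mult_left_mono) auto
    also have "\<dots> \<le> e" using f e by (simp add: mult_left_le_one_le)
    finally show ?thesis .
  qed
  have "\<exists>n\<ge>N. Z n \<le> e"
  proof (rule ccontr)
    assume "\<not> (\<exists>n\<ge>N. Z n \<le> e)"
    then have big: "\<And>n. n \<ge> N \<Longrightarrow> e < Z n" by force
    have dec: "c * e * (\<Sum>i<k. inverse (real (N + i))) \<le> Z N - Z (N + k)" for k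
    proof (induction k)
      case (Suc k)
      have nk: "N0 \<le> N + k" "0 < real (N + k)" by (auto simp: N_def)
      have "c / real (N + k) * e \<le> c / real (N + k) * Z (N + k)"
        using big[of "N + k"] c by (intro mult_left_mono) auto
      then have "Z (N + Suc k) \<le> Z (N + k) - c * e * inverse (real (N + k))"
        using N0[OF nk(1)] by (simp add: divide_inverse mult_ac)
      then show ?case using Suc by (simp add: distrib_left)
    qed simp
    have "summable (\<lambda>i. inverse (real (N + i)))"
    proof (rule summableI_nonneg_bounded)
      show "0 \<le> inverse (real (N + i))" for i by simp
      fix k
      have "c * e * (\<Sum>i<k. inverse (real (N + i))) \<le> Z N" using dec[of k] big[of "N + k"] e by simp
      then show "(\<Sum>i<k. inverse (real (N + i))) \<le> Z N / (c * e)" using c e by (simp add: field_simps)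
    qed
    then have "summable (\<lambda>i. inverse (real i))"
      using summable_iff_shift[of "\<lambda>i. inverse (real i)" N] by (simp add: add.commute)
    then show False using not_summable_harmonic[where 'a = real] by (simp add: inverse_eq_divide)
  qed
  then obtain n0 where n0: "N \<le> n0" "Z n0 \<le> e" by blast
  have "Z n \<le> e" if "n0 \<le> n" for n
    using that by (induction n rule: dec_induct) (use n0 step in auto)
  then show ?thesis by (auto simp: eventually_sequentially)
qed

section \<open>Decay of the mean divergence and convergence of the weight\<close>

locale sublinear_delayed_attachment = delayed_attachment \<beta> \<mu> f fs + sublinear_attachment f lam fs
  for \<beta> \<mu> f fs lam
begin

text \<open>As the divergence is at most 2, the dissipation is at least
  \<open>\<psi> * (lyap K p - \<epsilon>) / 2\<close>, trivially so when the bracket is negative.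
  This linear bound passes to expectations. Together with the upper bound
  \<open>2 * slope * n\<close> of the weight it yields the constant
  \<open>4 * slope\<close>.\<close>

lemma mean_lyap_step:
  assumes K: "good_level \<eta> K" "0 \<le> \<eta>" and mK: "m \<le> K" "1 \<le> m"
    and \<psi>: "0 < \<psi>" "\<And>p. vtree p \<Longrightarrow> \<epsilon> \<le> lyap K p \<Longrightarrow> \<psi> \<le> (\<Sum>j\<in>{1..m}. r j * breg (ratio K p 1) (ratio K p j))"
    and C: "0 \<le> C" "\<And>p v. vtree p \<Longrightarrow> v < length p \<Longrightarrow>
      lyap K (p @ [v]) - lyap K p \<le> lin K p v + C / (real (length p))\<^sup>2 \<and> \<bar>lyap K (p @ [v]) - lyap K p\<bar> \<le> C / real (length p)"
    and \<epsilon>: "0 \<le> \<epsilon>" and n: "2 \<le> n"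
  shows "mean (Suc n) (lyap K) \<le> mean n (lyap K) - lam * repro 1 * \<psi> / (4 * slope) / real n * (mean n (lyap K) - \<epsilon>)
    + drift_const * \<eta> / fs / real n + (C * (1 / real n) + C * delta n) / real n"
proof -
  have K1: "1 \<le> K" using K by (simp add: good_level_def)
  define a where "a = lam * repro 1 * \<psi> / (4 * slope)"
  define b where "b = drift_const * \<eta> / fs + C * (1 / real n)"
  have n0: "0 < real n" using n by simp
  have "mean (Suc n) (lyap K) \<le> mean n (\<lambda>p. lyap K p + drift p (\<lambda>v. lyap K (p @ [v]) - lyap K p)) + C / real n * delta n"
    by (rule mean_Suc_le[OF n]) (use C n in auto)
  also have "mean n (\<lambda>p. lyap K p + drift p (\<lambda>v. lyap K (p @ [v]) - lyap K p))
    \<le> mean n (\<lambda>p. lyap K p + (b / real n - a / real n * (lyap K p - \<epsilon>)))"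
  proof (rule mean_mono)
    fix p assume p: "vtree p" "length p = n"
    define S where "S = wt f p (length p)"
    define Dp where "Dp = (\<Sum>j\<in>{1..K}. r j * breg (ratio K p 1) (ratio K p j))"
    have S: "0 < S" "fs * real n \<le> S" "S \<le> 2 * slope * real n"
    proof -
      show "0 < S" unfolding S_def using n p by (intro wt_pos) simp
      show "fs * real n \<le> S" unfolding S_def using wt_ge[of "length p" p] p by simp
      show "S \<le> 2 * slope * real n" unfolding S_def wt_deg_sum
        using deg_sum_le_linear[OF p(1), of slope f] slope p by simp
    qed
    have rn: "0 \<le> r j * breg (ratio K p 1) (ratio K p j)" if "1 \<le> j" for j
      using r_pos[of j] ratio_nonneg[OF K1 p(1)] that by (intro mult_nonneg_nonneg breg_nonneg) auto
    have Dm: "(\<Sum>j\<in>{1..m}. r j * breg (ratio K p 1) (ratio K p j)) \<le> Dp"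
      unfolding Dp_def using mK rn by (intro sum_mono2) auto
    have D0: "0 \<le> Dp" unfolding Dp_def using rn by (intro sum_nonneg) auto
    have D: "\<psi> * ((lyap K p - \<epsilon>) / 2) \<le> Dp"
    proof (cases "\<epsilon> \<le> lyap K p")
      case True
      have "(lyap K p - \<epsilon>) / 2 \<le> 1" using lyap_le_2[OF K1 p(1)] \<epsilon> by simp
      then have "\<psi> * ((lyap K p - \<epsilon>) / 2) \<le> \<psi> * 1" using \<psi>(1) by (intro mult_left_mono) auto
      also have "\<dots> \<le> Dp" using \<psi>(2)[OF p(1) True] Dm by simp
      finally show ?thesis .
    next
      case False
      then have "\<psi> * ((lyap K p - \<epsilon>) / 2) \<le> 0" using \<psi>(1) by (intro mult_nonneg_nonpos) auto
      then show ?thesis using D0 by simp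
    qed
    have "drift p (\<lambda>v. lyap K (p @ [v]) - lyap K p) \<le> drift p (\<lambda>v. lin K p v + C / (real n)\<^sup>2)"
      using C(2)[OF p(1)] p(2) by (intro drift_mono) auto
    then have d1: "drift p (\<lambda>v. lyap K (p @ [v]) - lyap K p) \<le> drift p (lin K p) + C / (real n)\<^sup>2"
      unfolding drift_add drift_const[OF p(1)] .
    have "drift p (lin K p) \<le> (- (lam * repro 1) * Dp + drift_const * \<eta>) / S"
      unfolding drift_wt S_def[symmetric] using drift_lyap[OF K p(1)] S unfolding Dp_def[symmetric]
      by (intro divide_right_mono) auto
    then have d2: "drift p (lin K p) \<le> drift_const * \<eta> / S - lam * repro 1 * Dp / S" by (simp add: diff_divide_distrib)
    have d3: "drift_const * \<eta> / S \<le> drift_const * \<eta> / (fs * real n)"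
      using S drift_const_nonneg K fs(1) n0 by (intro divide_left_mono mult_pos_pos mult_nonneg_nonneg) auto
    have d4: "lam * repro 1 * Dp / (2 * slope * real n) \<le> lam * repro 1 * Dp / S"
      using S D0 lam_pos repro_pos[of 1] slope(1) n0 by (intro divide_left_mono mult_pos_pos mult_nonneg_nonneg) auto
    have d5: "a / real n * (lyap K p - \<epsilon>) \<le> lam * repro 1 * Dp / (2 * slope * real n)"
    proof -
      have "lam * repro 1 / (2 * slope * real n) * (\<psi> * ((lyap K p - \<epsilon>) / 2)) \<le> lam * repro 1 / (2 * slope * real n) * Dp"
        using D lam_pos repro_pos[of 1] slope(1) n0 by (intro mult_left_mono) auto
      moreover have "lam * repro 1 / (2 * slope * real n) * (\<psi> * ((lyap K p - \<epsilon>) / 2)) = a / real n * (lyap K p - \<epsilon>)"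
        using slope(1) n0 by (simp add: a_def field_simps)
      ultimately show ?thesis by simp
    qed
    have "drift p (\<lambda>v. lyap K (p @ [v]) - lyap K p) \<le> drift_const * \<eta> / (fs * real n) - a / real n * (lyap K p - \<epsilon>) + C / (real n)\<^sup>2"
      using d1 d2 d3 d4 d5 by linarith
    moreover have "b / real n = drift_const * \<eta> / (fs * real n) + C / (real n)\<^sup>2"
      by (simp add: b_def add_divide_distrib power2_eq_square)
    ultimately show "lyap K p + drift p (\<lambda>v. lyap K (p @ [v]) - lyap K p) \<le> lyap K p + (b / real n - a / real n * (lyap K p - \<epsilon>))"
      by simp
  qed (use n in simp)
  also have "\<dots> = mean n (lyap K) + (b / real n - a / real n * (mean n (lyap K) - \<epsilon>))"
  proof -
    have n1: "1 \<le> n" using n by simp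
    show ?thesis by (simp only: mean_add[OF n1] mean_diff[OF n1] mean_cmult mean_const)
  qed
  finally show ?thesis unfolding a_def b_def by (simp add: add_divide_distrib algebra_simps)
qed

theorem mean_lyap_small:
  assumes e: "0 < e"
  shows "\<exists>K\<ge>M. eventually (\<lambda>n. mean n (lyap K) \<le> e) sequentially"
proof -
  define \<epsilon> where "\<epsilon> = e / 2"
  have \<epsilon>: "0 < \<epsilon>" using e by (simp add: \<epsilon>_def)
  obtain m \<psi> where m: "1 \<le> m" "0 < \<psi>" "\<And>K p. m \<le> K \<Longrightarrow> vtree p \<Longrightarrow> \<epsilon> \<le> lyap K p \<Longrightarrow>
    \<psi> \<le> (\<Sum>j\<in>{1..m}. r j * breg (ratio K p 1) (ratio K p j))"
    using dissipation_lower_bound[OF \<epsilon>] by blast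
  define c where "c = lam * repro 1 * \<psi> / (4 * slope)"
  have c: "0 < c" unfolding c_def using lam_pos repro_pos[of 1] m(2) slope(1) by simp
  \<comment> \<open>The truncation error has to be below the gain \<open>c\<close> from dissipation,
    so \<open>\<eta>\<close> and with it \<open>K\<close> are chosen after \<open>m\<close> and
    \<open>\<psi>\<close>.\<close>
  define \<eta> where "\<eta> = c * \<epsilon> / 4 * fs / (drift_const + 1)"
  have dc: "0 < drift_const + 1" using drift_const_nonneg by simp
  have \<eta>: "0 < \<eta>" unfolding \<eta>_def using c \<epsilon> fs(1) dc by simp
  have \<eta>le: "drift_const * \<eta> / fs \<le> c * \<epsilon> / 4"
  proof -
    have "drift_const * \<eta> / fs = c * \<epsilon> / 4 * (drift_const / (drift_const + 1))" using fs(1) by (simp add: \<eta>_def)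
    also have "\<dots> \<le> c * \<epsilon> / 4 * 1" using c \<epsilon> dc by (intro mult_left_mono) auto
    finally show ?thesis by simp
  qed
  have "eventually (\<lambda>K. good_level \<eta> K \<and> m \<le> K \<and> M \<le> K) sequentially"
    using eventually_good_level[OF \<eta>] eventually_ge_at_top[of m] eventually_ge_at_top[of M] by eventually_elim auto
  then obtain K where K: "good_level \<eta> K" "m \<le> K" "M \<le> K" by (auto simp: eventually_sequentially)
  have K1: "1 \<le> K" using K m by simp
  obtain C where C: "0 \<le> C" "\<And>p v. vtree p \<Longrightarrow> v < length p \<Longrightarrow>
      lyap K (p @ [v]) - lyap K p \<le> lin K p v + C / (real (length p))\<^sup>2 \<and> \<bar>lyap K (p @ [v]) - lyap K p\<bar> \<le> C / real (length p)"
    using lyap_taylor[OF K1] by blast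
  have "(\<lambda>n. C * (1 / real n) + C * delta n) \<longlonglongrightarrow> C * 0 + C * 0"
    by (intro tendsto_add tendsto_mult tendsto_const lim_1_over_n delta_tendsto)
  then have ev: "eventually (\<lambda>n. C * (1 / real n) + C * delta n < c * \<epsilon> / 4) sequentially"
    using c \<epsilon> by (intro order_tendstoD) auto
  \<comment> \<open>Truncation and delay contribute at most \<open>c * \<epsilon> / 4\<close> each,
    which shifts the level \<open>\<epsilon>\<close> of the contraction by
    \<open>\<epsilon> / 2\<close>.\<close>
  define Z where "Z n = mean n (lyap K) - 3 / 2 * \<epsilon>" for n
  have "eventually (\<lambda>n. Z n \<le> \<epsilon> / 2) sequentially"
  proof (rule eventually_le_of_contraction[OF c])
    show "eventually (\<lambda>n. Z (Suc n) \<le> Z n - c / real n * Z n) sequentially"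
      using ev eventually_ge_at_top[of 2]
    proof eventually_elim
      case (elim n)
      have n0: "0 < real n" using elim by simp
      have "mean (Suc n) (lyap K) \<le> mean n (lyap K) - c / real n * (mean n (lyap K) - \<epsilon>)
        + drift_const * \<eta> / fs / real n + (C * (1 / real n) + C * delta n) / real n"
        unfolding c_def by (rule mean_lyap_step[OF K(1) less_imp_le[OF \<eta>] K(2) m(1) m(2) m(3)[OF K(2)] C less_imp_le[OF \<epsilon>] elim(2)])
      also have "drift_const * \<eta> / fs / real n \<le> c * \<epsilon> / 4 / real n" using \<eta>le n0 by (intro divide_right_mono) auto
      also have "(C * (1 / real n) + C * delta n) / real n \<le> c * \<epsilon> / 4 / real n" using elim n0 by (intro divide_right_mono) auto
      finally have "mean (Suc n) (lyap K) \<le> mean n (lyap K) - c / real n * (mean n (lyap K) - \<epsilon>) + c * \<epsilon> / 4 / real n + c * \<epsilon> / 4 / real n"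
        by simp
      also have "\<dots> = mean n (lyap K) - c / real n * Z n" using n0 by (simp add: Z_def field_simps)
      finally show ?case by (simp add: Z_def)
    qed
  qed (use \<epsilon> in simp)
  then have "eventually (\<lambda>n. mean n (lyap K) \<le> e) sequentially"
    by eventually_elim (simp add: Z_def \<epsilon>_def)
  then show ?thesis using K by blast
qed

text \<open>The deviation is the degree sum of \<open>f - lam\<close>, which vanishes in the
  limiting distribution. Departures of the ratios from 1 are controlled by
  \<open>(y - 1)^2 = (1 + y) * gain y\<close> and, to pass from squares to absolute values linearly
  in \<open>lyap\<close>, by an arithmetic-geometric inequality with parameter \<open>a\<close>.
  Degrees above \<open>m\<close> are absorbed by \<open>\<eta>\<close>.\<close>

lemma wt_deviation:
  assumes \<eta>: "good_level \<eta> m" "0 \<le> \<eta>" and K: "m \<le> K" and a: "0 < a" and p: "vtree p"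
  shows "\<bar>wt f p (length p) / real (length p) - lam\<bar> \<le> (2 * slope + 4) * \<eta>
    + 2 * slope * (\<Sum>k\<in>{1..m}. \<bar>f k - lam\<bar> * stat k) * a
    + 2 * slope * (\<Sum>k\<in>{1..m}. \<bar>f k - lam\<bar> * stat k * ((1 + 1 / (stat k * repro k)) / (stat k * repro k))) / a * lyap K p"
proof -
  define n where "n = real (length p)"
  define V where "V = value_of K p"
  define y where "y = ratio K p"
  define Y where "Y k = 1 / (stat k * repro k)" for k
  define T where "T = deg_sum (\<lambda>d. if m < d then f d - lam else 0) p"
  have m1: "1 \<le> m" using \<eta> by (simp add: good_level_def)
  have K1: "1 \<le> K" using m1 K by simp
  have n: "0 < n" using p by (simp add: n_def vtree_def)
  have V: "0 < V" "V \<le> 2 * slope * n" unfolding V_def n_def using value_pos[OF K1 p] value_le[OF K1 p] by auto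
  have y0: "0 \<le> y k" if "1 \<le> k" for k unfolding y_def by (rule ratio_nonneg[OF K1 p that])
  have T: "\<bar>T\<bar> \<le> 4 * \<eta> * n"
  proof -
    have "\<bar>T\<bar> \<le> deg_sum (\<lambda>d. if m < d then f d + lam else 0) p"
      unfolding T_def deg_sum_def
    proof (rule order_trans[OF sum_abs], rule sum_mono)
      fix v
      have "0 < f (deg p (length p) v)" by (intro f_gt0) simp
      then show "\<bar>if m < deg p (length p) v then f (deg p (length p) v) - lam else 0\<bar>
        \<le> (if m < deg p (length p) v then f (deg p (length p) v) + lam else 0)" using lam_pos by auto
    qed
    also have "\<dots> \<le> 2 * (2 * \<eta>) * real (length p)" using lam_pos by (intro tail_f_le[OF \<eta> p]) auto
    finally show ?thesis by (simp add: n_def)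
  qed
  define E where "E = (\<Sum>k\<in>{1..m}. (f k - lam) * stat k * (y k - 1)) + (\<Sum>k\<in>{1..m}. (f k - lam) * stat k)"
  have "wt f p (length p) - lam * n = deg_sum (\<lambda>d. f d - lam) p"
    unfolding wt_deg_sum deg_sum_def n_def by (simp add: sum_subtractf)
  also have "\<dots> = (\<Sum>k\<in>{1..m}. (f k - lam) * degc p k) + T" unfolding T_def by (rule deg_sum_split)
  also have "(\<Sum>k\<in>{1..m}. (f k - lam) * degc p k) = V * E"
  proof -
    have "(\<Sum>k\<in>{1..m}. (f k - lam) * degc p k) = (\<Sum>k\<in>{1..m}. V * ((f k - lam) * stat k * (y k - 1) + (f k - lam) * stat k))"
      unfolding y_def V_def using degc_ratio[OF K1 p] by (intro sum.cong refl) (simp add: algebra_simps)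
    then show ?thesis by (simp add: E_def sum_distrib_left[symmetric] sum.distrib)
  qed
  finally have dev: "wt f p (length p) - lam * n = V * E + T" .
  define Q where "Q = (\<Sum>k\<in>{1..m}. \<bar>f k - lam\<bar> * stat k)"
  define Q' where "Q' = (\<Sum>k\<in>{1..m}. \<bar>f k - lam\<bar> * stat k * ((1 + Y k) * Y k))"
  have per: "\<bar>y k - 1\<bar> \<le> a + (1 + Y k) * Y k / a * lyap K p" if k: "k \<in> {1..m}" for k
  proof -
    have k1: "1 \<le> k" "k \<le> K" using k K by auto
    have w: "0 < stat k * repro k" by (rule weight_pos[OF k1(1)])
    have "stat k * repro k * gain (y k) \<le> lyap K p"
      unfolding lyap_def y_def using k1 ratio_nonneg[OF K1 p] weight_pos gain_nonneg
      by (intro member_le_sum[of k "{1..K}" "\<lambda>k. stat k * repro k * gain (ratio K p k)"])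
         (auto intro!: mult_nonneg_nonneg simp: less_imp_le stat_pos repro_pos)
    then have g: "gain (y k) \<le> Y k * lyap K p" using w by (simp add: Y_def field_simps)
    have "(y k - 1)\<^sup>2 = (1 + y k) * gain (y k)" using y0[OF k1(1)] by (simp add: gain_def)
    also have "\<dots> \<le> (1 + Y k) * (Y k * lyap K p)"
      using g y0[OF k1(1)] gain_nonneg[OF y0[OF k1(1)]] ratio_le[OF K1 p k1] w
      by (intro mult_mono) (auto simp: Y_def y_def)
    finally have sq: "(y k - 1)\<^sup>2 \<le> (1 + Y k) * Y k * lyap K p" by (simp add: mult.assoc)
    have "2 * \<bar>y k - 1\<bar> * a \<le> \<bar>y k - 1\<bar>\<^sup>2 + a\<^sup>2" by (rule sum_squares_bound)
    moreover have "0 \<le> \<bar>y k - 1\<bar> * a" using a by simp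
    ultimately have "\<bar>y k - 1\<bar> * a \<le> (y k - 1)\<^sup>2 + a * a" by (simp add: power2_eq_square)
    moreover have "(a + (1 + Y k) * Y k / a * lyap K p) * a = a * a + (1 + Y k) * Y k * lyap K p"
      using a by (simp add: field_simps)
    ultimately have "\<bar>y k - 1\<bar> * a \<le> (a + (1 + Y k) * Y k / a * lyap K p) * a" using sq by linarith
    then show ?thesis using a by simp
  qed
  have E: "\<bar>E\<bar> \<le> Q * a + Q' / a * lyap K p + \<eta>"
  proof -
    have "\<bar>\<Sum>k\<in>{1..m}. (f k - lam) * stat k * (y k - 1)\<bar> \<le> (\<Sum>k\<in>{1..m}. \<bar>f k - lam\<bar> * stat k * (a + (1 + Y k) * Y k / a * lyap K p))"
    proof (rule order_trans[OF sum_abs], rule sum_mono)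
      fix k assume k: "k \<in> {1..m}"
      then have st: "0 < stat k" by (intro stat_pos) simp
      have "\<bar>(f k - lam) * stat k * (y k - 1)\<bar> = \<bar>f k - lam\<bar> * stat k * \<bar>y k - 1\<bar>" using st by (simp add: abs_mult)
      also have "\<dots> \<le> \<bar>f k - lam\<bar> * stat k * (a + (1 + Y k) * Y k / a * lyap K p)" using per[OF k] st by (intro mult_left_mono) auto
      finally show "\<bar>(f k - lam) * stat k * (y k - 1)\<bar> \<le> \<bar>f k - lam\<bar> * stat k * (a + (1 + Y k) * Y k / a * lyap K p)" .
    qed
    also have "\<dots> = (\<Sum>k\<in>{1..m}. \<bar>f k - lam\<bar> * stat k * a + \<bar>f k - lam\<bar> * stat k * ((1 + Y k) * Y k) * (1 / a * lyap K p))"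
      by (intro sum.cong refl) (simp add: distrib_left)
    also have "\<dots> = Q * a + Q' / a * lyap K p"
      unfolding Q_def Q'_def sum.distrib sum_distrib_right[symmetric] by simp
    finally have "\<bar>\<Sum>k\<in>{1..m}. (f k - lam) * stat k * (y k - 1)\<bar> \<le> Q * a + Q' / a * lyap K p" .
    moreover have "\<bar>\<Sum>k\<in>{1..m}. (f k - lam) * stat k\<bar> \<le> \<eta>" using \<eta> by (simp add: good_level_def)
    ultimately show ?thesis unfolding E_def by linarith
  qed
  have "\<bar>wt f p (length p) / n - lam\<bar> = \<bar>V * E + T\<bar> / n"
  proof -
    have "wt f p (length p) / n - lam = (V * E + T) / n" unfolding dev[symmetric] using n by (simp add: field_simps)
    then show ?thesis using n by simp
  qed
  also have "\<dots> \<le> (2 * slope * n * (Q * a + Q' / a * lyap K p + \<eta>) + 4 * \<eta> * n) / n"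
  proof (rule divide_right_mono)
    have "\<bar>V * E + T\<bar> \<le> V * \<bar>E\<bar> + \<bar>T\<bar>" using V by (simp add: abs_mult order_trans[OF abs_triangle_ineq])
    also have "\<dots> \<le> 2 * slope * n * (Q * a + Q' / a * lyap K p + \<eta>) + 4 * \<eta> * n"
      using V E T slope(1) n by (intro add_mono mult_mono) auto
    finally show "\<bar>V * E + T\<bar> \<le> 2 * slope * n * (Q * a + Q' / a * lyap K p + \<eta>) + 4 * \<eta> * n" .
  qed (use n in simp)
  also have "\<dots> = (2 * slope + 4) * \<eta> + 2 * slope * Q * a + 2 * slope * Q' / a * lyap K p"
    using n a by (simp add: field_simps)
  finally show ?thesis unfolding Q_def Q'_def Y_def n_def by simp
qed

theorem wt_convergence: "(\<lambda>n. mean n (\<lambda>p. \<bar>wt f p (length p) / real (length p) - lam\<bar>)) \<longlonglongrightarrow> 0"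
proof (rule LIMSEQ_I)
  fix e :: real assume e: "0 < e"
  define \<eta> where "\<eta> = e / 4 / (2 * slope + 4)"
  have s4: "0 < 2 * slope + 4" using slope(1) by simp
  have \<eta>: "0 < \<eta>" using e s4 by (simp add: \<eta>_def)
  obtain m where m: "good_level \<eta> m" using eventually_good_level[OF \<eta>] by (auto simp: eventually_sequentially)
  define Q where "Q = 2 * slope * (\<Sum>k\<in>{1..m}. \<bar>f k - lam\<bar> * stat k)"
  have Q: "0 \<le> Q" unfolding Q_def using slope(1) stat_pos by (intro mult_nonneg_nonneg sum_nonneg) (auto intro: less_imp_le)
  \<comment> \<open>The constants depend on each other in this order: \<open>m\<close> fixes
    \<open>Q\<close>, then \<open>a\<close>, then \<open>R\<close>, then the accuracy
    \<open>e'\<close> required of the divergence. Its level \<open>K\<close> comes last, which is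
    why \<open>mean_lyap_small\<close> offers arbitrarily large ones.\<close>
  define a where "a = e / 4 / (Q + 1)"
  have a: "0 < a" using e Q by (simp add: a_def)
  define R where "R = 2 * slope * (\<Sum>k\<in>{1..m}. \<bar>f k - lam\<bar> * stat k * ((1 + 1 / (stat k * repro k)) / (stat k * repro k))) / a"
  have R: "0 \<le> R" unfolding R_def using slope(1) stat_pos weight_pos a
    by (intro divide_nonneg_pos mult_nonneg_nonneg sum_nonneg divide_nonneg_nonneg add_nonneg_nonneg) (auto intro: less_imp_le simp: stat_pos repro_pos less_imp_le)
  define e' where "e' = e / 4 / (R + 1)"
  have e': "0 < e'" using e R by (simp add: e'_def)
  obtain K where K: "m \<le> K" "eventually (\<lambda>n. mean n (lyap K) \<le> e') sequentially" using mean_lyap_small[OF e'] by blast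
  then obtain N where N: "\<And>n. n \<ge> N \<Longrightarrow> mean n (lyap K) \<le> e'" by (auto simp: eventually_sequentially)
  show "\<exists>no. \<forall>n\<ge>no. norm (mean n (\<lambda>p. \<bar>wt f p (length p) / real (length p) - lam\<bar>) - 0) < e"
  proof (intro exI[of _ "max N 1"] allI impI)
    fix n assume "max N 1 \<le> n"
    then have n: "N \<le> n" "1 \<le> n" by auto
    have "mean n (\<lambda>p. \<bar>wt f p (length p) / real (length p) - lam\<bar>) \<le> mean n (\<lambda>p. ((2 * slope + 4) * \<eta> + Q * a) + R * lyap K p)"
      unfolding Q_def R_def by (intro mean_mono[OF n(2)] wt_deviation[OF m less_imp_le[OF \<eta>] K(1) a])
    also have "\<dots> = (2 * slope + 4) * \<eta> + Q * a + R * mean n (lyap K)"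
      by (simp only: mean_add[OF n(2)] mean_const mean_cmult)
    also have "\<dots> \<le> e / 4 + e / 4 + e / 4"
    proof (intro add_mono)
      have cancel: "x * (z / x) = z" if "x \<noteq> 0" for x z :: real using that by simp
      show "(2 * slope + 4) * \<eta> \<le> e / 4" unfolding \<eta>_def by (subst cancel) (use s4 in auto)
      have "Q * a = e / 4 * (Q / (Q + 1))" by (simp add: a_def)
      also have "\<dots> \<le> e / 4 * 1" using e Q by (intro mult_left_mono) auto
      finally show "Q * a \<le> e / 4" by simp
      have "R * mean n (lyap K) \<le> R * e'" using N[OF n(1)] R by (rule mult_left_mono)
      also have "\<dots> = e / 4 * (R / (R + 1))" by (simp add: e'_def)
      also have "\<dots> \<le> e / 4 * 1" using e R by (intro mult_left_mono) auto
      finally show "R * mean n (lyap K) \<le> e / 4" by simp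
    qed
    also have "\<dots> < e" using e by simp
    finally show "norm (mean n (\<lambda>p. \<bar>wt f p (length p) / real (length p) - lam\<bar>) - 0) < e"
      using mean_nonneg[OF n(2), of "\<lambda>p. \<bar>wt f p (length p) / real (length p) - lam\<bar>"] by simp
  qed
qed

end

section \<open>Convergence of the fringe distributions\<close>

lemma (in delayed_attachment) wt_convergence_linear:
  assumes f: "\<And>k. 1 \<le> k \<Longrightarrow> f k = real k + \<alpha>"
  shows "(\<lambda>n. mean n (\<lambda>p. \<bar>wt f p (length p) / real (length p) - (2 + \<alpha>)\<bar>)) \<longlonglongrightarrow> 0"
proof (rule Lim_transform_eventually[OF lim_inverse_n'])
  show "eventually (\<lambda>n. 1 / real n = mean n (\<lambda>p. \<bar>wt f p (length p) / real (length p) - (2 + \<alpha>)\<bar>)) sequentially"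
    using eventually_ge_at_top[of 1]
  proof eventually_elim
    case (elim n)
    have "\<bar>wt f p (length p) / real (length p) - (2 + \<alpha>)\<bar> = 1 / real n" if p: "vtree p" "length p = n" for p
    proof -
      have "wt f p n = (\<Sum>u<n. real (deg p n u) + \<alpha>)"
        unfolding wt_def by (intro sum.cong refl f) simp
      also have "\<dots> = (2 + \<alpha>) * real n - 1"
        using sum_deg[OF p(1) elim] p(2) by (simp add: sum.distrib algebra_simps)
      finally have "wt f p n / real n - (2 + \<alpha>) = - (1 / real n)"
        using elim by (simp add: diff_divide_distrib)
      then show ?thesis unfolding p(2) by simp
    qed
    then have "mean n (\<lambda>p. \<bar>wt f p (length p) / real (length p) - (2 + \<alpha>)\<bar>) = mean n (\<lambda>p. 1 / real n)"
      by (intro mean_cong elim) auto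
    then show ?case by simp
  qed
qed

text \<open>With an empty component both sides vanish for large trees. Otherwise empirical and
  limiting probabilities are the same multiple \<open>Q\<close> of a fringe density and of its
  limit, and Markov's inequality applies.\<close>

lemma (in delayed_attachment) ext_fringe_convergence:
  assumes lam: "0 < lambda_star f" and fpos: "\<And>k. 1 \<le> k \<Longrightarrow> 0 < f k"
    and wt: "(\<lambda>n. mean n (\<lambda>p. \<bar>wt f p (length p) / real (length p) - lambda_star f\<bar>)) \<longlonglongrightarrow> 0"
    and s: "length s = Suc k" and \<epsilon>: "0 < \<epsilon>"
  shows "(\<lambda>n. measure_pmf.prob (tree_pmf \<beta> \<mu> f n) {p. \<bar>emp_fringe p k s - sin_fringe_prob f s\<bar> > \<epsilon>}) \<longlonglongrightarrow> 0"
proof (cases "\<exists>m\<le>k. s ! m = None")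
  case True
  then obtain m where m: "m \<le> k" "s ! m = None" by blast
  obtain N where N: "\<And>p. vtree p \<Longrightarrow> N < length p \<Longrightarrow> emp_fringe p k s = 0"
    using emp_fringe_None[OF s m] by blast
  have "eventually (\<lambda>n. measure_pmf.prob (tree_pmf \<beta> \<mu> f n) {p. \<bar>emp_fringe p k s - sin_fringe_prob f s\<bar> > \<epsilon>} = 0) sequentially"
    using eventually_gt_at_top[of N]
  proof eventually_elim
    case (elim n)
    have "measure_pmf.prob (tree_pmf \<beta> \<mu> f n) {p. \<bar>emp_fringe p k s - sin_fringe_prob f s\<bar> > \<epsilon>} \<le> mean n (\<lambda>_. 0)"
    proof (rule prob_le_mean)
      fix p assume "vtree p" "length p = n" "p \<in> {p. \<bar>emp_fringe p k s - sin_fringe_prob f s\<bar> > \<epsilon>}"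
      then show "(1::real) \<le> 0" using N[of p] elim sin_fringe_prob_None[OF s m] \<epsilon> by simp
    qed (use elim in auto)
    then show ?case by (simp add: antisym[OF _ measure_nonneg])
  qed
  then show ?thesis by (rule tendsto_eventually)
next
  case False
  interpret crump_mode f "lambda_star f" by unfold_locales (use lam fpos in auto)
  define g where "g i = the (s ! i)" for i
  have sg: "s = map (\<lambda>i. Some (g i)) [0..<Suc k]"
  proof (rule nth_equalityI)
    fix i assume "i < length s"
    then show "s ! i = map (\<lambda>i. Some (g i)) [0..<Suc k] ! i"
      using False s by (auto simp: g_def nth_append less_Suc_eq_le simp del: upt_Suc)
  qed (use s in simp)
  define t where "t = bar_tree g k"
  define Q where "Q = (\<Prod>i<k. real (count (children_of (bar_tree g (Suc i))) (bar_tree g i)))"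
  have Q: "0 \<le> Q" unfolding Q_def by (intro prod_nonneg) simp
  have lim: "(\<lambda>n. mean n (\<lambda>p. \<bar>real (cnt p t) / real (length p) - shape_prob t\<bar>)) \<longlonglongrightarrow> 0"
    by (rule fringe_convergence[OF lam wt shape_prob_rec])
  let ?X = "\<lambda>p. Q / \<epsilon> * \<bar>real (cnt p t) / real (length p) - shape_prob t\<bar>"
  have sp: "sin_fringe_prob f s = shape_prob t * Q"
    unfolding sg sin_fringe_prob_Some t_def[symmetric] Q_def[symmetric] by (simp only: varpi_shape_prob[OF refl])
  have diff: "\<bar>emp_fringe p k s - sin_fringe_prob f s\<bar> = Q * \<bar>real (cnt p t) / real (length p) - shape_prob t\<bar>"
    if p: "vtree p" for p
  proof -
    have "emp_fringe p k s = real (cnt p t) / real (length p) * Q"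
      unfolding t_def Q_def by (subst sg) (rule emp_fringe_Some[OF p])
    then have "emp_fringe p k s - sin_fringe_prob f s = Q * (real (cnt p t) / real (length p) - shape_prob t)"
      unfolding sp by (simp add: right_diff_distrib mult.commute)
    then show ?thesis using Q by (simp only: abs_mult abs_of_nonneg)
  qed
  have le: "eventually (\<lambda>n. measure_pmf.prob (tree_pmf \<beta> \<mu> f n) {p. \<bar>emp_fringe p k s - sin_fringe_prob f s\<bar> > \<epsilon>} \<le> mean n ?X) sequentially"
    using eventually_ge_at_top[of 1]
  proof eventually_elim
    case (elim n)
    show ?case
    proof (rule prob_le_mean[OF elim])
      fix p assume p: "vtree p" "length p = n"
      show "0 \<le> ?X p" using Q \<epsilon> by simp
      assume "p \<in> {p. \<bar>emp_fringe p k s - sin_fringe_prob f s\<bar> > \<epsilon>}"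
      then show "1 \<le> ?X p" using diff[OF p(1)] \<epsilon> by (simp add: pos_le_divide_eq)
    qed
  qed
  have X: "(\<lambda>n. mean n ?X) \<longlonglongrightarrow> 0"
    unfolding mean_cmult by (rule tendsto_mult_right_zero[OF lim])
  show ?thesis
    by (rule tendsto_sandwich[OF _ le tendsto_const X]) simp
qed

theorem mainTheorem1:
  fixes \<beta> :: real and \<mu> :: "real measure" and f :: "nat \<Rightarrow> real"
  assumes "0 \<le> \<beta>" and "\<beta> < 1"
    and "prob_space \<mu>" and "sets \<mu> = sets borel" and "AE \<xi> in \<mu>. 0 \<le> \<xi>"
    and "assumption1 f"
    and "assumption2a \<beta> \<mu>" and "assumption2b f"
  shows "\<forall>k s. length s = Suc k \<longrightarrow>
           (\<forall>\<epsilon>>0. (\<lambda>n. measure_pmf.prob (tree_pmf \<beta> \<mu> f n)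
                     {p. \<bar>emp_fringe p k s - sin_fringe_prob f s\<bar> > \<epsilon>}) \<longlonglongrightarrow> 0)"
proof -
  define fs where "fs = (INF k\<in>{1..}. f k)"
  define lam where "lam = lambda_star f"
  have fpos: "\<And>k. 1 \<le> k \<Longrightarrow> 0 < f k" and fs: "0 < fs"
    using assms(6) unfolding assumption1_def fs_def by auto
  have bdd: "bdd_below (f ` {1..})"
    by (rule bdd_belowI[of _ 0]) (use fpos in \<open>auto intro: less_imp_le\<close>)
  have fs_le: "\<And>k. 1 \<le> k \<Longrightarrow> fs \<le> f k"
    unfolding fs_def by (rule cINF_lower[OF bdd]) simp
  obtain L where L: "{lam. 0 < lam \<and> rho_hat f lam < \<top>} \<noteq> {}" "(rho_hat f \<longlongrightarrow> L) (at_right (lambda_low f))" "L > 1"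
    using assms(6) unfolding assumption1_def by blast
  have ls: "0 < lam" "rho_hat f lam = 1"
    using lambda_star_exists[of f, OF fpos L] unfolding lam_def by simp_all
  have pert: "perturbation_bound f"
    using assms(8) unfolding assumption2b_def
  proof (elim disjE exE conjE)
    fix \<alpha> assume "\<forall>k\<ge>1. f k = real k + \<alpha>"
    then show ?thesis by (intro perturbation_bound_linear) simp
  qed (rule perturbation_bound_sublinear[OF fpos]; assumption)+
  interpret delayed_attachment \<beta> \<mu> f fs
    by (rule delayed_attachment.intro) (fact assms(1-5) fs fs_le pert)+
  \<comment> \<open>For affine \<open>f\<close> the weight is \<open>(2 + \<alpha>) * n - 1\<close>
    for every tree; in the sublinear case the divergence argument supplies its convergence.\<close>
  have "(\<lambda>n. mean n (\<lambda>p. \<bar>wt f p (length p) / real (length p) - lam\<bar>)) \<longlonglongrightarrow> 0"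
  proof (cases "\<exists>\<alpha>>-1. \<forall>k\<ge>1. f k = real k + \<alpha>")
    case True
    then obtain \<alpha> where \<alpha>: "-1 < \<alpha>" "\<And>k. 1 \<le> k \<Longrightarrow> f k = real k + \<alpha>" by blast
    have "lam = 2 + \<alpha>" unfolding lam_def by (rule lambda_star_linear[where f = f, OF \<alpha>])
    then show ?thesis using wt_convergence_linear[where \<alpha> = \<alpha>, OF \<alpha>(2)] by simp
  next
    case False
    then have sub: "(\<lambda>k. f k / real k) \<longlonglongrightarrow> 0"
      using assms(8) unfolding assumption2b_def by blast
    have malthus: "(\<lambda>k. survival f lam (Suc k)) sums 1"
      using rho_hat_eq_1_iff[of f lam, OF fpos ls(1)] ls(2) by simp
    interpret sublinear_delayed_attachment \<beta> \<mu> f fs lam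
      by (intro sublinear_delayed_attachment.intro sublinear_attachment.intro delayed_attachment_axioms)
        (fact fs fs_le ls(1) malthus sub)+
    show ?thesis by (rule wt_convergence)
  qed
  from ext_fringe_convergence[OF ls(1)[unfolded lam_def] fpos this[unfolded lam_def]]
  show ?thesis by blast
qed

end
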